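(* Let $n\geq 1$ be an integer and suppose that $(\mathcal{C},\mathbb{E},\mathfrak{s})$ is an $n$-exangulated category. Let $\widehat{\mathcal{C}}$ be the weak idempotent completion of $\mathcal{C}$, and let $\mathbb{G}$, $\mathfrak{r}$, $\mathscr{K}_{\mathcal{C}}$ and $\Delta$ be as defined in the context. Then $(\widehat{\mathcal{C}},\mathbb{G},\mathfrak{r})$ is a weakly idempotent complete $n$-exangulated category, and $(\mathscr{K}_{\mathcal{C}},\Delta)\colon(\mathcal{C},\mathbb{E},\mathfrak{s})\to(\widehat{\mathcal{C}},\mathbb{G},\mathfrak{r})$ is an $n$-exangulated functor, such that the following $2$-universal property is satisfied. Suppose $(\mathscr{F},\Lambda)\colon(\mathcal{C},\mathbb{E},\mathfrak{s})\to(\mathcal{C}',\mathbb{E}',\mathfrak{s}')$ is an $n$-exangulated functor to a weakly idempotent complete $n$-exangulated category $(\mathcal{C}',\mathbb{E}',\mathfrak{s}')$. Then: (i) There is an $n$-exangulated functor $(\mathscr{E},\Psi)\colon(\widehat{\mathcal{C}},\mathbb{G},\mathfrak{r})\to(\mathcal{C}',\mathbb{E}',\mathfrak{s}')$ and an $n$-exangulated natural isomorphism $\alpha\colon(\mathscr{F},\Lambda)\Rightarrow(\mathscr{E},\Psi)\circ(\mathscr{K}_{\mathcal{C}},\Delta)$. (ii) In addition, for any $n$-exangulated functor $(\mathscr{G},\Theta)\colon(\widehat{\mathcal{C}},\mathbb{G},\mathfrak{r})\to(\mathcal{C}',\mathbb{E}',\mathfrak{s}')$ and any $n$-exangulated natural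 transformation $\beta\colon(\mathscr{F},\Lambda)\Rightarrow(\mathscr{G},\Theta)\circ(\mathscr{K}_{\mathcal{C}},\Delta)$, there is a unique $n$-exangulated natural transformation $\gamma\colon(\mathscr{E},\Psi)\Rightarrow(\mathscr{G},\Theta)$ with $\beta=\gamma_{\mathscr{K}_{\mathcal{C}}}\alpha$.
   Context: **$n$-exangulated categories.** Let $\mathcal{C}$ be an additive category and $\mathbb{E}\colon\mathcal{C}^{\mathrm{op}}\times\mathcal{C}\to\mathsf{Ab}$ a biadditive functor. An $\mathbb{E}$-extension is an element $\delta\in\mathbb{E}(C,A)$. For $a\colon A\to B$ and $d\colon D\to C$ put $a_{\mathbb{E}}\delta=\mathbb{E}(C,a)(\delta)$ and $d^{\mathbb{E}}\delta=\mathbb{E}(d,A)(\delta)$. The zero of $\mathbb{E}(C,A)$ is ${}_A0_C$. A morphism of $\mathbb{E}$-extensions from $\delta\in\mathbb{E}(C,A)$ to $\rho\in\mathbb{E}(D,B)$ is a pair $(a\colon A\to B,\,c\colon C\to D)$ with $a_{\mathbb{E}}\delta=c^{\mathbb{E}}\rho$. $\mathsf{Ch}(\mathcal{C})^n$ is the category of complexes $X_\bullet\colon X_0\xrightarrow{d^X_0}X_1\to\cdots\xrightarrow{d^X_n}X_{n+1}$ concentrated in degrees $0,\dots,n+1$. An $\mathbb{E}$-attached complex $\langle X_\bullet,\delta\rangle$ consists of $X_\bullet\in\mathsf{Ch}(\mathcal{C})^n$ and $\delta\in\mathbb{E}(X_{n+1},X_0)$ with $(d^X_0)_{\mathbb{E}}\delta=0$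 and $(d^X_n)^{\mathbb{E}}\delta=0$. It is an $n$-exangle if for every $Y\in\mathcal{C}$ the sequences $\mathcal{C}(Y,X_0)\to\cdots\to\mathcal{C}(Y,X_{n+1})\to\mathbb{E}(Y,X_0)$ (last map $u\mapsto u^{\mathbb{E}}\delta$) and $\mathcal{C}(X_{n+1},Y)\to\cdots\to\mathcal{C}(X_0,Y)\to\mathbb{E}(X_{n+1},Y)$ (last map $u\mapsto u_{\mathbb{E}}\delta$) are exact. For $A,C\in\mathcal{C}$, $\mathsf{Ch}(\mathcal{C})^n_{(A,C)}$ has as objects the $X_\bullet\in\mathsf{Ch}(\mathcal{C})^n$ with $X_0=A$, $X_{n+1}=C$, and as morphisms the chain maps $f_\bullet$ with $f_0=\mathrm{id}_A$, $f_{n+1}=\mathrm{id}_C$; $\mathsf{K}(\mathcal{C})^n_{(A,C)}$ is its quotient by the usual chain homotopy relation, and $[X_\bullet]$ is the isomorphism class of $X_\bullet$ in $\mathsf{K}(\mathcal{C})^n_{(A,C)}$. An exact realisation $\mathfrak{s}$ of $\mathbb{E}$ assigns to each $\delta\in\mathbb{E}(C,A)$ a class $\mathfrak{s}(\delta)=[X_\bullet]$ in $\mathsf{K}(\mathcal{C})^n_{(A,C)}$ such that: (R0) for each morphism $(a,c)\colon\delta\to\rho$ with $\mathfrak{s}(\delta)=[X_\bullet]$, $\mathfrak{s}(\rho)=[Y_\bullet]$ there is a chain map $f_\bullet\colon X_\bullet\to Y_\bullet$ with $f_0=a$, $f_{n+1}=c$ (a lift of $(a,c)$); (R1) if $\mathfrak{s}(\delta)=[X_\bullet]$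 then $\langle X_\bullet,\delta\rangle$ is an $n$-exangle; (R2) $\mathfrak{s}({}_A0_0)=[A\xrightarrow{\mathrm{id}}A\to0\to\cdots\to0]$ and $\mathfrak{s}({}_00_A)=[0\to\cdots\to0\to A\xrightarrow{\mathrm{id}}A]$. If $\mathfrak{s}(\delta)=[X_\bullet]$, then $\langle X_\bullet,\delta\rangle$ is called $\mathfrak{s}$-distinguished, $d^X_0$ an $\mathfrak{s}$-inflation and $d^X_n$ an $\mathfrak{s}$-deflation. For a chain map $f_\bullet\colon X_\bullet\to Y_\bullet$ in $\mathsf{Ch}(\mathcal{C})^n$ with $X_0=Y_0$, $f_0=\mathrm{id}$, the mapping cone $M_f$ is the complex $X_1\to X_2\oplus Y_1\to\cdots\to X_{n+1}\oplus Y_n\to Y_{n+1}$ with differentials $\begin{pmatrix}-d^X_1\\ f_1\end{pmatrix}$, $\begin{pmatrix}-d^X_{i+1}&0\\ f_{i+1}&d^Y_i\end{pmatrix}$ ($1\le i\le n-1$), $\begin{pmatrix}f_{n+1}&d^Y_n\end{pmatrix}$. $(\mathcal{C},\mathbb{E},\mathfrak{s})$ is an $n$-exangulated category if $\mathfrak{s}$ is an exact realisation of $\mathbb{E}$ and: (EA1) $\mathfrak{s}$-inflations are closed under composition and $\mathfrak{s}$-deflations are closed under composition; (EA2) for $\delta\in\mathbb{E}(D,A)$, $c\colon C\to D$, $\mathfrak{s}(c^{\mathbb{E}}\delta)=[Y_\bullet]$, $\mathfrak{s}(\delta)=[X_\bullet]$, there is a lift $f_\bullet\colon Y_\bullet\to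 X_\bullet$ of $(\mathrm{id}_A,c)$ with $\mathfrak{s}((d^Y_0)_{\mathbb{E}}\delta)=[M_f]$; (EA2)$^{\mathrm{op}}$ the dual of (EA2). It is weakly idempotent complete if every retraction in $\mathcal{C}$ has a kernel. **Functors and transformations.** An $n$-exangulated functor $(\mathscr{F},\Lambda)\colon(\mathcal{C},\mathbb{E},\mathfrak{s})\to(\mathcal{C}',\mathbb{E}',\mathfrak{s}')$ is an additive functor $\mathscr{F}$ with a natural transformation $\Lambda\colon\mathbb{E}(-,-)\Rightarrow\mathbb{E}'(\mathscr{F}-,\mathscr{F}-)$ (of $\mathsf{Ab}$-valued functors) such that $\mathfrak{s}(\delta)=[X_\bullet]$ implies $\mathfrak{s}'(\Lambda_{(C,A)}(\delta))=[\mathscr{F}(X_\bullet)]$ for all $\delta\in\mathbb{E}(C,A)$. Composition: $(\mathscr{L},\Phi)\circ(\mathscr{F},\Gamma)=(\mathscr{L}\mathscr{F},\Phi_{\mathscr{F}\times\mathscr{F}}\circ\Gamma)$. An $n$-exangulated natural transformation $(\mathscr{F},\Gamma)\Rightarrow(\mathscr{G},\Lambda)$ is a natural transformation $\beta\colon\mathscr{F}\Rightarrow\mathscr{G}$ with $(\beta_A)_{\mathbb{E}'}\Gamma_{(C,A)}(\delta)=(\beta_C)^{\mathbb{E}'}\Lambda_{(C,A)}(\delta)$ for all $\delta\in\mathbb{E}(C,A)$; it is an $n$-exangulated natural isomorphism if it has an $n$-exangulated inverse. Whiskering: $(\gamma_{\mathscr{K}})_X=\gamma_{\mathscr{K}(X)}$.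 **Idempotent completion.** Objects of $\widetilde{\mathcal{C}}$ are pairs $(X,e)$ with $e\in\mathrm{End}_{\mathcal{C}}(X)$, $e^2=e$. Morphisms $(X,e)\to(Y,e')$ are triplets $(e',r,e)$ with $r\in\mathcal{C}(X,Y)$, $re=r=e'r$. Composition: $(e'',s,e')\circ(e',r,e)=(e'',sr,e)$; the identity of $(X,e)$ is $(e,e,e)$. $\mathbb{F}\colon\widetilde{\mathcal{C}}^{\mathrm{op}}\times\widetilde{\mathcal{C}}\to\mathsf{Ab}$ is given by $\mathbb{F}((Z,e'),(X,e))=\{(e,\delta,e')\mid\delta\in\mathbb{E}(Z,X),\ e_{\mathbb{E}}\delta=\delta=(e')^{\mathbb{E}}\delta\}$ with addition inherited from $\mathbb{E}(Z,X)$; for morphisms $\tilde a=(e_1,a,e)\colon(X,e)\to(X_1,e_1)$ and $\tilde c=(e',c,e_2)\colon(Z_2,e_2)\to(Z,e')$, $\mathbb{F}(\tilde c,\tilde a)(e,\delta,e')=(e_1,\mathbb{E}(c,a)(\delta),e_2)$. For $\tilde\delta=(e_0,\delta,e_{n+1})\in\mathbb{F}((X_{n+1},e_{n+1}),(X_0,e_0))$ choose $X_\bullet$ with $\mathfrak{s}(\delta)=[X_\bullet]$ and an idempotent chain map $e_\bullet\colon X_\bullet\to X_\bullet$ with the given end terms $e_0$ and $e_{n+1}$ (such exists), and set $\mathfrak{t}(\tilde\delta)=[(X_\bullet,e_\bullet)]$, where $(X_\bullet,e_\bullet)$ has objects $(X_i,e_i)$ and differentials $(e_{i+1},e_{i+1}d^X_ie_i,e_i)$;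 this class is independent of the choices, and $(\widetilde{\mathcal{C}},\mathbb{F},\mathfrak{t})$ is $n$-exangulated. **Weak idempotent completion.** $\widehat{\mathcal{C}}$ is the full subcategory of $\widetilde{\mathcal{C}}$ on the objects $(X,e)$ such that $\mathrm{id}_X-e$ is a split idempotent in $\mathcal{C}$ (i.e. $\mathrm{id}_X-e=sr$ with $rs=\mathrm{id}_Y$ for some $r\colon X\to Y$, $s\colon Y\to X$). $\mathbb{G}$ is the restriction of $\mathbb{F}$ to $\widehat{\mathcal{C}}^{\mathrm{op}}\times\widehat{\mathcal{C}}$. For $\tilde\delta\in\mathbb{G}(\widetilde X_{n+1},\widetilde X_0)$ there is $\widetilde X_\bullet\in\mathsf{Ch}(\widehat{\mathcal{C}})^n$ with $\mathfrak{t}(\tilde\delta)=[\widetilde X_\bullet]$, and $\mathfrak{r}(\tilde\delta)$ is defined to be the isomorphism class of $\widetilde X_\bullet$ in $\mathsf{K}(\widehat{\mathcal{C}})^n_{(\widetilde X_0,\widetilde X_{n+1})}$. $\mathscr{K}_{\mathcal{C}}\colon\mathcal{C}\to\widehat{\mathcal{C}}$ is $X\mapsto(X,\mathrm{id}_X)$, $r\mapsto(\mathrm{id}_Y,r,\mathrm{id}_X)$, and $\Delta\colon\mathbb{E}(-,-)\Rightarrow\mathbb{G}(\mathscr{K}_{\mathcal{C}}-,\mathscr{K}_{\mathcal{C}}-)$ is $\Delta(\delta)=(\mathrm{id}_{X_0},\delta,\mathrm{id}_{X_{n+1}})$ for $\delta\in\mathbb{E}(X_{n+1},X_0)$. *)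

theory Defs
  imports "HOL-Algebra.Coset"
begin

section \<open>Additive categories\<close>

text \<open>
  A category is given by a set of objects, hom-sets (pairwise disjoint, and empty outside the
  objects; see \<open>category\<close> below), composition in applicative order and identities. For categories
  enriched in abelian groups, \<open>Add\<close> is the sum of parallel morphisms (one operation suffices,
  as hom-sets are disjoint) and \<open>Zer A B\<close> the zero morphism from \<open>A\<close> to \<open>B\<close>.
\<close>

record ('o, 'm) cat =
  Ob :: "'o set"
  Mor :: "'o \<Rightarrow> 'o \<Rightarrow> 'm set"
  Cmp :: "'m \<Rightarrow> 'm \<Rightarrow> 'm"  (infixr "\<cdot>\<index>" 70)
  Idt :: "'o \<Rightarrow> 'm"
  Add :: "'m \<Rightarrow> 'm \<Rightarrow> 'm"  (infixl "\<boxplus>\<index>" 65)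
  Zer :: "'o \<Rightarrow> 'o \<Rightarrow> 'm"

text \<open>Abelian groups are rendered by the library's \<open>comm_group\<close>, hence multiplicatively:
  the neutral element is \<open>\<one>\<close> and the negative is \<open>inv\<close>.\<close>

definition HomG :: "('o, 'm) cat \<Rightarrow> 'o \<Rightarrow> 'o \<Rightarrow> 'm monoid" where
  "HomG C A B = \<lparr>carrier = Mor C A B, monoid.mult = Add C, one = Zer C A B\<rparr>"

definition Neg :: "('o, 'm) cat \<Rightarrow> 'o \<Rightarrow> 'o \<Rightarrow> 'm \<Rightarrow> 'm" where
  "Neg C A B f = inv\<^bsub>HomG C A B\<^esub> f"

locale category =
  fixes C :: "('o, 'm) cat" (structure)
  assumes mor_ob: "f \<in> Mor C A B \<Longrightarrow> A \<in> Ob C \<and> B \<in> Ob C"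
    and mor_disjoint: "f \<in> Mor C A B \<Longrightarrow> f \<in> Mor C A' B' \<Longrightarrow> A = A' \<and> B = B'"
    and idt_mor: "A \<in> Ob C \<Longrightarrow> Idt C A \<in> Mor C A A"
    and cmp_mor: "f \<in> Mor C A B \<Longrightarrow> g \<in> Mor C B D \<Longrightarrow> g \<cdot> f \<in> Mor C A D"
    and cmp_assoc: "f \<in> Mor C A B \<Longrightarrow> g \<in> Mor C B D \<Longrightarrow> h \<in> Mor C D F \<Longrightarrow>
      (h \<cdot> g) \<cdot> f = h \<cdot> (g \<cdot> f)"
    and cmp_idt: "f \<in> Mor C A B \<Longrightarrow> f \<cdot> Idt C A = f"
    and idt_cmp: "f \<in> Mor C A B \<Longrightarrow> Idt C B \<cdot> f = f"

definition zero_object :: "('o, 'm) cat \<Rightarrow> 'o \<Rightarrow> bool" where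
  "zero_object C Z \<longleftrightarrow> Z \<in> Ob C \<and>
     (\<forall>A \<in> Ob C. (\<exists>!f. f \<in> Mor C A Z) \<and> (\<exists>!f. f \<in> Mor C Z A))"

definition biproduct ::
    "('o, 'm) cat \<Rightarrow> 'o \<Rightarrow> 'o \<Rightarrow> 'o \<Rightarrow> 'm \<Rightarrow> 'm \<Rightarrow> 'm \<Rightarrow> 'm \<Rightarrow> bool" where
  "biproduct C A B P i1 i2 p1 p2 \<longleftrightarrow>
     i1 \<in> Mor C A P \<and> i2 \<in> Mor C B P \<and> p1 \<in> Mor C P A \<and> p2 \<in> Mor C P B \<and>
     p1 \<cdot>\<^bsub>C\<^esub> i1 = Idt C A \<and> p2 \<cdot>\<^bsub>C\<^esub> i2 = Idt C B \<and>
     p1 \<cdot>\<^bsub>C\<^esub> i2 = Zer C B A \<and> p2 \<cdot>\<^bsub>C\<^esub> i1 = Zer C A B \<and>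
     (i1 \<cdot>\<^bsub>C\<^esub> p1) \<boxplus>\<^bsub>C\<^esub> (i2 \<cdot>\<^bsub>C\<^esub> p2) = Idt C P"

locale additive_category = category +
  assumes hom_group: "A \<in> Ob C \<Longrightarrow> B \<in> Ob C \<Longrightarrow> comm_group (HomG C A B)"
    and cmp_add: "f \<in> Mor C A B \<Longrightarrow> f' \<in> Mor C A B \<Longrightarrow> g \<in> Mor C B D \<Longrightarrow>
      g \<cdot> (f \<boxplus> f') = (g \<cdot> f) \<boxplus> (g \<cdot> f')"
    and add_cmp: "f \<in> Mor C A B \<Longrightarrow> g \<in> Mor C B D \<Longrightarrow> g' \<in> Mor C B D \<Longrightarrow>
      (g \<boxplus> g') \<cdot> f = (g \<cdot> f) \<boxplus> (g' \<cdot> f)"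
    and ex_zero: "\<exists>Z. zero_object C Z"
    and ex_biproduct: "A \<in> Ob C \<Longrightarrow> B \<in> Ob C \<Longrightarrow> \<exists>P i1 i2 p1 p2. biproduct C A B P i1 i2 p1 p2"

definition is_kernel :: "('o, 'm) cat \<Rightarrow> 'o \<Rightarrow> 'o \<Rightarrow> 'm \<Rightarrow> 'o \<Rightarrow> 'm \<Rightarrow> bool" where
  "is_kernel C A B f K k \<longleftrightarrow> k \<in> Mor C K A \<and> f \<cdot>\<^bsub>C\<^esub> k = Zer C K B \<and>
     (\<forall>W g. g \<in> Mor C W A \<and> f \<cdot>\<^bsub>C\<^esub> g = Zer C W B \<longrightarrow> (\<exists>!h. h \<in> Mor C W K \<and> k \<cdot>\<^bsub>C\<^esub> h = g))"

definition weakly_idempotent_complete :: "('o, 'm) cat \<Rightarrow> bool" where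
  "weakly_idempotent_complete C \<longleftrightarrow>
     (\<forall>A B r. r \<in> Mor C A B \<and> (\<exists>s \<in> Mor C B A. r \<cdot>\<^bsub>C\<^esub> s = Idt C B) \<longrightarrow>
        (\<exists>K k. is_kernel C A B r K k))"

section \<open>Biadditive functors\<close>

text \<open>\<open>Ext E Z A\<close> is the abelian group of extensions \<open>\<delta> \<in> E(Z, A)\<close>, contravariant in \<open>Z\<close>, and
  \<open>Act E c a\<close> is the map \<open>E(c, a)\<close>. The groups for different \<open>(Z, A)\<close> may overlap.\<close>

record ('o, 'm, 'x) bifunctor =
  Ext :: "'o \<Rightarrow> 'o \<Rightarrow> 'x monoid"
  Act :: "'m \<Rightarrow> 'm \<Rightarrow> 'x \<Rightarrow> 'x"

locale biadditive_functor = additive_category C for C :: "('o, 'm) cat" (structure) +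
  fixes E :: "('o, 'm, 'x) bifunctor"
  assumes ext_group: "Z \<in> Ob C \<Longrightarrow> A \<in> Ob C \<Longrightarrow> comm_group (Ext E Z A)"
    and act_hom: "c \<in> Mor C W Z \<Longrightarrow> a \<in> Mor C A B \<Longrightarrow> Act E c a \<in> hom (Ext E Z A) (Ext E W B)"
    and act_idt: "Z \<in> Ob C \<Longrightarrow> A \<in> Ob C \<Longrightarrow> \<delta> \<in> carrier (Ext E Z A) \<Longrightarrow>
      Act E (Idt C Z) (Idt C A) \<delta> = \<delta>"
    and act_cmp: "c \<in> Mor C W Z \<Longrightarrow> c' \<in> Mor C V W \<Longrightarrow> a \<in> Mor C A B \<Longrightarrow> a' \<in> Mor C B D \<Longrightarrow>
      \<delta> \<in> carrier (Ext E Z A) \<Longrightarrow> Act E (c \<cdot> c') (a' \<cdot> a) \<delta> = Act E c' a' (Act E c a \<delta>)"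
    and act_add_left: "c \<in> Mor C W Z \<Longrightarrow> c' \<in> Mor C W Z \<Longrightarrow> a \<in> Mor C A B \<Longrightarrow>
      \<delta> \<in> carrier (Ext E Z A) \<Longrightarrow>
      Act E (c \<boxplus> c') a \<delta> = Act E c a \<delta> \<otimes>\<^bsub>Ext E W B\<^esub> Act E c' a \<delta>"
    and act_add_right: "c \<in> Mor C W Z \<Longrightarrow> a \<in> Mor C A B \<Longrightarrow> a' \<in> Mor C A B \<Longrightarrow>
      \<delta> \<in> carrier (Ext E Z A) \<Longrightarrow>
      Act E c (a \<boxplus> a') \<delta> = Act E c a \<delta> \<otimes>\<^bsub>Ext E W B\<^esub> Act E c a' \<delta>"

text \<open>For \<open>\<delta> \<in> E(Z, A)\<close>: \<open>push C E Z a \<delta>\<close> is \<open>a\<^sub>E \<delta>\<close> and \<open>pull C E A c \<delta>\<close> is \<open>c\<^sup>E \<delta>\<close>.\<close>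

definition push :: "('o, 'm) cat \<Rightarrow> ('o, 'm, 'x) bifunctor \<Rightarrow> 'o \<Rightarrow> 'm \<Rightarrow> 'x \<Rightarrow> 'x" where
  "push C E Z a \<delta> = Act E (Idt C Z) a \<delta>"

definition pull :: "('o, 'm) cat \<Rightarrow> ('o, 'm, 'x) bifunctor \<Rightarrow> 'o \<Rightarrow> 'm \<Rightarrow> 'x \<Rightarrow> 'x" where
  "pull C E A c \<delta> = Act E c (Idt C A) \<delta>"

section \<open>Complexes concentrated in degrees \<open>0, \<dots>, n + 1\<close>\<close>

text \<open>Only \<open>cob X i\<close> for \<open>i \<le> n + 1\<close> and \<open>cdf X i\<close> for \<open>i \<le> n\<close> are relevant. The classes
  \<open>kclass\<close> below are closed under changing the other values.\<close>

record ('o, 'm) cpx =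
  cob :: "nat \<Rightarrow> 'o"
  cdf :: "nat \<Rightarrow> 'm"

definition Ch :: "('o, 'm) cat \<Rightarrow> nat \<Rightarrow> ('o, 'm) cpx set" where
  "Ch C n = {X. (\<forall>i \<le> n + 1. cob X i \<in> Ob C) \<and>
     (\<forall>i \<le> n. cdf X i \<in> Mor C (cob X i) (cob X (i + 1))) \<and>
     (\<forall>i < n. cdf X (i + 1) \<cdot>\<^bsub>C\<^esub> cdf X i = Zer C (cob X i) (cob X (i + 2)))}"

definition Ch_ends :: "('o, 'm) cat \<Rightarrow> nat \<Rightarrow> 'o \<Rightarrow> 'o \<Rightarrow> ('o, 'm) cpx set" where
  "Ch_ends C n A Z = {X \<in> Ch C n. cob X 0 = A \<and> cob X (n + 1) = Z}"

definition chain_map ::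
    "('o, 'm) cat \<Rightarrow> nat \<Rightarrow> ('o, 'm) cpx \<Rightarrow> ('o, 'm) cpx \<Rightarrow> (nat \<Rightarrow> 'm) \<Rightarrow> bool" where
  "chain_map C n X Y f \<longleftrightarrow>
     (\<forall>i \<le> n + 1. f i \<in> Mor C (cob X i) (cob Y i)) \<and>
     (\<forall>i \<le> n. f (i + 1) \<cdot>\<^bsub>C\<^esub> cdf X i = cdf Y i \<cdot>\<^bsub>C\<^esub> f i)"

definition chain_map_ends ::
    "('o, 'm) cat \<Rightarrow> nat \<Rightarrow> ('o, 'm) cpx \<Rightarrow> ('o, 'm) cpx \<Rightarrow> (nat \<Rightarrow> 'm) \<Rightarrow> bool" where
  "chain_map_ends C n X Y f \<longleftrightarrow>
     chain_map C n X Y f \<and> f 0 = Idt C (cob X 0) \<and> f (n + 1) = Idt C (cob X (n + 1))"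

text \<open>\<open>h i\<close>, for \<open>1 \<le> i \<le> n + 1\<close>, goes from degree \<open>i\<close> to degree \<open>i - 1\<close>; the end terms of the
  homotopy are not required to vanish.\<close>

definition homotopic ::
    "('o, 'm) cat \<Rightarrow> nat \<Rightarrow> ('o, 'm) cpx \<Rightarrow> ('o, 'm) cpx \<Rightarrow> (nat \<Rightarrow> 'm) \<Rightarrow> (nat \<Rightarrow> 'm) \<Rightarrow> bool" where
  "homotopic C n X Y f g \<longleftrightarrow> (\<exists>h.
     (\<forall>i \<in> {1..n + 1}. h i \<in> Mor C (cob X i) (cob Y (i - 1))) \<and>
     f 0 = g 0 \<boxplus>\<^bsub>C\<^esub> (h 1 \<cdot>\<^bsub>C\<^esub> cdf X 0) \<and>
     (\<forall>i \<in> {1..n}. f i =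
        g i \<boxplus>\<^bsub>C\<^esub> ((cdf Y (i - 1) \<cdot>\<^bsub>C\<^esub> h i) \<boxplus>\<^bsub>C\<^esub> (h (i + 1) \<cdot>\<^bsub>C\<^esub> cdf X i))) \<and>
     f (n + 1) = g (n + 1) \<boxplus>\<^bsub>C\<^esub> (cdf Y n \<cdot>\<^bsub>C\<^esub> h (n + 1)))"

definition K_iso :: "('o, 'm) cat \<Rightarrow> nat \<Rightarrow> ('o, 'm) cpx \<Rightarrow> ('o, 'm) cpx \<Rightarrow> bool" where
  "K_iso C n X Y \<longleftrightarrow> (\<exists>f g. chain_map_ends C n X Y f \<and> chain_map_ends C n Y X g \<and>
     homotopic C n X X (\<lambda>i. g i \<cdot>\<^bsub>C\<^esub> f i) (\<lambda>i. Idt C (cob X i)) \<and>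
     homotopic C n Y Y (\<lambda>i. f i \<cdot>\<^bsub>C\<^esub> g i) (\<lambda>i. Idt C (cob Y i)))"

text \<open>The isomorphism class \<open>[X]\<close> in the homotopy category of complexes with the ends of \<open>X\<close>.\<close>

definition kclass :: "('o, 'm) cat \<Rightarrow> nat \<Rightarrow> ('o, 'm) cpx \<Rightarrow> ('o, 'm) cpx set" where
  "kclass C n X = {Y \<in> Ch_ends C n (cob X 0) (cob X (n + 1)). K_iso C n X Y}"

definition exangle ::
    "('o, 'm) cat \<Rightarrow> ('o, 'm, 'x) bifunctor \<Rightarrow> nat \<Rightarrow> ('o, 'm) cpx \<Rightarrow> 'x \<Rightarrow> bool" where
  "exangle C E n X \<delta> \<longleftrightarrow>
     X \<in> Ch C n \<and> \<delta> \<in> carrier (Ext E (cob X (n + 1)) (cob X 0)) \<and>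
     push C E (cob X (n + 1)) (cdf X 0) \<delta> = \<one>\<^bsub>Ext E (cob X (n + 1)) (cob X 1)\<^esub> \<and>
     pull C E (cob X 0) (cdf X n) \<delta> = \<one>\<^bsub>Ext E (cob X n) (cob X 0)\<^esub> \<and>
     (\<forall>Y \<in> Ob C.
        (\<forall>i \<in> {1..n}.
           kernel (HomG C Y (cob X i)) (HomG C Y (cob X (i + 1))) (\<lambda>u. cdf X i \<cdot>\<^bsub>C\<^esub> u) =
           (\<lambda>u. cdf X (i - 1) \<cdot>\<^bsub>C\<^esub> u) ` Mor C Y (cob X (i - 1))) \<and>
        kernel (HomG C Y (cob X (n + 1))) (Ext E Y (cob X 0)) (\<lambda>u. pull C E (cob X 0) u \<delta>) =
          (\<lambda>u. cdf X n \<cdot>\<^bsub>C\<^esub> u) ` Mor C Y (cob X n)) \<and>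
     (\<forall>Y \<in> Ob C.
        (\<forall>i \<in> {1..n}.
           kernel (HomG C (cob X i) Y) (HomG C (cob X (i - 1)) Y) (\<lambda>u. u \<cdot>\<^bsub>C\<^esub> cdf X (i - 1)) =
           (\<lambda>u. u \<cdot>\<^bsub>C\<^esub> cdf X i) ` Mor C (cob X (i + 1)) Y) \<and>
        kernel (HomG C (cob X 0) Y) (Ext E (cob X (n + 1)) Y) (\<lambda>u. push C E (cob X (n + 1)) u \<delta>) =
          (\<lambda>u. u \<cdot>\<^bsub>C\<^esub> cdf X 0) ` Mor C (cob X 1) Y)"

text \<open>\<open>M\<close> is a mapping cone of \<open>f\<close>, formed with some choice of biproducts
  \<open>M\<^sub>i = X\<^sub>i\<^sub>+\<^sub>1 \<oplus> Y\<^sub>i\<close> for \<open>1 \<le> i \<le> n\<close>; different choices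
  give isomorphic complexes with the same ends, hence the same \<open>kclass\<close>.\<close>

definition mapping_cone ::
    "('o, 'm) cat \<Rightarrow> nat \<Rightarrow> ('o, 'm) cpx \<Rightarrow> ('o, 'm) cpx \<Rightarrow> (nat \<Rightarrow> 'm) \<Rightarrow> ('o, 'm) cpx \<Rightarrow> bool" where
  "mapping_cone C n X Y f M \<longleftrightarrow> (\<exists>i1 i2 p1 p2.
     cob M 0 = cob X 1 \<and> cob M (n + 1) = cob Y (n + 1) \<and>
     (\<forall>i \<in> {1..n}. biproduct C (cob X (i + 1)) (cob Y i) (cob M i) (i1 i) (i2 i) (p1 i) (p2 i)) \<and>
     cdf M 0 = (i1 1 \<cdot>\<^bsub>C\<^esub> Neg C (cob X 1) (cob X 2) (cdf X 1)) \<boxplus>\<^bsub>C\<^esub> (i2 1 \<cdot>\<^bsub>C\<^esub> f 1) \<and>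
     (\<forall>i \<in> {1..<n}. cdf M i =
        (i1 (i + 1) \<cdot>\<^bsub>C\<^esub> Neg C (cob X (i + 1)) (cob X (i + 2)) (cdf X (i + 1)) \<cdot>\<^bsub>C\<^esub> p1 i) \<boxplus>\<^bsub>C\<^esub>
        (i2 (i + 1) \<cdot>\<^bsub>C\<^esub> f (i + 1) \<cdot>\<^bsub>C\<^esub> p1 i) \<boxplus>\<^bsub>C\<^esub>
        (i2 (i + 1) \<cdot>\<^bsub>C\<^esub> cdf Y i \<cdot>\<^bsub>C\<^esub> p2 i)) \<and>
     cdf M n = (f (n + 1) \<cdot>\<^bsub>C\<^esub> p1 n) \<boxplus>\<^bsub>C\<^esub> (cdf Y n \<cdot>\<^bsub>C\<^esub> p2 n))"

section \<open>\<open>n\<close>-exangulated categories\<close>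

text \<open>A realisation \<open>s\<close> maps \<open>\<delta> \<in> E(Z, A)\<close> to a set \<open>s Z A \<delta>\<close> of complexes.
  \<open>realises C n s Z A \<delta> X\<close> says that \<open>s(\<delta>) = [X]\<close>, with \<open>X\<close> starting in \<open>A\<close> and ending in \<open>Z\<close>.\<close>

type_synonym ('o, 'm, 'x) realisation = "'o \<Rightarrow> 'o \<Rightarrow> 'x \<Rightarrow> ('o, 'm) cpx set"

definition realises ::
    "('o, 'm) cat \<Rightarrow> nat \<Rightarrow> ('o, 'm, 'x) realisation \<Rightarrow> 'o \<Rightarrow> 'o \<Rightarrow> 'x \<Rightarrow> ('o, 'm) cpx \<Rightarrow> bool" where
  "realises C n s Z A \<delta> X \<longleftrightarrow> X \<in> Ch_ends C n A Z \<and> s Z A \<delta> = kclass C n X"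

definition triv_left :: "('o, 'm) cat \<Rightarrow> 'o \<Rightarrow> 'o \<Rightarrow> ('o, 'm) cpx" where
  "triv_left C Z A = (let X = (\<lambda>i. if i \<le> 1 then A else Z) in
     \<lparr>cob = X, cdf = (\<lambda>i. if i = 0 then Idt C A else Zer C (X i) (X (i + 1)))\<rparr>)"

definition triv_right :: "('o, 'm) cat \<Rightarrow> nat \<Rightarrow> 'o \<Rightarrow> 'o \<Rightarrow> ('o, 'm) cpx" where
  "triv_right C n Z A = (let X = (\<lambda>i. if i < n then Z else A) in
     \<lparr>cob = X, cdf = (\<lambda>i. if i = n then Idt C A else Zer C (X i) (X (i + 1)))\<rparr>)"

locale exact_realisation = biadditive_functor C E
    for C :: "('o, 'm) cat" (structure) and E :: "('o, 'm, 'x) bifunctor" +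
  fixes n :: nat and s :: "('o, 'm, 'x) realisation"
  assumes realised: "Z \<in> Ob C \<Longrightarrow> A \<in> Ob C \<Longrightarrow> \<delta> \<in> carrier (Ext E Z A) \<Longrightarrow>
      \<exists>X. realises C n s Z A \<delta> X"
    and R0: "\<delta> \<in> carrier (Ext E Z A) \<Longrightarrow> \<rho> \<in> carrier (Ext E W B) \<Longrightarrow>
      a \<in> Mor C A B \<Longrightarrow> c \<in> Mor C Z W \<Longrightarrow> push C E Z a \<delta> = pull C E B c \<rho> \<Longrightarrow>
      realises C n s Z A \<delta> X \<Longrightarrow> realises C n s W B \<rho> Y \<Longrightarrow>
      \<exists>f. chain_map C n X Y f \<and> f 0 = a \<and> f (n + 1) = c"
    and R1: "Z \<in> Ob C \<Longrightarrow> A \<in> Ob C \<Longrightarrow> \<delta> \<in> carrier (Ext E Z A) \<Longrightarrow>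
      realises C n s Z A \<delta> X \<Longrightarrow> exangle C E n X \<delta>"
    and R2_left: "zero_object C Z \<Longrightarrow> A \<in> Ob C \<Longrightarrow>
      realises C n s Z A \<one>\<^bsub>Ext E Z A\<^esub> (triv_left C Z A)"
    and R2_right: "zero_object C Z \<Longrightarrow> A \<in> Ob C \<Longrightarrow>
      realises C n s A Z \<one>\<^bsub>Ext E A Z\<^esub> (triv_right C n Z A)"

definition inflation ::
    "('o, 'm) cat \<Rightarrow> ('o, 'm, 'x) bifunctor \<Rightarrow> nat \<Rightarrow> ('o, 'm, 'x) realisation \<Rightarrow> 'm \<Rightarrow> bool" where
  "inflation C E n s f \<longleftrightarrow> (\<exists>Z \<in> Ob C. \<exists>A \<in> Ob C. \<exists>\<delta> \<in> carrier (Ext E Z A). \<exists>X.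
     realises C n s Z A \<delta> X \<and> f = cdf X 0)"

definition deflation ::
    "('o, 'm) cat \<Rightarrow> ('o, 'm, 'x) bifunctor \<Rightarrow> nat \<Rightarrow> ('o, 'm, 'x) realisation \<Rightarrow> 'm \<Rightarrow> bool" where
  "deflation C E n s f \<longleftrightarrow> (\<exists>Z \<in> Ob C. \<exists>A \<in> Ob C. \<exists>\<delta> \<in> carrier (Ext E Z A). \<exists>X.
     realises C n s Z A \<delta> X \<and> f = cdf X n)"

definition EA2 ::
    "('o, 'm) cat \<Rightarrow> ('o, 'm, 'x) bifunctor \<Rightarrow> nat \<Rightarrow> ('o, 'm, 'x) realisation \<Rightarrow> bool" where
  "EA2 C E n s \<longleftrightarrow> (\<forall>A B D c \<delta> X Y.
     A \<in> Ob C \<and> c \<in> Mor C B D \<and> \<delta> \<in> carrier (Ext E D A) \<and>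
     realises C n s B A (pull C E A c \<delta>) Y \<and> realises C n s D A \<delta> X \<longrightarrow>
     (\<exists>f M. chain_map C n Y X f \<and> f 0 = Idt C A \<and> f (n + 1) = c \<and>
        mapping_cone C n Y X f M \<and>
        realises C n s D (cob Y 1) (push C E D (cdf Y 0) \<delta>) M))"

definition op_cat :: "('o, 'm) cat \<Rightarrow> ('o, 'm) cat" where
  "op_cat C = \<lparr>Ob = Ob C, Mor = (\<lambda>A B. Mor C B A), Cmp = (\<lambda>g f. f \<cdot>\<^bsub>C\<^esub> g), Idt = Idt C,
     Add = Add C, Zer = (\<lambda>A B. Zer C B A)\<rparr>"

definition op_bifunctor :: "('o, 'm, 'x) bifunctor \<Rightarrow> ('o, 'm, 'x) bifunctor" where
  "op_bifunctor E = \<lparr>Ext = (\<lambda>Z A. Ext E A Z), Act = (\<lambda>c a. Act E a c)\<rparr>"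

definition op_cpx :: "nat \<Rightarrow> ('o, 'm) cpx \<Rightarrow> ('o, 'm) cpx" where
  "op_cpx n X = \<lparr>cob = (\<lambda>i. cob X (n + 1 - i)), cdf = (\<lambda>i. cdf X (n - i))\<rparr>"

text \<open>A preimage, not an image: \<open>op_cpx\<close> forgets the irrelevant degrees, and a \<open>kclass\<close> must
  contain all complexes that differ from its members only there.\<close>

definition op_realisation :: "nat \<Rightarrow> ('o, 'm, 'x) realisation \<Rightarrow> ('o, 'm, 'x) realisation" where
  "op_realisation n s = (\<lambda>Z A \<delta>. op_cpx n -` s A Z \<delta>)"

locale n_exangulated_category = exact_realisation C E n s
    for C :: "('o, 'm) cat" (structure) and E :: "('o, 'm, 'x) bifunctor"
      and n :: nat and s :: "('o, 'm, 'x) realisation" +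
  assumes EA1_inflation: "f \<in> Mor C A B \<Longrightarrow> g \<in> Mor C B D \<Longrightarrow>
      inflation C E n s f \<Longrightarrow> inflation C E n s g \<Longrightarrow> inflation C E n s (g \<cdot> f)"
    and EA1_deflation: "f \<in> Mor C A B \<Longrightarrow> g \<in> Mor C B D \<Longrightarrow>
      deflation C E n s f \<Longrightarrow> deflation C E n s g \<Longrightarrow> deflation C E n s (g \<cdot> f)"
    and EA2: "EA2 C E n s"
    and EA2_op: "EA2 (op_cat C) (op_bifunctor E) n (op_realisation n s)"

section \<open>\<open>n\<close>-exangulated functors and natural transformations\<close>

record ('o, 'm, 'p, 'q) cfunctor =
  Fob :: "'o \<Rightarrow> 'p"
  Fmor :: "'m \<Rightarrow> 'q"

definition additive_functor ::
    "('o, 'm) cat \<Rightarrow> ('p, 'q) cat \<Rightarrow> ('o, 'm, 'p, 'q) cfunctor \<Rightarrow> bool" where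
  "additive_functor C D F \<longleftrightarrow>
     (\<forall>A \<in> Ob C. Fob F A \<in> Ob D) \<and>
     (\<forall>A B. \<forall>f \<in> Mor C A B. Fmor F f \<in> Mor D (Fob F A) (Fob F B)) \<and>
     (\<forall>A \<in> Ob C. Fmor F (Idt C A) = Idt D (Fob F A)) \<and>
     (\<forall>A B B'. \<forall>f \<in> Mor C A B. \<forall>g \<in> Mor C B B'.
        Fmor F (g \<cdot>\<^bsub>C\<^esub> f) = Fmor F g \<cdot>\<^bsub>D\<^esub> Fmor F f) \<and>
     (\<forall>A B. \<forall>f \<in> Mor C A B. \<forall>g \<in> Mor C A B.
        Fmor F (f \<boxplus>\<^bsub>C\<^esub> g) = Fmor F f \<boxplus>\<^bsub>D\<^esub> Fmor F g)"

definition comp_functor ::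
    "('p, 'q, 'r, 't) cfunctor \<Rightarrow> ('o, 'm, 'p, 'q) cfunctor \<Rightarrow> ('o, 'm, 'r, 't) cfunctor" where
  "comp_functor L F = \<lparr>Fob = Fob L \<circ> Fob F, Fmor = Fmor L \<circ> Fmor F\<rparr>"

definition map_cpx :: "('o, 'm, 'p, 'q) cfunctor \<Rightarrow> ('o, 'm) cpx \<Rightarrow> ('p, 'q) cpx" where
  "map_cpx F X = \<lparr>cob = Fob F \<circ> cob X, cdf = Fmor F \<circ> cdf X\<rparr>"

text \<open>The component at \<open>(Z, A)\<close> of a transformation \<open>\<Gamma>\<close> from \<open>E\<close> to \<open>E'(F-, F-)\<close> is \<open>\<Gamma> Z A\<close>.\<close>

definition n_exangulated_functor ::
    "('o, 'm) cat \<Rightarrow> ('o, 'm, 'x) bifunctor \<Rightarrow> ('o, 'm, 'x) realisation \<Rightarrow>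
     ('p, 'q) cat \<Rightarrow> ('p, 'q, 'y) bifunctor \<Rightarrow> ('p, 'q, 'y) realisation \<Rightarrow> nat \<Rightarrow>
     ('o, 'm, 'p, 'q) cfunctor \<Rightarrow> ('o \<Rightarrow> 'o \<Rightarrow> 'x \<Rightarrow> 'y) \<Rightarrow> bool" where
  "n_exangulated_functor C E s C' E' s' n F \<Gamma> \<longleftrightarrow>
     additive_functor C C' F \<and>
     (\<forall>Z \<in> Ob C. \<forall>A \<in> Ob C. \<Gamma> Z A \<in> hom (Ext E Z A) (Ext E' (Fob F Z) (Fob F A))) \<and>
     (\<forall>Z W A B c a. c \<in> Mor C W Z \<longrightarrow> a \<in> Mor C A B \<longrightarrow> (\<forall>\<delta> \<in> carrier (Ext E Z A).
        \<Gamma> W B (Act E c a \<delta>) = Act E' (Fmor F c) (Fmor F a) (\<Gamma> Z A \<delta>))) \<and>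
     (\<forall>Z \<in> Ob C. \<forall>A \<in> Ob C. \<forall>\<delta> \<in> carrier (Ext E Z A). \<forall>X. realises C n s Z A \<delta> X \<longrightarrow>
        realises C' n s' (Fob F Z) (Fob F A) (\<Gamma> Z A \<delta>) (map_cpx F X))"

text \<open>The second component of \<open>(L, \<Phi>) \<circ> (F, \<Gamma>)\<close>.\<close>

definition comp_trans ::
    "('p \<Rightarrow> 'p \<Rightarrow> 'y \<Rightarrow> 'z) \<Rightarrow> ('o, 'm, 'p, 'q) cfunctor \<Rightarrow> ('o \<Rightarrow> 'o \<Rightarrow> 'x \<Rightarrow> 'y) \<Rightarrow>
     'o \<Rightarrow> 'o \<Rightarrow> 'x \<Rightarrow> 'z" where
  "comp_trans \<Phi> F \<Gamma> = (\<lambda>Z A. \<Phi> (Fob F Z) (Fob F A) \<circ> \<Gamma> Z A)"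

definition natural_trans ::
    "('o, 'm) cat \<Rightarrow> ('p, 'q) cat \<Rightarrow> ('o, 'm, 'p, 'q) cfunctor \<Rightarrow> ('o, 'm, 'p, 'q) cfunctor \<Rightarrow>
     ('o \<Rightarrow> 'q) \<Rightarrow> bool" where
  "natural_trans C D F G \<beta> \<longleftrightarrow>
     (\<forall>A \<in> Ob C. \<beta> A \<in> Mor D (Fob F A) (Fob G A)) \<and>
     (\<forall>A B. \<forall>f \<in> Mor C A B. \<beta> B \<cdot>\<^bsub>D\<^esub> Fmor F f = Fmor G f \<cdot>\<^bsub>D\<^esub> \<beta> A)"

definition n_exangulated_trans ::
    "('o, 'm) cat \<Rightarrow> ('o, 'm, 'x) bifunctor \<Rightarrow> ('p, 'q) cat \<Rightarrow> ('p, 'q, 'y) bifunctor \<Rightarrow>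
     ('o, 'm, 'p, 'q) cfunctor \<Rightarrow> ('o \<Rightarrow> 'o \<Rightarrow> 'x \<Rightarrow> 'y) \<Rightarrow>
     ('o, 'm, 'p, 'q) cfunctor \<Rightarrow> ('o \<Rightarrow> 'o \<Rightarrow> 'x \<Rightarrow> 'y) \<Rightarrow> ('o \<Rightarrow> 'q) \<Rightarrow> bool" where
  "n_exangulated_trans C E C' E' F \<Gamma> G \<Lambda> \<beta> \<longleftrightarrow>
     natural_trans C C' F G \<beta> \<and>
     (\<forall>Z \<in> Ob C. \<forall>A \<in> Ob C. \<forall>\<delta> \<in> carrier (Ext E Z A).
        push C' E' (Fob F Z) (\<beta> A) (\<Gamma> Z A \<delta>) = pull C' E' (Fob G A) (\<beta> Z) (\<Lambda> Z A \<delta>))"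

definition n_exangulated_iso ::
    "('o, 'm) cat \<Rightarrow> ('o, 'm, 'x) bifunctor \<Rightarrow> ('p, 'q) cat \<Rightarrow> ('p, 'q, 'y) bifunctor \<Rightarrow>
     ('o, 'm, 'p, 'q) cfunctor \<Rightarrow> ('o \<Rightarrow> 'o \<Rightarrow> 'x \<Rightarrow> 'y) \<Rightarrow>
     ('o, 'm, 'p, 'q) cfunctor \<Rightarrow> ('o \<Rightarrow> 'o \<Rightarrow> 'x \<Rightarrow> 'y) \<Rightarrow> ('o \<Rightarrow> 'q) \<Rightarrow> bool" where
  "n_exangulated_iso C E C' E' F \<Gamma> G \<Lambda> \<alpha> \<longleftrightarrow>
     n_exangulated_trans C E C' E' F \<Gamma> G \<Lambda> \<alpha> \<and>
     (\<exists>\<beta>. n_exangulated_trans C E C' E' G \<Lambda> F \<Gamma> \<beta> \<and>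
        (\<forall>A \<in> Ob C. \<beta> A \<cdot>\<^bsub>C'\<^esub> \<alpha> A = Idt C' (Fob F A) \<and> \<alpha> A \<cdot>\<^bsub>C'\<^esub> \<beta> A = Idt C' (Fob G A)))"

section \<open>Idempotent completion\<close>

definition idem_cat :: "('o, 'm) cat \<Rightarrow> ('o \<times> 'm, 'm \<times> 'm \<times> 'm) cat" where
  "idem_cat C =
     (let ob = {(X, e). X \<in> Ob C \<and> e \<in> Mor C X X \<and> e \<cdot>\<^bsub>C\<^esub> e = e} in
     \<lparr>Ob = ob,
      Mor = (\<lambda>(X, e) (Y, e'). {(e', r, e) | r. (X, e) \<in> ob \<and> (Y, e') \<in> ob \<and>
               r \<in> Mor C X Y \<and> r \<cdot>\<^bsub>C\<^esub> e = r \<and> e' \<cdot>\<^bsub>C\<^esub> r = r}),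
      Cmp = (\<lambda>(e'', s, _) (_, r, e). (e'', s \<cdot>\<^bsub>C\<^esub> r, e)),
      Idt = (\<lambda>(X, e). (e, e, e)),
      Add = (\<lambda>(e', r, e) (_, r', _). (e', r \<boxplus>\<^bsub>C\<^esub> r', e)),
      Zer = (\<lambda>(X, e) (Y, e'). (e', Zer C X Y, e))\<rparr>)"

definition idem_bifunctor ::
    "('o, 'm) cat \<Rightarrow> ('o, 'm, 'x) bifunctor \<Rightarrow> ('o \<times> 'm, 'm \<times> 'm \<times> 'm, 'm \<times> 'x \<times> 'm) bifunctor" where
  "idem_bifunctor C E =
     \<lparr>Ext = (\<lambda>(Z, e') (X, e).
        \<lparr>carrier = {(e, \<delta>, e') | \<delta>. \<delta> \<in> carrier (Ext E Z X) \<and>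
                     push C E Z e \<delta> = \<delta> \<and> pull C E X e' \<delta> = \<delta>},
         monoid.mult = (\<lambda>(_, \<delta>, _) (_, \<rho>, _). (e, \<delta> \<otimes>\<^bsub>Ext E Z X\<^esub> \<rho>, e')),
         one = (e, \<one>\<^bsub>Ext E Z X\<^esub>, e')\<rparr>),
      Act = (\<lambda>(_, c, e2) (e1, a, _) (_, \<delta>, _). (e1, Act E c a \<delta>, e2))\<rparr>"

definition idem_cpx :: "('o, 'm) cat \<Rightarrow> ('o, 'm) cpx \<Rightarrow> (nat \<Rightarrow> 'm) \<Rightarrow> ('o \<times> 'm, 'm \<times> 'm \<times> 'm) cpx" where
  "idem_cpx C X e = \<lparr>cob = (\<lambda>i. (cob X i, e i)),
     cdf = (\<lambda>i. (e (i + 1), e (i + 1) \<cdot>\<^bsub>C\<^esub> cdf X i \<cdot>\<^bsub>C\<^esub> e i, e i))\<rparr>"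

text \<open>The value is \<open>[(X, e)]\<close> for an arbitrary choice of \<open>X\<close> and of an idempotent chain map \<open>e\<close>.\<close>

definition idem_realisation ::
    "('o, 'm) cat \<Rightarrow> nat \<Rightarrow> ('o, 'm, 'x) realisation \<Rightarrow>
     ('o \<times> 'm, 'm \<times> 'm \<times> 'm, 'm \<times> 'x \<times> 'm) realisation" where
  "idem_realisation C n s = (\<lambda>(Z, e') (A, e0) (_, \<delta>, _). SOME K. \<exists>X e.
     realises C n s Z A \<delta> X \<and> chain_map C n X X e \<and>
     (\<forall>i \<le> n + 1. e i \<cdot>\<^bsub>C\<^esub> e i = e i) \<and> e 0 = e0 \<and> e (n + 1) = e' \<and>
     K = kclass (idem_cat C) n (idem_cpx C X e))"

section \<open>Weak idempotent completion\<close>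

definition split_idempotent :: "('o, 'm) cat \<Rightarrow> 'o \<Rightarrow> 'm \<Rightarrow> bool" where
  "split_idempotent C X e \<longleftrightarrow> (\<exists>Y. \<exists>r \<in> Mor C X Y. \<exists>s \<in> Mor C Y X.
     e = s \<cdot>\<^bsub>C\<^esub> r \<and> r \<cdot>\<^bsub>C\<^esub> s = Idt C Y)"

definition full_subcat :: "('o, 'm) cat \<Rightarrow> 'o set \<Rightarrow> ('o, 'm) cat" where
  "full_subcat C S = C\<lparr>Ob := Ob C \<inter> S, Mor := (\<lambda>A B. if A \<in> S \<and> B \<in> S then Mor C A B else {})\<rparr>"

definition wic_cat :: "('o, 'm) cat \<Rightarrow> ('o \<times> 'm, 'm \<times> 'm \<times> 'm) cat" where
  "wic_cat C = full_subcat (idem_cat C)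
     {(X, e). split_idempotent C X (Idt C X \<boxplus>\<^bsub>C\<^esub> Neg C X X e)}"

text \<open>Bifunctors have no domain component, so restricting one to the objects and morphisms of
  \<open>wic_cat C\<close> does not change the underlying data.\<close>

definition wic_bifunctor ::
    "('o, 'm) cat \<Rightarrow> ('o, 'm, 'x) bifunctor \<Rightarrow> ('o \<times> 'm, 'm \<times> 'm \<times> 'm, 'm \<times> 'x \<times> 'm) bifunctor" where
  "wic_bifunctor C E = idem_bifunctor C E"

definition wic_realisation ::
    "('o, 'm) cat \<Rightarrow> nat \<Rightarrow> ('o, 'm, 'x) realisation \<Rightarrow>
     ('o \<times> 'm, 'm \<times> 'm \<times> 'm, 'm \<times> 'x \<times> 'm) realisation" where
  "wic_realisation C n s = (\<lambda>Z A \<delta>. SOME K. \<exists>X \<in> Ch (wic_cat C) n.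
     realises (idem_cat C) n (idem_realisation C n s) Z A \<delta> X \<and> K = kclass (wic_cat C) n X)"

definition wic_functor :: "('o, 'm) cat \<Rightarrow> ('o, 'm, 'o \<times> 'm, 'm \<times> 'm \<times> 'm) cfunctor" where
  "wic_functor C = \<lparr>Fob = (\<lambda>X. (X, Idt C X)),
     Fmor = (\<lambda>r. THE t. \<exists>X Y. r \<in> Mor C X Y \<and> t = (Idt C Y, r, Idt C X))\<rparr>"

definition wic_trans :: "('o, 'm) cat \<Rightarrow> 'o \<Rightarrow> 'o \<Rightarrow> 'x \<Rightarrow> 'm \<times> 'x \<times> 'm" where
  "wic_trans C = (\<lambda>Z A \<delta>. (Idt C A, \<delta>, Idt C Z))"

end

(* Every object (X, e) of the weak idempotent completion is a direct summand of (X, id), with a complement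
   of the form (Y, id). An extension between such objects therefore becomes, after adding complements,
   an extension in C. A complex realises it iff it is an n-exangle that maps to and from a realisation
   in C by chain maps whose ends are the inclusions and projections of the summands. Such complexes are
   obtained by splitting off the contractible pieces on the complements, and each axiom is transferred
   from C along these maps. Two complexes that are exact in the inner degrees and compare in both
   directions, identically at the ends, are isomorphic in the homotopy category; so only chain maps have
   to be constructed, never inverses. The dual axioms follow by applying everything to opposite categories.

   For the universal property, an idempotent e of X with split complement has an image L(X, e) under F
   because a kernel of the image of the retraction onto the complement exists in C'. The maps into and out
   of L(X, e) determine the extension of F, of its transformation, and of natural transformations. *)
theory Submission
  imports Defs
begin

text \<open>What shapes the proof is the behaviour at the ends of complexes.
  \<open>homotopic\<close> admits homotopies with nonzero outer components, whereas (EA2) asks for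
  one particular cone. When a good lift is restricted to summands, the squares linking it to the
  original lift commute only up to homotopy, and such a square induces a map of cones only if the
  homotopy vanishes in degree 1. Therefore homotopies vanishing at both ends are constructed where
  possible, and elsewhere the outer components are computed explicitly and carried along. Inflations
  pose a different difficulty: the middle object of a composite need not come from C, and the
  enlargements that bring the two factors into C do not match. Being an inflation is therefore
  rephrased as a factorisation property in which all enlargements can be done inside C. Finally, the
  opposite of the completion is not literally the completion of the opposite category, as the
  triples are reversed. Hence the argument runs for an abstract class of objects of which all
  objects are summands, supplied by a full embedding.\<close>

definition mor :: "('o, 'm) cat \<Rightarrow> 'm \<Rightarrow> bool" where
  "mor C f \<longleftrightarrow> (\<exists>A B. f \<in> Mor C A B)"

definition dm :: "('o, 'm) cat \<Rightarrow> 'm \<Rightarrow> 'o" where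
  "dm C f = (THE A. \<exists>B. f \<in> Mor C A B)"

definition cd :: "('o, 'm) cat \<Rightarrow> 'm \<Rightarrow> 'o" where
  "cd C f = (THE B. \<exists>A. f \<in> Mor C A B)"

section \<open>Calculus of composition\<close>

context category
begin

text \<open>Hom-sets are disjoint, so a morphism determines its ends. Trading membership for
  equations about \<open>dm\<close> and \<open>cd\<close> lets rewriting settle typing conditions
  without guessing intermediate objects.\<close>

lemma in_Mor_iff: "f \<in> Mor C A B \<longleftrightarrow> mor C f \<and> dm C f = A \<and> cd C f = B"
proof -
  have "dm C f = A \<and> cd C f = B" if "f \<in> Mor C A B" for A B
    unfolding dm_def cd_def
    by (intro conjI the_equality) (use that mor_disjoint in blast)+
  then show ?thesis unfolding mor_def by metis
qed

lemma mor_Ob: "mor C f \<Longrightarrow> dm C f \<in> Ob C" "mor C f \<Longrightarrow> cd C f \<in> Ob C"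
  using mor_ob in_Mor_iff by blast+

lemma Idt_typ: "A \<in> Ob C \<Longrightarrow> mor C (Idt C A)" "A \<in> Ob C \<Longrightarrow> dm C (Idt C A) = A"
    "A \<in> Ob C \<Longrightarrow> cd C (Idt C A) = A"
  using idt_mor in_Mor_iff by blast+

lemma cmp_typ:
  assumes "mor C f" "mor C g" "dm C g = cd C f"
  shows "mor C (g \<cdot> f)" "dm C (g \<cdot> f) = dm C f" "cd C (g \<cdot> f) = cd C g"
  using cmp_mor[of f "dm C f" "cd C f" g "cd C g"] assms by (simp_all add: in_Mor_iff)

lemma cmp_assoc': "mor C f \<Longrightarrow> mor C g \<Longrightarrow> mor C h \<Longrightarrow> dm C g = cd C f \<Longrightarrow> dm C h = cd C g \<Longrightarrow>
    (h \<cdot> g) \<cdot> f = h \<cdot> (g \<cdot> f)"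
  by (rule cmp_assoc[of f "dm C f" "cd C f" g "cd C g" h "cd C h"]) (simp_all add: in_Mor_iff)

lemma idt_cmp': "mor C f \<Longrightarrow> cd C f = B \<Longrightarrow> Idt C B \<cdot> f = f"
  using idt_cmp in_Mor_iff by blast

lemma cmp_idt': "mor C f \<Longrightarrow> dm C f = A \<Longrightarrow> f \<cdot> Idt C A = f"
  using cmp_idt in_Mor_iff by blast

text \<open>Composites are normalised to right-nested form, in which the left side of an equation
  between composites no longer occurs as a subterm once another factor follows. This form restores
  the equation in front of a trailing factor \<open>x\<close>.\<close>

lemma eqR: "g \<cdot> f = h \<Longrightarrow> mor C f \<Longrightarrow> mor C g \<Longrightarrow> dm C g = cd C f \<Longrightarrow> mor C x \<Longrightarrow>
    dm C f = cd C x \<Longrightarrow> g \<cdot> (f \<cdot> x) = h \<cdot> x"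
  using cmp_assoc' by metis

end

lemmas (in category) cat_simps = in_Mor_iff mor_Ob Idt_typ cmp_typ cmp_assoc' idt_cmp' cmp_idt'

section \<open>Calculus of hom groups and biproducts\<close>

context additive_category
begin

lemma HomG_simps: "carrier (HomG C A B) = Mor C A B" "x \<otimes>\<^bsub>HomG C A B\<^esub> y = x \<boxplus> y"
    "\<one>\<^bsub>HomG C A B\<^esub> = Zer C A B"
  by (simp_all add: HomG_def)

lemma HomG_group: "A \<in> Ob C \<Longrightarrow> B \<in> Ob C \<Longrightarrow> group (HomG C A B)"
  using hom_group comm_group_def by blast

lemma Zer_mor: "A \<in> Ob C \<Longrightarrow> B \<in> Ob C \<Longrightarrow> Zer C A B \<in> Mor C A B"
  using monoid.one_closed[OF group.is_monoid[OF HomG_group]] by (simp add: HomG_simps)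

lemma Zer_typ: "A \<in> Ob C \<Longrightarrow> B \<in> Ob C \<Longrightarrow> mor C (Zer C A B)"
    "A \<in> Ob C \<Longrightarrow> B \<in> Ob C \<Longrightarrow> dm C (Zer C A B) = A" "A \<in> Ob C \<Longrightarrow> B \<in> Ob C \<Longrightarrow> cd C (Zer C A B) = B"
  using Zer_mor in_Mor_iff by blast+

lemma add_mor: "f \<in> Mor C A B \<Longrightarrow> g \<in> Mor C A B \<Longrightarrow> f \<boxplus> g \<in> Mor C A B"
  using monoid.m_closed[OF group.is_monoid[OF HomG_group]] mor_ob by (metis HomG_simps(1,2))

lemma add_typ:
  assumes "mor C f" "mor C g" "dm C f = dm C g" "cd C f = cd C g"
  shows "mor C (f \<boxplus> g)" "dm C (f \<boxplus> g) = dm C g" "cd C (f \<boxplus> g) = cd C g"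
  using add_mor[of f "dm C g" "cd C g" g] assms by (simp_all add: in_Mor_iff)

lemma add_assoc: "mor C f \<Longrightarrow> mor C g \<Longrightarrow> mor C h \<Longrightarrow> dm C f = dm C h \<Longrightarrow> cd C f = cd C h \<Longrightarrow>
    dm C g = dm C h \<Longrightarrow> cd C g = cd C h \<Longrightarrow> (f \<boxplus> g) \<boxplus> h = f \<boxplus> (g \<boxplus> h)"
  using monoid.m_assoc[OF group.is_monoid[OF HomG_group[of "dm C h" "cd C h"]], of f g h]
  by (simp add: HomG_simps in_Mor_iff mor_Ob)

lemma add_comm: "mor C f \<Longrightarrow> mor C g \<Longrightarrow> dm C f = dm C g \<Longrightarrow> cd C f = cd C g \<Longrightarrow> f \<boxplus> g = g \<boxplus> f"
  using comm_monoid.m_comm[OF comm_group.axioms(1)[OF hom_group[of "dm C g" "cd C g"]], of f g]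
  by (simp add: HomG_simps in_Mor_iff mor_Ob)

lemma add_lcomm: "mor C f \<Longrightarrow> mor C g \<Longrightarrow> mor C h \<Longrightarrow> dm C f = dm C h \<Longrightarrow> cd C f = cd C h \<Longrightarrow>
    dm C g = dm C h \<Longrightarrow> cd C g = cd C h \<Longrightarrow> f \<boxplus> (g \<boxplus> h) = g \<boxplus> (f \<boxplus> h)"
  using add_assoc[of f g h] add_assoc[of g f h] add_comm[of f g] by simp

lemma add_zero:
  assumes "mor C f" "dm C f = A" "cd C f = B"
  shows "Zer C A B \<boxplus> f = f" "f \<boxplus> Zer C A B = f"
proof -
  interpret G: group "HomG C A B" using HomG_group assms mor_Ob by blast
  show "Zer C A B \<boxplus> f = f" "f \<boxplus> Zer C A B = f"
    using G.l_one[of f] G.r_one[of f] assms by (simp_all add: HomG_simps in_Mor_iff)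
qed

lemma add_cancel: "mor C f \<Longrightarrow> mor C g \<Longrightarrow> mor C h \<Longrightarrow> dm C f = dm C h \<Longrightarrow> cd C f = cd C h \<Longrightarrow>
    dm C g = dm C h \<Longrightarrow> cd C g = cd C h \<Longrightarrow> f \<boxplus> h = g \<boxplus> h \<Longrightarrow> f = g"
  using group.right_cancel[OF HomG_group[of "dm C h" "cd C h"], of h f g]
  by (simp add: HomG_simps in_Mor_iff mor_Ob)

lemma Neg_mor: "f \<in> Mor C A B \<Longrightarrow> Neg C A B f \<in> Mor C A B"
  using group.inv_closed[OF HomG_group] mor_ob unfolding Neg_def by (metis HomG_simps(1))

lemma Neg_typ: "mor C f \<Longrightarrow> dm C f = A \<Longrightarrow> cd C f = B \<Longrightarrow> mor C (Neg C A B f)"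
    "mor C f \<Longrightarrow> dm C f = A \<Longrightarrow> cd C f = B \<Longrightarrow> dm C (Neg C A B f) = A"
    "mor C f \<Longrightarrow> dm C f = A \<Longrightarrow> cd C f = B \<Longrightarrow> cd C (Neg C A B f) = B"
  using Neg_mor in_Mor_iff by blast+

lemma add_Neg: assumes "f \<in> Mor C A B" shows "f \<boxplus> Neg C A B f = Zer C A B" "Neg C A B f \<boxplus> f = Zer C A B"
proof -
  interpret G: group "HomG C A B" using HomG_group assms mor_ob by blast
  show "f \<boxplus> Neg C A B f = Zer C A B" "Neg C A B f \<boxplus> f = Zer C A B"
    using G.r_inv[of f] G.l_inv[of f] assms by (simp_all add: HomG_simps Neg_def)
qed

lemma cmp_add': "mor C f \<Longrightarrow> mor C f' \<Longrightarrow> mor C g \<Longrightarrow> dm C f = dm C f' \<Longrightarrow> cd C f = cd C f' \<Longrightarrow>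
    dm C g = cd C f' \<Longrightarrow> g \<cdot> (f \<boxplus> f') = (g \<cdot> f) \<boxplus> (g \<cdot> f')"
  by (rule cmp_add[of f "dm C f'" "cd C f'" f' g "cd C g"]) (simp_all add: in_Mor_iff)

lemma add_cmp': "mor C f \<Longrightarrow> mor C g \<Longrightarrow> mor C g' \<Longrightarrow> dm C g = dm C g' \<Longrightarrow> cd C g = cd C g' \<Longrightarrow>
    dm C g' = cd C f \<Longrightarrow> (g \<boxplus> g') \<cdot> f = (g \<cdot> f) \<boxplus> (g' \<cdot> f)"
  by (rule add_cmp[of f "dm C f" "cd C f" g "cd C g'" g']) (simp_all add: in_Mor_iff)

lemma self_add_zero: "mor C f \<Longrightarrow> f \<boxplus> f = f \<Longrightarrow> f = Zer C (dm C f) (cd C f)"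
  by (rule add_cancel[of _ _ f]) (simp_all add: Zer_typ mor_Ob add_zero)

lemma cmp_zero: assumes "mor C g" "dm C g = B" "A \<in> Ob C" shows "g \<cdot> Zer C A B = Zer C A (cd C g)"
proof -
  have B: "B \<in> Ob C" using assms mor_Ob by blast
  have "g \<cdot> Zer C A B = g \<cdot> (Zer C A B \<boxplus> Zer C A B)" by (simp add: add_zero Zer_typ B assms)
  also have "\<dots> = g \<cdot> Zer C A B \<boxplus> g \<cdot> Zer C A B" by (rule cmp_add') (simp_all add: Zer_typ B assms)
  finally show ?thesis using self_add_zero[of "g \<cdot> Zer C A B"] by (simp add: cmp_typ Zer_typ B assms)
qed

lemma zero_cmp: assumes "mor C f" "cd C f = A" "B \<in> Ob C" shows "Zer C A B \<cdot> f = Zer C (dm C f) B"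
proof -
  have A: "A \<in> Ob C" using assms mor_Ob by blast
  have "Zer C A B \<cdot> f = (Zer C A B \<boxplus> Zer C A B) \<cdot> f" by (simp add: add_zero Zer_typ A assms)
  also have "\<dots> = Zer C A B \<cdot> f \<boxplus> Zer C A B \<cdot> f" by (rule add_cmp') (simp_all add: Zer_typ A assms)
  finally show ?thesis using self_add_zero[of "Zer C A B \<cdot> f"] by (simp add: cmp_typ Zer_typ A assms)
qed

text \<open>Differences enter as witnesses. Together with \<open>add_cancel\<close> this lets most
  calculations add one term to both sides instead of distributing minus signs.\<close>

lemma ex_diff: assumes "f \<in> Mor C A B" "g \<in> Mor C A B" shows "\<exists>h \<in> Mor C A B. f = g \<boxplus> h"
proof -
  have "f = g \<boxplus> (Neg C A B g \<boxplus> f)"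
    using add_Neg(1)[OF assms(2)] add_assoc[of g "Neg C A B g" f] assms
    by (simp add: in_Mor_iff Neg_typ add_zero)
  then show ?thesis using Neg_mor add_mor assms by blast
qed

lemma ex_neg: assumes "g \<in> Mor C A B" shows "\<exists>h \<in> Mor C A B. g \<boxplus> h = Zer C A B"
  using add_Neg Neg_mor assms by blast

end

lemmas (in additive_category) add_simps = cat_simps Zer_typ add_typ Neg_typ add_zero cmp_add' add_cmp'
  cmp_zero zero_cmp
lemmas (in additive_category) add_ac = add_assoc add_comm add_lcomm

lemma (in additive_category) eqRadd: "g \<cdot> f = h \<boxplus> h' \<Longrightarrow> mor C f \<Longrightarrow> mor C g \<Longrightarrow> dm C g = cd C f \<Longrightarrow> mor C x \<Longrightarrow>
    dm C f = cd C x \<Longrightarrow> mor C h' \<Longrightarrow> mor C h \<Longrightarrow> dm C h = dm C h' \<Longrightarrow> cd C h = cd C h' \<Longrightarrow> dm C h' = cd C x \<Longrightarrow>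
    g \<cdot> (f \<cdot> x) = (h \<cdot> x) \<boxplus> (h' \<cdot> x)"
  using eqR[of g f _ x] by (simp add: add_simps)

context additive_category begin

lemma biproductD:
  assumes "biproduct C A B P i1 i2 p1 p2"
  shows "i1 \<in> Mor C A P" "i2 \<in> Mor C B P" "p1 \<in> Mor C P A" "p2 \<in> Mor C P B"
    "p1 \<cdot> i1 = Idt C A" "p2 \<cdot> i2 = Idt C B" "p1 \<cdot> i2 = Zer C B A" "p2 \<cdot> i1 = Zer C A B"
    "(i1 \<cdot> p1) \<boxplus> (i2 \<cdot> p2) = Idt C P"
    "A \<in> Ob C" "B \<in> Ob C" "P \<in> Ob C"
  using assms mor_ob unfolding biproduct_def by blast+

lemma biproduct_split:
  assumes "biproduct C A B P i1 i2 p1 p2"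
  shows "f \<in> Mor C P V \<Longrightarrow> f = (f \<cdot> i1) \<cdot> p1 \<boxplus> (f \<cdot> i2) \<cdot> p2"
    "g \<in> Mor C V P \<Longrightarrow> g = i1 \<cdot> (p1 \<cdot> g) \<boxplus> i2 \<cdot> (p2 \<cdot> g)"
proof -
  note b = biproductD[OF assms]
  assume f: "f \<in> Mor C P V"
  have "f = f \<cdot> ((i1 \<cdot> p1) \<boxplus> (i2 \<cdot> p2))" using f by (simp add: b(9) cmp_idt)
  also have "\<dots> = (f \<cdot> i1) \<cdot> p1 \<boxplus> (f \<cdot> i2) \<cdot> p2"
    using f b(1-4) by (simp add: add_simps)
  finally show "f = (f \<cdot> i1) \<cdot> p1 \<boxplus> (f \<cdot> i2) \<cdot> p2" .
next
  note b = biproductD[OF assms]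
  assume g: "g \<in> Mor C V P"
  have "g = ((i1 \<cdot> p1) \<boxplus> (i2 \<cdot> p2)) \<cdot> g" using g by (simp add: b(9) idt_cmp)
  also have "\<dots> = i1 \<cdot> (p1 \<cdot> g) \<boxplus> i2 \<cdot> (p2 \<cdot> g)"
    using g b(1-4) by (simp add: add_simps)
  finally show "g = i1 \<cdot> (p1 \<cdot> g) \<boxplus> i2 \<cdot> (p2 \<cdot> g)" .
qed

end

section \<open>Chain maps and homotopies\<close>

definition hty :: "('o, 'm) cat \<Rightarrow> nat \<Rightarrow> ('o, 'm) cpx \<Rightarrow> ('o, 'm) cpx \<Rightarrow> (nat \<Rightarrow> 'm) \<Rightarrow> bool" where
  "hty C n X Y h \<longleftrightarrow> (\<forall>i \<in> {1..n + 1}. h i \<in> Mor C (cob X i) (cob Y (i - 1)))"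

definition hb :: "('o, 'm) cat \<Rightarrow> nat \<Rightarrow> ('o, 'm) cpx \<Rightarrow> ('o, 'm) cpx \<Rightarrow> (nat \<Rightarrow> 'm) \<Rightarrow> nat \<Rightarrow> 'm" where
  "hb C n X Y h i = (if i = 0 then h 1 \<cdot>\<^bsub>C\<^esub> cdf X 0
     else if i = n + 1 then cdf Y n \<cdot>\<^bsub>C\<^esub> h (n + 1)
     else (cdf Y (i - 1) \<cdot>\<^bsub>C\<^esub> h i) \<boxplus>\<^bsub>C\<^esub> (h (i + 1) \<cdot>\<^bsub>C\<^esub> cdf X i))"

text \<open>With vanishing outer components, f and g agree in the degrees 0 and n + 1, and in the
  degrees 1 and n one of the two summands of \<open>hb\<close> disappears. The treatment of mapping
  cones depends on this.\<close>

definition strong_homotopic :: "('o, 'm) cat \<Rightarrow> nat \<Rightarrow> ('o, 'm) cpx \<Rightarrow> ('o, 'm) cpx \<Rightarrow> (nat \<Rightarrow> 'm) \<Rightarrow> (nat \<Rightarrow> 'm) \<Rightarrow> bool" where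
  "strong_homotopic C n X Y f g \<longleftrightarrow> (\<exists>h. hty C n X Y h \<and> h 1 = Zer C (cob X 1) (cob Y 0) \<and>
     h (n + 1) = Zer C (cob X (n + 1)) (cob Y n) \<and> (\<forall>i \<le> n + 1. f i = g i \<boxplus>\<^bsub>C\<^esub> hb C n X Y h i))"

text \<open>Exactness of \<open>C(-, Y)\<close> in the inner degrees \<open>1, \<dots>, n\<close> only; it makes chain maps with
  equal start homotopic (\<open>comparison\<close>), hence complexes with comparison maps in both directions
  isomorphic in the homotopy category (\<open>K_isoI\<close>).\<close>

definition cexact :: "('o, 'm) cat \<Rightarrow> nat \<Rightarrow> ('o, 'm) cpx \<Rightarrow> bool" where
  "cexact C n X \<longleftrightarrow> (\<forall>i < n. \<forall>Y. \<forall>u \<in> Mor C (cob X (Suc i)) Y.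
     u \<cdot>\<^bsub>C\<^esub> cdf X i = Zer C (cob X i) Y \<longrightarrow>
     (\<exists>w \<in> Mor C (cob X (Suc (Suc i))) Y. u = w \<cdot>\<^bsub>C\<^esub> cdf X (Suc i)))"

definition dexact :: "('o, 'm) cat \<Rightarrow> nat \<Rightarrow> ('o, 'm) cpx \<Rightarrow> bool" where
  "dexact C n X \<longleftrightarrow> (\<forall>i < n. \<forall>Y. \<forall>u \<in> Mor C Y (cob X (Suc i)).
     cdf X (Suc i) \<cdot>\<^bsub>C\<^esub> u = Zer C Y (cob X (Suc (Suc i))) \<longrightarrow>
     (\<exists>w \<in> Mor C Y (cob X i). u = cdf X i \<cdot>\<^bsub>C\<^esub> w))"

text \<open>Dependent choice with a prescribed initial value; in \<open>comparison\<close> that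
  value is the zero map, the first component of a homotopy.\<close>

lemma dependent_nat_choice2:
  assumes "P 0 x" "\<And>x i. P i x \<Longrightarrow> \<exists>y. P (Suc i) y \<and> Q i x y"
  shows "\<exists>f. f 0 = x \<and> (\<forall>i. P i (f i) \<and> Q i (f i) (f (Suc i)))"
proof -
  define P' where "P' i y \<longleftrightarrow> P i y \<and> (i = 0 \<longrightarrow> y = x)" for i y
  have "\<exists>f. \<forall>i. P' i (f i) \<and> Q i (f i) (f (Suc i))"
    by (rule dependent_nat_choice) (use assms in \<open>auto simp: P'_def\<close>)
  then show ?thesis unfolding P'_def by blast
qed

lemma hb_simps:
  "hb C n X Y h 0 = h (Suc 0) \<cdot>\<^bsub>C\<^esub> cdf X 0"
  "hb C n X Y h (Suc n) = cdf Y n \<cdot>\<^bsub>C\<^esub> h (Suc n)"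
  "i < n \<Longrightarrow> hb C n X Y h (Suc i) = (cdf Y i \<cdot>\<^bsub>C\<^esub> h (Suc i)) \<boxplus>\<^bsub>C\<^esub> (h (Suc (Suc i)) \<cdot>\<^bsub>C\<^esub> cdf X (Suc i))"
  by (simp_all add: hb_def)

lemma homotopic_iff:
  "homotopic C n X Y f g \<longleftrightarrow> (\<exists>h. hty C n X Y h \<and> (\<forall>i \<le> n + 1. f i = g i \<boxplus>\<^bsub>C\<^esub> hb C n X Y h i))"
proof -
  have "(\<forall>i \<le> n + 1. f i = g i \<boxplus>\<^bsub>C\<^esub> hb C n X Y h i) \<longleftrightarrow>
     f 0 = g 0 \<boxplus>\<^bsub>C\<^esub> (h 1 \<cdot>\<^bsub>C\<^esub> cdf X 0) \<and>
     (\<forall>i \<in> {1..n}. f i =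
        g i \<boxplus>\<^bsub>C\<^esub> ((cdf Y (i - 1) \<cdot>\<^bsub>C\<^esub> h i) \<boxplus>\<^bsub>C\<^esub> (h (i + 1) \<cdot>\<^bsub>C\<^esub> cdf X i))) \<and>
     f (n + 1) = g (n + 1) \<boxplus>\<^bsub>C\<^esub> (cdf Y n \<cdot>\<^bsub>C\<^esub> h (n + 1))" (is "?L \<longleftrightarrow> ?R") for h
  proof
    assume L: ?L
    show ?R using L[rule_format, of 0] L[rule_format, of "n+1"] L by (auto simp: hb_def)
  next
    assume R: ?R
    show ?L
    proof (intro allI impI)
      fix i assume "i \<le> n + 1"
      then consider "i = 0" | "i = n + 1" | "i \<in> {1..n}" by fastforce
      then show "f i = g i \<boxplus>\<^bsub>C\<^esub> hb C n X Y h i" by cases (use R in \<open>auto simp: hb_def\<close>)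
    qed
  qed
  then show ?thesis unfolding homotopic_def hty_def by blast
qed

lemma strong_homotopic_homotopic: "strong_homotopic C n X Y f g \<Longrightarrow> homotopic C n X Y f g"
  unfolding strong_homotopic_def homotopic_iff by blast

context additive_category
begin

lemma Ch_simps:
  assumes "X \<in> Ch C n"
  shows "i \<le> Suc n \<Longrightarrow> cob X i \<in> Ob C" "i \<le> n \<Longrightarrow> mor C (cdf X i)" "i \<le> n \<Longrightarrow> dm C (cdf X i) = cob X i"
    "i \<le> n \<Longrightarrow> cd C (cdf X i) = cob X (Suc i)"
    "i < n \<Longrightarrow> cdf X (Suc i) \<cdot> cdf X i = Zer C (cob X i) (cob X (Suc (Suc i)))"
    "i < n \<Longrightarrow> mor C x \<Longrightarrow> cd C x = cob X i \<Longrightarrow> cdf X (Suc i) \<cdot> (cdf X i \<cdot> x) = Zer C (dm C x) (cob X (Suc (Suc i)))"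
proof -
  have a: "i \<le> Suc n \<Longrightarrow> cob X i \<in> Ob C" "i \<le> n \<Longrightarrow> cdf X i \<in> Mor C (cob X i) (cob X (Suc i))"
    "i < n \<Longrightarrow> cdf X (Suc i) \<cdot> cdf X i = Zer C (cob X i) (cob X (Suc (Suc i)))" for i
    using assms unfolding Ch_def by auto
  show "i \<le> Suc n \<Longrightarrow> cob X i \<in> Ob C" "i \<le> n \<Longrightarrow> mor C (cdf X i)" "i \<le> n \<Longrightarrow> dm C (cdf X i) = cob X i"
    "i \<le> n \<Longrightarrow> cd C (cdf X i) = cob X (Suc i)"
    "i < n \<Longrightarrow> cdf X (Suc i) \<cdot> cdf X i = Zer C (cob X i) (cob X (Suc (Suc i)))"
    using a by (auto simp: in_Mor_iff)
  show "cdf X (Suc i) \<cdot> (cdf X i \<cdot> x) = Zer C (dm C x) (cob X (Suc (Suc i)))"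
    if "i < n" "mor C x" "cd C x = cob X i"
    using eqR[OF a(3)[OF that(1)], of x] a(2)[of i] a(2)[of "Suc i"] a(1)[of "Suc (Suc i)"] that
    by (simp add: in_Mor_iff zero_cmp)
qed

lemma ChI:
  assumes "\<And>i. i \<le> Suc n \<Longrightarrow> cob X i \<in> Ob C" "\<And>i. i \<le> n \<Longrightarrow> cdf X i \<in> Mor C (cob X i) (cob X (Suc i))"
    "\<And>i. i < n \<Longrightarrow> cdf X (Suc i) \<cdot> cdf X i = Zer C (cob X i) (cob X (Suc (Suc i)))"
  shows "X \<in> Ch C n"
  using assms unfolding Ch_def by auto

lemma chain_map_simps:
  assumes "X \<in> Ch C n" "Y \<in> Ch C n" "chain_map C n X Y f"
  shows "i \<le> Suc n \<Longrightarrow> mor C (f i)" "i \<le> Suc n \<Longrightarrow> dm C (f i) = cob X i" "i \<le> Suc n \<Longrightarrow> cd C (f i) = cob Y i"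
    "i \<le> n \<Longrightarrow> f (Suc i) \<cdot> cdf X i = cdf Y i \<cdot> f i"
    "i \<le> n \<Longrightarrow> mor C x \<Longrightarrow> cd C x = cob X i \<Longrightarrow> f (Suc i) \<cdot> (cdf X i \<cdot> x) = cdf Y i \<cdot> (f i \<cdot> x)"
proof -
  have a: "i \<le> Suc n \<Longrightarrow> f i \<in> Mor C (cob X i) (cob Y i)" "i \<le> n \<Longrightarrow> f (Suc i) \<cdot> cdf X i = cdf Y i \<cdot> f i" for i
    using assms unfolding chain_map_def by auto
  show "i \<le> Suc n \<Longrightarrow> mor C (f i)" "i \<le> Suc n \<Longrightarrow> dm C (f i) = cob X i" "i \<le> Suc n \<Longrightarrow> cd C (f i) = cob Y i"
    "i \<le> n \<Longrightarrow> f (Suc i) \<cdot> cdf X i = cdf Y i \<cdot> f i"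
    using a by (auto simp: in_Mor_iff)
  show "f (Suc i) \<cdot> (cdf X i \<cdot> x) = cdf Y i \<cdot> (f i \<cdot> x)" if "i \<le> n" "mor C x" "cd C x = cob X i"
    using eqR[OF a(2)[OF that(1)], of x] a(1)[of i] a(1)[of "Suc i"] that Ch_simps[OF assms(1), of i]
      Ch_simps[OF assms(2), of i]
    by (simp add: cat_simps)
qed

lemma chain_mapI:
  assumes "\<And>i. i \<le> Suc n \<Longrightarrow> f i \<in> Mor C (cob X i) (cob Y i)" "\<And>i. i \<le> n \<Longrightarrow> f (Suc i) \<cdot> cdf X i = cdf Y i \<cdot> f i"
  shows "chain_map C n X Y f"
  using assms unfolding chain_map_def by auto

lemma hty_simps:
  assumes "hty C n X Y h"
  shows "i \<le> n \<Longrightarrow> mor C (h (Suc i))" "i \<le> n \<Longrightarrow> dm C (h (Suc i)) = cob X (Suc i)"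
    "i \<le> n \<Longrightarrow> cd C (h (Suc i)) = cob Y i"
proof -
  have "h (Suc i) \<in> Mor C (cob X (Suc i)) (cob Y i)" if "i \<le> n"
    using assms[unfolded hty_def, rule_format, of "Suc i"] that by simp
  then show "i \<le> n \<Longrightarrow> mor C (h (Suc i))" "i \<le> n \<Longrightarrow> dm C (h (Suc i)) = cob X (Suc i)"
    "i \<le> n \<Longrightarrow> cd C (h (Suc i)) = cob Y i" by (simp_all add: in_Mor_iff)
qed

lemma htyI: "(\<And>i. i \<le> n \<Longrightarrow> h (Suc i) \<in> Mor C (cob X (Suc i)) (cob Y i)) \<Longrightarrow> hty C n X Y h"
proof -
  assume a: "\<And>i. i \<le> n \<Longrightarrow> h (Suc i) \<in> Mor C (cob X (Suc i)) (cob Y i)"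
  show ?thesis unfolding hty_def
  proof
    fix i assume "i \<in> {1..n+1}"
    then show "h i \<in> Mor C (cob X i) (cob Y (i - 1))" using a[of "i - 1"] by (cases i) auto
  qed
qed

lemma chain_map_id: "X \<in> Ch C n \<Longrightarrow> chain_map C n X X (\<lambda>i. Idt C (cob X i))"
  by (rule chain_mapI) (simp_all add: Ch_simps cat_simps)

lemma chain_map_comp:
  assumes "X \<in> Ch C n" "Y \<in> Ch C n" "Z \<in> Ch C n" "chain_map C n X Y f" "chain_map C n Y Z g"
  shows "chain_map C n X Z (\<lambda>i. g i \<cdot> f i)"
  using chain_map_simps[OF assms(1,2,4)] chain_map_simps[OF assms(2,3,5)] Ch_simps[OF assms(1)] Ch_simps[OF assms(2)] Ch_simps[OF assms(3)]
  by (intro chain_mapI) (simp_all add: cat_simps)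

lemma degree_cases:
  assumes "i \<le> Suc n"
  obtains "i = 0" | "i = Suc n" | j where "i = Suc j" "j < n"
  using assms by (metis le_SucE less_eq_Suc_le old.nat.exhaust)

lemma hb_typ:
  assumes "X \<in> Ch C n" "Y \<in> Ch C n" "hty C n X Y h" "i \<le> Suc n"
  shows "mor C (hb C n X Y h i)" "dm C (hb C n X Y h i) = cob X i" "cd C (hb C n X Y h i) = cob Y i"
  using Ch_simps[OF assms(1)] Ch_simps[OF assms(2)] hty_simps[OF assms(3)]
  by (rule_tac degree_cases[OF assms(4)]; simp add: hb_simps add_simps)+

lemma hty_post: "X \<in> Ch C n \<Longrightarrow> Y \<in> Ch C n \<Longrightarrow> Z \<in> Ch C n \<Longrightarrow> hty C n X Y h \<Longrightarrow> chain_map C n Y Z f \<Longrightarrow>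
    hty C n X Z (\<lambda>i. f (i - 1) \<cdot> h i)"
  by (rule htyI) (simp add: cat_simps chain_map_simps hty_simps)

lemma hty_pre: "X \<in> Ch C n \<Longrightarrow> Y \<in> Ch C n \<Longrightarrow> W \<in> Ch C n \<Longrightarrow> hty C n X Y h \<Longrightarrow> chain_map C n W X g \<Longrightarrow>
    hty C n W Y (\<lambda>i. h i \<cdot> g i)"
  by (rule htyI) (simp add: cat_simps chain_map_simps hty_simps)

lemma hb_post:
  assumes "X \<in> Ch C n" "Y \<in> Ch C n" "Z \<in> Ch C n" "hty C n X Y h" "chain_map C n Y Z f" "i \<le> Suc n"
  shows "f i \<cdot> hb C n X Y h i = hb C n X Z (\<lambda>i. f (i - 1) \<cdot> h i) i"
  using Ch_simps[OF assms(1)] Ch_simps[OF assms(2)] Ch_simps[OF assms(3)]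
    hty_simps[OF assms(4)] chain_map_simps[OF assms(2,3,5)]
  by (rule_tac degree_cases[OF assms(6)]; simp add: hb_simps add_simps)+

lemma hb_pre:
  assumes "X \<in> Ch C n" "Y \<in> Ch C n" "W \<in> Ch C n" "hty C n X Y h" "chain_map C n W X g" "i \<le> Suc n"
  shows "hb C n X Y h i \<cdot> g i = hb C n W Y (\<lambda>i. h i \<cdot> g i) i"
  using Ch_simps[OF assms(1)] Ch_simps[OF assms(2)] Ch_simps[OF assms(3)]
    hty_simps[OF assms(4)] chain_map_simps(4,5)[OF assms(3,1,5), symmetric] chain_map_simps(1-3)[OF assms(3,1,5)]
  by (rule_tac degree_cases[OF assms(6)]; simp add: hb_simps add_simps)+

lemma hty_add:
  assumes "hty C n X Y h" "hty C n X Y h'"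
  shows "hty C n X Y (\<lambda>i. h i \<boxplus> h' i)"
  using assms unfolding hty_def by (auto intro: add_mor)

lemma hb_add:
  assumes "X \<in> Ch C n" "Y \<in> Ch C n" "hty C n X Y h" "hty C n X Y h'" "i \<le> Suc n"
  shows "hb C n X Y (\<lambda>i. h i \<boxplus> h' i) i = hb C n X Y h i \<boxplus> hb C n X Y h' i"
  using Ch_simps[OF assms(1)] Ch_simps[OF assms(2)]
    hty_simps[OF assms(3)] hty_simps[OF assms(4)]
  by (rule_tac degree_cases[OF assms(5)]; simp add: hb_simps add_simps add_ac)+

lemma hb_chain:
  assumes "X \<in> Ch C n" "Y \<in> Ch C n" "hty C n X Y h" "i \<le> n" "1 \<le> n"
  shows "hb C n X Y h (Suc i) \<cdot> cdf X i = cdf Y i \<cdot> hb C n X Y h i"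
proof -
  note t = Ch_simps[OF assms(1)] Ch_simps[OF assms(2)] hty_simps[OF assms(3)]
  have "i = 0 \<or> (\<exists>j. i = Suc j)" by (cases i) auto
  then consider "i = 0" | j where "i = Suc j" "Suc j = n" | j where "i = Suc j" "Suc j < n"
    using assms(4) by force
  then show ?thesis
  proof cases
    case 1 then show ?thesis using assms(5) t by (simp add: hb_simps add_simps)
  next
    case (2 j)
    show ?thesis using t unfolding 2(1) 2(2)[symmetric] by (simp add: hb_simps add_simps)
  next
    case (3 j) then show ?thesis using t by (simp add: hb_simps add_simps)
  qed
qed

text \<open>The negative is described by its components as well as by its boundary, since it must be
  checked that vanishing outer components stay zero.\<close>

lemma ex_hty_neg:
  assumes "X \<in> Ch C n" "Y \<in> Ch C n" "hty C n X Y h"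
  obtains h' where "hty C n X Y h'" "\<And>i. i \<le> n \<Longrightarrow> h (Suc i) \<boxplus> h' (Suc i) = Zer C (cob X (Suc i)) (cob Y i)"
    "\<And>i. i \<le> Suc n \<Longrightarrow> hb C n X Y h i \<boxplus> hb C n X Y h' i = Zer C (cob X i) (cob Y i)"
proof -
  define h' where "h' i = Neg C (cob X i) (cob Y (i - 1)) (h i)" for i
  have h': "hty C n X Y h'" using assms(3) unfolding hty_def h'_def by (auto intro: Neg_mor)
  have s: "h (Suc i) \<boxplus> h' (Suc i) = Zer C (cob X (Suc i)) (cob Y i)" if "i \<le> n" for i
    using add_Neg(1)[of "h (Suc i)" "cob X (Suc i)" "cob Y i"] that hty_simps[OF assms(3)]
    unfolding h'_def by (simp add: in_Mor_iff)
  have "hb C n X Y h i \<boxplus> hb C n X Y h' i = Zer C (cob X i) (cob Y i)" if "i \<le> Suc n" for i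
    unfolding hb_add[OF assms h' that, symmetric]
    using Ch_simps[OF assms(1)] Ch_simps[OF assms(2)] s
    by (rule_tac degree_cases[OF that]; simp add: hb_simps add_simps)+
  then show thesis using that h' s by blast
qed

lemma strong_homotopic_hb:
  assumes "strong_homotopic C n X Y f g"
  obtains h where "hty C n X Y h" "h (Suc 0) = Zer C (cob X (Suc 0)) (cob Y 0)"
    "h (Suc n) = Zer C (cob X (Suc n)) (cob Y n)" "\<And>i. i \<le> Suc n \<Longrightarrow> f i = g i \<boxplus> hb C n X Y h i"
  using assms unfolding strong_homotopic_def by auto

lemma strong_homotopicI:
  assumes "hty C n X Y h" "h (Suc 0) = Zer C (cob X (Suc 0)) (cob Y 0)"
    "h (Suc n) = Zer C (cob X (Suc n)) (cob Y n)" "\<And>i. i \<le> Suc n \<Longrightarrow> f i = g i \<boxplus> hb C n X Y h i"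
  shows "strong_homotopic C n X Y f g"
  using assms unfolding strong_homotopic_def by auto

lemma strong_homotopic_post:
  assumes "X \<in> Ch C n" "Y \<in> Ch C n" "Z \<in> Ch C n" "chain_map C n X Y g" "chain_map C n Y Z a" "strong_homotopic C n X Y f g"
  shows "strong_homotopic C n X Z (\<lambda>i. a i \<cdot> f i) (\<lambda>i. a i \<cdot> g i)"
proof -
  obtain h where h: "hty C n X Y h" "h (Suc 0) = Zer C (cob X (Suc 0)) (cob Y 0)"
    "h (Suc n) = Zer C (cob X (Suc n)) (cob Y n)" "\<And>i. i \<le> Suc n \<Longrightarrow> f i = g i \<boxplus> hb C n X Y h i"
    using strong_homotopic_hb assms(6) by blast
  note t = Ch_simps[OF assms(1)] Ch_simps[OF assms(2)] Ch_simps[OF assms(3)] chain_map_simps[OF assms(1,2,4)]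
    chain_map_simps[OF assms(2,3,5)] hb_typ[OF assms(1,2) h(1)]
  show ?thesis
    by (rule strong_homotopicI[OF hty_post[OF assms(1-3) h(1) assms(5)]])
      (use t hb_post[OF assms(1-3) h(1) assms(5)] in \<open>simp_all add: h(2-4) add_simps\<close>)
qed

lemma strong_homotopic_pre:
  assumes "W \<in> Ch C n" "X \<in> Ch C n" "Y \<in> Ch C n" "chain_map C n X Y g" "chain_map C n W X a" "strong_homotopic C n X Y f g"
  shows "strong_homotopic C n W Y (\<lambda>i. f i \<cdot> a i) (\<lambda>i. g i \<cdot> a i)"
proof -
  obtain h where h: "hty C n X Y h" "h (Suc 0) = Zer C (cob X (Suc 0)) (cob Y 0)"
    "h (Suc n) = Zer C (cob X (Suc n)) (cob Y n)" "\<And>i. i \<le> Suc n \<Longrightarrow> f i = g i \<boxplus> hb C n X Y h i"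
    using strong_homotopic_hb assms(6) by blast
  note t = Ch_simps[OF assms(1)] Ch_simps[OF assms(2)] Ch_simps[OF assms(3)] chain_map_simps(1-3)[OF assms(2,3,4)]
    chain_map_simps(1-3)[OF assms(1,2,5)] hb_typ[OF assms(2,3) h(1)]
  show ?thesis
    by (rule strong_homotopicI[OF hty_pre[OF assms(2,3,1) h(1) assms(5)]])
      (use t hb_pre[OF assms(2,3,1) h(1) assms(5)] in \<open>simp_all add: h(2-4) add_simps\<close>)
qed

lemma strong_homotopic_trans:
  assumes "X \<in> Ch C n" "Y \<in> Ch C n" "chain_map C n X Y k" "strong_homotopic C n X Y f g" "strong_homotopic C n X Y g k"
  shows "strong_homotopic C n X Y f k"
proof -
  obtain h where h: "hty C n X Y h" "h (Suc 0) = Zer C (cob X (Suc 0)) (cob Y 0)"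
    "h (Suc n) = Zer C (cob X (Suc n)) (cob Y n)" "\<And>i. i \<le> Suc n \<Longrightarrow> f i = g i \<boxplus> hb C n X Y h i"
    using strong_homotopic_hb assms(4) by blast
  obtain h' where h': "hty C n X Y h'" "h' (Suc 0) = Zer C (cob X (Suc 0)) (cob Y 0)"
    "h' (Suc n) = Zer C (cob X (Suc n)) (cob Y n)" "\<And>i. i \<le> Suc n \<Longrightarrow> g i = k i \<boxplus> hb C n X Y h' i"
    using strong_homotopic_hb assms(5) by blast
  note t = Ch_simps[OF assms(1)] Ch_simps[OF assms(2)] chain_map_simps[OF assms(1,2,3)]
    hb_typ[OF assms(1,2) h(1)] hb_typ[OF assms(1,2) h'(1)]
  show ?thesis
    by (rule strong_homotopicI[OF hty_add[OF h(1) h'(1)]])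
     (use t hb_add[OF assms(1,2) h(1) h'(1)] in \<open>simp_all add: h(2-4) h'(2-4) add_simps add_ac\<close>)
qed

lemma strong_homotopic_sym:
  assumes "X \<in> Ch C n" "Y \<in> Ch C n" "chain_map C n X Y g" "strong_homotopic C n X Y f g"
  shows "strong_homotopic C n X Y g f"
proof -
  obtain h where h: "hty C n X Y h" "h (Suc 0) = Zer C (cob X (Suc 0)) (cob Y 0)"
    "h (Suc n) = Zer C (cob X (Suc n)) (cob Y n)" "\<And>i. i \<le> Suc n \<Longrightarrow> f i = g i \<boxplus> hb C n X Y h i"
    using strong_homotopic_hb assms(4) by blast
  obtain h' where h': "hty C n X Y h'" "\<And>i. i \<le> n \<Longrightarrow> h (Suc i) \<boxplus> h' (Suc i) = Zer C (cob X (Suc i)) (cob Y i)"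
    "\<And>i. i \<le> Suc n \<Longrightarrow> hb C n X Y h i \<boxplus> hb C n X Y h' i = Zer C (cob X i) (cob Y i)"
    using ex_hty_neg[OF assms(1,2) h(1)] by blast
  note t = Ch_simps[OF assms(1)] Ch_simps[OF assms(2)] chain_map_simps[OF assms(1,2,3)]
    hb_typ[OF assms(1,2) h(1)] hb_typ[OF assms(1,2) h'(1)] hty_simps[OF h'(1)]
  have "h' (Suc 0) = Zer C (cob X (Suc 0)) (cob Y 0)" "h' (Suc n) = Zer C (cob X (Suc n)) (cob Y n)"
    using h'(2)[of 0] h'(2)[of n] h(2,3) t by (simp_all add: add_simps)
  then show ?thesis
    by (rule strong_homotopicI[OF h'(1)]) (use t h'(3) in \<open>simp add: h(4) add_simps add_assoc\<close>)
qed

lemma chain_map_endsD: "chain_map_ends C n X Y f \<Longrightarrow> chain_map C n X Y f"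
    "chain_map_ends C n X Y f \<Longrightarrow> f 0 = Idt C (cob X 0)" "chain_map_ends C n X Y f \<Longrightarrow> f (Suc n) = Idt C (cob X (Suc n))"
  by (simp_all add: chain_map_ends_def)

lemma chain_map_ends_cob: "X \<in> Ch C n \<Longrightarrow> Y \<in> Ch C n \<Longrightarrow> chain_map_ends C n X Y f \<Longrightarrow> cob Y 0 = cob X 0 \<and> cob Y (Suc n) = cob X (Suc n)"
  using chain_map_simps(3)[of X n Y f 0] chain_map_simps(3)[of X n Y f "Suc n"]
  by (simp add: chain_map_ends_def Ch_simps Idt_typ)

lemma chain_map_ends_comp:
  assumes "X \<in> Ch C n" "Y \<in> Ch C n" "Z \<in> Ch C n" "chain_map_ends C n X Y f" "chain_map_ends C n Y Z g"
  shows "chain_map_ends C n X Z (\<lambda>i. g i \<cdot> f i)"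
  using chain_map_comp[OF assms(1-3)] assms(4,5) chain_map_ends_cob[OF assms(1,2,4)] Ch_simps[OF assms(1)]
  unfolding chain_map_ends_def by (simp add: cat_simps)

lemma chain_map_ends_id: "X \<in> Ch C n \<Longrightarrow> chain_map_ends C n X X (\<lambda>i. Idt C (cob X i))"
  using chain_map_id unfolding chain_map_ends_def by blast

lemma cexact_diff:
  assumes "X \<in> Ch C n" "cexact C n X" "i < n" "x \<in> Mor C (cob X (Suc i)) Y" "y \<in> Mor C (cob X (Suc i)) Y"
    "x \<cdot> cdf X i = y \<cdot> cdf X i"
  shows "\<exists>w \<in> Mor C (cob X (Suc (Suc i))) Y. x = y \<boxplus> w \<cdot> cdf X (Suc i)"
proof -
  note t = Ch_simps[OF assms(1)]
  obtain z where z: "z \<in> Mor C (cob X (Suc i)) Y" "x = y \<boxplus> z" using ex_diff assms(4,5) by blast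
  have "z \<cdot> cdf X i \<boxplus> y \<cdot> cdf X i = Zer C (cob X i) Y \<boxplus> y \<cdot> cdf X i"
    using assms(3-6) z t mor_ob[OF z(1)] by (simp add: add_simps add_comm)
  then have "z \<cdot> cdf X i = Zer C (cob X i) Y"
    using assms(3-6) z(1) t mor_ob[OF z(1)] by (rule_tac add_cancel[of "z \<cdot> cdf X i" _ "y \<cdot> cdf X i"]) (simp_all add: add_simps)
  then show ?thesis using z assms(2,3) unfolding cexact_def by metis
qed

text \<open>The homotopy is built upwards, starting from zero in degree 1, each component being
  supplied by exactness of C(-, Y). The induction ends with the component in degree n + 1; the
  equation in that degree itself is not reached, because nothing factors further there.\<close>

lemma comparison:
  assumes "X \<in> Ch C n" "Y \<in> Ch C n" "cexact C n X" "chain_map C n X Y f" "chain_map C n X Y g" "f 0 = g 0" "1 \<le> n"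
  obtains h where "hty C n X Y h" "h (Suc 0) = Zer C (cob X (Suc 0)) (cob Y 0)"
    "\<And>i. i \<le> n \<Longrightarrow> f i = g i \<boxplus> hb C n X Y h i"
proof -
  note t = Ch_simps[OF assms(1)] Ch_simps[OF assms(2)]
  note tf = chain_map_simps(1-3)[OF assms(1,2,4)]
  note tg = chain_map_simps(1-3)[OF assms(1,2,5)]
  \<comment> \<open>\<open>Q\<close> is what remains of the homotopy equation in degree i after
    composing with \<open>cdf Y i\<close>, which kills the contribution of the preceding component.
    It says exactly that \<open>f (Suc i)\<close> and
    \<open>g (Suc i) \<boxplus> cdf Y i \<cdot> h\<close> agree on \<open>cdf X i\<close>, so
    exactness provides the component required by \<open>R\<close>.\<close>
  define Q where "Q i h \<longleftrightarrow> (i \<le> n \<longrightarrow> h \<in> Mor C (cob X (Suc i)) (cob Y i) \<and>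
     cdf Y i \<cdot> f i = cdf Y i \<cdot> (g i \<boxplus> h \<cdot> cdf X i))" for i h
  define R where "R i h h' \<longleftrightarrow> (i < n \<longrightarrow> f (Suc i) = g (Suc i) \<boxplus> ((cdf Y i \<cdot> h) \<boxplus> (h' \<cdot> cdf X (Suc i))))" for i h h'
  have "\<exists>k. k 0 = Zer C (cob X (Suc 0)) (cob Y 0) \<and> (\<forall>i. Q i (k i) \<and> R i (k i) (k (Suc i)))"
  proof (rule dependent_nat_choice2)
    show "Q 0 (Zer C (cob X (Suc 0)) (cob Y 0))"
      using t tg assms(6) unfolding Q_def by (simp add: add_simps)
  next
    fix h i assume q: "Q i h"
    show "\<exists>h'. Q (Suc i) h' \<and> R i h h'"
    proof (cases "i < n")
      case True
      have h: "mor C h" "dm C h = cob X (Suc i)" "cd C h = cob Y i"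
        and e: "cdf Y i \<cdot> f i = cdf Y i \<cdot> (g i \<boxplus> h \<cdot> cdf X i)"
        using q True unfolding Q_def by (auto simp: in_Mor_iff)
      have "f (Suc i) \<cdot> cdf X i = (g (Suc i) \<boxplus> cdf Y i \<cdot> h) \<cdot> cdf X i"
        using e h t tf tg True chain_map_simps(4)[OF assms(1,2,4)] chain_map_simps(4)[OF assms(1,2,5)]
        by (simp add: add_simps)
      then obtain h' where h': "h' \<in> Mor C (cob X (Suc (Suc i))) (cob Y (Suc i))"
          "f (Suc i) = (g (Suc i) \<boxplus> cdf Y i \<cdot> h) \<boxplus> h' \<cdot> cdf X (Suc i)"
        using cexact_diff[OF assms(1,3) True, of "f (Suc i)" "cob Y (Suc i)" "g (Suc i) \<boxplus> cdf Y i \<cdot> h"] h t tf tg True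
        by (auto simp: add_simps)
      have "R i h h'" "Q (Suc i) h'" unfolding R_def Q_def
        using h' h t tf tg True by (auto simp: add_simps add_assoc)
      then show ?thesis by blast
    next
      case False
      then show ?thesis unfolding Q_def R_def by auto
    qed
  qed
  then obtain k where k: "k 0 = Zer C (cob X (Suc 0)) (cob Y 0)" "\<And>i. Q i (k i)" "\<And>i. R i (k i) (k (Suc i))"
    by blast
  define h where "h i = k (i - 1)" for i
  have "hty C n X Y h" using k(2) unfolding Q_def h_def by (intro htyI) auto
  moreover have "h (Suc 0) = Zer C (cob X (Suc 0)) (cob Y 0)" using k(1) unfolding h_def by simp
  moreover have "f i = g i \<boxplus> hb C n X Y h i" if i: "i \<le> n" for i
  proof (cases i)
    case 0
    then show ?thesis using k(1) t tg assms(6,7) unfolding h_def by (simp add: hb_simps add_simps)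
  next
    case (Suc j)
    then show ?thesis using k(3)[of j] i unfolding h_def R_def by (simp add: hb_simps)
  qed
  ultimately show thesis using that by blast
qed

text \<open>\<open>u = 1 + \<phi>\<close> with \<open>\<phi>\<close> null-homotopic except in degree \<open>n + 1\<close>, where it vanishes; then \<open>1 - \<phi>\<close> is an
  inverse because \<open>\<phi>\<^sup>2\<close> is null-homotopic by a homotopy vanishing at both ends.\<close>

lemma strong_inverse:
  assumes "X \<in> Ch C n" "cexact C n X" "chain_map_ends C n X X u" "1 \<le> n"
  obtains v where "chain_map_ends C n X X v" "strong_homotopic C n X X (\<lambda>i. u i \<cdot> v i) (\<lambda>i. Idt C (cob X i))"
    "strong_homotopic C n X X (\<lambda>i. v i \<cdot> u i) (\<lambda>i. Idt C (cob X i))"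
proof -
  note u = chain_map_endsD[OF assms(3)]
  note t = Ch_simps[OF assms(1)]
  note tu = chain_map_simps(1-3)[OF assms(1,1) u(1)]
  obtain h where h: "hty C n X X h" "h (Suc 0) = Zer C (cob X (Suc 0)) (cob X 0)"
    "\<And>i. i \<le> n \<Longrightarrow> u i = Idt C (cob X i) \<boxplus> hb C n X X h i"
    using comparison[OF assms(1,1,2) u(1) chain_map_id[OF assms(1)] _ assms(4)] u(2) by auto
  have "\<exists>p. p \<in> Mor C (cob X i) (cob X i) \<and> u i = Idt C (cob X i) \<boxplus> p" if "i \<le> Suc n" for i
    using ex_diff[of "u i" "cob X i" "cob X i" "Idt C (cob X i)"] tu t that by (auto simp: in_Mor_iff Idt_typ)
  then obtain p where p: "\<And>i. i \<le> Suc n \<Longrightarrow> p i \<in> Mor C (cob X i) (cob X i)"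
    "\<And>i. i \<le> Suc n \<Longrightarrow> u i = Idt C (cob X i) \<boxplus> p i" by metis
  have "\<forall>i. \<exists>q. i \<le> Suc n \<longrightarrow> q \<in> Mor C (cob X i) (cob X i) \<and> p i \<boxplus> q = Zer C (cob X i) (cob X i)"
    using ex_neg p by blast
  then obtain q where q: "\<And>i. i \<le> Suc n \<Longrightarrow> q i \<in> Mor C (cob X i) (cob X i)"
    "\<And>i. i \<le> Suc n \<Longrightarrow> p i \<boxplus> q i = Zer C (cob X i) (cob X i)" by metis
  note tp = p(1)[unfolded in_Mor_iff] note tq = q(1)[unfolded in_Mor_iff]
  have lc: "a = b" if "i \<le> Suc n" "Idt C (cob X i) \<boxplus> a = Idt C (cob X i) \<boxplus> b" "a \<in> Mor C (cob X i) (cob X i)" "b \<in> Mor C (cob X i) (cob X i)" for a b i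
    using add_cancel[of a b "Idt C (cob X i)"] add_comm[of "Idt C (cob X i)" a] add_comm[of "Idt C (cob X i)" b] that t by (simp add: add_simps)
  have pz: "p 0 = Zer C (cob X 0) (cob X 0)"
    using lc[of 0 "p 0" "Zer C (cob X 0) (cob X 0)"] u(2) p(1,2)[of 0] t(1)[of 0] Zer_mor by (simp add: add_zero Idt_typ)
  have pz': "p (Suc n) = Zer C (cob X (Suc n)) (cob X (Suc n))"
    using lc[of "Suc n" "p (Suc n)" "Zer C (cob X (Suc n)) (cob X (Suc n))"] u(3) p(1,2)[of "Suc n"] t(1)[of "Suc n"] Zer_mor
    by (simp add: add_zero Idt_typ)
  have qz: "q 0 = Zer C (cob X 0) (cob X 0)" "q (Suc n) = Zer C (cob X (Suc n)) (cob X (Suc n))"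
    using q(2)[of 0] q(2)[of "Suc n"] tq[of 0] tq[of "Suc n"] t pz pz' by (auto simp: add_simps)
  have ph: "p i = hb C n X X h i" if "i \<le> n" for i
    using h(3)[OF that] p(2)[of i] tp[of i] hb_typ[OF assms(1,1) h(1), of i] that
    by (rule_tac lc) (auto simp: add_simps)
  have pc: "p (Suc i) \<cdot> cdf X i = cdf X i \<cdot> p i" if "i \<le> n" for i
    using chain_map_simps(4)[OF assms(1,1) u(1) that] p(2)[of i] p(2)[of "Suc i"] tp[of i] tp[of "Suc i"] t that
    by (rule_tac add_cancel[of _ _ "cdf X i"]) (simp_all add: add_simps add_comm)
  have qc: "q (Suc i) \<cdot> cdf X i = cdf X i \<cdot> q i" if i: "i \<le> n" for i
  proof -
    have "(p (Suc i) \<boxplus> q (Suc i)) \<cdot> cdf X i = cdf X i \<cdot> (p i \<boxplus> q i)"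
      using q(2)[of i] q(2)[of "Suc i"] t i by (simp add: add_simps)
    then show ?thesis
      using tp[of i] tp[of "Suc i"] tq[of i] tq[of "Suc i"] t i pc[OF i]
      by (rule_tac add_cancel[of _ _ "cdf X i \<cdot> p i"]) (simp_all add: add_simps add_comm)
  qed
  define v where "v i = Idt C (cob X i) \<boxplus> q i" for i
  have cq: "chain_map C n X X q" by (rule chain_mapI) (use q(1) qc in auto)
  have v: "chain_map_ends C n X X v" unfolding chain_map_ends_def
    using tq t qc qz by (auto intro!: chain_mapI simp: v_def add_simps)
  have vq: "u i \<cdot> v i = Idt C (cob X i) \<boxplus> p i \<cdot> q i" "v i \<cdot> u i = Idt C (cob X i) \<boxplus> q i \<cdot> p i" if i: "i \<le> Suc n" for i
  proof -
    have "u i \<cdot> v i = Idt C (cob X i) \<boxplus> ((p i \<boxplus> q i) \<boxplus> p i \<cdot> q i)"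
      using p(2)[OF i] tp[OF i] tq[OF i] t(1)[OF i] by (simp add: v_def add_simps add_ac)
    then show "u i \<cdot> v i = Idt C (cob X i) \<boxplus> p i \<cdot> q i" using q(2)[OF i] tp[OF i] tq[OF i] by (simp add: add_simps)
    have "v i \<cdot> u i = Idt C (cob X i) \<boxplus> ((p i \<boxplus> q i) \<boxplus> q i \<cdot> p i)"
      using p(2)[OF i] tp[OF i] tq[OF i] t(1)[OF i] by (simp add: v_def add_simps add_ac)
    then show "v i \<cdot> u i = Idt C (cob X i) \<boxplus> q i \<cdot> p i" using q(2)[OF i] tp[OF i] tq[OF i] by (simp add: add_simps)
  qed
  have qp: "q i \<cdot> p i = p i \<cdot> q i" if i: "i \<le> Suc n" for i
  proof -
    have "(q i \<boxplus> p i) \<cdot> p i = p i \<cdot> (q i \<boxplus> p i)" using q(2)[OF i] tp[OF i] tq[OF i] t(1)[OF i] by (simp add: add_comm add_simps)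
    then show ?thesis using tp[OF i] tq[OF i] by (rule_tac add_cancel[of "q i \<cdot> p i" "p i \<cdot> q i" "p i \<cdot> p i"]) (simp_all add: add_simps)
  qed
  \<comment> \<open>\<open>q\<close> is the negative of \<open>p\<close>. In degree n + 1 the map
    \<open>p\<close> is not the boundary of \<open>h\<close>, but both \<open>p\<close> and
    \<open>q\<close> vanish there, so the identity persists. The homotopy with components
    \<open>h i \<cdot> q i\<close> is zero at both ends: at the left through \<open>h\<close>, at
    the right through \<open>q\<close>.\<close>
  have pq: "p i \<cdot> q i = hb C n X X (\<lambda>i. h i \<cdot> q i) i" if i: "i \<le> Suc n" for i
  proof (cases "i = Suc n")
    case True
    then show ?thesis using pz pz' qz t tq[of "Suc n"] hty_simps[OF h(1)] by (simp add: hb_simps add_simps)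
  next
    case False
    then show ?thesis using ph[of i] hb_pre[OF assms(1,1,1) h(1) cq, of i] i by simp
  qed
  have hq: "strong_homotopic C n X X f (\<lambda>i. Idt C (cob X i))" if "\<And>i. i \<le> Suc n \<Longrightarrow> f i = Idt C (cob X i) \<boxplus> p i \<cdot> q i" for f
    by (rule strong_homotopicI[OF hty_pre[OF assms(1,1,1) h(1) cq]])
     (use that pq h(2) qz t tq[of "Suc 0"] assms(4) hty_simps[OF h(1)] in \<open>simp_all add: add_simps\<close>)
  show thesis using that[OF v hq hq] vq qp by simp
qed

text \<open>Both composites of f and g have strong inverses v and w. Thus f has the left inverse v g
  and the right inverse g w, and evaluating v g f g w in two ways identifies them up to strong
  homotopy.\<close>

lemma strong_equivalence:
  assumes X: "X \<in> Ch C n" "cexact C n X" and Y: "Y \<in> Ch C n" "cexact C n Y"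
    and f: "chain_map_ends C n X Y f" and g: "chain_map_ends C n Y X g" and n: "1 \<le> n"
  obtains r where "chain_map_ends C n Y X r" "strong_homotopic C n X X (\<lambda>i. r i \<cdot> f i) (\<lambda>i. Idt C (cob X i))"
    "strong_homotopic C n Y Y (\<lambda>i. f i \<cdot> r i) (\<lambda>i. Idt C (cob Y i))"
proof -
  note fc = chain_map_endsD(1)[OF f] note gc = chain_map_endsD(1)[OF g]
  obtain v where v: "chain_map_ends C n X X v" "strong_homotopic C n X X (\<lambda>i. v i \<cdot> (g i \<cdot> f i)) (\<lambda>i. Idt C (cob X i))"
    using strong_inverse[OF X chain_map_ends_comp[OF X(1) Y(1) X(1) f g] n] by blast
  obtain w where w: "chain_map_ends C n Y Y w" "strong_homotopic C n Y Y (\<lambda>i. (f i \<cdot> g i) \<cdot> w i) (\<lambda>i. Idt C (cob Y i))"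
    using strong_inverse[OF Y chain_map_ends_comp[OF Y(1) X(1) Y(1) g f] n] by blast
  define r where "r i = g i \<cdot> w i" for i
  define l where "l i = v i \<cdot> g i" for i
  have r: "chain_map_ends C n Y X r" unfolding r_def by (rule chain_map_ends_comp[OF Y(1) Y(1) X(1) w(1) g])
  have l: "chain_map_ends C n Y X l" unfolding l_def by (rule chain_map_ends_comp[OF Y(1) X(1) X(1) g v(1)])
  note rc = chain_map_endsD(1)[OF r] note lc = chain_map_endsD(1)[OF l]
  note t = chain_map_simps(1-3)[OF X(1) Y(1) fc] chain_map_simps(1-3)[OF Y(1) X(1) gc]
    chain_map_simps(1-3)[OF X(1) X(1) chain_map_endsD(1)[OF v(1)]]  chain_map_simps(1-3)[OF Y(1) Y(1) chain_map_endsD(1)[OF w(1)]]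
    Ch_simps(1)[OF X(1)] Ch_simps(1)[OF Y(1)]
  note tr = chain_map_simps(1-3)[OF Y(1) X(1) rc] note tl = chain_map_simps(1-3)[OF Y(1) X(1) lc]
  have cong: "strong_homotopic C n A B a b" if "strong_homotopic C n A B a' b'" "\<And>i. i \<le> Suc n \<Longrightarrow> a i = a' i" "\<And>i. i \<le> Suc n \<Longrightarrow> b i = b' i" for A B a b a' b'
    using that unfolding strong_homotopic_def by auto
  have fr: "strong_homotopic C n Y Y (\<lambda>i. f i \<cdot> r i) (\<lambda>i. Idt C (cob Y i))"
    by (rule cong[OF w(2)]) (use t in \<open>simp_all add: r_def cat_simps\<close>)
  have lf: "strong_homotopic C n X X (\<lambda>i. l i \<cdot> f i) (\<lambda>i. Idt C (cob X i))"
    by (rule cong[OF v(2)]) (use t in \<open>simp_all add: l_def cat_simps\<close>)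
  have 1: "strong_homotopic C n Y X (\<lambda>i. l i \<cdot> (f i \<cdot> r i)) l"
    by (rule cong[OF strong_homotopic_post[OF Y(1) Y(1) X(1) chain_map_id[OF Y(1)] lc fr]]) (use tl in \<open>simp_all add: cat_simps\<close>)
  have 2: "strong_homotopic C n Y X (\<lambda>i. l i \<cdot> (f i \<cdot> r i)) r"
    by (rule cong[OF strong_homotopic_pre[OF Y(1) X(1) X(1) chain_map_id[OF X(1)] rc lf]]) (use t tl tr in \<open>simp_all add: cat_simps\<close>)
  have 3: "strong_homotopic C n Y X r l"
    by (rule strong_homotopic_trans[OF Y(1) X(1) lc strong_homotopic_sym[OF Y(1) X(1) rc 2] 1])
  have "strong_homotopic C n X X (\<lambda>i. r i \<cdot> f i) (\<lambda>i. l i \<cdot> f i)" by (rule strong_homotopic_pre[OF X(1) Y(1) X(1) lc fc 3])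
  from strong_homotopic_trans[OF X(1) X(1) chain_map_id[OF X(1)] this lf] fr r that show thesis by blast
qed

text \<open>If u vanishes on the differential of Y, then u g vanishes on that of X and factors
  through the next one. Composing with f and using that g f is the identity plus a boundary gives u
  back, up to a term that already factors as desired; the other half of the boundary is killed by
  u.\<close>

lemma cexact_retract:
  assumes X: "X \<in> Ch C n" "cexact C n X" and Y: "Y \<in> Ch C n"
    and f: "chain_map C n Y X f" and g: "chain_map C n X Y g"
    and h: "homotopic C n Y Y (\<lambda>i. g i \<cdot> f i) (\<lambda>i. Idt C (cob Y i))"
  shows "cexact C n Y"
  unfolding cexact_def
proof (intro allI ballI impI)
  fix i V u assume i: "i < n" and u: "u \<in> Mor C (cob Y (Suc i)) V" "u \<cdot> cdf Y i = Zer C (cob Y i) V"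
  obtain h where h: "hty C n Y Y h" "\<And>i. i \<le> Suc n \<Longrightarrow> g i \<cdot> f i = Idt C (cob Y i) \<boxplus> hb C n Y Y h i"
    using h unfolding homotopic_iff by auto
  note t = Ch_simps[OF X(1)] Ch_simps[OF Y(1)] chain_map_simps(1-3)[OF Y X(1) f] chain_map_simps(1-3)[OF X(1) Y g] hty_simps[OF h(1)]
  note u' = u(1)[unfolded in_Mor_iff]
  note uR = eqR[OF u(2)]
  have V: "V \<in> Ob C" using mor_ob u by blast
  have "(u \<cdot> g (Suc i)) \<cdot> cdf X i = Zer C (cob X i) V"
    using t i V u' uR chain_map_simps(4)[OF X(1) Y g] by (simp add: add_simps)
  moreover have "u \<cdot> g (Suc i) \<in> Mor C (cob X (Suc i)) V" using u' t i by (simp add: cat_simps)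
  ultimately obtain w where w: "w \<in> Mor C (cob X (Suc (Suc i))) V" "u \<cdot> g (Suc i) = w \<cdot> cdf X (Suc i)"
    using X(2) i unfolding cexact_def by blast
  have "u \<boxplus> (u \<cdot> h (Suc (Suc i))) \<cdot> cdf Y (Suc i) = u \<cdot> (g (Suc i) \<cdot> f (Suc i))"
    using t i V u' uR by (simp add: h(2) hb_simps add_simps)
  also have "\<dots> = (u \<cdot> g (Suc i)) \<cdot> f (Suc i)" using u' t i by (simp add: cat_simps)
  also have "\<dots> = (w \<cdot> f (Suc (Suc i))) \<cdot> cdf Y (Suc i)"
    unfolding w(2) using t i w(1) chain_map_simps(4)[OF Y X(1) f, symmetric] by (simp add: cat_simps)
  finally have e: "u \<boxplus> (u \<cdot> h (Suc (Suc i))) \<cdot> cdf Y (Suc i) = (w \<cdot> f (Suc (Suc i))) \<cdot> cdf Y (Suc i)" .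
  obtain z where z: "z \<in> Mor C (cob Y (Suc (Suc i))) V" "w \<cdot> f (Suc (Suc i)) = (u \<cdot> h (Suc (Suc i))) \<boxplus> z"
    using ex_diff[of "w \<cdot> f (Suc (Suc i))" "cob Y (Suc (Suc i))" V "u \<cdot> h (Suc (Suc i))"] t u' i w(1) by (auto simp: cat_simps)
  have "u \<boxplus> (u \<cdot> h (Suc (Suc i))) \<cdot> cdf Y (Suc i) = z \<cdot> cdf Y (Suc i) \<boxplus> (u \<cdot> h (Suc (Suc i))) \<cdot> cdf Y (Suc i)"
    unfolding e z(2) using z(1) t u' i by (simp add: add_simps add_comm)
  then have "u = z \<cdot> cdf Y (Suc i)"
    using z(1) t u' i by (rule_tac add_cancel[of u _ "(u \<cdot> h (Suc (Suc i))) \<cdot> cdf Y (Suc i)"]) (simp_all add: add_simps)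
  then show "\<exists>w \<in> Mor C (cob Y (Suc (Suc i))) V. u = w \<cdot> cdf Y (Suc i)" using z(1) by blast
qed

lemma dexact_retract:
  assumes X: "X \<in> Ch C n" "dexact C n X" and Y: "Y \<in> Ch C n"
    and f: "chain_map C n Y X f" and g: "chain_map C n X Y g"
    and h: "homotopic C n Y Y (\<lambda>i. g i \<cdot> f i) (\<lambda>i. Idt C (cob Y i))"
  shows "dexact C n Y"
  unfolding dexact_def
proof (intro allI ballI impI)
  fix i V u assume i: "i < n" and u: "u \<in> Mor C V (cob Y (Suc i))" "cdf Y (Suc i) \<cdot> u = Zer C V (cob Y (Suc (Suc i)))"
  obtain h where h: "hty C n Y Y h" "\<And>i. i \<le> Suc n \<Longrightarrow> g i \<cdot> f i = Idt C (cob Y i) \<boxplus> hb C n Y Y h i"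
    using h unfolding homotopic_iff by auto
  note t = Ch_simps[OF X(1)] Ch_simps[OF Y(1)] chain_map_simps(1-3)[OF Y X(1) f] chain_map_simps(1-3)[OF X(1) Y g] hty_simps[OF h(1)]
  note u' = u(1)[unfolded in_Mor_iff]
  have V: "V \<in> Ob C" using mor_ob u by blast
  have "cdf X (Suc i) \<cdot> (f (Suc i) \<cdot> u) = Zer C V (cob X (Suc (Suc i)))"
    using t i V u u' chain_map_simps(5)[OF Y X(1) f, symmetric] by (simp add: add_simps)
  moreover have "f (Suc i) \<cdot> u \<in> Mor C V (cob X (Suc i))" using u' t i by (simp add: cat_simps)
  ultimately obtain w where w: "w \<in> Mor C V (cob X i)" "f (Suc i) \<cdot> u = cdf X i \<cdot> w"
    using X(2) i unfolding dexact_def by blast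
  have "u \<boxplus> cdf Y i \<cdot> (h (Suc i) \<cdot> u) = (g (Suc i) \<cdot> f (Suc i)) \<cdot> u"
    using t i V u u' by (simp add: h(2) hb_simps add_simps)
  also have "\<dots> = g (Suc i) \<cdot> (f (Suc i) \<cdot> u)" using u' t i by (simp add: cat_simps)
  also have "\<dots> = cdf Y i \<cdot> (g i \<cdot> w)"
    unfolding w(2) using t i w(1) chain_map_simps(5)[OF X(1) Y g] by (simp add: cat_simps)
  finally have e: "u \<boxplus> cdf Y i \<cdot> (h (Suc i) \<cdot> u) = cdf Y i \<cdot> (g i \<cdot> w)" .
  obtain z where z: "z \<in> Mor C V (cob Y i)" "g i \<cdot> w = (h (Suc i) \<cdot> u) \<boxplus> z"
    using ex_diff[of "g i \<cdot> w" V "cob Y i" "h (Suc i) \<cdot> u"] t u' i w(1) by (auto simp: cat_simps)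
  have "u \<boxplus> cdf Y i \<cdot> (h (Suc i) \<cdot> u) = cdf Y i \<cdot> z \<boxplus> cdf Y i \<cdot> (h (Suc i) \<cdot> u)"
    unfolding e z(2) using z(1) t u' i by (simp add: add_simps add_comm)
  then have "u = cdf Y i \<cdot> z"
    using z(1) t u' i by (rule_tac add_cancel[of u _ "cdf Y i \<cdot> (h (Suc i) \<cdot> u)"]) (simp_all add: add_simps)
  then show "\<exists>w \<in> Mor C V (cob Y i). u = cdf Y i \<cdot> w" using z(1) by blast
qed

lemma K_isoI:
  assumes "X \<in> Ch C n" "cexact C n X" "Y \<in> Ch C n" "cexact C n Y"
    "chain_map_ends C n X Y f" "chain_map_ends C n Y X g" "1 \<le> n"
  shows "K_iso C n X Y"
  proof -
  obtain r where "chain_map_ends C n Y X r" "strong_homotopic C n X X (\<lambda>i. r i \<cdot> f i) (\<lambda>i. Idt C (cob X i))"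
    "strong_homotopic C n Y Y (\<lambda>i. f i \<cdot> r i) (\<lambda>i. Idt C (cob Y i))" using strong_equivalence[OF assms] by blast
  then show ?thesis using strong_homotopic_homotopic assms(5) unfolding K_iso_def by blast
qed

text \<open>Turns isomorphism in the homotopy category into the mere existence of maps in both
  directions, which is what lifting properties such as (R0) deliver.\<close>

lemma kclass_iff:
  assumes "X \<in> Ch C n" "cexact C n X" "1 \<le> n"
  shows "Y \<in> kclass C n X \<longleftrightarrow> Y \<in> Ch C n \<and> cexact C n Y \<and> (\<exists>f. chain_map_ends C n X Y f) \<and> (\<exists>g. chain_map_ends C n Y X g)"
proof
  assume "Y \<in> kclass C n X"
  then show "Y \<in> Ch C n \<and> cexact C n Y \<and> (\<exists>f. chain_map_ends C n X Y f) \<and> (\<exists>g. chain_map_ends C n Y X g)"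
    unfolding kclass_def K_iso_def Ch_ends_def using cexact_retract[OF assms(1,2)] chain_map_endsD(1) by blast
next
  assume "Y \<in> Ch C n \<and> cexact C n Y \<and> (\<exists>f. chain_map_ends C n X Y f) \<and> (\<exists>g. chain_map_ends C n Y X g)"
  then show "Y \<in> kclass C n X"
    using K_isoI[OF assms(1,2) _ _ _ _ assms(3)] chain_map_ends_cob[OF assms(1)] unfolding kclass_def Ch_ends_def by auto
qed

end

section \<open>Deformation retracts and mapping cones\<close>

text \<open>Deformation retract data: strict on the small complex Y, up to a recorded homotopy on
  the large complex X. The homotopy is an argument, not existentially quantified, because its outer
  components are used later.\<close>

definition sdr :: "('o, 'm) cat \<Rightarrow> nat \<Rightarrow> ('o, 'm) cpx \<Rightarrow> ('o, 'm) cpx \<Rightarrow> (nat \<Rightarrow> 'm) \<Rightarrow> (nat \<Rightarrow> 'm) \<Rightarrow> (nat \<Rightarrow> 'm) \<Rightarrow> bool" where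
  "sdr C n X Y \<iota> \<pi> h \<longleftrightarrow> X \<in> Ch C n \<and> Y \<in> Ch C n \<and> chain_map C n Y X \<iota> \<and> chain_map C n X Y \<pi> \<and> hty C n X X h \<and>
     (\<forall>i \<le> Suc n. \<pi> i \<cdot>\<^bsub>C\<^esub> \<iota> i = Idt C (cob Y i)) \<and>
     (\<forall>i \<le> Suc n. (\<iota> i \<cdot>\<^bsub>C\<^esub> \<pi> i) \<boxplus>\<^bsub>C\<^esub> hb C n X X h i = Idt C (cob X i))"

lemma sdrD:
  assumes "sdr C n X Y \<iota> \<pi> h"
  shows "X \<in> Ch C n" "Y \<in> Ch C n" "chain_map C n Y X \<iota>" "chain_map C n X Y \<pi>" "hty C n X X h"
    "i \<le> Suc n \<Longrightarrow> \<pi> i \<cdot>\<^bsub>C\<^esub> \<iota> i = Idt C (cob Y i)"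
    "i \<le> Suc n \<Longrightarrow> (\<iota> i \<cdot>\<^bsub>C\<^esub> \<pi> i) \<boxplus>\<^bsub>C\<^esub> hb C n X X h i = Idt C (cob X i)"
  using assms unfolding sdr_def by blast+

context additive_category begin

text \<open>A degreewise splitting is enough. The boundary of a homotopy commutes with the
  differential, hence so does its complement \<iota> \<pi>, an idempotent. Conjugating the
  differential by the splitting therefore yields a complex, and \<iota> and \<pi> become chain
  maps.\<close>

lemma sdr_construct:
  assumes X: "X \<in> Ch C n" and n: "1 \<le> n" and h: "hty C n X X h"
    and \<iota>: "\<And>i. i \<le> Suc n \<Longrightarrow> \<iota> i \<in> Mor C (Y i) (cob X i)"
    and \<pi>: "\<And>i. i \<le> Suc n \<Longrightarrow> \<pi> i \<in> Mor C (cob X i) (Y i)"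
    and \<pi>\<iota>: "\<And>i. i \<le> Suc n \<Longrightarrow> \<pi> i \<cdot> \<iota> i = Idt C (Y i)"
    and e: "\<And>i. i \<le> Suc n \<Longrightarrow> (\<iota> i \<cdot> \<pi> i) \<boxplus> hb C n X X h i = Idt C (cob X i)"
  shows "sdr C n X \<lparr>cob = Y, cdf = (\<lambda>i. \<pi> (Suc i) \<cdot> (cdf X i \<cdot> \<iota> i))\<rparr> \<iota> \<pi> h"
proof -
  note t = Ch_simps[OF X] \<iota>[unfolded in_Mor_iff] \<pi>[unfolded in_Mor_iff] hb_typ[OF X X h]
  have c: "(\<iota> (Suc i) \<cdot> \<pi> (Suc i)) \<cdot> cdf X i = cdf X i \<cdot> (\<iota> i \<cdot> \<pi> i)" if i: "i \<le> n" for i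
  proof -
    have "((\<iota> (Suc i) \<cdot> \<pi> (Suc i)) \<boxplus> hb C n X X h (Suc i)) \<cdot> cdf X i = cdf X i \<cdot> ((\<iota> i \<cdot> \<pi> i) \<boxplus> hb C n X X h i)"
      using e[of i] e[of "Suc i"] i t by (simp add: cat_simps)
    then show ?thesis using t i hb_chain[OF X X h i n]
      by (rule_tac add_cancel[of _ _ "cdf X i \<cdot> hb C n X X h i"]) (simp_all add: add_simps)
  qed
  have r: "\<pi> i \<cdot> (\<iota> i \<cdot> x) = x" if "i \<le> Suc n" "mor C x" "cd C x = Y i" for i x
    using eqR[OF \<pi>\<iota>, of i x] that t by (simp add: cat_simps)
  have c1: "\<pi> (Suc i) \<cdot> cdf X i = \<pi> (Suc i) \<cdot> (cdf X i \<cdot> (\<iota> i \<cdot> \<pi> i))" if i: "i \<le> n" for i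
    using r[of "Suc i" "\<pi> (Suc i) \<cdot> cdf X i"] c[OF i] t i by (simp add: cat_simps)
  have c2: "\<iota> (Suc i) \<cdot> (\<pi> (Suc i) \<cdot> (cdf X i \<cdot> \<iota> i)) = cdf X i \<cdot> \<iota> i" if i: "i \<le> n" for i
  proof -
    have "\<iota> (Suc i) \<cdot> (\<pi> (Suc i) \<cdot> (cdf X i \<cdot> \<iota> i)) = ((\<iota> (Suc i) \<cdot> \<pi> (Suc i)) \<cdot> cdf X i) \<cdot> \<iota> i"
      using t i by (simp add: cat_simps)
    also have "\<dots> = cdf X i \<cdot> \<iota> i" unfolding c[OF i] using t i \<pi>\<iota>[of i] by (simp add: cat_simps)
    finally show ?thesis .
  qed
  have Y: "\<lparr>cob = Y, cdf = (\<lambda>i. \<pi> (Suc i) \<cdot> (cdf X i \<cdot> \<iota> i))\<rparr> \<in> Ch C n"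
  proof (rule ChI, simp_all)
    fix i assume i: "i < n"
    have "(\<pi> (Suc (Suc i)) \<cdot> (cdf X (Suc i) \<cdot> \<iota> (Suc i))) \<cdot> (\<pi> (Suc i) \<cdot> (cdf X i \<cdot> \<iota> i)) =
      \<pi> (Suc (Suc i)) \<cdot> (cdf X (Suc i) \<cdot> (\<iota> (Suc i) \<cdot> (\<pi> (Suc i) \<cdot> (cdf X i \<cdot> \<iota> i))))"
      using t i by (simp add: cat_simps)
    also have "\<dots> = Zer C (Y i) (Y (Suc (Suc i)))" using i t c2[of i] mor_ob[OF \<iota>[of i]] by (simp add: add_simps)
    finally show "(\<pi> (Suc (Suc i)) \<cdot> (cdf X (Suc i) \<cdot> \<iota> (Suc i))) \<cdot> (\<pi> (Suc i) \<cdot> (cdf X i \<cdot> \<iota> i)) = Zer C (Y i) (Y (Suc (Suc i)))" .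
  qed (use t mor_ob[OF \<iota>] in \<open>auto simp: cat_simps\<close>)
  show ?thesis unfolding sdr_def
    using X Y h \<iota> \<pi> \<pi>\<iota> e c1 c2 t by (auto intro!: chain_mapI simp: cat_simps)
qed

text \<open>Removes a contractible summand B in the degrees j and j + 1. The two conditions
  \<open>d\<close> say that the differential carries B identically to B and is diagonal with respect
  to the decompositions. The contraction is \<open>i2 \<cdot> p2'\<close>, from degree j + 1 back to
  degree j.\<close>

lemma strip:
  assumes X: "X \<in> Ch C n" and n: "1 \<le> n" and j: "j \<le> n"
    and b: "biproduct C A B (cob X j) i1 i2 p1 p2" and b': "biproduct C A' B (cob X (Suc j)) i1' i2' p1' p2'"
    and d: "cdf X j \<cdot> i2 = i2'" "p2' \<cdot> cdf X j = p2"
  shows "\<exists>Y \<iota> \<pi> h. sdr C n X Y \<iota> \<pi> h \<and> cob Y j = A \<and> cob Y (Suc j) = A' \<and> \<iota> j = i1 \<and> \<pi> j = p1 \<and>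
    \<iota> (Suc j) = i1' \<and> \<pi> (Suc j) = p1' \<and> h (Suc j) = i2 \<cdot> p2' \<and>
    (\<forall>i. i \<noteq> j \<longrightarrow> i \<noteq> Suc j \<longrightarrow> cob Y i = cob X i \<and> \<iota> i = Idt C (cob X i) \<and> \<pi> i = Idt C (cob X i)) \<and>
    (\<forall>i. i \<noteq> Suc j \<longrightarrow> h i = Zer C (cob X i) (cob X (i - 1)))"
proof -
  define Y where "Y i = (if i = j then A else if i = Suc j then A' else cob X i)" for i
  define \<iota> where "\<iota> i = (if i = j then i1 else if i = Suc j then i1' else Idt C (cob X i))" for i
  define \<pi> where "\<pi> i = (if i = j then p1 else if i = Suc j then p1' else Idt C (cob X i))" for i
  define h where "h i = (if i = Suc j then i2 \<cdot> p2' else Zer C (cob X i) (cob X (i - 1)))" for i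
  note b = biproductD[OF b] note b' = biproductD[OF b']
  note t = Ch_simps[OF X] b(1-4)[unfolded in_Mor_iff] b'(1-4)[unfolded in_Mor_iff]
  note dR = eqR[OF d(1)] eqR[OF d(2)]
  have hy: "hty C n X X h" by (rule htyI) (use t j in \<open>auto simp: h_def add_simps\<close>)
  have hS: "h (Suc i) = (if i = j then i2 \<cdot> p2' else Zer C (cob X (Suc i)) (cob X i))" for i
    by (simp add: h_def)
  have P: "(i2 \<cdot> p2') \<cdot> cdf X j = i2 \<cdot> p2" "cdf X j \<cdot> (i2 \<cdot> p2') = i2' \<cdot> p2'"
    using dR d(2) t j by (simp_all add: cat_simps)
  have T: "mor C (i2 \<cdot> p2)" "mor C (i2' \<cdot> p2')" "mor C (i2 \<cdot> p2')" "dm C (i2 \<cdot> p2) = cob X j" "dm C (i2' \<cdot> p2') = cob X (Suc j)"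
    "dm C (i2 \<cdot> p2') = cob X (Suc j)"
    "cd C (i2 \<cdot> p2) = cob X j" "cd C (i2' \<cdot> p2') = cob X (Suc j)" "cd C (i2 \<cdot> p2') = cob X j"
    using t by (simp_all add: cat_simps)
  note tX = Ch_simps(1-4)[OF X]
  have e: "(\<iota> i \<cdot> \<pi> i) \<boxplus> hb C n X X h i = Idt C (cob X i)" if i: "i \<le> Suc n" for i
  proof -
    \<comment> \<open>The homotopy has a single nonzero component, so its boundary is the projector
      onto B in the degrees j and j + 1 and zero elsewhere.\<close>
    have "hb C n X X h i = (if i = j then i2 \<cdot> p2 else if i = Suc j then i2' \<cdot> p2' else Zer C (cob X i) (cob X i))"
    proof (rule degree_cases[OF i])
      assume "i = 0" then show ?thesis
        using P(1) T tX by (cases "j = 0") (simp_all add: hb_simps hS zero_cmp)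
    next
      assume "i = Suc n" then show ?thesis
        using P(2) T tX j by (cases "j = n") (simp_all add: hb_simps hS cmp_zero)
    next
      fix k assume k: "i = Suc k" "k < n"
      then have "hb C n X X h i = cdf X k \<cdot> (if k = j then i2 \<cdot> p2' else Zer C (cob X (Suc k)) (cob X k)) \<boxplus>
         (if Suc k = j then i2 \<cdot> p2' else Zer C (cob X (Suc (Suc k))) (cob X (Suc k))) \<cdot> cdf X (Suc k)"
        by (simp add: hb_simps hS)
      moreover have "cdf X k \<cdot> (if k = j then i2 \<cdot> p2' else Zer C (cob X (Suc k)) (cob X k)) = (if k = j then i2' \<cdot> p2' else Zer C (cob X i) (cob X i))"
        using P(2) tX k by (simp add: cmp_zero)
      moreover have "(if Suc k = j then i2 \<cdot> p2' else Zer C (cob X (Suc (Suc k))) (cob X (Suc k))) \<cdot> cdf X (Suc k) = (if Suc k = j then i2 \<cdot> p2 else Zer C (cob X i) (cob X i))"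
        using P(1) tX k by (auto simp: zero_cmp)
      ultimately show ?thesis using T tX k by (auto simp: add_zero Zer_typ)
    qed
    then show ?thesis using b(9) b'(9) tX i by (auto simp: \<iota>_def \<pi>_def add_simps)
  qed
  have "sdr C n X \<lparr>cob = Y, cdf = (\<lambda>i. \<pi> (Suc i) \<cdot> (cdf X i \<cdot> \<iota> i))\<rparr> \<iota> \<pi> h"
    by (rule sdr_construct[OF X n hy _ _ _ e])
      (use t j b(5) b'(5) in \<open>auto simp: Y_def \<iota>_def \<pi>_def add_simps\<close>)
  then show ?thesis
    by (intro exI[of _ "\<lparr>cob = Y, cdf = (\<lambda>i. \<pi> (Suc i) \<cdot> (cdf X i \<cdot> \<iota> i))\<rparr>"] exI[of _ \<iota>] exI[of _ \<pi>] exI[of _ h])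
      (simp add: Y_def \<iota>_def \<pi>_def h_def)
qed

lemma sdr_comp:
  assumes 1: "sdr C n X Y \<iota> \<pi> h" and 2: "sdr C n Y Z \<iota>' \<pi>' h'"
  shows "sdr C n X Z (\<lambda>i. \<iota> i \<cdot> \<iota>' i) (\<lambda>i. \<pi>' i \<cdot> \<pi> i) (\<lambda>i. h i \<boxplus> (\<iota> (i - 1) \<cdot> (h' i \<cdot> \<pi> i)))"
proof -
  note a = sdrD[OF 1] and b = sdrD[OF 2]
  note t = Ch_simps(1-4)[OF a(1)] Ch_simps(1-4)[OF a(2)] Ch_simps(1-4)[OF b(2)] chain_map_simps(1-3)[OF a(2,1,3)] chain_map_simps(1-3)[OF a(1,2,4)]
    chain_map_simps(1-3)[OF b(2,1,3)] chain_map_simps(1-3)[OF b(1,2,4)]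
    hb_typ[OF a(1,1,5)] hb_typ[OF b(1,1,5)]
  note h1 = hty_pre[OF b(1) b(1) a(1) b(5) a(4)]
  note h2 = hty_post[OF a(1,2,1) h1 a(3)]
  have "\<pi>' i \<cdot> (\<pi> i \<cdot> (\<iota> i \<cdot> \<iota>' i)) = Idt C (cob Z i)" if i: "i \<le> Suc n" for i
    using eqR[OF a(6)[OF i]] b(6)[OF i] t i by (simp add: cat_simps)
  moreover have "((\<iota> i \<cdot> \<iota>' i) \<cdot> (\<pi>' i \<cdot> \<pi> i)) \<boxplus> hb C n X X (\<lambda>i. h i \<boxplus> (\<iota> (i - 1) \<cdot> (h' i \<cdot> \<pi> i))) i = Idt C (cob X i)" if i: "i \<le> Suc n" for i
  proof -
    have "hb C n X X (\<lambda>i. h i \<boxplus> (\<iota> (i - 1) \<cdot> (h' i \<cdot> \<pi> i))) i = hb C n X X h i \<boxplus> \<iota> i \<cdot> (hb C n Y Y h' i \<cdot> \<pi> i)"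
      using hb_add[OF a(1,1,5) h2 i] hb_post[OF a(1,2,1) h1 a(3) i] hb_pre[OF b(1) b(1) a(1) b(5) a(4) i] by simp
    then have "((\<iota> i \<cdot> \<iota>' i) \<cdot> (\<pi>' i \<cdot> \<pi> i)) \<boxplus> hb C n X X (\<lambda>i. h i \<boxplus> (\<iota> (i - 1) \<cdot> (h' i \<cdot> \<pi> i))) i =
       \<iota> i \<cdot> (((\<iota>' i \<cdot> \<pi>' i) \<boxplus> hb C n Y Y h' i) \<cdot> \<pi> i) \<boxplus> hb C n X X h i"
      using t i by (simp add: add_simps add_ac)
    also have "\<dots> = Idt C (cob X i)" using a(7)[OF i] b(7)[OF i] t i by (simp add: cat_simps)
    finally show ?thesis .
  qed
  ultimately show ?thesis unfolding sdr_def
    using a(1) b(2) chain_map_comp[OF b(2) b(1) a(1) b(3) a(3)] chain_map_comp[OF a(1,2) b(2) a(4) b(4)] hty_add[OF a(5) h2] t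
    by (simp add: cat_simps)
qed

end

text \<open>The mapping cone by the columns of its differentials, that is, by their composites with
  the inclusions. Negative entries are moved to the other side of the equations. The conventions
  that \<open>j1 0\<close> and \<open>j2 (Suc n)\<close> are identities make the outer degrees,
  which have only one summand, fit the general pattern. The last clause is the first component of
  the first differential.\<close>

definition cone :: "('o, 'm) cat \<Rightarrow> nat \<Rightarrow> ('o, 'm) cpx \<Rightarrow> ('o, 'm) cpx \<Rightarrow> (nat \<Rightarrow> 'm) \<Rightarrow> ('o, 'm) cpx \<Rightarrow>
    (nat \<Rightarrow> 'm) \<Rightarrow> (nat \<Rightarrow> 'm) \<Rightarrow> (nat \<Rightarrow> 'm) \<Rightarrow> (nat \<Rightarrow> 'm) \<Rightarrow> bool" where
  "cone C n X Y f M j1 j2 p1 p2 \<longleftrightarrow>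
     cob M 0 = cob X 1 \<and> cob M (Suc n) = cob Y (Suc n) \<and> j1 0 = Idt C (cob X 1) \<and> j2 (Suc n) = Idt C (cob Y (Suc n)) \<and>
     (\<forall>i \<le> n. cdf M i \<in> Mor C (cob M i) (cob M (Suc i))) \<and>
     (\<forall>i < n. biproduct C (cob X (Suc (Suc i))) (cob Y (Suc i)) (cob M (Suc i)) (j1 (Suc i)) (j2 (Suc i)) (p1 (Suc i)) (p2 (Suc i))) \<and>
     (\<forall>i < n. (cdf M i \<cdot>\<^bsub>C\<^esub> j1 i) \<boxplus>\<^bsub>C\<^esub> (j1 (Suc i) \<cdot>\<^bsub>C\<^esub> cdf X (Suc i)) = j2 (Suc i) \<cdot>\<^bsub>C\<^esub> f (Suc i)) \<and>
     cdf M n \<cdot>\<^bsub>C\<^esub> j1 n = f (Suc n) \<and>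
     (\<forall>i < n. cdf M (Suc i) \<cdot>\<^bsub>C\<^esub> j2 (Suc i) = j2 (Suc (Suc i)) \<cdot>\<^bsub>C\<^esub> cdf Y (Suc i)) \<and>
     (p1 1 \<cdot>\<^bsub>C\<^esub> cdf M 0) \<boxplus>\<^bsub>C\<^esub> cdf X 1 = Zer C (cob X 1) (cob X 2)"

context additive_category begin

lemma neg_cancel: "mor C g \<Longrightarrow> mor C d \<Longrightarrow> dm C g = cd C d \<Longrightarrow> dm C d = A \<Longrightarrow> cd C d = B \<Longrightarrow>
    (g \<cdot> Neg C A B d) \<boxplus> (g \<cdot> d) = Zer C A (cd C g)"
  using cmp_add'[of "Neg C A B d" d g] add_Neg(2)[of d A B] mor_Ob(1)[of d] by (simp add: add_simps)

lemma neg_cancel2: "mor C g \<Longrightarrow> mor C d \<Longrightarrow> dm C g = cd C d \<Longrightarrow> dm C d = A \<Longrightarrow> cd C d = B \<Longrightarrow>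
    (g \<cdot> d) \<boxplus> (g \<cdot> Neg C A B d) = Zer C A (cd C g)"
  using neg_cancel[of g d A B] by (subst add_comm) (simp_all add: add_simps)

lemma mapping_cone_imp_cone:
  assumes X: "X \<in> Ch C n" and Y: "Y \<in> Ch C n" and f: "chain_map C n X Y f" and n: "1 \<le> n"
    and M: "mapping_cone C n X Y f M"
  obtains j1 j2 p1 p2 where "cone C n X Y f M j1 j2 p1 p2"
proof -
  obtain i1 i2 p1 p2 where m: "cob M 0 = cob X 1 \<and> cob M (n + 1) = cob Y (n + 1) \<and>
     (\<forall>i \<in> {1..n}. biproduct C (cob X (i + 1)) (cob Y i) (cob M i) (i1 i) (i2 i) (p1 i) (p2 i)) \<and>
     cdf M 0 = (i1 1 \<cdot> Neg C (cob X 1) (cob X 2) (cdf X 1)) \<boxplus> (i2 1 \<cdot> f 1) \<and>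
     (\<forall>i \<in> {1..<n}. cdf M i =
        (i1 (i + 1) \<cdot> Neg C (cob X (i + 1)) (cob X (i + 2)) (cdf X (i + 1)) \<cdot> p1 i) \<boxplus>
        (i2 (i + 1) \<cdot> f (i + 1) \<cdot> p1 i) \<boxplus>
        (i2 (i + 1) \<cdot> cdf Y i \<cdot> p2 i)) \<and>
     cdf M n = (f (n + 1) \<cdot> p1 n) \<boxplus> (cdf Y n \<cdot> p2 n)"
    using M unfolding mapping_cone_def by blast
  define j1 where "j1 i = (if i = 0 then Idt C (cob X 1) else i1 i)" for i
  define j2 where "j2 i = (if i = Suc n then Idt C (cob Y (Suc n)) else i2 i)" for i
  have bp: "biproduct C (cob X (Suc (Suc i))) (cob Y (Suc i)) (cob M (Suc i)) (i1 (Suc i)) (i2 (Suc i)) (p1 (Suc i)) (p2 (Suc i))" if "i < n" for i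
    using m that by simp
  note b = biproductD[OF bp]
  have d0: "cdf M 0 = (i1 (Suc 0) \<cdot> Neg C (cob X (Suc 0)) (cob X (Suc (Suc 0))) (cdf X (Suc 0))) \<boxplus> (i2 (Suc 0) \<cdot> f (Suc 0))"
    using m by (simp add: numeral_2_eq_2)
  have dS: "cdf M (Suc i) =
        (i1 (Suc (Suc i)) \<cdot> (Neg C (cob X (Suc (Suc i))) (cob X (Suc (Suc (Suc i)))) (cdf X (Suc (Suc i))) \<cdot> p1 (Suc i))) \<boxplus>
        (i2 (Suc (Suc i)) \<cdot> (f (Suc (Suc i)) \<cdot> p1 (Suc i))) \<boxplus>
        (i2 (Suc (Suc i)) \<cdot> (cdf Y (Suc i) \<cdot> p2 (Suc i)))" if "Suc i < n" for i
    using m that by simp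
  have dn: "cdf M n = (f (Suc n) \<cdot> p1 n) \<boxplus> (cdf Y n \<cdot> p2 n)" and c0: "cob M 0 = cob X (Suc 0)" and cn: "cob M (Suc n) = cob Y (Suc n)"
    using m by simp_all
  note t = Ch_simps[OF X] Ch_simps[OF Y] chain_map_simps(1-3)[OF X Y f] b(1-4)[unfolded in_Mor_iff]
  note s = t b(5-8) b(5-8)[THEN eqR] add_simps add_ac neg_cancel neg_cancel2
  obtain m' where n': "n = Suc m'" using n by (cases n) auto
  have dn': "cdf M (Suc m') = (f (Suc (Suc m')) \<cdot> p1 (Suc m')) \<boxplus> (cdf Y (Suc m') \<cdot> p2 (Suc m'))" using dn n' by simp
  have cases_i: "i = 0 \<or> (\<exists>k. i = Suc k \<and> Suc k < n)" if "i < n" for i using that by (cases i) auto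
  have cases_n: "i < n \<or> i = Suc m'" if "i \<le> n" for i using that n' by auto
  have d: "cdf M i \<in> Mor C (cob M i) (cob M (Suc i))" if i: "i \<le> n" for i
  proof -
    have "i = 0 \<or> (\<exists>k. i = Suc k \<and> Suc k < n) \<or> i = Suc m'" using cases_n[OF i] cases_i[of i] by auto
    then show ?thesis
    proof (elim disjE exE conjE)
      assume "i = 0" then show ?thesis using n t c0 by (simp add: d0 add_simps)
    next
      fix k assume "i = Suc k" "Suc k < n" then show ?thesis using t by (simp add: dS add_simps)
    next
      assume "i = Suc m'" then show ?thesis using n' t cn by (simp add: dn' add_simps)
    qed
  qed
  have c2: "(cdf M i \<cdot> j1 i) \<boxplus> (j1 (Suc i) \<cdot> cdf X (Suc i)) = j2 (Suc i) \<cdot> f (Suc i)" if i: "i < n" for i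
    using cases_i[OF i] n i
  proof (elim disjE exE conjE)
    assume "i = 0"
    then show ?thesis using n by (simp add: j1_def j2_def d0 s)
  next
    fix k assume k: "i = Suc k" "Suc k < n"
    have "i1 (Suc (Suc k)) \<cdot> Neg C (cob X (Suc (Suc k))) (cob X (Suc (Suc (Suc k)))) (cdf X (Suc (Suc k))) \<boxplus>
      (i1 (Suc (Suc k)) \<cdot> cdf X (Suc (Suc k)) \<boxplus> i2 (Suc (Suc k)) \<cdot> f (Suc (Suc k))) = i2 (Suc (Suc k)) \<cdot> f (Suc (Suc k))"
      using k by (simp add: t add_simps add_assoc[symmetric] neg_cancel)
    then show ?thesis using k by (simp add: j1_def j2_def dS s)
  qed
  have c3: "cdf M n \<cdot> j1 n = f (Suc n)" unfolding n' using n' by (simp add: dn' j1_def s)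
  have c4: "cdf M (Suc i) \<cdot> j2 (Suc i) = j2 (Suc (Suc i)) \<cdot> cdf Y (Suc i)" if i: "i < n" for i
  proof (cases "Suc i < n")
    case True
    then show ?thesis using b(12)[of "Suc i"] t b(7,6)[of i] by (simp add: dS j2_def add_simps)
  next
    case False
    then have "i = m'" using i n' by simp
    then show ?thesis using n' t b(7,6)[of m'] by (simp add: dn' j2_def add_simps)
  qed
  have c6: "(p1 (Suc 0) \<cdot> cdf M 0) \<boxplus> cdf X (Suc 0) = Zer C (cob X (Suc 0)) (cob X (Suc (Suc 0)))"
    using n add_Neg(2)[of "cdf X (Suc 0)" "cob X (Suc 0)" "cob X (Suc (Suc 0))"] by (simp add: d0 s)
  have "cone C n X Y f M j1 j2 p1 p2"
    unfolding cone_def using c0 cn c2 c3 c4 c6 bp d by (auto simp: j1_def j2_def numeral_2_eq_2)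
  then show thesis by (rule that)
qed

lemma ex_mapping_cone:
  assumes "X \<in> Ch C n" and "Y \<in> Ch C n" and n: "1 \<le> n"
  obtains M where "mapping_cone C n X Y f M"
proof -
  have "\<exists>P i1 i2 p1 p2. i \<in> {1..n} \<longrightarrow> biproduct C (cob X (i + 1)) (cob Y i) P i1 i2 p1 p2" for i
    using ex_biproduct[of "cob X (i+1)" "cob Y i"] Ch_simps[OF assms(1)] Ch_simps[OF assms(2)] by (cases "i \<in> {1..n}") auto
  then obtain P i1 i2 p1 p2 where b: "\<And>i. i \<in> {1..n} \<Longrightarrow> biproduct C (cob X (i + 1)) (cob Y i) (P i) (i1 i) (i2 i) (p1 i) (p2 i)"
    by metis
  define M where "M = \<lparr>cob = (\<lambda>i. if i = 0 then cob X 1 else if i = n + 1 then cob Y (n + 1) else P i),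
    cdf = (\<lambda>i. if i = 0 then (i1 1 \<cdot> Neg C (cob X 1) (cob X 2) (cdf X 1)) \<boxplus> (i2 1 \<cdot> f 1)
      else if i < n then (i1 (i + 1) \<cdot> Neg C (cob X (i + 1)) (cob X (i + 2)) (cdf X (i + 1)) \<cdot> p1 i) \<boxplus>
        (i2 (i + 1) \<cdot> f (i + 1) \<cdot> p1 i) \<boxplus>
        (i2 (i + 1) \<cdot> cdf Y i \<cdot> p2 i) else (f (n + 1) \<cdot> p1 n) \<boxplus> (cdf Y n \<cdot> p2 n))\<rparr>"
  have "mapping_cone C n X Y f M" unfolding mapping_cone_def
    by (intro exI[of _ i1] exI[of _ i2] exI[of _ p1] exI[of _ p2]) (use n b in \<open>auto simp: M_def\<close>)
  then show thesis by (rule that)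
qed

lemma coneD:
  assumes "cone C n X Y f M j1 j2 p1 p2"
  shows "cob M 0 = cob X (Suc 0)" "cob M (Suc n) = cob Y (Suc n)" "j1 0 = Idt C (cob X (Suc 0))" "j2 (Suc n) = Idt C (cob Y (Suc n))"
     "i \<le> n \<Longrightarrow> cdf M i \<in> Mor C (cob M i) (cob M (Suc i))"
     "i < n \<Longrightarrow> biproduct C (cob X (Suc (Suc i))) (cob Y (Suc i)) (cob M (Suc i)) (j1 (Suc i)) (j2 (Suc i)) (p1 (Suc i)) (p2 (Suc i))"
     "i < n \<Longrightarrow> (cdf M i \<cdot> j1 i) \<boxplus> (j1 (Suc i) \<cdot> cdf X (Suc i)) = j2 (Suc i) \<cdot> f (Suc i)"
     "cdf M n \<cdot> j1 n = f (Suc n)"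
     "i < n \<Longrightarrow> cdf M (Suc i) \<cdot> j2 (Suc i) = j2 (Suc (Suc i)) \<cdot> cdf Y (Suc i)"
     "(p1 (Suc 0) \<cdot> cdf M 0) \<boxplus> cdf X (Suc 0) = Zer C (cob X (Suc 0)) (cob X (Suc (Suc 0)))"
  using assms unfolding cone_def by (auto simp: numeral_2_eq_2)

end

locale mcone = additive_category C for C :: "('o, 'm) cat" (structure) +
  fixes n X Y f M j1 j2 p1 p2
  assumes X: "X \<in> Ch C n" and Y: "Y \<in> Ch C n" and f: "chain_map C n X Y f" and n: "1 \<le> n"
    and cone: "cone C n X Y f M j1 j2 p1 p2"
begin

lemmas c = coneD[OF cone]
lemmas b = biproductD[OF c(6)]
lemmas tXY = Ch_simps[OF X] Ch_simps[OF Y] chain_map_simps(1-3)[OF X Y f]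

lemma j1_typ: "i \<le> n \<Longrightarrow> mor C (j1 i)" "i \<le> n \<Longrightarrow> dm C (j1 i) = cob X (Suc i)" "i \<le> n \<Longrightarrow> cd C (j1 i) = cob M i"
  by (cases i; use b(1)[of "i-1"] c(1,3) tXY n in \<open>simp add: add_simps\<close>)+

lemma j2_typ: "i \<le> n \<Longrightarrow> mor C (j2 (Suc i))" "i \<le> n \<Longrightarrow> dm C (j2 (Suc i)) = cob Y (Suc i)" "i \<le> n \<Longrightarrow> cd C (j2 (Suc i)) = cob M (Suc i)"
  by (cases "i = n"; use b(2)[of i] c(2,4) tXY n in \<open>simp add: add_simps\<close>)+

lemma M_typ: "i \<le> Suc n \<Longrightarrow> cob M i \<in> Ob C" "i \<le> n \<Longrightarrow> mor C (cdf M i)" "i \<le> n \<Longrightarrow> dm C (cdf M i) = cob M i" "i \<le> n \<Longrightarrow> cd C (cdf M i) = cob M (Suc i)"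
  using c(5)[of i] j1_typ[of i] mor_Ob(2)[of "j1 i"] c(2) tXY by (auto simp: in_Mor_iff le_Suc_eq)

lemma p_typ: "i < n \<Longrightarrow> mor C (p1 (Suc i))" "i < n \<Longrightarrow> dm C (p1 (Suc i)) = cob M (Suc i)" "i < n \<Longrightarrow> cd C (p1 (Suc i)) = cob X (Suc (Suc i))"
  "i < n \<Longrightarrow> mor C (p2 (Suc i))" "i < n \<Longrightarrow> dm C (p2 (Suc i)) = cob M (Suc i)" "i < n \<Longrightarrow> cd C (p2 (Suc i)) = cob Y (Suc i)"
  using b(3,4)[of i] by (auto simp: in_Mor_iff)

lemmas tys = tXY j1_typ j2_typ M_typ p_typ

lemma dj2: "i < n \<Longrightarrow> mor C x \<Longrightarrow> cd C x = cob Y (Suc i) \<Longrightarrow> cdf M (Suc i) \<cdot> (j2 (Suc i) \<cdot> x) = j2 (Suc (Suc i)) \<cdot> (cdf Y (Suc i) \<cdot> x)"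
  using eqR[OF c(9)[of i], of x] tys by (simp add: cat_simps)

lemma epi:
  assumes "i \<le> n" "x \<in> Mor C (cob M i) V" "y \<in> Mor C (cob M i) V" "x \<cdot> j1 i = y \<cdot> j1 i"
    "\<And>k. i = Suc k \<Longrightarrow> x \<cdot> j2 i = y \<cdot> j2 i"
  shows "x = y"
proof (cases i)
  case 0
  then show ?thesis using assms c(1,3) by (simp add: cat_simps)
next
  case (Suc k)
  then have bp: "biproduct C (cob X (Suc (Suc k))) (cob Y (Suc k)) (cob M i) (j1 i) (j2 i) (p1 i) (p2 i)" using c(6)[of k] assms(1) by simp
  have "x = (x \<cdot> j1 i) \<cdot> p1 i \<boxplus> (x \<cdot> j2 i) \<cdot> p2 i" by (rule biproduct_split(1)[OF bp assms(2)])
  also have "\<dots> = (y \<cdot> j1 i) \<cdot> p1 i \<boxplus> (y \<cdot> j2 i) \<cdot> p2 i" using assms(4,5) Suc by simp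
  also have "\<dots> = y" by (rule biproduct_split(1)[OF bp assms(3), symmetric])
  finally show ?thesis .
qed

lemma ex_out:
  assumes "i < n" "x \<in> Mor C (cob X (Suc (Suc i))) V" "y \<in> Mor C (cob Y (Suc i)) V"
  shows "\<exists>u \<in> Mor C (cob M (Suc i)) V. u \<cdot> j1 (Suc i) = x \<and> u \<cdot> j2 (Suc i) = y"
  by (rule bexI[of _ "x \<cdot> p1 (Suc i) \<boxplus> y \<cdot> p2 (Suc i)"])
   (use assms b[OF assms(1)] b(5-8)[OF assms(1)] tys mor_ob[OF assms(2)] in \<open>auto simp: add_simps\<close>)

lemma M_Ch: "M \<in> Ch C n"
proof (rule ChI)
  fix i assume i: "i < n"
  show "cdf M (Suc i) \<cdot> cdf M i = Zer C (cob M i) (cob M (Suc (Suc i)))"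
  proof (rule epi[of i _ "cob M (Suc (Suc i))"])
    \<comment> \<open>\<open>?z\<close> is added in order to complete the column equation of the
      cone; cancelling it afterwards takes the place of a subtraction.\<close>
    let ?z = "cdf M (Suc i) \<cdot> (j1 (Suc i) \<cdot> cdf X (Suc i))"
    have "(cdf M (Suc i) \<cdot> cdf M i) \<cdot> j1 i \<boxplus> ?z = cdf M (Suc i) \<cdot> ((cdf M i \<cdot> j1 i) \<boxplus> (j1 (Suc i) \<cdot> cdf X (Suc i)))"
      using i tys by (simp add: add_simps)
    also have "\<dots> = j2 (Suc (Suc i)) \<cdot> (f (Suc (Suc i)) \<cdot> cdf X (Suc i))"
      unfolding c(7)[OF i] using i tys dj2 chain_map_simps(4)[OF X Y f] by (simp add: cat_simps)
    also have "\<dots> = ?z"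
    proof (cases "Suc i < n")
      case True
      have "j2 (Suc (Suc i)) \<cdot> (f (Suc (Suc i)) \<cdot> cdf X (Suc i)) = ((cdf M (Suc i) \<cdot> j1 (Suc i)) \<boxplus> (j1 (Suc (Suc i)) \<cdot> cdf X (Suc (Suc i)))) \<cdot> cdf X (Suc i)"
        unfolding c(7)[OF True] using True tys by (simp add: add_simps)
      then show ?thesis using True tys by (simp add: add_simps)
    next
      case False
      then have "Suc i = n" using i by simp
      then show ?thesis using c(4) c(8) tys eqR[of "cdf M n" "j1 n" "f (Suc n)" "cdf X n"] i by (simp add: add_simps)
    qed
    finally have "(cdf M (Suc i) \<cdot> cdf M i) \<cdot> j1 i \<boxplus> ?z = ?z" .
    then show "(cdf M (Suc i) \<cdot> cdf M i) \<cdot> j1 i = Zer C (cob M i) (cob M (Suc (Suc i))) \<cdot> j1 i"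
      using i tys by (rule_tac add_cancel[of _ _ ?z]) (simp_all add: add_simps)
  next
    fix k assume "i = Suc k"
    then show "(cdf M (Suc i) \<cdot> cdf M i) \<cdot> j2 i = Zer C (cob M i) (cob M (Suc (Suc i))) \<cdot> j2 i"
      using i tys c(9)[of k] dj2[of "Suc k"] by (simp add: add_simps)
  qed (use i tys in \<open>auto simp: add_simps\<close>)
qed (use tys in \<open>auto simp: in_Mor_iff\<close>)

text \<open>The Y-component of u factors by exactness of Y; the error made on the X-component is
  then killed by a differential of X and factors by exactness of X one degree higher. This last use
  of exactness is available only below the top degree, whence the bound on i.\<close>

lemma cexact_low:
  assumes "cexact C n X" "cexact C n Y" "f 0 = Idt C (cob X 0)" and i: "Suc i < n"
    and u: "u \<in> Mor C (cob M (Suc i)) V" "u \<cdot> cdf M i = Zer C (cob M i) V"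
  shows "\<exists>w \<in> Mor C (cob M (Suc (Suc i))) V. u = w \<cdot> cdf M (Suc i)"
proof -
  note fc = chain_map_simps(4)[OF X Y f]
  note tu = u(1)[unfolded in_Mor_iff]
  have V: "V \<in> Ob C" using mor_ob u by blast
  note uR = eqR[OF u(2)]
  have i': "i < n" using i by simp
  have e: "u \<cdot> (j1 (Suc i) \<cdot> cdf X (Suc i)) = u \<cdot> (j2 (Suc i) \<cdot> f (Suc i))"
    using c(7)[OF i', symmetric] uR i tys tu V by (simp add: add_simps)
  have "(u \<cdot> j2 (Suc i)) \<cdot> cdf Y i = Zer C (cob Y i) V"
  proof (cases i)
    \<comment> \<open>Degree 0 of the cone has no summand from Y. The missing relation is obtained
      from f 0 being the identity: the differential of Y followed by \<open>u \<cdot> j2\<close>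
      equals that of X followed by \<open>u \<cdot> j2 \<cdot> f\<close>, which is a composite of
      two differentials of X followed by \<open>u \<cdot> j1\<close>.\<close>
    case 0
    have y: "cob Y 0 = cob X 0" using tys assms(3) chain_map_simps(3)[OF X Y f, of 0] by (simp add: Idt_typ)
    have "(u \<cdot> j2 (Suc 0)) \<cdot> cdf Y 0 = (u \<cdot> (j2 (Suc 0) \<cdot> f (Suc 0))) \<cdot> cdf X 0"
      using fc[of 0] tys tu i 0 assms(3) y by (simp add: add_simps)
    also have "\<dots> = Zer C (cob X 0) V" unfolding e[unfolded 0, symmetric] using tys tu i 0 V by (simp add: add_simps)
    finally show ?thesis using 0 y by simp
  next
    case (Suc k)
    then show ?thesis using c(9)[of k, symmetric] i uR tys tu V by (simp add: add_simps)
  qed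
  then obtain w2 where w2: "w2 \<in> Mor C (cob Y (Suc (Suc i))) V" "u \<cdot> j2 (Suc i) = w2 \<cdot> cdf Y (Suc i)"
    using assms(2)[unfolded cexact_def, rule_format, OF i', of "u \<cdot> j2 (Suc i)" V] tu tys i by (auto simp: cat_simps)
  have "(w2 \<cdot> f (Suc (Suc i))) \<cdot> cdf X (Suc i) = (w2 \<cdot> cdf Y (Suc i)) \<cdot> f (Suc i)" using w2(1) fc[of "Suc i"] tys i by (simp add: add_simps)
  also have "\<dots> = (u \<cdot> j1 (Suc i)) \<cdot> cdf X (Suc i)" unfolding w2(2)[symmetric] using e tys tu i by (simp add: cat_simps)
  finally obtain w1 where w1: "w1 \<in> Mor C (cob X (Suc (Suc (Suc i)))) V" "w2 \<cdot> f (Suc (Suc i)) = (u \<cdot> j1 (Suc i)) \<boxplus> w1 \<cdot> cdf X (Suc (Suc i))"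
    using cexact_diff[OF X assms(1) i, of "w2 \<cdot> f (Suc (Suc i))" V "u \<cdot> j1 (Suc i)"] tys tu w2(1) i by (auto simp: cat_simps)
  obtain w where w: "w \<in> Mor C (cob M (Suc (Suc i))) V" "w \<cdot> j1 (Suc (Suc i)) = w1" "w \<cdot> j2 (Suc (Suc i)) = w2"
    using ex_out[OF i w1(1) w2(1)] by blast
  have "u = w \<cdot> cdf M (Suc i)"
  proof (rule epi[of "Suc i" _ V])
    have "(w \<cdot> cdf M (Suc i)) \<cdot> j1 (Suc i) \<boxplus> w1 \<cdot> cdf X (Suc (Suc i)) = w \<cdot> ((cdf M (Suc i) \<cdot> j1 (Suc i)) \<boxplus> (j1 (Suc (Suc i)) \<cdot> cdf X (Suc (Suc i))))"
      unfolding w(2)[symmetric] using w(1) tys i by (simp add: add_simps)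
    also have "\<dots> = (u \<cdot> j1 (Suc i)) \<boxplus> w1 \<cdot> cdf X (Suc (Suc i))"
      unfolding c(7)[OF i] w1(2)[symmetric] w(3)[symmetric] using w(1) tys i by (simp add: add_simps)
    finally show "u \<cdot> j1 (Suc i) = (w \<cdot> cdf M (Suc i)) \<cdot> j1 (Suc i)"
      using w(1) w1(1) tys i tu by (rule_tac add_cancel[of _ _ "w1 \<cdot> cdf X (Suc (Suc i))"]) (simp_all add: add_simps)
    show "u \<cdot> j2 (Suc i) = (w \<cdot> cdf M (Suc i)) \<cdot> j2 (Suc i)"
      unfolding w2(2) w(3)[symmetric] using w(1) tys i c(9)[OF i'] by (simp add: cat_simps)
  qed (use tu tys w(1) i in \<open>auto simp: cat_simps\<close>)
  then show ?thesis using w(1) by blast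
qed

end

text \<open>A square commuting up to a homotopy L induces a triangular map of cones, with diagonal
  entries \<eta> and \<xi> and off-diagonal entry L. Since the cones start in degree 1 of X, the
  square has to commute in positive degrees only; since degree 0 of the target cone has no summand
  from Y', the first component of L must vanish.\<close>

lemma (in additive_category) cone_map:
  assumes 1: "mcone C n X Y f M j1 j2 p1 p2" and 2: "mcone C n X' Y' f' M' j1' j2' p1' p2'"
    and \<eta>: "chain_map C n X X' \<eta>" and \<xi>: "chain_map C n Y Y' \<xi>" and L: "hty C n X Y' L" "L (Suc 0) = Zer C (cob X (Suc 0)) (cob Y' 0)"
    and e: "\<And>i. i \<le> n \<Longrightarrow> f' (Suc i) \<cdot> \<eta> (Suc i) \<boxplus> hb C n X Y' L (Suc i) = \<xi> (Suc i) \<cdot> f (Suc i)"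
  obtains \<phi> where "chain_map C n M M' \<phi>" "\<phi> 0 = \<eta> (Suc 0)" "\<phi> (Suc n) = \<xi> (Suc n)"
    "\<And>i. i < n \<Longrightarrow> \<phi> (Suc i) \<cdot> j1 (Suc i) = j1' (Suc i) \<cdot> \<eta> (Suc (Suc i)) \<boxplus> j2' (Suc i) \<cdot> L (Suc (Suc i))"
    "\<And>i. i < n \<Longrightarrow> \<phi> (Suc i) \<cdot> j2 (Suc i) = j2' (Suc i) \<cdot> \<xi> (Suc i)"
proof -
  interpret A: mcone C n X Y f M j1 j2 p1 p2 by (rule 1)
  interpret B: mcone C n X' Y' f' M' j1' j2' p1' p2' by (rule 2)
  note t = A.tys B.tys chain_map_simps(1-3)[OF A.X B.X \<eta>] chain_map_simps(1-3)[OF A.Y B.Y \<xi>] hty_simps[OF L(1)]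
  have "\<forall>i. \<exists>u. i < n \<longrightarrow> u \<in> Mor C (cob M (Suc i)) (cob M' (Suc i)) \<and>
     u \<cdot> j1 (Suc i) = j1' (Suc i) \<cdot> \<eta> (Suc (Suc i)) \<boxplus> j2' (Suc i) \<cdot> L (Suc (Suc i)) \<and> u \<cdot> j2 (Suc i) = j2' (Suc i) \<cdot> \<xi> (Suc i)"
  proof
    fix i
    show "\<exists>u. i < n \<longrightarrow> u \<in> Mor C (cob M (Suc i)) (cob M' (Suc i)) \<and>
     u \<cdot> j1 (Suc i) = j1' (Suc i) \<cdot> \<eta> (Suc (Suc i)) \<boxplus> j2' (Suc i) \<cdot> L (Suc (Suc i)) \<and> u \<cdot> j2 (Suc i) = j2' (Suc i) \<cdot> \<xi> (Suc i)"
    proof (cases "i < n")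
      case True
      have "j1' (Suc i) \<cdot> \<eta> (Suc (Suc i)) \<boxplus> j2' (Suc i) \<cdot> L (Suc (Suc i)) \<in> Mor C (cob X (Suc (Suc i))) (cob M' (Suc i))"
        "j2' (Suc i) \<cdot> \<xi> (Suc i) \<in> Mor C (cob Y (Suc i)) (cob M' (Suc i))" using True t by (auto simp: add_simps)
      then show ?thesis using A.ex_out[OF True] by blast
    qed simp
  qed
  then obtain u where u: "\<And>i. i < n \<Longrightarrow> u i \<in> Mor C (cob M (Suc i)) (cob M' (Suc i))"
     "\<And>i. i < n \<Longrightarrow> u i \<cdot> j1 (Suc i) = j1' (Suc i) \<cdot> \<eta> (Suc (Suc i)) \<boxplus> j2' (Suc i) \<cdot> L (Suc (Suc i))"
     "\<And>i. i < n \<Longrightarrow> u i \<cdot> j2 (Suc i) = j2' (Suc i) \<cdot> \<xi> (Suc i)" by metis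
  define \<phi> where "\<phi> i = (if i = 0 then \<eta> (Suc 0) else if i = Suc n then \<xi> (Suc n) else u (i - 1))" for i
  have P: "\<phi> i \<in> Mor C (cob M i) (cob M' i)" if "i \<le> Suc n" for i
    by (rule degree_cases[OF that]) (use t u(1) A.n in \<open>auto simp: \<phi>_def add_simps A.c(1,2) B.c(1,2)\<close>)
  note tP = P[unfolded in_Mor_iff]
  have j2: "\<phi> (Suc i) \<cdot> j2 (Suc i) = j2' (Suc i) \<cdot> \<xi> (Suc i)" if "i \<le> n" for i
    using that u(3)[of i] t A.c(4) B.c(4) by (cases "i = n") (auto simp: \<phi>_def cat_simps)
  have j1: "\<phi> i \<cdot> j1 i = j1' i \<cdot> \<eta> (Suc i) \<boxplus> (if i = 0 then Zer C (cob X (Suc 0)) (cob M' 0) else j2' i \<cdot> L (Suc i))" if "i \<le> n" for i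
  proof (cases i)
    case 0
    then show ?thesis using t A.n by (simp add: \<phi>_def A.c(1,3) B.c(1,3) add_simps)
  next
    case (Suc k)
    then show ?thesis using u(2)[of k] that by (simp add: \<phi>_def)
  qed
  have "\<phi> (Suc i) \<cdot> cdf M i = cdf M' i \<cdot> \<phi> i" if i: "i \<le> n" for i
  proof (rule A.epi[OF i, of _ "cob M' (Suc i)"])
    show "\<phi> (Suc i) \<cdot> cdf M i \<in> Mor C (cob M i) (cob M' (Suc i))" "cdf M' i \<cdot> \<phi> i \<in> Mor C (cob M i) (cob M' (Suc i))"
      using tP[of i] tP[of "Suc i"] t i by (auto simp: cat_simps)
    fix k assume k: "i = Suc k"
    show "(\<phi> (Suc i) \<cdot> cdf M i) \<cdot> j2 i = (cdf M' i \<cdot> \<phi> i) \<cdot> j2 i"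
      using k i tP[of i] tP[of "Suc i"] t j2[of k] eqR[OF j2[of i]] A.c(9)[of k] B.dj2[of k] chain_map_simps(4)[OF A.Y B.Y \<xi>] by (simp add: cat_simps)
  next
    \<comment> \<open>In degree 0 the summand belonging to \<open>j2'\<close> is absent; there the
      term with \<open>L (Suc i)\<close> is zero by the assumption on L, so one formula covers all
      degrees.\<close>
    have e': "cdf M' i \<cdot> (\<phi> i \<cdot> j1 i) = cdf M' i \<cdot> (j1' i \<cdot> \<eta> (Suc i)) \<boxplus> j2' (Suc i) \<cdot> (cdf Y' i \<cdot> L (Suc i))"
      unfolding j1[OF i] using t i L(2) B.dj2[of "i - 1"] by (cases i) (simp_all add: add_simps)
    show "(\<phi> (Suc i) \<cdot> cdf M i) \<cdot> j1 i = (cdf M' i \<cdot> \<phi> i) \<cdot> j1 i"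
    proof (cases "i = n")
      case True
      have "(\<phi> (Suc n) \<cdot> cdf M n) \<cdot> j1 n = \<phi> (Suc n) \<cdot> f (Suc n)" using tP[of "Suc n"] t A.c(8) by (simp add: cat_simps)
      also have "\<dots> = \<xi> (Suc n) \<cdot> f (Suc n)" by (simp add: \<phi>_def)
      also have "\<dots> = f' (Suc n) \<cdot> \<eta> (Suc n) \<boxplus> cdf Y' n \<cdot> L (Suc n)" using e[of n] by (simp add: hb_simps)
      also have "\<dots> = cdf M' n \<cdot> (\<phi> n \<cdot> j1 n)"
        using e' True A.n eqR[OF B.c(8), of "\<eta> (Suc n)"] t B.c(4) by (simp add: cat_simps)
      also have "\<dots> = (cdf M' n \<cdot> \<phi> n) \<cdot> j1 n" using tP[of n] t by (simp add: cat_simps)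
      finally show ?thesis using True by simp
    next
      case False
      then have i: "i < n" using i by simp
      let ?z = "\<phi> (Suc i) \<cdot> (j1 (Suc i) \<cdot> cdf X (Suc i))"
      note ti = tP[of i] tP[of "Suc i"] t i
      have z: "?z = j1' (Suc i) \<cdot> (cdf X' (Suc i) \<cdot> \<eta> (Suc i)) \<boxplus> j2' (Suc i) \<cdot> (L (Suc (Suc i)) \<cdot> cdf X (Suc i))"
        using eqRadd[OF j1[of "Suc i", simplified], of "cdf X (Suc i)"] ti chain_map_simps(4)[OF A.X B.X \<eta>, of "Suc i"] by (simp add: add_simps)
      have "(\<phi> (Suc i) \<cdot> cdf M i) \<cdot> j1 i \<boxplus> ?z = \<phi> (Suc i) \<cdot> ((cdf M i \<cdot> j1 i) \<boxplus> (j1 (Suc i) \<cdot> cdf X (Suc i)))"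
        using ti by (simp add: add_simps)
      also have "\<dots> = j2' (Suc i) \<cdot> (\<xi> (Suc i) \<cdot> f (Suc i))" unfolding A.c(7)[OF i] using eqR[OF j2[of i], of "f (Suc i)"] ti by (simp add: cat_simps)
      also have "\<dots> = j2' (Suc i) \<cdot> (f' (Suc i) \<cdot> \<eta> (Suc i)) \<boxplus> j2' (Suc i) \<cdot> hb C n X Y' L (Suc i)"
        using e[of i, symmetric] hb_typ[OF A.X B.Y L(1), of "Suc i"] ti by (simp add: add_simps)
      also have "j2' (Suc i) \<cdot> (f' (Suc i) \<cdot> \<eta> (Suc i)) = ((cdf M' i \<cdot> j1' i) \<boxplus> (j1' (Suc i) \<cdot> cdf X' (Suc i))) \<cdot> \<eta> (Suc i)"
        unfolding B.c(7)[OF i] using ti by (simp add: cat_simps)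
      also have "((cdf M' i \<cdot> j1' i) \<boxplus> (j1' (Suc i) \<cdot> cdf X' (Suc i))) \<cdot> \<eta> (Suc i) \<boxplus> j2' (Suc i) \<cdot> hb C n X Y' L (Suc i) = (cdf M' i \<cdot> \<phi> i) \<cdot> j1 i \<boxplus> ?z"
      proof -
        have x: "(a \<boxplus> b) \<boxplus> (c \<boxplus> d) = (a \<boxplus> c) \<boxplus> (b \<boxplus> d)" if "mor C a" "mor C b" "mor C c" "mor C d" "dm C a = dm C d" "dm C b = dm C d" "dm C c = dm C d"
          "cd C a = cd C d" "cd C b = cd C d" "cd C c = cd C d" for a b c d
          using that by (simp add: add_typ add_ac)
        have "((cdf M' i \<cdot> j1' i) \<boxplus> (j1' (Suc i) \<cdot> cdf X' (Suc i))) \<cdot> \<eta> (Suc i) = cdf M' i \<cdot> (j1' i \<cdot> \<eta> (Suc i)) \<boxplus> j1' (Suc i) \<cdot> (cdf X' (Suc i) \<cdot> \<eta> (Suc i))"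
          using ti by (simp add: add_simps)
        moreover have "j2' (Suc i) \<cdot> hb C n X Y' L (Suc i) = j2' (Suc i) \<cdot> (cdf Y' i \<cdot> L (Suc i)) \<boxplus> j2' (Suc i) \<cdot> (L (Suc (Suc i)) \<cdot> cdf X (Suc i))"
          using ti by (simp add: hb_simps add_simps)
        moreover have "(cdf M' i \<cdot> \<phi> i) \<cdot> j1 i = cdf M' i \<cdot> (j1' i \<cdot> \<eta> (Suc i)) \<boxplus> j2' (Suc i) \<cdot> (cdf Y' i \<cdot> L (Suc i))"
          using e' ti by (simp add: cat_simps)
        ultimately show ?thesis unfolding z using ti by (simp add: x cat_simps)
      qed
      finally show ?thesis using ti by (rule_tac add_cancel[of _ _ ?z]) (simp_all add: add_simps)
    qed
  qed
  then have "chain_map C n M M' \<phi>" using P by (intro chain_mapI) auto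
  moreover have "\<phi> 0 = \<eta> (Suc 0)" "\<phi> (Suc n) = \<xi> (Suc n)" by (simp_all add: \<phi>_def)
  moreover have "\<phi> (Suc i) \<cdot> j1 (Suc i) = j1' (Suc i) \<cdot> \<eta> (Suc (Suc i)) \<boxplus> j2' (Suc i) \<cdot> L (Suc (Suc i))" if "i < n" for i
    using j1[of "Suc i"] that by simp
  moreover have "\<phi> (Suc i) \<cdot> j2 (Suc i) = j2' (Suc i) \<cdot> \<xi> (Suc i)" if "i < n" for i
    using j2[of i] that by simp
  ultimately show thesis by (rule that)
qed

section \<open>Exangles and duality\<close>

context biadditive_functor begin

lemma act_closed: "c \<in> Mor C W Z \<Longrightarrow> a \<in> Mor C A B \<Longrightarrow> \<delta> \<in> carrier (Ext E Z A) \<Longrightarrow> Act E c a \<delta> \<in> carrier (Ext E W B)"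
  using act_hom hom_in_carrier by fast

lemma act_one:
  assumes "c \<in> Mor C W Z" "a \<in> Mor C A B"
  shows "Act E c a \<one>\<^bsub>Ext E Z A\<^esub> = \<one>\<^bsub>Ext E W B\<^esub>"
  using act_hom[OF assms] ext_group mor_ob[OF assms(1)] mor_ob[OF assms(2)]
  by (meson group_hom.hom_one group_hom.intro group_hom_axioms.intro comm_group_def ext_group)

lemma ext_group': "Z \<in> Ob C \<Longrightarrow> A \<in> Ob C \<Longrightarrow> group (Ext E Z A)"
  using ext_group comm_group_def by blast

lemma act_zero_left:
  assumes "W \<in> Ob C" "Z \<in> Ob C" "a \<in> Mor C A B" "\<delta> \<in> carrier (Ext E Z A)"
  shows "Act E (Zer C W Z) a \<delta> = \<one>\<^bsub>Ext E W B\<^esub>"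
proof -
  have z: "Zer C W Z \<in> Mor C W Z" using Zer_mor assms by blast
  let ?x = "Act E (Zer C W Z) a \<delta>"
  have "?x = ?x \<otimes>\<^bsub>Ext E W B\<^esub> ?x" using act_add_left[OF z z assms(3,4)] z by (simp add: add_zero in_Mor_iff)
  then show ?thesis using group.l_cancel_one[OF ext_group'[of W B], of ?x ?x] act_closed[OF z assms(3,4)] assms mor_ob by metis
qed

lemma act_zero_right:
  assumes "A \<in> Ob C" "B \<in> Ob C" "c \<in> Mor C W Z" "\<delta> \<in> carrier (Ext E Z A)"
  shows "Act E c (Zer C A B) \<delta> = \<one>\<^bsub>Ext E W B\<^esub>"
proof -
  have z: "Zer C A B \<in> Mor C A B" using Zer_mor assms by blast
  let ?x = "Act E c (Zer C A B) \<delta>"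
  have "?x = ?x \<otimes>\<^bsub>Ext E W B\<^esub> ?x" using act_add_right[OF assms(3) z z assms(4)] z by (simp add: add_zero in_Mor_iff)
  then show ?thesis using group.l_cancel_one[OF ext_group'[of W B], of ?x ?x] act_closed[OF assms(3) z assms(4)] assms mor_ob by metis
qed

lemma act_act:
  assumes "c' \<in> Mor C V W" "c \<in> Mor C W Z" "a \<in> Mor C A B" "a' \<in> Mor C B D" "\<delta> \<in> carrier (Ext E Z A)"
  shows "Act E c' a' (Act E c a \<delta>) = Act E (c \<cdot> c') (a' \<cdot> a) \<delta>"
  using act_cmp[OF assms(2,1,3,4,5)] by simp

text \<open>Images lie in kernels because X is a complex attached to \<delta>; what remains of
  exactness are the inclusions of kernels in images. The shifted indices make the inner part equal
  to \<open>cexact\<close> and \<open>dexact\<close>.\<close>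

lemma exangle_iff':
  "exangle C E n X \<delta> \<longleftrightarrow> X \<in> Ch C n \<and> \<delta> \<in> carrier (Ext E (cob X (Suc n)) (cob X 0)) \<and>
     push C E (cob X (Suc n)) (cdf X 0) \<delta> = \<one>\<^bsub>Ext E (cob X (Suc n)) (cob X (Suc 0))\<^esub> \<and>
     pull C E (cob X 0) (cdf X n) \<delta> = \<one>\<^bsub>Ext E (cob X n) (cob X 0)\<^esub> \<and> cexact C n X \<and> dexact C n X \<and>
     (\<forall>Y. \<forall>u \<in> Mor C Y (cob X (Suc n)). pull C E (cob X 0) u \<delta> = \<one>\<^bsub>Ext E Y (cob X 0)\<^esub> \<longrightarrow>
       (\<exists>w \<in> Mor C Y (cob X n). u = cdf X n \<cdot>\<^bsub>C\<^esub> w)) \<and>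
     (\<forall>Y. \<forall>u \<in> Mor C (cob X 0) Y. push C E (cob X (Suc n)) u \<delta> = \<one>\<^bsub>Ext E (cob X (Suc n)) Y\<^esub> \<longrightarrow>
       (\<exists>w \<in> Mor C (cob X (Suc 0)) Y. u = w \<cdot>\<^bsub>C\<^esub> cdf X 0))" (is "?L \<longleftrightarrow> ?R")
proof -
  have ker: "kernel (HomG C A B) (HomG C A' B') h = {u \<in> Mor C A B. h u = Zer C A' B'}"
    "kernel (HomG C A B) (Ext E A' B') h' = {u \<in> Mor C A B. h' u = \<one>\<^bsub>Ext E A' B'\<^esub>}" for A B A' B' h h'
    by (simp_all add: kernel_def HomG_simps)
  have idx: "(\<forall>i\<in>{1..n}. P i (i - 1) (i + 1)) \<longleftrightarrow> (\<forall>i<n. P (Suc i) i (Suc (Suc i)))" for P :: "nat \<Rightarrow> nat \<Rightarrow> nat \<Rightarrow> bool"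
  proof
    assume "\<forall>i\<in>{1..n}. P i (i - 1) (i + 1)"
    then show "\<forall>i<n. P (Suc i) i (Suc (Suc i))" by force
  next
    assume a: "\<forall>i<n. P (Suc i) i (Suc (Suc i))"
    show "\<forall>i\<in>{1..n}. P i (i - 1) (i + 1)"
    proof
      fix i assume "i \<in> {1..n}"
      then show "P i (i - 1) (i + 1)" using a by (cases i) auto
    qed
  qed
  show ?thesis
  proof
    assume L: ?L
    have X: "X \<in> Ch C n" using L unfolding exangle_def by blast
    have 1: "\<And>i. i < n \<Longrightarrow> {u \<in> Mor C Y (cob X (Suc i)). cdf X (Suc i) \<cdot> u = Zer C Y (cob X (Suc (Suc i)))} = (\<lambda>u. cdf X i \<cdot> u) ` Mor C Y (cob X i)"
      "{u \<in> Mor C Y (cob X (Suc n)). pull C E (cob X 0) u \<delta> = \<one>\<^bsub>Ext E Y (cob X 0)\<^esub>} = (\<lambda>u. cdf X n \<cdot> u) ` Mor C Y (cob X n)"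
      "\<And>i. i < n \<Longrightarrow> {u \<in> Mor C (cob X (Suc i)) Y. u \<cdot> cdf X i = Zer C (cob X i) Y} = (\<lambda>u. u \<cdot> cdf X (Suc i)) ` Mor C (cob X (Suc (Suc i))) Y"
      "{u \<in> Mor C (cob X 0) Y. push C E (cob X (Suc n)) u \<delta> = \<one>\<^bsub>Ext E (cob X (Suc n)) Y\<^esub>} = (\<lambda>u. u \<cdot> cdf X 0) ` Mor C (cob X (Suc 0)) Y"
      if "Y \<in> Ob C" for Y
      using L that unfolding exangle_def ker
        idx[of "\<lambda>j i k. {u \<in> Mor C Y (cob X j). cdf X j \<cdot> u = Zer C Y (cob X k)} = (\<lambda>u. cdf X i \<cdot> u) ` Mor C Y (cob X i)" for Y]
        idx[of "\<lambda>j i k. {u \<in> Mor C (cob X j) Y. u \<cdot> cdf X i = Zer C (cob X i) Y} = (\<lambda>u. u \<cdot> cdf X j) ` Mor C (cob X k) Y" for Y]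
      by simp_all
    have "cexact C n X" unfolding cexact_def using 1(3) mor_ob by blast
    moreover have "dexact C n X" unfolding dexact_def using 1(1) mor_ob by blast
    moreover have "\<forall>Y. \<forall>u \<in> Mor C Y (cob X (Suc n)). pull C E (cob X 0) u \<delta> = \<one>\<^bsub>Ext E Y (cob X 0)\<^esub> \<longrightarrow>
       (\<exists>w \<in> Mor C Y (cob X n). u = cdf X n \<cdot> w)" using 1(2) mor_ob by blast
    moreover have "\<forall>Y. \<forall>u \<in> Mor C (cob X 0) Y. push C E (cob X (Suc n)) u \<delta> = \<one>\<^bsub>Ext E (cob X (Suc n)) Y\<^esub> \<longrightarrow>
       (\<exists>w \<in> Mor C (cob X (Suc 0)) Y. u = w \<cdot> cdf X 0)" using 1(4) mor_ob by blast
    ultimately show ?R using L unfolding exangle_def by simp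
  next
    assume R: ?R
    note t = Ch_simps[OF R[THEN conjunct1]]
    have \<delta>: "\<delta> \<in> carrier (Ext E (cob X (Suc n)) (cob X 0))"
      and p1: "Act E (Idt C (cob X (Suc n))) (cdf X 0) \<delta> = \<one>\<^bsub>Ext E (cob X (Suc n)) (cob X (Suc 0))\<^esub>"
      and p2: "Act E (cdf X n) (Idt C (cob X 0)) \<delta> = \<one>\<^bsub>Ext E (cob X n) (cob X 0)\<^esub>" using R unfolding push_def pull_def by blast+
    have 1: "{u \<in> Mor C Y (cob X (Suc i)). cdf X (Suc i) \<cdot> u = Zer C Y (cob X (Suc (Suc i)))} = (\<lambda>u. cdf X i \<cdot> u) ` Mor C Y (cob X i)" (is "?A = ?B") if "i < n" "Y \<in> Ob C" for i Y
    proof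
      show "?A \<subseteq> ?B" using R that unfolding dexact_def by blast
      show "?B \<subseteq> ?A" using t that by (auto simp: add_simps)
    qed
    have 3: "{u \<in> Mor C (cob X (Suc i)) Y. u \<cdot> cdf X i = Zer C (cob X i) Y} = (\<lambda>u. u \<cdot> cdf X (Suc i)) ` Mor C (cob X (Suc (Suc i))) Y" (is "?A = ?B") if "i < n" "Y \<in> Ob C" for i Y
    proof
      show "?A \<subseteq> ?B" using R that unfolding cexact_def by blast
      show "?B \<subseteq> ?A" using t that by (auto simp: add_simps)
    qed
    have 2: "{u \<in> Mor C Y (cob X (Suc n)). pull C E (cob X 0) u \<delta> = \<one>\<^bsub>Ext E Y (cob X 0)\<^esub>} = (\<lambda>u. cdf X n \<cdot> u) ` Mor C Y (cob X n)" (is "?A = ?B") if "Y \<in> Ob C" for Y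
    proof
      show "?A \<subseteq> ?B" using R that by blast
      show "?B \<subseteq> ?A"
      proof
        fix v assume "v \<in> ?B"
        then obtain u where u: "u \<in> Mor C Y (cob X n)" "v = cdf X n \<cdot> u" by blast
        have "Act E (cdf X n \<cdot> u) (Idt C (cob X 0)) \<delta> = Act E u (Idt C (cob X 0)) (Act E (cdf X n) (Idt C (cob X 0)) \<delta>)"
          using act_cmp[of "cdf X n" "cob X n" "cob X (Suc n)" u Y "Idt C (cob X 0)" "cob X 0" "cob X 0" "Idt C (cob X 0)" "cob X 0"] u t \<delta> by (simp add: cat_simps)
        then show "v \<in> ?A" using u t p2 act_one[of u Y "cob X n" "Idt C (cob X 0)" "cob X 0" "cob X 0"] by (auto simp: pull_def cat_simps)
      qed
    qed
    have 4: "{u \<in> Mor C (cob X 0) Y. push C E (cob X (Suc n)) u \<delta> = \<one>\<^bsub>Ext E (cob X (Suc n)) Y\<^esub>} = (\<lambda>u. u \<cdot> cdf X 0) ` Mor C (cob X (Suc 0)) Y" (is "?A = ?B") if "Y \<in> Ob C" for Y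
    proof
      show "?A \<subseteq> ?B" using R that by blast
      show "?B \<subseteq> ?A"
      proof
        fix v assume "v \<in> ?B"
        then obtain u where u: "u \<in> Mor C (cob X (Suc 0)) Y" "v = u \<cdot> cdf X 0" by blast
        have "Act E (Idt C (cob X (Suc n))) (u \<cdot> cdf X 0) \<delta> = Act E (Idt C (cob X (Suc n))) u (Act E (Idt C (cob X (Suc n))) (cdf X 0) \<delta>)"
          using act_cmp[of "Idt C (cob X (Suc n))" "cob X (Suc n)" "cob X (Suc n)" "Idt C (cob X (Suc n))" "cob X (Suc n)" "cdf X 0" "cob X 0" "cob X (Suc 0)" u Y] u t \<delta> by (simp add: cat_simps)
        then show "v \<in> ?A" using u t p1 act_one[of "Idt C (cob X (Suc n))" "cob X (Suc n)" "cob X (Suc n)" u "cob X (Suc 0)" Y] by (auto simp: push_def cat_simps)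
      qed
    qed
    show ?L unfolding exangle_def ker
        idx[of "\<lambda>j i k. {u \<in> Mor C Y (cob X j). cdf X j \<cdot> u = Zer C Y (cob X k)} = (\<lambda>u. cdf X i \<cdot> u) ` Mor C Y (cob X i)" for Y]
        idx[of "\<lambda>j i k. {u \<in> Mor C (cob X j) Y. u \<cdot> cdf X i = Zer C (cob X i) Y} = (\<lambda>u. u \<cdot> cdf X j) ` Mor C (cob X k) Y" for Y]
      using R 1 2 3 4 by simp
  qed
qed

lemma exangleD:
  assumes "exangle C E n X \<delta>"
  shows "X \<in> Ch C n" "\<delta> \<in> carrier (Ext E (cob X (Suc n)) (cob X 0))"
    "Act E (Idt C (cob X (Suc n))) (cdf X 0) \<delta> = \<one>\<^bsub>Ext E (cob X (Suc n)) (cob X (Suc 0))\<^esub>"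
    "Act E (cdf X n) (Idt C (cob X 0)) \<delta> = \<one>\<^bsub>Ext E (cob X n) (cob X 0)\<^esub>" "cexact C n X" "dexact C n X"
    "u \<in> Mor C Y (cob X (Suc n)) \<Longrightarrow> Act E u (Idt C (cob X 0)) \<delta> = \<one>\<^bsub>Ext E Y (cob X 0)\<^esub> \<Longrightarrow> \<exists>w \<in> Mor C Y (cob X n). u = cdf X n \<cdot> w"
    "u \<in> Mor C (cob X 0) Y \<Longrightarrow> Act E (Idt C (cob X (Suc n))) u \<delta> = \<one>\<^bsub>Ext E (cob X (Suc n)) Y\<^esub> \<Longrightarrow> \<exists>w \<in> Mor C (cob X (Suc 0)) Y. u = w \<cdot> cdf X 0"
  using assms unfolding exangle_iff' push_def pull_def by blast+

text \<open>The inner degrees need only a retract up to homotopy. At the two ends the retraction is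
  strict, which allows an extension to be moved from Y to X and back without loss, and with it the
  attachment and the exactness at the extension groups.\<close>

lemma exangle_retract:
  assumes X: "exangle C E n X \<delta>'" and Y: "Y \<in> Ch C n" and \<delta>: "\<delta> \<in> carrier (Ext E (cob Y (Suc n)) (cob Y 0))"
    and f: "chain_map C n Y X f" and g: "chain_map C n X Y g"
    and h: "homotopic C n Y Y (\<lambda>i. g i \<cdot> f i) (\<lambda>i. Idt C (cob Y i))"
    and e: "\<delta>' = Act E (g (Suc n)) (f 0) \<delta>" "g 0 \<cdot> f 0 = Idt C (cob Y 0)" "g (Suc n) \<cdot> f (Suc n) = Idt C (cob Y (Suc n))"
  shows "exangle C E n Y \<delta>"
proof -
  note x = exangleD[OF X]
  note t = Ch_simps[OF x(1)] Ch_simps[OF Y] chain_map_simps(1-3)[OF Y x(1) f] chain_map_simps(1-3)[OF x(1) Y g]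
  note c = chain_map_simps(4)[OF Y x(1) f] chain_map_simps(4)[OF x(1) Y g]
  \<comment> \<open>\<open>\<delta>\<close> is recovered from \<open>\<delta>'\<close> because g f
    is strictly the identity in both end degrees.\<close>
  have e1: "\<delta> = Act E (f (Suc n)) (g 0) \<delta>'"
    unfolding e(1) by (subst act_act[of _ "cob Y (Suc n)" "cob X (Suc n)" _ "cob Y (Suc n)" _ "cob Y 0" "cob X 0" _ "cob Y 0"])
     (use t \<delta> e(2,3) act_idt in \<open>simp_all add: cat_simps\<close>)
  have A: "Act E c a \<delta> = Act E (f (Suc n) \<cdot> c) (a \<cdot> g 0) \<delta>'" if "mor C c" "cd C c = cob Y (Suc n)" "mor C a" "dm C a = cob Y 0" for c a
    by (subst e1, subst act_act[of _ "dm C c" "cob Y (Suc n)" _ "cob X (Suc n)" _ "cob X 0" "cob Y 0" _ "cd C a"])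
     (use t x(2) that in \<open>simp_all add: cat_simps\<close>)
  have A': "Act E c a \<delta>' = Act E (g (Suc n) \<cdot> c) (a \<cdot> f 0) \<delta>" if "mor C c" "cd C c = cob X (Suc n)" "mor C a" "dm C a = cob X 0" for c a
    by (subst e(1), subst act_act[of _ "dm C c" "cob X (Suc n)" _ "cob Y (Suc n)" _ "cob Y 0" "cob X 0" _ "cd C a"])
     (use t \<delta> that in \<open>simp_all add: cat_simps\<close>)
  have B: "Act E c' a' (Act E c a \<delta>') = Act E (c \<cdot> c') (a' \<cdot> a) \<delta>'" if "mor C c" "cd C c = cob X (Suc n)" "mor C a" "dm C a = cob X 0" "mor C c'" "cd C c' = dm C c" "mor C a'" "dm C a' = cd C a" for c a c' a'
    by (rule act_act[of _ "dm C c'" "dm C c" _ "cob X (Suc n)" _ "cob X 0" "cd C a" _ "cd C a'"])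
     (use t x(2) that in \<open>simp_all add: cat_simps\<close>)
  have 1: "Act E (Idt C (cob Y (Suc n))) (cdf Y 0) \<delta> = \<one>\<^bsub>Ext E (cob Y (Suc n)) (cob Y (Suc 0))\<^esub>"
  proof -
    have "Act E (Idt C (cob Y (Suc n))) (cdf Y 0) \<delta> = Act E (f (Suc n)) (g (Suc 0)) (Act E (Idt C (cob X (Suc n))) (cdf X 0) \<delta>')"
      using t c(2)[of 0] by (simp add: A B cat_simps)
    also have "\<dots> = \<one>\<^bsub>Ext E (cob Y (Suc n)) (cob Y (Suc 0))\<^esub>" unfolding x(3) by (rule act_one) (use t in \<open>simp_all add: cat_simps\<close>)
    finally show ?thesis .
  qed
  have 2: "Act E (cdf Y n) (Idt C (cob Y 0)) \<delta> = \<one>\<^bsub>Ext E (cob Y n) (cob Y 0)\<^esub>"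
  proof -
    have "Act E (cdf Y n) (Idt C (cob Y 0)) \<delta> = Act E (f n) (g 0) (Act E (cdf X n) (Idt C (cob X 0)) \<delta>')"
      using t c(1)[of n] by (simp add: A B cat_simps)
    also have "\<dots> = \<one>\<^bsub>Ext E (cob Y n) (cob Y 0)\<^esub>" unfolding x(4) by (rule act_one) (use t in \<open>simp_all add: cat_simps\<close>)
    finally show ?thesis .
  qed
  have 3: "\<exists>w \<in> Mor C V (cob Y n). u = cdf Y n \<cdot> w" if u: "u \<in> Mor C V (cob Y (Suc n))" "Act E u (Idt C (cob Y 0)) \<delta> = \<one>\<^bsub>Ext E V (cob Y 0)\<^esub>" for u V
  proof -
    have "Act E (f (Suc n) \<cdot> u) (Idt C (cob X 0)) \<delta>' = Act E u (f 0) \<delta>"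
      using t u e(3) eqR[OF e(3), of u] by (simp add: A' cat_simps)
    also have "\<dots> = Act E (Idt C V) (f 0) (Act E u (Idt C (cob Y 0)) \<delta>)"
      by (subst act_act[of _ V V _ "cob Y (Suc n)" _ "cob Y 0" "cob Y 0" _ "cob X 0"]) (use t u \<delta> mor_ob[OF u(1)] in \<open>simp_all add: cat_simps\<close>)
    also have "\<dots> = \<one>\<^bsub>Ext E V (cob X 0)\<^esub>" unfolding u(2) by (rule act_one) (use t mor_ob[OF u(1)] in \<open>simp_all add: cat_simps\<close>)
    finally obtain w where w: "w \<in> Mor C V (cob X n)" "f (Suc n) \<cdot> u = cdf X n \<cdot> w"
      using x(7)[of "f (Suc n) \<cdot> u" V] t u(1) by (auto simp: cat_simps)
    have "u = g (Suc n) \<cdot> (f (Suc n) \<cdot> u)" using eqR[OF e(3), of u] u(1) t by (simp add: cat_simps)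
    also have "\<dots> = cdf Y n \<cdot> (g n \<cdot> w)" unfolding w(2) using eqR[OF c(2), of n w] w(1) t by (simp add: cat_simps)
    finally show ?thesis using w(1) t by (intro bexI[of _ "g n \<cdot> w"]) (auto simp: cat_simps)
  qed
  have 4: "\<exists>w \<in> Mor C (cob Y (Suc 0)) V. u = w \<cdot> cdf Y 0" if u: "u \<in> Mor C (cob Y 0) V" "Act E (Idt C (cob Y (Suc n))) u \<delta> = \<one>\<^bsub>Ext E (cob Y (Suc n)) V\<^esub>" for u V
  proof -
    have "Act E (Idt C (cob X (Suc n))) (u \<cdot> g 0) \<delta>' = Act E (g (Suc n)) u \<delta>"
      using t u e(2) by (simp add: A' cat_simps)
    also have "\<dots> = Act E (g (Suc n)) (Idt C V) (Act E (Idt C (cob Y (Suc n))) u \<delta>)"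
      by (subst act_act[of _ "cob X (Suc n)" "cob Y (Suc n)" _ "cob Y (Suc n)" _ "cob Y 0" V _ V]) (use t u \<delta> mor_ob[OF u(1)] in \<open>simp_all add: cat_simps\<close>)
    also have "\<dots> = \<one>\<^bsub>Ext E (cob X (Suc n)) V\<^esub>" unfolding u(2) by (rule act_one) (use t mor_ob[OF u(1)] in \<open>simp_all add: cat_simps\<close>)
    finally obtain w where w: "w \<in> Mor C (cob X (Suc 0)) V" "u \<cdot> g 0 = w \<cdot> cdf X 0"
      using x(8)[of "u \<cdot> g 0" V] t u(1) by (auto simp: cat_simps)
    have "u = (u \<cdot> g 0) \<cdot> f 0" using e(2) u(1) t by (simp add: cat_simps)
    also have "\<dots> = (w \<cdot> f (Suc 0)) \<cdot> cdf Y 0" unfolding w(2) using c(1)[of 0] w(1) t by (simp add: cat_simps)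
    finally show ?thesis using w(1) t by (intro bexI[of _ "w \<cdot> f (Suc 0)"]) (auto simp: cat_simps)
  qed
  show ?thesis unfolding exangle_iff' push_def pull_def
    using Y \<delta> 1 2 3 4 cexact_retract[OF x(1,5) Y f g h] dexact_retract[OF x(1,6) Y f g h] by blast
qed

end

section \<open>Opposite categories and reversed complexes\<close>

lemma op_cat_simps [simp]: "Ob (op_cat C) = Ob C" "Mor (op_cat C) A B = Mor C B A" "Cmp (op_cat C) g f = Cmp C f g"
    "Idt (op_cat C) = Idt C" "Add (op_cat C) = Add C" "Zer (op_cat C) A B = Zer C B A"
  by (simp_all add: op_cat_def)

lemma op_op_cat [simp]: "op_cat (op_cat C) = C"
  by (simp add: op_cat_def)

lemma op_bifunctor_simps [simp]: "Ext (op_bifunctor E) Z A = Ext E A Z" "Act (op_bifunctor E) c a = Act E a c"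
  by (simp_all add: op_bifunctor_def)

lemma op_op_bifunctor [simp]: "op_bifunctor (op_bifunctor E) = E"
  by (simp add: op_bifunctor_def)

lemma op_cpx_simps [simp]: "cob (op_cpx n X) i = cob X (Suc n - i)" "cdf (op_cpx n X) i = cdf X (n - i)"
  by (simp_all add: op_cpx_def)

lemma push_pull_op [simp]: "push (op_cat C) (op_bifunctor E) = pull C E" "pull (op_cat C) (op_bifunctor E) = push C E"
  by (simp_all add: push_def pull_def fun_eq_iff)

lemma HomG_op [simp]: "HomG (op_cat C) A B = HomG C B A"
  by (simp add: HomG_def)

lemma biproduct_op: "biproduct (op_cat C) A B P p1 p2 i1 i2 \<longleftrightarrow> biproduct C A B P i1 i2 p1 p2"
  unfolding biproduct_def by auto

lemma zero_object_op [simp]: "zero_object (op_cat C) Z \<longleftrightarrow> zero_object C Z"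
  unfolding zero_object_def by auto

lemma category_op: assumes "category C" shows "category (op_cat C)"
proof -
  interpret category C by fact
  show ?thesis by unfold_locales (auto simp: cat_simps)
qed

lemma additive_category_op: assumes "additive_category C" shows "additive_category (op_cat C)"
proof -
  interpret additive_category C by fact
  interpret op: category "op_cat C" using category_op category_axioms by blast
  show ?thesis
  proof (intro additive_category.intro additive_category_axioms.intro)
    show "category (op_cat C)" by (rule op.category_axioms)
    fix A B show "A \<in> Ob (op_cat C) \<Longrightarrow> B \<in> Ob (op_cat C) \<Longrightarrow> comm_group (HomG (op_cat C) A B)"
      using hom_group by simp
    show "A \<in> Ob (op_cat C) \<Longrightarrow> B \<in> Ob (op_cat C) \<Longrightarrow> \<exists>P i1 i2 p1 p2. biproduct (op_cat C) A B P i1 i2 p1 p2"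
      using ex_biproduct[of A B] biproduct_op by fastforce
  qed (use ex_zero in \<open>auto simp: cmp_add add_cmp\<close>)
qed

lemma biadditive_functor_op: assumes "biadditive_functor C E" shows "biadditive_functor (op_cat C) (op_bifunctor E)"
proof -
  interpret biadditive_functor C E by fact
  interpret op: additive_category "op_cat C" using additive_category_op additive_category_axioms by blast
  show ?thesis
    by (intro biadditive_functor.intro biadditive_functor_axioms.intro op.additive_category_axioms)
      (auto simp: ext_group act_hom act_idt act_cmp act_add_left act_add_right)
qed

lemma all_less_reindex: "(\<forall>i<n::nat. P i) \<longleftrightarrow> (\<forall>i<n. P (n - Suc i))"
proof
  assume a: "\<forall>i<n. P (n - Suc i)"
  show "\<forall>i<n. P i"
  proof (intro allI impI)
    fix i assume "i < n"
    then show "P i" using a[rule_format, of "n - Suc i"] by simp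
  qed
qed simp

lemma all_le_reindex: "(\<forall>i\<le>n::nat. P i) \<longleftrightarrow> (\<forall>i\<le>n. P (n - i))"
  by (metis diff_diff_cancel diff_le_self)

lemma Ch_op: "X \<in> Ch (op_cat C) n \<longleftrightarrow> op_cpx n X \<in> Ch C n"
proof -
  have "(\<forall>i\<le>Suc n. cob X i \<in> Ob C) = (\<forall>i\<le>Suc n. cob X (Suc n - i) \<in> Ob C)"
    by (rule all_le_reindex)
  moreover have "(\<forall>i\<le>n. cdf X i \<in> Mor C (cob X (Suc i)) (cob X i)) = (\<forall>i\<le>n. cdf X (n - i) \<in> Mor C (cob X (Suc n - i)) (cob X (n - i)))"
    by (subst all_le_reindex) (auto simp: Suc_diff_le)
  moreover have "(\<forall>i<n. cdf X i \<cdot>\<^bsub>C\<^esub> cdf X (Suc i) = Zer C (cob X (Suc (Suc i))) (cob X i)) = (\<forall>i<n. cdf X (n - Suc i) \<cdot>\<^bsub>C\<^esub> cdf X (n - i) = Zer C (cob X (Suc n - i)) (cob X (n - Suc i)))"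
    by (subst all_less_reindex) (auto simp: Suc_diff_le Suc_diff_Suc)
  ultimately show ?thesis unfolding Ch_def by simp
qed

lemma chain_map_op: "chain_map (op_cat C) n X Y f \<longleftrightarrow> chain_map C n (op_cpx n Y) (op_cpx n X) (\<lambda>i. f (Suc n - i))"
proof -
  have "(\<forall>i\<le>Suc n. f i \<in> Mor C (cob Y i) (cob X i)) = (\<forall>i\<le>Suc n. f (Suc n - i) \<in> Mor C (cob Y (Suc n - i)) (cob X (Suc n - i)))"
    by (rule all_le_reindex)
  moreover have "(\<forall>i\<le>n. cdf X i \<cdot>\<^bsub>C\<^esub> f (Suc i) = f i \<cdot>\<^bsub>C\<^esub> cdf Y i) = (\<forall>i\<le>n. cdf X (n - i) \<cdot>\<^bsub>C\<^esub> f (Suc n - i) = f (n - i) \<cdot>\<^bsub>C\<^esub> cdf Y (n - i))"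
    by (subst all_le_reindex) (auto simp: Suc_diff_le)
  ultimately show ?thesis unfolding chain_map_def by (auto simp: Suc_diff_le)
qed

lemma cexact_op: "cexact (op_cat C) n X \<longleftrightarrow> dexact C n (op_cpx n X)"
  unfolding cexact_def dexact_def by (subst all_less_reindex) (auto simp: Suc_diff_le Suc_diff_Suc)

lemma dexact_op: "dexact (op_cat C) n X \<longleftrightarrow> cexact C n (op_cpx n X)"
  unfolding cexact_def dexact_def by (subst all_less_reindex) (auto simp: Suc_diff_le Suc_diff_Suc)

lemma exangle_op:
  assumes "biadditive_functor C E"
  shows "exangle (op_cat C) (op_bifunctor E) n X \<delta> \<longleftrightarrow> exangle C E n (op_cpx n X) \<delta>"
  unfolding biadditive_functor.exangle_iff'[OF assms] biadditive_functor.exangle_iff'[OF biadditive_functor_op[OF assms]] push_pull_op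
  by (auto simp: Ch_op cexact_op dexact_op)

lemma chain_map_ends_op: "chain_map_ends (op_cat C) n X Y f \<longleftrightarrow> chain_map_ends C n (op_cpx n Y) (op_cpx n X) (\<lambda>i. f (Suc n - i))"
  if "X \<in> Ch (op_cat C) n" "Y \<in> Ch (op_cat C) n" "additive_category C" "cob X 0 = cob Y 0" "cob X (Suc n) = cob Y (Suc n)"
  using that(4,5) unfolding chain_map_ends_def chain_map_op by auto

text \<open>Reversing a complex twice gives a different record: truncated subtraction overwrites the
  values outside the relevant degrees. \<open>agree\<close> is equality in the relevant degrees, and
  every notion used here respects it.\<close>

definition agree :: "nat \<Rightarrow> ('o, 'm) cpx \<Rightarrow> ('o, 'm) cpx \<Rightarrow> bool" where
  "agree n X Y \<longleftrightarrow> (\<forall>i \<le> Suc n. cob X i = cob Y i) \<and> (\<forall>i \<le> n. cdf X i = cdf Y i)"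

lemma agree_op_op: "agree n (op_cpx n (op_cpx n X)) X"
  by (simp add: agree_def)

lemma agree_sym: "agree n X Y \<Longrightarrow> agree n Y X"
  by (simp add: agree_def)

lemma agree_Ch: "agree n X Y \<Longrightarrow> X \<in> Ch C n \<Longrightarrow> Y \<in> Ch C n"
  unfolding agree_def Ch_def by auto

lemma agree_cexact: "agree n X Y \<Longrightarrow> cexact C n X \<Longrightarrow> cexact C n Y"
  unfolding agree_def cexact_def by (auto simp: less_imp_le)

lemma agree_dexact: "agree n X Y \<Longrightarrow> dexact C n X \<Longrightarrow> dexact C n Y"
  unfolding agree_def dexact_def by (auto simp: less_imp_le)

lemma (in biadditive_functor) agree_exangle: "agree n X Y \<Longrightarrow> 1 \<le> n \<Longrightarrow> exangle C E n X \<delta> \<Longrightarrow> exangle C E n Y \<delta>"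
  using agree_Ch[of n X Y C] agree_cexact[of n X Y C] agree_dexact[of n X Y C] unfolding exangle_iff' by (simp add: agree_def)

lemma agree_chain_map: "agree n X Y \<Longrightarrow> chain_map C n X Z f \<Longrightarrow> chain_map C n Y Z f"
    "agree n X Y \<Longrightarrow> chain_map C n Z X f \<Longrightarrow> chain_map C n Z Y f"
  unfolding agree_def chain_map_def by auto

lemma agree_chain_map_ends: "agree n X Y \<Longrightarrow> chain_map_ends C n X Z f \<Longrightarrow> chain_map_ends C n Y Z f"
    "agree n X Y \<Longrightarrow> chain_map_ends C n Z X f \<Longrightarrow> chain_map_ends C n Z Y f"
  unfolding chain_map_ends_def by (auto intro: agree_chain_map) (auto simp: agree_def)

context additive_category begin

lemma homotopic_eq:
  assumes "X \<in> Ch C n" "Y \<in> Ch C n" "chain_map C n X Y g" "\<And>i. i \<le> Suc n \<Longrightarrow> f i = g i"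
  shows "homotopic C n X Y f g"
proof -
  define h where "h i = Zer C (cob X i) (cob Y (i - 1))" for i
  note t = Ch_simps[OF assms(1)] Ch_simps[OF assms(2)] chain_map_simps(1-3)[OF assms(1-3)]
  have "hty C n X Y h" by (rule htyI) (use t in \<open>auto simp: h_def add_simps\<close>)
  moreover have "f i = g i \<boxplus> hb C n X Y h i" if "i \<le> Suc n" for i
    by (rule degree_cases[OF that]; use t assms(4) in \<open>simp add: hb_simps h_def add_simps\<close>)
  ultimately show ?thesis unfolding homotopic_iff by auto
qed

lemma kclass_agree:
  assumes "X \<in> Ch C n" "cexact C n X" "1 \<le> n" "Y \<in> kclass C n X" "agree n Y Y'"
  shows "Y' \<in> kclass C n X"
  using assms(4) agree_Ch[OF assms(5)] agree_cexact[OF assms(5)] agree_chain_map_ends[OF assms(5)]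
  unfolding kclass_iff[OF assms(1-3)] by blast

lemma kclass_self: "X \<in> Ch C n \<Longrightarrow> cexact C n X \<Longrightarrow> 1 \<le> n \<Longrightarrow> X \<in> kclass C n X"
  using chain_map_ends_id kclass_iff by blast

lemma kclass_eq:
  assumes "X \<in> Ch C n" "cexact C n X" "1 \<le> n" "Y \<in> kclass C n X"
  shows "kclass C n Y = kclass C n X"
proof -
  have Y: "Y \<in> Ch C n" "cexact C n Y" "\<exists>f. chain_map_ends C n X Y f" "\<exists>f. chain_map_ends C n Y X f" using assms(4) kclass_iff[OF assms(1-3)] by blast+
  show ?thesis
  proof (rule Set.set_eqI)
    fix Z
    obtain f g where fg: "chain_map_ends C n X Y f" "chain_map_ends C n Y X g" using Y by blast
    show "Z \<in> kclass C n Y \<longleftrightarrow> Z \<in> kclass C n X"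
      unfolding kclass_iff[OF assms(1-3)] kclass_iff[OF Y(1,2) assms(3)]
      using chain_map_ends_comp[OF assms(1) Y(1) _ fg(1)] chain_map_ends_comp[OF Y(1) assms(1) _ fg(2)]
        chain_map_ends_comp[OF _ Y(1) assms(1) _ fg(2)] chain_map_ends_comp[OF _ assms(1) Y(1) _ fg(1)] by meson
  qed
qed

lemma K_iso_refl: "X \<in> Ch C n \<Longrightarrow> K_iso C n X X"
  unfolding K_iso_def
  by (intro exI[of _ "\<lambda>i. Idt C (cob X i)"] conjI chain_map_ends_id homotopic_eq chain_map_id)
    (simp_all add: cat_simps Ch_simps)

lemma kclass_dexact:
  assumes "X \<in> Ch C n" "cexact C n X" "dexact C n X" "1 \<le> n" "Y \<in> kclass C n X"
  shows "dexact C n Y"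
proof -
  obtain f g where "chain_map_ends C n X Y f" "chain_map_ends C n Y X g" "homotopic C n Y Y (\<lambda>i. f i \<cdot> g i) (\<lambda>i. Idt C (cob Y i))" "Y \<in> Ch C n"
    using assms(5) unfolding kclass_def K_iso_def Ch_ends_def by blast
  then show ?thesis using dexact_retract[OF assms(1,3)] chain_map_endsD(1) by blast
qed

end

lemma chain_map_ends_op_imp:
  assumes "additive_category C" "X \<in> Ch (op_cat C) n" "Y \<in> Ch (op_cat C) n" "chain_map_ends (op_cat C) n X Y f"
  shows "chain_map_ends C n (op_cpx n Y) (op_cpx n X) (\<lambda>i. f (Suc n - i))"
proof -
  interpret O: additive_category "op_cat C" by (rule additive_category_op) fact
  show ?thesis using chain_map_ends_op[OF assms(2,3,1)] O.chain_map_ends_cob[OF assms(2-4)] assms(4) by simp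
qed

lemma ex_chain_map_ends_op:
  assumes "additive_category C" "X \<in> Ch (op_cat C) n" "Y \<in> Ch (op_cat C) n"
  shows "(\<exists>f. chain_map_ends (op_cat C) n X Y f) \<longleftrightarrow> (\<exists>f. chain_map_ends C n (op_cpx n Y) (op_cpx n X) f)"
proof
  assume "\<exists>f. chain_map_ends C n (op_cpx n Y) (op_cpx n X) f"
  then obtain f where "chain_map_ends (op_cat (op_cat C)) n (op_cpx n Y) (op_cpx n X) f" by auto
  then have "chain_map_ends (op_cat C) n (op_cpx n (op_cpx n X)) (op_cpx n (op_cpx n Y)) (\<lambda>i. f (Suc n - i))"
    by (rule chain_map_ends_op_imp[rotated 3]) (use assms Ch_op in \<open>auto intro: additive_category_op\<close>)
  then show "\<exists>f. chain_map_ends (op_cat C) n X Y f"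
    using agree_chain_map_ends agree_op_op by blast
qed (use chain_map_ends_op_imp[OF assms] in blast)

text \<open>Both memberships amount to comparison maps in two directions plus inner exactness, of
  one variance on each side. The missing variance is supplied by \<open>kclass_dexact\<close>, which
  is why X is assumed exact in both. Membership is compared rather than sets, since
  \<open>op_cpx n\<close> is not a bijection.\<close>

lemma kclass_op:
  assumes "additive_category C" and X: "op_cpx n X \<in> Ch C n" "cexact C n (op_cpx n X)" "dexact C n (op_cpx n X)" and n: "1 \<le> n"
  shows "Y \<in> kclass (op_cat C) n X \<longleftrightarrow> op_cpx n Y \<in> kclass C n (op_cpx n X)"
proof -
  interpret A: additive_category C by fact
  interpret O: additive_category "op_cat C" by (rule additive_category_op) fact
  have Xo: "X \<in> Ch (op_cat C) n" "cexact (op_cat C) n X" "dexact (op_cat C) n X" using X by (simp_all add: Ch_op cexact_op dexact_op)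
  note A = A.kclass_iff[OF X(1,2) n] and O = O.kclass_iff[OF Xo(1,2) n]
  have ch: "(\<exists>f. chain_map_ends (op_cat C) n X Y f) \<longleftrightarrow> (\<exists>f. chain_map_ends C n (op_cpx n Y) (op_cpx n X) f)"
    "(\<exists>f. chain_map_ends (op_cat C) n Y X f) \<longleftrightarrow> (\<exists>f. chain_map_ends C n (op_cpx n X) (op_cpx n Y) f)"
    if "Y \<in> Ch (op_cat C) n" using ex_chain_map_ends_op[OF assms(1)] that Xo(1) by blast+
  show ?thesis
  proof
    assume Y: "Y \<in> kclass (op_cat C) n X"
    then show "op_cpx n Y \<in> kclass C n (op_cpx n X)"
      unfolding A using O.kclass_dexact[OF Xo n Y] O ch by (simp add: Ch_op dexact_op)
  next
    assume Y: "op_cpx n Y \<in> kclass C n (op_cpx n X)"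
    then show "Y \<in> kclass (op_cat C) n X"
      unfolding O using A.kclass_dexact[OF X n Y] A ch by (simp add: Ch_op cexact_op)
  qed
qed

section \<open>Realisations and their axioms in the opposite category\<close>

lemma realises_Ch: "realises C n s Z A \<delta> X \<Longrightarrow> X \<in> Ch C n \<and> cob X 0 = A \<and> cob X (Suc n) = Z"
  unfolding realises_def Ch_ends_def by auto

context exact_realisation begin

lemma realises_exact: "Z \<in> Ob C \<Longrightarrow> A \<in> Ob C \<Longrightarrow> \<delta> \<in> carrier (Ext E Z A) \<Longrightarrow> realises C n s Z A \<delta> X \<Longrightarrow>
   X \<in> Ch C n \<and> cexact C n X \<and> dexact C n X"
  using R1[of Z A \<delta> X] exangleD(1,5,6)[of n X \<delta>] by blast

text \<open>The set \<open>s Z A \<delta>\<close> is a full isomorphism class, so each of its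
  members represents it.\<close>

lemma realises_iff:
  assumes "1 \<le> n" "Z \<in> Ob C" "A \<in> Ob C" "\<delta> \<in> carrier (Ext E Z A)"
  shows "realises C n s Z A \<delta> X \<longleftrightarrow> X \<in> s Z A \<delta>"
proof
  assume "realises C n s Z A \<delta> X"
  then show "X \<in> s Z A \<delta>" using realises_exact[OF assms(2-4)] kclass_self assms(1) unfolding realises_def by metis
next
  assume X: "X \<in> s Z A \<delta>"
  obtain Y where Y: "realises C n s Z A \<delta> Y" using realised assms by blast
  then show "realises C n s Z A \<delta> X"
    using X realises_exact[OF assms(2-4) Y] kclass_eq[of Y n X] assms(1) unfolding realises_def by (auto simp: kclass_def Ch_ends_def)
qed

lemma realises_agree:
  assumes "1 \<le> n" "Z \<in> Ob C" "A \<in> Ob C" "\<delta> \<in> carrier (Ext E Z A)" "realises C n s Z A \<delta> X" "agree n X Y"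
  shows "realises C n s Z A \<delta> Y"
  using assms(5,6) realises_exact[OF assms(2-5)] kclass_agree[OF _ _ assms(1) _ assms(6)] kclass_self[OF _ _ assms(1)]
  unfolding realises_iff[OF assms(1-4)] by (metis assms(1-5) realises_def)

text \<open>\<open>op_realisation\<close> is a preimage under reversal, so both sides express that
  the reversed complex lies in \<open>s Z A \<delta>\<close>; \<open>kclass_op\<close> shows that
  this preimage is again a class.\<close>

lemma realises_op:
  assumes "1 \<le> n" "Z \<in> Ob C" "A \<in> Ob C" "\<delta> \<in> carrier (Ext E Z A)"
  shows "realises (op_cat C) n (op_realisation n s) A Z \<delta> X \<longleftrightarrow> realises C n s Z A \<delta> (op_cpx n X)"
proof
  assume r: "realises (op_cat C) n (op_realisation n s) A Z \<delta> X"
  interpret O: additive_category "op_cat C" by (rule additive_category_op) unfold_locales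
  have "X \<in> kclass (op_cat C) n X" using r O.K_iso_refl unfolding realises_def kclass_def Ch_ends_def by auto
  then have "op_cpx n X \<in> s Z A \<delta>" using r unfolding realises_def by (auto simp: op_realisation_def)
  then show "realises C n s Z A \<delta> (op_cpx n X)" using realises_iff[OF assms] by simp
next
  assume r: "realises C n s Z A \<delta> (op_cpx n X)"
  note x = realises_exact[OF assms(2-4) r]
  have ad: "additive_category C" by unfold_locales
  have "op_realisation n s A Z \<delta> = kclass (op_cat C) n X"
    using r x kclass_op[OF ad _ _ _ assms(1), of X] unfolding realises_def op_realisation_def by auto
  then show "realises (op_cat C) n (op_realisation n s) A Z \<delta> X"
    using r x unfolding realises_def Ch_ends_def by (simp add: Ch_op)
qed

end

lemma triv_agree: "agree n (op_cpx n (triv_left (op_cat C) Z A)) (triv_right C n Z A)" "agree n (op_cpx n (triv_right (op_cat C) n Z A)) (triv_left C Z A)" if "1 \<le> n"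
  using that by (auto simp: agree_def triv_left_def triv_right_def Let_def)

lemma exact_realisation_op:
  assumes "exact_realisation C E n s" and n: "1 \<le> n"
  shows "exact_realisation (op_cat C) (op_bifunctor E) n (op_realisation n s)"
proof -
  interpret exact_realisation C E n s by fact
  have bi: "biadditive_functor C E" by unfold_locales
  interpret O: biadditive_functor "op_cat C" "op_bifunctor E" by (rule biadditive_functor_op[OF bi])
  show ?thesis
  proof (intro exact_realisation.intro exact_realisation_axioms.intro O.biadditive_functor_axioms)
    fix Z A \<delta> assume a: "Z \<in> Ob (op_cat C)" "A \<in> Ob (op_cat C)" "\<delta> \<in> carrier (Ext (op_bifunctor E) Z A)"
    then obtain W where W: "realises C n s A Z \<delta> W" using realised[of A Z \<delta>] by auto
    \<comment> \<open>The reversal of W is the required witness, provided that the reversal of this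
      reversal realises \<delta>; it agrees with W in the relevant degrees.\<close>
    then have "realises C n s A Z \<delta> (op_cpx n (op_cpx n W))" using realises_agree[OF n _ _ _ W] agree_sym agree_op_op a by fastforce
    then show "\<exists>X. realises (op_cat C) n (op_realisation n s) Z A \<delta> X" using realises_op[OF n, of A Z \<delta>] a by auto
  next
    fix \<delta> Z A \<rho> W B a c X Y
    assume a: "\<delta> \<in> carrier (Ext (op_bifunctor E) Z A)" "\<rho> \<in> carrier (Ext (op_bifunctor E) W B)"
       "a \<in> Mor (op_cat C) A B" "c \<in> Mor (op_cat C) Z W" "push (op_cat C) (op_bifunctor E) Z a \<delta> = pull (op_cat C) (op_bifunctor E) B c \<rho>"
       "realises (op_cat C) n (op_realisation n s) Z A \<delta> X" "realises (op_cat C) n (op_realisation n s) W B \<rho> Y"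
    have r: "realises C n s A Z \<delta> (op_cpx n X)" "realises C n s B W \<rho> (op_cpx n Y)"
      using a realises_op[OF n, of A Z \<delta> X] realises_op[OF n, of B W \<rho> Y] mor_ob[of a B A] mor_ob[of c W Z] by auto
    obtain f where f: "chain_map C n (op_cpx n Y) (op_cpx n X) f" "f 0 = c" "f (n + 1) = a"
      using R0[of \<rho> B W \<delta> A Z c a, OF _ _ _ _ _ r(2,1)] a by auto
    have "chain_map (op_cat C) n X Y (\<lambda>i. f (Suc n - i))"
      unfolding chain_map_op using f(1) unfolding chain_map_def by (auto simp: Suc_diff_le)
    then show "\<exists>f. chain_map (op_cat C) n X Y f \<and> f 0 = a \<and> f (n + 1) = c"
      using f by (intro exI[of _ "\<lambda>i. f (Suc n - i)"]) auto
  next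
    fix Z A \<delta> X assume a: "Z \<in> Ob (op_cat C)" "A \<in> Ob (op_cat C)" "\<delta> \<in> carrier (Ext (op_bifunctor E) Z A)"
      "realises (op_cat C) n (op_realisation n s) Z A \<delta> X"
    then show "exangle (op_cat C) (op_bifunctor E) n X \<delta>"
      using realises_op[OF n, of A Z \<delta> X] R1 exangle_op[OF bi] by auto
  next
    fix Z A assume a: "zero_object (op_cat C) Z" "A \<in> Ob (op_cat C)"
    then have Z: "Z \<in> Ob C" unfolding zero_object_def by simp
    have one: "\<one>\<^bsub>Ext E A Z\<^esub> \<in> carrier (Ext E A Z)" "\<one>\<^bsub>Ext E Z A\<^esub> \<in> carrier (Ext E Z A)"
      using ext_group' a(2) Z monoid.one_closed group.is_monoid by auto
    show "realises (op_cat C) n (op_realisation n s) Z A \<one>\<^bsub>Ext (op_bifunctor E) Z A\<^esub> (triv_left (op_cat C) Z A)"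
      using realises_agree[OF n _ _ _ R2_right, of A Z] realises_op[OF n, of A Z] one a Z triv_agree(1)[OF n] agree_sym by fastforce
    show "realises (op_cat C) n (op_realisation n s) A Z \<one>\<^bsub>Ext (op_bifunctor E) A Z\<^esub> (triv_right (op_cat C) n Z A)"
      using realises_agree[OF n _ _ _ R2_left, of Z A] realises_op[OF n, of Z A] one a Z triv_agree(2)[OF n] agree_sym by fastforce
  qed
qed

lemma inflation_op:
  assumes "exact_realisation C E n s" and n: "1 \<le> n"
  shows "inflation (op_cat C) (op_bifunctor E) n (op_realisation n s) f \<longleftrightarrow> deflation C E n s f"
    "deflation (op_cat C) (op_bifunctor E) n (op_realisation n s) f \<longleftrightarrow> inflation C E n s f"
proof -
  interpret exact_realisation C E n s by fact
  have ag: "realises C n s Z A \<delta> (op_cpx n (op_cpx n X))" if "realises C n s Z A \<delta> X" "Z \<in> Ob C" "A \<in> Ob C" "\<delta> \<in> carrier (Ext E Z A)" for Z A \<delta> X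
    using realises_agree[OF n that(2-4,1)] agree_sym agree_op_op by blast
  show "inflation (op_cat C) (op_bifunctor E) n (op_realisation n s) f \<longleftrightarrow> deflation C E n s f"
  proof
    assume "inflation (op_cat C) (op_bifunctor E) n (op_realisation n s) f"
    then obtain Z A \<delta> X where "Z \<in> Ob C" "A \<in> Ob C" "\<delta> \<in> carrier (Ext E A Z)" "realises (op_cat C) n (op_realisation n s) Z A \<delta> X" "f = cdf X 0"
      unfolding inflation_def by auto
    then show "deflation C E n s f" unfolding deflation_def using realises_op[OF n, of A Z \<delta> X]
      by (intro bexI[of _ A] bexI[of _ Z] bexI[of _ \<delta>] exI[of _ "op_cpx n X"]) auto
  next
    assume "deflation C E n s f"
    then obtain Z A \<delta> X where "Z \<in> Ob C" "A \<in> Ob C" "\<delta> \<in> carrier (Ext E Z A)" "realises C n s Z A \<delta> X" "f = cdf X n"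
      unfolding deflation_def by auto
    then show "inflation (op_cat C) (op_bifunctor E) n (op_realisation n s) f" unfolding inflation_def using realises_op[OF n, of Z A \<delta> "op_cpx n X"] ag
      by (intro bexI[of _ A] bexI[of _ Z] bexI[of _ \<delta>] exI[of _ "op_cpx n X"]) auto
  qed
  show "deflation (op_cat C) (op_bifunctor E) n (op_realisation n s) f \<longleftrightarrow> inflation C E n s f"
  proof
    assume "deflation (op_cat C) (op_bifunctor E) n (op_realisation n s) f"
    then obtain Z A \<delta> X where "Z \<in> Ob C" "A \<in> Ob C" "\<delta> \<in> carrier (Ext E A Z)" "realises (op_cat C) n (op_realisation n s) Z A \<delta> X" "f = cdf X n"
      unfolding deflation_def by auto
    then show "inflation C E n s f" unfolding inflation_def using realises_op[OF n, of A Z \<delta> X]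
      by (intro bexI[of _ A] bexI[of _ Z] bexI[of _ \<delta>] exI[of _ "op_cpx n X"]) auto
  next
    assume "inflation C E n s f"
    then obtain Z A \<delta> X where "Z \<in> Ob C" "A \<in> Ob C" "\<delta> \<in> carrier (Ext E Z A)" "realises C n s Z A \<delta> X" "f = cdf X 0"
      unfolding inflation_def by auto
    then show "deflation (op_cat C) (op_bifunctor E) n (op_realisation n s) f" unfolding deflation_def using realises_op[OF n, of Z A \<delta> "op_cpx n X"] ag
      by (intro bexI[of _ A] bexI[of _ Z] bexI[of _ \<delta>] exI[of _ "op_cpx n X"]) auto
  qed
qed

text \<open>A realisation has arbitrary values outside the extension groups. The double dual of s
  therefore agrees with s only on actual extensions, and (EA2) has to be transferred along this
  partial agreement.\<close>

lemma EA2_cong: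
  assumes "biadditive_functor C E" "EA2 C E n s"
    and "\<And>Z A \<delta>. Z \<in> Ob C \<Longrightarrow> A \<in> Ob C \<Longrightarrow> \<delta> \<in> carrier (Ext E Z A) \<Longrightarrow> s' Z A \<delta> = s Z A \<delta>"
  shows "EA2 C E n s'"
proof -
  interpret biadditive_functor C E by fact
  have r: "realises C n s' Z A \<delta> X \<longleftrightarrow> realises C n s Z A \<delta> X" if "Z \<in> Ob C" "A \<in> Ob C" "\<delta> \<in> carrier (Ext E Z A)" for Z A \<delta> X
    using assms(3)[OF that] unfolding realises_def by simp
  show ?thesis unfolding EA2_def
  proof (intro allI impI, elim conjE)
    fix A B D c \<delta> X Y
    assume a: "A \<in> Ob C" "c \<in> Mor C B D" "\<delta> \<in> carrier (Ext E D A)" "realises C n s' B A (pull C E A c \<delta>) Y" "realises C n s' D A \<delta> X"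
    have ob: "B \<in> Ob C" "D \<in> Ob C" using mor_ob[OF a(2)] by auto
    have p: "pull C E A c \<delta> \<in> carrier (Ext E B A)" using act_closed[OF a(2) idt_mor[OF a(1)] a(3)] by (simp add: pull_def)
    obtain f M where fM: "chain_map C n Y X f \<and> f 0 = Idt C A \<and> f (n + 1) = c \<and> mapping_cone C n Y X f M \<and>
       realises C n s D (cob Y 1) (push C E D (cdf Y 0) \<delta>) M"
      using assms(2)[unfolded EA2_def, rule_format, of A c B D \<delta> Y X] a p ob r by blast
    have Y: "Y \<in> Ch C n" "cob Y 0 = A" using realises_Ch[OF a(4)] by auto
    have "cob Y 1 \<in> Ob C" "cdf Y 0 \<in> Mor C A (cob Y 1)" using Ch_simps[OF Y(1)] Ch_simps(1)[OF Y(1), of "Suc 0"] Y(2) realises_Ch[OF fM[THEN conjunct2,THEN conjunct2,THEN conjunct2,THEN conjunct2]]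
      by (auto simp: in_Mor_iff Ch_def)
    moreover have "push C E D (cdf Y 0) \<delta> \<in> carrier (Ext E D (cob Y 1))" using act_closed[OF idt_mor[OF ob(2)] calculation(2) a(3)] by (simp add: push_def)
    ultimately show "\<exists>f M. chain_map C n Y X f \<and> f 0 = Idt C A \<and> f (n + 1) = c \<and> mapping_cone C n Y X f M \<and>
       realises C n s' D (cob Y 1) (push C E D (cdf Y 0) \<delta>) M" using fM r ob by blast
  qed
qed

lemma n_exangulated_category_op:
  assumes "n_exangulated_category C E n s" and n: "1 \<le> n"
  shows "n_exangulated_category (op_cat C) (op_bifunctor E) n (op_realisation n s)"
proof -
  interpret n_exangulated_category C E n s by fact
  have ex: "exact_realisation C E n s" by unfold_locales
  have "op_realisation n (op_realisation n s) Z A \<delta> = s Z A \<delta>" if "Z \<in> Ob C" "A \<in> Ob C" "\<delta> \<in> carrier (Ext E Z A)" for Z A \<delta>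
  proof -
    have "op_cpx n (op_cpx n X) \<in> s Z A \<delta> \<longleftrightarrow> X \<in> s Z A \<delta>" for X
      using realises_agree[OF n that, of "op_cpx n (op_cpx n X)" X] realises_agree[OF n that, of X "op_cpx n (op_cpx n X)"]
        agree_op_op[of n X] agree_sym[OF agree_op_op[of n X]] realises_iff[OF n that] by blast
    then show ?thesis unfolding op_realisation_def by auto
  qed
  then have "EA2 C E n (op_realisation n (op_realisation n s))" by (intro EA2_cong[OF _ EA2]) unfold_locales
  then show ?thesis
    by (intro n_exangulated_category.intro n_exangulated_category_axioms.intro exact_realisation_op[OF ex n])
     (auto simp: inflation_op[OF ex n] EA2_op intro: EA1_inflation EA1_deflation)
qed

section \<open>Realising direct summands\<close>

definition compl :: "('o, 'm) cat \<Rightarrow> 'o set \<Rightarrow> 'o \<Rightarrow> 'o \<Rightarrow> 'o \<Rightarrow> 'm \<Rightarrow> 'm \<Rightarrow> 'm \<Rightarrow> 'm \<Rightarrow> bool" where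
  "compl C S A A' T i j p q \<longleftrightarrow> biproduct C A A' T i j p q \<and> A' \<in> S \<and> T \<in> S"

text \<open>The complements are quantified existentially: \<open>rd_lift\<close> compares complexes
  built with different complements, so no choice has to be fixed. The extension
  \<open>Act E p' i \<delta>\<close> is \<delta> extended by zero to the larger ends TZ and
  TA.\<close>

definition summand_realises :: "('o, 'm) cat \<Rightarrow> ('o, 'm, 'x) bifunctor \<Rightarrow> nat \<Rightarrow> 'o set \<Rightarrow> ('o \<Rightarrow> 'o \<Rightarrow> 'x \<Rightarrow> ('o, 'm) cpx \<Rightarrow> bool) \<Rightarrow>
    'o \<Rightarrow> 'o \<Rightarrow> 'x \<Rightarrow> ('o, 'm) cpx \<Rightarrow> bool" where
  "summand_realises C E n S R Z A \<delta> X \<longleftrightarrow> exangle C E n X \<delta> \<and> cob X 0 = A \<and> cob X (Suc n) = Z \<and>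
     (\<exists>A' TA i j p q Z' TZ i' j' p' q' Y \<iota> \<pi>. compl C S A A' TA i j p q \<and> compl C S Z Z' TZ i' j' p' q' \<and>
        R TZ TA (Act E p' i \<delta>) Y \<and> chain_map C n X Y \<iota> \<and> \<iota> 0 = i \<and> \<iota> (Suc n) = i' \<and>
        chain_map C n Y X \<pi> \<and> \<pi> 0 = p \<and> \<pi> (Suc n) = p')"

lemma complD: "compl C S A A' T i j p q \<Longrightarrow> biproduct C A A' T i j p q" "compl C S A A' T i j p q \<Longrightarrow> A' \<in> S" "compl C S A A' T i j p q \<Longrightarrow> T \<in> S"
  by (simp_all add: compl_def)

text \<open>\<open>S\<close> is a class of objects of which all objects are summands, and \<open>R\<close> realises extensions between
  objects of \<open>S\<close>. Used for the objects \<open>(X, id)\<close> of the weak idempotent completion, and for its opposite.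
  The closure of deflations is left out: it is the dual of \<open>R_comp\<close>, and \<open>R_push\<close> is what is needed of the dual of (EA2).\<close>

locale dense_realisation = biadditive_functor C E for C :: "('o, 'm) cat" (structure) and E :: "('o, 'm, 'x) bifunctor" +
  fixes n :: nat and S :: "'o set" and R :: "'o \<Rightarrow> 'o \<Rightarrow> 'x \<Rightarrow> ('o, 'm) cpx \<Rightarrow> bool"
  assumes n_pos: "1 \<le> n"
    and S_Ob: "S \<subseteq> Ob C"
    and S_zero: "\<exists>Z \<in> S. zero_object C Z"
    and S_biproduct: "A \<in> S \<Longrightarrow> B \<in> S \<Longrightarrow> \<exists>P \<in> S. \<exists>i j p q. biproduct C A B P i j p q"
    and S_compl: "A \<in> Ob C \<Longrightarrow> \<exists>A' T i j p q. compl C S A A' T i j p q"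
    and S_split: "P \<in> S \<Longrightarrow> B \<in> S \<Longrightarrow> s \<in> Mor C B P \<Longrightarrow> r \<in> Mor C P B \<Longrightarrow> r \<cdot> s = Idt C B \<Longrightarrow>
      \<exists>K i p. biproduct C K B P i s p r"
    and R_dom: "R Z A \<delta> X \<Longrightarrow> Z \<in> S \<and> A \<in> S \<and> \<delta> \<in> carrier (Ext E Z A)"
    and R_cpx: "R Z A \<delta> X \<Longrightarrow> X \<in> Ch C n \<and> cob X 0 = A \<and> cob X (Suc n) = Z \<and> (\<forall>i \<le> Suc n. cob X i \<in> S)"
    and R_exangle: "R Z A \<delta> X \<Longrightarrow> exangle C E n X \<delta>"
    and R_ex: "Z \<in> S \<Longrightarrow> A \<in> S \<Longrightarrow> \<delta> \<in> carrier (Ext E Z A) \<Longrightarrow> \<exists>X. R Z A \<delta> X"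
    and R_lift: "R Z A \<delta> X \<Longrightarrow> R W B \<rho> Y \<Longrightarrow> a \<in> Mor C A B \<Longrightarrow> c \<in> Mor C Z W \<Longrightarrow>
      Act E (Idt C Z) a \<delta> = Act E c (Idt C B) \<rho> \<Longrightarrow> \<exists>f. chain_map C n X Y f \<and> f 0 = a \<and> f (Suc n) = c"
    and R_comp: "R Z A \<delta> X \<Longrightarrow> R W (cob X 1) \<rho> Y \<Longrightarrow>
      \<exists>V \<sigma> U. R V A \<sigma> U \<and> cob U 1 = cob Y 1 \<and> cdf U 0 = cdf Y 0 \<cdot> cdf X 0"
    and R_push: "R Z A \<delta> X \<Longrightarrow> a \<in> Mor C A B \<Longrightarrow> B \<in> S \<Longrightarrow>
      \<exists>Q i j p q V \<sigma> U. Q \<in> S \<and> biproduct C (cob X 1) B Q i j p q \<and> R V A \<sigma> U \<and> cob U 1 = Q \<and>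
        cdf U 0 = (i \<cdot> cdf X 0) \<boxplus> (j \<cdot> a)"
    and R_EA2: "A \<in> S \<Longrightarrow> c \<in> Mor C B D \<Longrightarrow> R B A (Act E c (Idt C A) \<delta>) Y \<Longrightarrow> R D A \<delta> X \<Longrightarrow>
      \<exists>f M. chain_map C n Y X f \<and> f 0 = Idt C A \<and> f (Suc n) = c \<and> mapping_cone C n Y X f M \<and>
        R D (cob Y 1) (Act E (Idt C D) (cdf Y 0) \<delta>) M"
begin

abbreviation "rd \<equiv> summand_realises C E n S R"

lemma S_ob: "A \<in> S \<Longrightarrow> A \<in> Ob C" using S_Ob by blast

text \<open>\<open>S_split\<close> covers only retractions between objects of S. So r is extended by
  identities: with T a sum of A and A', and U a sum of B and B', it becomes a retraction from P, a
  sum of A, A' and B', onto L, a sum of B, B' and A'. A complement of L in P is also one of B in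
  A.\<close>

lemma ex_complement:
  assumes r: "r \<in> Mor C A B" and s: "s \<in> Mor C B A" and rs: "r \<cdot> s = Idt C B"
  shows "\<exists>Y i p. biproduct C Y B A i s p r"
proof -
  have ob: "A \<in> Ob C" "B \<in> Ob C" using mor_ob[OF r] by auto
  obtain A' T i j p q where c: "compl C S A A' T i j p q" using S_compl[OF ob(1)] by blast
  obtain B' U i' j' p' q' where c': "compl C S B B' U i' j' p' q'" using S_compl[OF ob(2)] by blast
  obtain P m1 m2 q1 q2 where P: "P \<in> S" "biproduct C T B' P m1 m2 q1 q2" using S_biproduct[of T B'] complD[OF c] complD[OF c'] by blast
  obtain L l1 l2 t1 t2 where L: "L \<in> S" "biproduct C U A' L l1 l2 t1 t2" using S_biproduct[of U A'] complD[OF c] complD[OF c'] by blast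
  note b = biproductD[OF complD(1)[OF c]] biproductD[OF complD(1)[OF c']] biproductD[OF P(2)] biproductD[OF L(2)]
  note t = b(1-4,10-16,22-28,34-40,46-48)[unfolded in_Mor_iff] r[unfolded in_Mor_iff] s[unfolded in_Mor_iff]
  note B1 = biproductD(5-8)[OF complD(1)[OF c]] and B2 = biproductD(5-8)[OF complD(1)[OF c']] and B3 = biproductD(5-8)[OF P(2)] and B4 = biproductD(5-8)[OF L(2)]
  note e = B1 B1[THEN eqR] B2 B2[THEN eqR] B3 B3[THEN eqR] B4 B4[THEN eqR] rs rs[THEN eqR]
  \<comment> \<open>\<open>\<sigma>\<close> and \<open>\<rho>\<close> are s and r extended by the
    identities of A' and B', written in the coordinates of L and P.\<close>
  define \<sigma> where "\<sigma> = (m1 \<cdot> (i \<cdot> (s \<cdot> (p' \<cdot> t1))) \<boxplus> m2 \<cdot> (q' \<cdot> t1)) \<boxplus> m1 \<cdot> (j \<cdot> t2)"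
  define \<rho> where "\<rho> = l1 \<cdot> (i' \<cdot> (r \<cdot> (p \<cdot> q1)) \<boxplus> j' \<cdot> q2) \<boxplus> l2 \<cdot> (q \<cdot> q1)"
  have st: "mor C \<sigma>" "dm C \<sigma> = L" "cd C \<sigma> = P" "mor C \<rho>" "dm C \<rho> = P" "cd C \<rho> = L"
    unfolding \<sigma>_def \<rho>_def using t by (simp_all add: add_simps)
  have f1: "(i' \<cdot> p') \<boxplus> (j' \<cdot> q') = Idt C U" "(l1 \<cdot> t1) \<boxplus> (l2 \<cdot> t2) = Idt C L" "(i \<cdot> p) \<boxplus> (j \<cdot> q) = Idt C T" "(m1 \<cdot> q1) \<boxplus> (m2 \<cdot> q2) = Idt C P"
    using biproductD(9)[OF complD(1)[OF c']] biproductD(9)[OF L(2)] biproductD(9)[OF complD(1)[OF c]] biproductD(9)[OF P(2)] by auto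
  have "\<rho> \<cdot> \<sigma> = l1 \<cdot> (((i' \<cdot> p') \<boxplus> (j' \<cdot> q')) \<cdot> t1) \<boxplus> l2 \<cdot> t2"
    unfolding \<rho>_def \<sigma>_def using t by (simp add: add_simps e add_ac)
  also have "\<dots> = Idt C L" using f1 t by (simp add: cat_simps)
  finally have rho_sig: "\<rho> \<cdot> \<sigma> = Idt C L" .
  obtain Y k k' where Y: "biproduct C Y L P k \<sigma> k' \<rho>"
    using S_split[OF P(1) L(1) _ _ rho_sig] st by (auto simp: in_Mor_iff)
  note y = biproductD[OF Y] note ty = y(1-4)[unfolded in_Mor_iff] y(10-12)
  note ey = y(5-8) y(5-8)[THEN eqR]
  have p1: "p' \<cdot> (t1 \<cdot> \<rho>) = r \<cdot> (p \<cdot> q1)" "q' \<cdot> (t1 \<cdot> \<rho>) = q2"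
    unfolding \<rho>_def using t by (simp_all add: add_simps e)
  have p2: "\<sigma> \<cdot> (l1 \<cdot> i') = m1 \<cdot> (i \<cdot> s)" "\<sigma> \<cdot> l2 = m1 \<cdot> j"
    unfolding \<sigma>_def using t by (simp_all add: add_simps e)
  let ?i = "p \<cdot> (q1 \<cdot> k)" and ?p = "k' \<cdot> (m1 \<cdot> i)"
  \<comment> \<open>The inclusion k of the complement is killed by \<open>\<rho>\<close>, hence has
    no component in B'. The corresponding fact about A' is used for the projection k' (see
    \<open>kj\<close>). So Y sits in P inside A.\<close>
  have q2k: "q2 \<cdot> k = Zer C Y B'"
  proof -
    have "q2 \<cdot> k = (q' \<cdot> (t1 \<cdot> \<rho>)) \<cdot> k" using p1 by simp
    also have "\<dots> = q' \<cdot> (t1 \<cdot> (\<rho> \<cdot> k))" using t ty by (simp add: cat_simps)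
    finally show ?thesis using t ty by (simp add: ey add_simps)
  qed
  have ri: "r \<cdot> ?i = Zer C Y B"
  proof -
    have "r \<cdot> ?i = (p' \<cdot> (t1 \<cdot> \<rho>)) \<cdot> k" unfolding p1 using t ty by (simp add: cat_simps)
    also have "\<dots> = p' \<cdot> (t1 \<cdot> (\<rho> \<cdot> k))" using t ty by (simp add: cat_simps)
    finally show ?thesis using t ty by (simp add: ey add_simps)
  qed
  have ps: "?p \<cdot> s = Zer C B Y"
  proof -
    have "?p \<cdot> s = k' \<cdot> (\<sigma> \<cdot> (l1 \<cdot> i'))" unfolding p2 using t ty by (simp add: cat_simps)
    then show ?thesis using t ty by (simp add: ey add_simps)
  qed
  have kj: "k' \<cdot> (m1 \<cdot> j) = Zer C A' Y" unfolding p2(2)[symmetric] using t ty by (simp add: ey add_simps)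
  have pi: "?p \<cdot> ?i = Idt C Y"
  proof -
    have "Idt C Y = k' \<cdot> (((m1 \<cdot> q1) \<boxplus> (m2 \<cdot> q2)) \<cdot> k)" using f1 t ty by (simp add: ey cat_simps)
    also have "\<dots> = k' \<cdot> (m1 \<cdot> (((i \<cdot> p) \<boxplus> (j \<cdot> q)) \<cdot> (q1 \<cdot> k)))"
      unfolding f1(3) using t ty by (simp add: add_simps q2k)
    also have "\<dots> = ?p \<cdot> ?i \<boxplus> (k' \<cdot> (m1 \<cdot> j)) \<cdot> (q \<cdot> (q1 \<cdot> k))" using t ty by (simp add: add_simps)
    finally show ?thesis unfolding kj using t ty by (simp add: add_simps)
  qed
  have ip: "(?i \<cdot> ?p) \<boxplus> (s \<cdot> r) = Idt C A"
  proof -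
    have "Idt C A = p \<cdot> (q1 \<cdot> (((k \<cdot> k') \<boxplus> (\<sigma> \<cdot> \<rho>)) \<cdot> (m1 \<cdot> i)))" unfolding y(9) using t by (simp add: cat_simps e)
    also have "\<dots> = (?i \<cdot> ?p) \<boxplus> p \<cdot> (q1 \<cdot> (\<sigma> \<cdot> (\<rho> \<cdot> (m1 \<cdot> i))))" using t ty st by (simp add: add_simps)
    also have "p \<cdot> (q1 \<cdot> (\<sigma> \<cdot> (\<rho> \<cdot> (m1 \<cdot> i)))) = s \<cdot> r" unfolding \<sigma>_def \<rho>_def using t by (simp add: add_simps e)
    finally show ?thesis by simp
  qed
  have "biproduct C Y B A ?i s ?p r"
    unfolding biproduct_def using t ty ri ps pi ip rs by (simp add: cat_simps)
  then show ?thesis by blast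
qed

lemma R_D:
  assumes "R Z A \<delta> X"
  shows "Z \<in> S" "A \<in> S" "\<delta> \<in> carrier (Ext E Z A)" "X \<in> Ch C n" "cob X 0 = A" "cob X (Suc n) = Z" "exangle C E n X \<delta>"
    "i \<le> Suc n \<Longrightarrow> cob X i \<in> S"
  using R_dom[OF assms] R_cpx[OF assms] R_exangle[OF assms] by blast+

lemma rd_D:
  assumes "rd Z A \<delta> X"
  shows "X \<in> Ch C n" "cob X 0 = A" "cob X (Suc n) = Z" "exangle C E n X \<delta>" "\<delta> \<in> carrier (Ext E Z A)" "Z \<in> Ob C" "A \<in> Ob C"
    "cexact C n X" "dexact C n X"
proof -
  show *: "cob X 0 = A" "cob X (Suc n) = Z" "exangle C E n X \<delta>" using assms unfolding summand_realises_def by blast+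
  show "X \<in> Ch C n" "\<delta> \<in> carrier (Ext E Z A)" "cexact C n X" "dexact C n X" using exangleD[OF *(3)] * by auto
  then show "Z \<in> Ob C" "A \<in> Ob C" using Ch_simps(1)[of X n 0] Ch_simps(1)[of X n "Suc n"] * by auto
qed

lemma rd_obtain:
  assumes "rd Z A \<delta> X"
  obtains A' TA i j p q Z' TZ i' j' p' q' Y \<iota> \<pi> where "compl C S A A' TA i j p q" "compl C S Z Z' TZ i' j' p' q'"
        "R TZ TA (Act E p' i \<delta>) Y" "chain_map C n X Y \<iota>" "\<iota> 0 = i" "\<iota> (Suc n) = i'"
        "chain_map C n Y X \<pi>" "\<pi> 0 = p" "\<pi> (Suc n) = p'"
  using assms unfolding summand_realises_def by blast

lemma rd_I:
  assumes "exangle C E n X \<delta>" "cob X 0 = A" "cob X (Suc n) = Z" "compl C S A A' TA i j p q" "compl C S Z Z' TZ i' j' p' q'"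
        "R TZ TA (Act E p' i \<delta>) Y" "chain_map C n X Y \<iota>" "\<iota> 0 = i" "\<iota> (Suc n) = i'"
        "chain_map C n Y X \<pi>" "\<pi> 0 = p" "\<pi> (Suc n) = p'"
  shows "rd Z A \<delta> X"
  unfolding summand_realises_def using assms by blast

text \<open>Composing a and c with projections and inclusions turns them into a morphism between the
  extensions over S, which lifts by \<open>R_lift\<close>. The lift is cut back by \<iota> on one
  side and \<rho>' on the other; the prescribed ends reappear because each projection is a left
  inverse of its inclusion.\<close>

lemma rd_lift:
  assumes X: "rd Z A \<delta> X" and Y: "rd W B \<rho> Y" and a: "a \<in> Mor C A B" and c: "c \<in> Mor C Z W"
    and e: "Act E (Idt C Z) a \<delta> = Act E c (Idt C B) \<rho>"
  shows "\<exists>f. chain_map C n X Y f \<and> f 0 = a \<and> f (Suc n) = c"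
proof -
  note dX = rd_D[OF X] and dY = rd_D[OF Y]
  obtain A' TA i j p q Z' TZ i' j' p' q' X0 \<iota> \<pi> where 1: "compl C S A A' TA i j p q" "compl C S Z Z' TZ i' j' p' q'"
        "R TZ TA (Act E p' i \<delta>) X0" "chain_map C n X X0 \<iota>" "\<iota> 0 = i" "\<iota> (Suc n) = i'"
        "chain_map C n X0 X \<pi>" "\<pi> 0 = p" "\<pi> (Suc n) = p'" using rd_obtain[OF X] by metis
  obtain B' TB k l r s W' TW k' l' r' s' Y0 \<kappa> \<rho>' where 2: "compl C S B B' TB k l r s" "compl C S W W' TW k' l' r' s'"
        "R TW TB (Act E r' k \<rho>) Y0" "chain_map C n Y Y0 \<kappa>" "\<kappa> 0 = k" "\<kappa> (Suc n) = k'"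
        "chain_map C n Y0 Y \<rho>'" "\<rho>' 0 = r" "\<rho>' (Suc n) = r'" using rd_obtain[OF Y] by metis
  note b = biproductD[OF complD(1)[OF 1(1)]] biproductD[OF complD(1)[OF 1(2)]] biproductD[OF complD(1)[OF 2(1)]] biproductD[OF complD(1)[OF 2(2)]]
  note t = b[unfolded in_Mor_iff] a[unfolded in_Mor_iff] c[unfolded in_Mor_iff]
  note E1 = biproductD(5)[OF complD(1)[OF 1(1)]] biproductD(5)[OF complD(1)[OF 1(2)]] biproductD(5)[OF complD(1)[OF 2(1)]] biproductD(5)[OF complD(1)[OF 2(2)]]
  note ee = E1 E1[THEN eqR]
  have AA: "Act E c' a' (Act E c a \<delta>) = Act E (c \<cdot> c') (a' \<cdot> a) \<delta>" if "mor C c" "cd C c = Z" "mor C a" "dm C a = A" "mor C c'" "cd C c' = dm C c" "mor C a'" "dm C a' = cd C a" for c a c' a'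
    by (rule act_act[of _ "dm C c'" "dm C c" _ Z _ A "cd C a" _ "cd C a'"]) (use dX that in \<open>simp_all add: cat_simps\<close>)
  have AB: "Act E c' a' (Act E c a \<rho>) = Act E (c \<cdot> c') (a' \<cdot> a) \<rho>" if "mor C c" "cd C c = W" "mor C a" "dm C a = B" "mor C c'" "cd C c' = dm C c" "mor C a'" "dm C a' = cd C a" for c a c' a'
    by (rule act_act[of _ "dm C c'" "dm C c" _ W _ B "cd C a" _ "cd C a'"]) (use dY that in \<open>simp_all add: cat_simps\<close>)
  have "Act E (Idt C TZ) (k \<cdot> (a \<cdot> p)) (Act E p' i \<delta>) = Act E p' k (Act E (Idt C Z) a \<delta>)"
    using t by (simp add: AA cat_simps ee)
  also have "\<dots> = Act E (k' \<cdot> (c \<cdot> p')) (Idt C TB) (Act E r' k \<rho>)"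
    unfolding e using t dY dX by (simp add: AB cat_simps ee)
  finally obtain f where f: "chain_map C n X0 Y0 f" "f 0 = k \<cdot> (a \<cdot> p)" "f (Suc n) = k' \<cdot> (c \<cdot> p')"
    using R_lift[OF 1(3) 2(3), of "k \<cdot> (a \<cdot> p)" "k' \<cdot> (c \<cdot> p')"] t by (auto simp: cat_simps)
  have "chain_map C n X Y (\<lambda>i. \<rho>' i \<cdot> (f i \<cdot> \<iota> i))"
    using chain_map_comp[OF _ _ _ chain_map_comp[OF _ _ _ 1(4) f(1)] 2(7)] dX(1) dY(1) R_D(4)[OF 1(3)] R_D(4)[OF 2(3)] by blast
  moreover have "\<rho>' 0 \<cdot> (f 0 \<cdot> \<iota> 0) = a" "\<rho>' (Suc n) \<cdot> (f (Suc n) \<cdot> \<iota> (Suc n)) = c"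
    unfolding f 1 2 using t by (simp_all add: cat_simps ee)
  ultimately show ?thesis by blast
qed

lemma rd_lift_id:
  assumes "rd Z A \<delta> X" "rd Z A \<delta> Y" shows "\<exists>f. chain_map_ends C n X Y f"
  using rd_lift[OF assms, of "Idt C A" "Idt C Z"] rd_D[OF assms(1)] unfolding chain_map_ends_def by (auto simp: idt_mor)

text \<open>Summand realisations of one extension lift to each other over the identities, hence lie
  in one class. Conversely the defining chain maps may be composed with an isomorphism of the
  homotopy category, whose ends are identities.\<close>

lemma rd_kclass:
  assumes X: "rd Z A \<delta> X"
  shows "Y \<in> kclass C n X \<longleftrightarrow> rd Z A \<delta> Y"
proof
  note x = rd_D[OF X]
  assume "Y \<in> kclass C n X"
  then obtain f g where Y: "Y \<in> Ch C n" "cob Y 0 = A" "cob Y (Suc n) = Z" "chain_map_ends C n X Y f" "chain_map_ends C n Y X g"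
    "homotopic C n Y Y (\<lambda>i. f i \<cdot> g i) (\<lambda>i. Idt C (cob Y i))"
    using x unfolding kclass_def K_iso_def Ch_ends_def by auto
  have ends: "f 0 = Idt C A" "f (Suc n) = Idt C Z" "g 0 = Idt C A" "g (Suc n) = Idt C Z"
    using Y x chain_map_endsD by metis+
  have ex: "exangle C E n Y \<delta>"
    by (rule exangle_retract[OF x(4) Y(1) _ chain_map_endsD(1)[OF Y(5)] chain_map_endsD(1)[OF Y(4)] Y(6)])
     (use Y x ends in \<open>simp_all add: act_idt cat_simps\<close>)
  obtain A' TA i j p q Z' TZ i' j' p' q' X0 \<iota> \<pi> where 1: "compl C S A A' TA i j p q" "compl C S Z Z' TZ i' j' p' q'"
        "R TZ TA (Act E p' i \<delta>) X0" "chain_map C n X X0 \<iota>" "\<iota> 0 = i" "\<iota> (Suc n) = i'"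
        "chain_map C n X0 X \<pi>" "\<pi> 0 = p" "\<pi> (Suc n) = p'" using rd_obtain[OF X] by metis
  note b = biproductD[OF complD(1)[OF 1(1)]] biproductD[OF complD(1)[OF 1(2)]]
  show "rd Z A \<delta> Y"
    by (rule rd_I[OF ex Y(2,3) 1(1-3) chain_map_comp[OF Y(1) x(1) R_D(4)[OF 1(3)] chain_map_endsD(1)[OF Y(5)] 1(4)] _ _ chain_map_comp[OF R_D(4)[OF 1(3)] x(1) Y(1) 1(7) chain_map_endsD(1)[OF Y(4)]]])
      (use ends b in \<open>auto simp: 1 cat_simps\<close>)
next
  assume Y: "rd Z A \<delta> Y"
  then show "Y \<in> kclass C n X"
    unfolding kclass_iff[OF rd_D(1,8)[OF X] n_pos] using rd_D[OF Y] rd_lift_id[OF X Y] rd_lift_id[OF Y X] by blast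
qed

text \<open>The complement A' is stripped off in the degrees 0 and 1, then Z' in the degrees n and n
  + 1. At the left the given w is a retraction for A'; at the right A' is replaced by Z' and the
  retraction by a lift of its inclusion. The outer components of the combined homotopy are part of
  the conclusion for the sake of the cone argument.\<close>

lemma ex_standard_summand:
  assumes \<delta>: "\<delta> \<in> carrier (Ext E Z A)" and cA: "compl C S A A' TA i j p q" and cZ: "compl C S Z Z' TZ i' j' p' q'"
    and X: "R TZ TA (Act E p' i \<delta>) X" and w: "w \<in> Mor C (cob X (Suc 0)) A'" "w \<cdot> cdf X 0 = q"
  obtains Y \<iota> \<pi> h v where "sdr C n X Y \<iota> \<pi> h" "rd Z A \<delta> Y" "\<iota> 0 = i" "\<pi> 0 = p" "\<iota> (Suc n) = i'" "\<pi> (Suc n) = p'"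
    "w \<cdot> \<iota> (Suc 0) = Zer C (cob Y (Suc 0)) A'" "h (Suc 0) = j \<cdot> w" "v \<in> Mor C Z' (cob X n)" "h (Suc n) = v \<cdot> q'"
proof -
  note x = R_D[OF X] note ex = exangleD[OF x(7)]
  note bA = biproductD[OF complD(1)[OF cA]] and bZ = biproductD[OF complD(1)[OF cZ]]
  note t = bA[unfolded in_Mor_iff] bZ[unfolded in_Mor_iff] w(1)[unfolded in_Mor_iff] Ch_simps[OF x(4)]
  \<comment> \<open>So \<open>cdf X 0 \<cdot> j\<close> embeds A' as a summand of degree 1, and A1
    is a complement of it.\<close>
  have wd: "w \<cdot> (cdf X 0 \<cdot> j) = Idt C A'" using eqR[OF w(2), of j] t x bA(6) by (simp add: cat_simps)
  obtain A1 i1 p1 where b1: "biproduct C A1 A' (cob X (Suc 0)) i1 (cdf X 0 \<cdot> j) p1 w"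
    using ex_complement[OF w(1) _ wd] t x by (auto simp: cat_simps)
  have b0: "biproduct C A A' (cob X 0) i j p q" using complD(1)[OF cA] x by simp
  obtain Y1 \<iota>1 \<pi>1 h1 where s1: "sdr C n X Y1 \<iota>1 \<pi>1 h1" "cob Y1 0 = A" "cob Y1 (Suc 0) = A1" "\<iota>1 0 = i" "\<pi>1 0 = p"
    "\<iota>1 (Suc 0) = i1" "\<pi>1 (Suc 0) = p1" "h1 (Suc 0) = j \<cdot> w"
    "\<And>k. k \<noteq> 0 \<Longrightarrow> k \<noteq> Suc 0 \<Longrightarrow> cob Y1 k = cob X k"
    "\<And>k. k \<noteq> 0 \<Longrightarrow> k \<noteq> Suc 0 \<Longrightarrow> \<iota>1 k = Idt C (cob X k)"
    "\<And>k. k \<noteq> 0 \<Longrightarrow> k \<noteq> Suc 0 \<Longrightarrow> \<pi>1 k = Idt C (cob X k)"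
    "\<And>k. k \<noteq> Suc 0 \<Longrightarrow> h1 k = Zer C (cob X k) (cob X (k - 1))"
    using strip[OF x(4) n_pos le0 b0 b1 refl w(2)] by blast
  have n1: "Suc n \<noteq> Suc 0" "n \<noteq> 0" using n_pos by auto
  have last: "cob Y1 (Suc n) = TZ" "\<iota>1 (Suc n) = Idt C TZ" "\<pi>1 (Suc n) = Idt C TZ" using s1(9-11)[of "Suc n"] n1 x(6) by auto
  note d1 = sdrD[OF s1(1)]
  note t1 = Ch_simps[OF d1(2)] chain_map_simps(1-3)[OF d1(2,1,3)] chain_map_simps(1-3)[OF d1(1,2,4)]
  \<comment> \<open>Pulling the extension back along the inclusion of Z' gives zero, since p'
    vanishes on Z'. By exactness at the end, that inclusion lifts through the last
    differential.\<close>
  have "Act E j' (Idt C TA) (Act E p' i \<delta>) = Act E (p' \<cdot> j') (Idt C TA \<cdot> i) \<delta>"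
    by (rule act_act) (use bA bZ \<delta> idt_mor in auto)
  also have "\<dots> = \<one>\<^bsub>Ext E Z' TA\<^esub>" unfolding bZ(7) using bA(1) by (simp add: idt_cmp) (rule act_zero_left[OF bZ(11,10) bA(1) \<delta>])
  finally obtain v0 where v0: "v0 \<in> Mor C Z' (cob X n)" "j' = cdf X n \<cdot> v0" using ex(7)[of j' Z'] bZ x by auto
  \<comment> \<open>If n = 1, degree n has been altered by the first stripping; composing with
    \<open>\<pi>1\<close> moves the lift to the new complex in every case.\<close>
  define v1 where "v1 = \<pi>1 n \<cdot> v0"
  have v1: "v1 \<in> Mor C Z' (cob Y1 n)" unfolding v1_def using v0(1) t1 by (simp add: cat_simps)
  have "cdf Y1 n \<cdot> v1 = \<pi>1 (Suc n) \<cdot> (cdf X n \<cdot> v0)"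
    unfolding v1_def using chain_map_simps(5)[OF d1(1,2,4), of n v0] v0(1) by (simp add: cat_simps)
  then have dv: "cdf Y1 n \<cdot> v1 = j'" unfolding last v0(2)[symmetric] using bZ(2) by (simp add: cat_simps)
  have qd: "(q' \<cdot> cdf Y1 n) \<cdot> v1 = Idt C Z'" using dv v1 t1 t last bZ(6) by (simp add: cat_simps)
  obtain A2 i2 p2 where b2: "biproduct C A2 Z' (cob Y1 n) i2 v1 p2 (q' \<cdot> cdf Y1 n)"
    using ex_complement[OF _ v1 qd] t1 t last by (auto simp: cat_simps)
  have b3: "biproduct C Z Z' (cob Y1 (Suc n)) i' j' p' q'" using complD(1)[OF cZ] last by simp
  obtain Y \<iota>2 \<pi>2 h2 where s2: "sdr C n Y1 Y \<iota>2 \<pi>2 h2" "cob Y (Suc n) = Z"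
    "\<iota>2 (Suc n) = i'" "\<pi>2 (Suc n) = p'" "h2 (Suc n) = v1 \<cdot> q'"
    "\<And>k. k \<noteq> n \<Longrightarrow> k \<noteq> Suc n \<Longrightarrow> cob Y k = cob Y1 k"
    "\<And>k. k \<noteq> n \<Longrightarrow> k \<noteq> Suc n \<Longrightarrow> \<iota>2 k = Idt C (cob Y1 k)"
    "\<And>k. k \<noteq> n \<Longrightarrow> k \<noteq> Suc n \<Longrightarrow> \<pi>2 k = Idt C (cob Y1 k)"
    "\<And>k. k \<noteq> Suc n \<Longrightarrow> h2 k = Zer C (cob Y1 k) (cob Y1 (k - 1))"
    using strip[OF d1(2) n_pos order_refl b2 b3 dv refl] by blast
  note d2 = sdrD[OF s2(1)]
  note t2 = Ch_simps[OF d2(2)] chain_map_simps(1-3)[OF d2(2,1,3)] chain_map_simps(1-3)[OF d2(1,2,4)]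
  define \<iota> where "\<iota> = (\<lambda>i. \<iota>1 i \<cdot> \<iota>2 i)"
  define \<pi> where "\<pi> = (\<lambda>i. \<pi>2 i \<cdot> \<pi>1 i)"
  define h where "h = (\<lambda>i. h1 i \<boxplus> (\<iota>1 (i - 1) \<cdot> (h2 i \<cdot> \<pi>1 i)))"
  have s: "sdr C n X Y \<iota> \<pi> h" unfolding \<iota>_def \<pi>_def h_def by (rule sdr_comp[OF s1(1) s2(1)])
  have Y0: "cob Y 0 = A" using s2(6)[of 0] s1(2) n1 by simp
  have e: "\<iota> 0 = i" "\<pi> 0 = p" "\<iota> (Suc n) = i'" "\<pi> (Suc n) = p'"
    unfolding \<iota>_def \<pi>_def using s2(7,8)[of 0] s1(2,4,5) n1 s2(3,4) last bA bZ by (simp_all add: cat_simps)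
  note d = sdrD[OF s]
  have "exangle C E n Y \<delta>"
    by (rule exangle_retract[OF x(7) d(2) _ d(3,4)])
      (use d \<delta> s2(2) Y0 e bA bZ homotopic_eq[OF d(2,2) chain_map_id[OF d(2)]] in auto)
  then have rd: "rd Z A \<delta> Y" by (rule rd_I[OF _ Y0 s2(2) cA cZ X d(3) e(1,3) d(4) e(2,4)])
  have "w \<cdot> \<iota> (Suc 0) = (w \<cdot> i1) \<cdot> \<iota>2 (Suc 0)" unfolding \<iota>_def s1(6) using biproductD(1)[OF b1] w(1) t2 s1(3) by (simp add: cat_simps)
  also have "\<dots> = Zer C (cob Y (Suc 0)) A'" unfolding biproductD(8)[OF b1] using t2 s1(3) biproductD(10,11)[OF b1] by (simp add: zero_cmp)
  finally have wi: "w \<cdot> \<iota> (Suc 0) = Zer C (cob Y (Suc 0)) A'" .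
  have h0: "h (Suc 0) = j \<cdot> w" unfolding h_def using s1(2-4,7,8) s2(9)[of "Suc 0"] n1 t biproductD(3,10)[OF b1] x(5) by (simp add: add_simps)
  have hn: "h (Suc n) = (\<iota>1 n \<cdot> v1) \<cdot> q'" unfolding h_def using s1(12)[of "Suc n"] s2(5) n1 t t1 last v1 x by (simp add: add_simps)
  have "\<iota>1 n \<cdot> v1 \<in> Mor C Z' (cob X n)" using t1 v1 by (simp add: cat_simps)
  with that[OF s rd e wi h0 _ hn] show thesis by blast
qed

text \<open>The projection q kills i, hence also the extension obtained by pushing along i. By
  exactness q factors through the first differential, and the factor is the retraction that
  \<open>ex_standard_summand\<close> requires.\<close>

lemma ex_factor_inflation:
  assumes "\<delta> \<in> carrier (Ext E Z A)" "biproduct C A A' TA i j p q" "p' \<in> Mor C TZ Z" "R TZ TA (Act E p' i \<delta>) X"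
  shows "\<exists>w \<in> Mor C (cob X (Suc 0)) A'. w \<cdot> cdf X 0 = q"
proof -
  note b = biproductD[OF assms(2)] note x = R_D[OF assms(4)]
  have "Act E (Idt C TZ) q (Act E p' i \<delta>) = Act E (p' \<cdot> Idt C TZ) (q \<cdot> i) \<delta>"
    by (rule act_act) (use b assms x S_ob idt_mor in auto)
  also have "\<dots> = \<one>\<^bsub>Ext E TZ A'\<^esub>" unfolding b(8) using assms(3) by (simp add: cmp_idt) (rule act_zero_right[OF b(10,11) assms(3,1)])
  finally show ?thesis using exangleD(8)[OF x(7), of q A'] b x by metis
qed

lemma rd_ex:
  assumes \<delta>: "\<delta> \<in> carrier (Ext E Z A)" and "Z \<in> Ob C" "A \<in> Ob C"
  shows "\<exists>X. rd Z A \<delta> X"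
proof -
  obtain A' TA i j p q where cA: "compl C S A A' TA i j p q" using S_compl assms(3) by metis
  obtain Z' TZ i' j' p' q' where cZ: "compl C S Z Z' TZ i' j' p' q'" using S_compl assms(2) by metis
  note bA = biproductD[OF complD(1)[OF cA]] and bZ = biproductD[OF complD(1)[OF cZ]]
  obtain X where X: "R TZ TA (Act E p' i \<delta>) X" using R_ex[OF complD(3)[OF cZ] complD(3)[OF cA]] act_closed[OF bZ(3) bA(1) \<delta>] by blast
  obtain w where "w \<in> Mor C (cob X (Suc 0)) A'" "w \<cdot> cdf X 0 = q" using ex_factor_inflation[OF \<delta> complD(1)[OF cA] bZ(3) X] by blast
  then show ?thesis using ex_standard_summand[OF \<delta> cA cZ X] by metis
qed

text \<open>With a zero object as complement, an object of S is a summand of itself; this makes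
  \<open>R\<close> a special case of \<open>rd\<close>.\<close>

lemma compl_self: assumes "A \<in> S" obtains A' j q where "compl C S A A' A (Idt C A) j (Idt C A) q"
proof -
  obtain Z where Z: "Z \<in> S" "zero_object C Z" using S_zero by blast
  have A: "A \<in> Ob C" "Z \<in> Ob C" using assms S_ob Z by auto
  have "Zer C Z Z = Idt C Z" using Z(2) A Zer_mor idt_mor unfolding zero_object_def by blast
  then have "compl C S A Z A (Idt C A) (Zer C Z A) (Idt C A) (Zer C A Z)"
    unfolding compl_def biproduct_def using A Z assms by (simp add: add_simps)
  then show thesis by (rule that)
qed

lemma R_rd: assumes "R Z A \<delta> X" shows "rd Z A \<delta> X"
proof -
  note x = R_D[OF assms]
  obtain A' j q where A: "compl C S A A' A (Idt C A) j (Idt C A) q" using compl_self x by metis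
  obtain Z' j' q' where Z: "compl C S Z Z' Z (Idt C Z) j' (Idt C Z) q'" using compl_self x by metis
  show ?thesis
    by (rule rd_I[OF x(7,5,6) A Z _ chain_map_id[OF x(4)] _ _ chain_map_id[OF x(4)]])
      (use x assms S_ob in \<open>simp_all add: act_idt\<close>)
qed

end

section \<open>Composition of inflations\<close>

context additive_category begin

lemma biproduct_swap: "biproduct C A B P i j p q \<Longrightarrow> biproduct C B A P j i q p"
  using add_comm[of "i \<cdot> p" "j \<cdot> q"] unfolding biproduct_def by (auto simp: cat_simps)

lemma biproduct_assoc:
  assumes 1: "biproduct C A L Q m1 m2 n1 n2" and 2: "biproduct C B D L l1 l2 t1 t2" and 3: "biproduct C A B P u1 u2 v1 v2"
  shows "biproduct C P D Q (m1 \<cdot> v1 \<boxplus> m2 \<cdot> (l1 \<cdot> v2)) (m2 \<cdot> l2) (u1 \<cdot> n1 \<boxplus> u2 \<cdot> (t1 \<cdot> n2)) (t2 \<cdot> n2)"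
proof -
  note b = biproductD[OF 1] biproductD[OF 2] biproductD[OF 3]
  note t = biproductD(1-4,10-12)[OF 1, unfolded in_Mor_iff] biproductD(1-4,10-12)[OF 2, unfolded in_Mor_iff] biproductD(1-4,10-12)[OF 3, unfolded in_Mor_iff]
  note e = biproductD(5-8)[OF 1] biproductD(5-8)[OF 2] biproductD(5-8)[OF 3]
  note ee = e e[THEN eqR]
  have x: "(u1 \<cdot> n1 \<boxplus> u2 \<cdot> (t1 \<cdot> n2)) \<cdot> (m1 \<cdot> v1 \<boxplus> m2 \<cdot> (l1 \<cdot> v2)) = u1 \<cdot> v1 \<boxplus> u2 \<cdot> v2"
    using t by (simp add: add_simps ee)
  have "(m1 \<cdot> v1 \<boxplus> m2 \<cdot> (l1 \<cdot> v2)) \<cdot> (u1 \<cdot> n1 \<boxplus> u2 \<cdot> (t1 \<cdot> n2)) \<boxplus> (m2 \<cdot> l2) \<cdot> (t2 \<cdot> n2) = m1 \<cdot> n1 \<boxplus> m2 \<cdot> (((l1 \<cdot> t1) \<boxplus> (l2 \<cdot> t2)) \<cdot> n2)"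
    using t by (simp add: add_simps ee add_ac)
  also have "\<dots> = Idt C Q" unfolding biproductD(9)[OF 2] using biproductD(9)[OF 1] t by (simp add: cat_simps)
  finally show ?thesis unfolding biproduct_def x biproductD(9)[OF 3] using t by (simp add: add_simps ee)
qed

text \<open>Applies the elementary automorphism of A \<oplus> L given by c: the second inclusion is
  sheared by c, and the first projection is corrected to n1 - c n2.\<close>

lemma biproduct_shear:
  assumes 1: "biproduct C A L Q m1 m2 n1 n2" and c: "c \<in> Mor C L A"
  shows "\<exists>n1'. biproduct C A L Q m1 (m1 \<cdot> c \<boxplus> m2) n1' n2"
proof -
  note t = biproductD(1-4,10-12)[OF 1, unfolded in_Mor_iff] c[unfolded in_Mor_iff]
  note e = biproductD(5-8)[OF 1] note ee = e e[THEN eqR]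
  obtain n1' where n': "n1' \<in> Mor C Q A" "n1 = c \<cdot> n2 \<boxplus> n1'" using ex_diff[of n1 Q A "c \<cdot> n2"] t by (auto simp: cat_simps)
  note t' = n'(1)[unfolded in_Mor_iff] t
  have a: "n1' \<cdot> m1 = Idt C A" using e(1) unfolding n'(2) using t' by (simp add: add_simps ee)
  have b: "c \<boxplus> n1' \<cdot> m2 = Zer C L A" using e(3) unfolding n'(2) using t' by (simp add: add_simps ee)
  have "m1 \<cdot> n1' \<boxplus> (m1 \<cdot> c \<boxplus> m2) \<cdot> n2 = m1 \<cdot> n1 \<boxplus> m2 \<cdot> n2" unfolding n'(2) using t' by (simp add: add_simps add_ac)
  then have "biproduct C A L Q m1 (m1 \<cdot> c \<boxplus> m2) n1' n2"
    unfolding biproduct_def using biproductD(9)[OF 1] a b t' eqR[OF a, of c] by (simp add: add_simps ee)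
  then show ?thesis by blast
qed

text \<open>Subtracts from a the boundary of the homotopy whose only component is \<kappa>. Only the
  degrees 0 and 1 change, where a 1 becomes a 1 - d \<kappa>; degree n + 1 is at least 2 and stays
  as it was.\<close>

lemma chain_map_fix_start:
  assumes P: "P \<in> Ch C n" and Q: "Q \<in> Ch C n" and a: "chain_map C n P Q a" and n: "1 \<le> n" and k: "\<kappa> \<in> Mor C (cob P (Suc 0)) (cob P 0)"
    and e: "a 0 = Idt C (cob P 0) \<boxplus> \<kappa> \<cdot> cdf P 0" and T: "cob Q 0 = cob P 0"
  obtains b where "chain_map C n P Q b" "b 0 = Idt C (cob P 0)" "b (Suc n) = a (Suc n)"
proof -
  note t = Ch_simps[OF P] Ch_simps[OF Q] chain_map_simps(1-3)[OF P Q a] k[unfolded in_Mor_iff]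
  note c = chain_map_simps(4)[OF P Q a]
  obtain b1 where b1: "b1 \<in> Mor C (cob P (Suc 0)) (cob Q (Suc 0))" "a (Suc 0) = cdf Q 0 \<cdot> \<kappa> \<boxplus> b1"
    using ex_diff[of "a (Suc 0)" "cob P (Suc 0)" "cob Q (Suc 0)" "cdf Q 0 \<cdot> \<kappa>"] t T n by (auto simp: cat_simps)
  define b where "b i = (if i = 0 then Idt C (cob P 0) else if i = Suc 0 then b1 else a i)" for i
  have "b1 \<cdot> cdf P 0 \<boxplus> cdf Q 0 \<cdot> (\<kappa> \<cdot> cdf P 0) = cdf Q 0 \<boxplus> cdf Q 0 \<cdot> (\<kappa> \<cdot> cdf P 0)"
    using c[of 0] unfolding b1(2) e using t b1(1) T by (simp add: add_simps add_comm)
  then have 0: "b1 \<cdot> cdf P 0 = cdf Q 0"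
    using t b1(1) T by (rule_tac add_cancel[of _ _ "cdf Q 0 \<cdot> (\<kappa> \<cdot> cdf P 0)"]) (simp_all add: add_simps)
  have 1: "a (Suc (Suc 0)) \<cdot> cdf P (Suc 0) = cdf Q (Suc 0) \<cdot> b1" if "Suc 0 \<le> n"
    using c[of "Suc 0"] that t b1(1) T unfolding b1(2) by (simp add: add_simps)
  have "chain_map C n P Q b"
  proof (rule chain_mapI)
    fix i assume i: "i \<le> n"
    consider "i = 0" | "i = Suc 0" | "i \<ge> Suc (Suc 0)" by linarith
    then show "b (Suc i) \<cdot> cdf P i = cdf Q i \<cdot> b i"
      by cases (use i 0 1 c[of i] t T in \<open>auto simp: b_def cat_simps\<close>)
  qed (use t b1(1) T in \<open>auto simp: b_def cat_simps\<close>)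
  then show thesis using that n by (simp add: b_def)
qed

end

context dense_realisation begin

text \<open>A composition-friendly form of being an inflation: \<open>k\<close> becomes a left factor of an \<open>R\<close>-inflation \<open>d\<close>
  after enlarging its source to \<open>T \<cong> A \<oplus> A'\<close>. Conversely, with \<open>a = (k, 0; 0, 1) : T \<rightarrow> D \<oplus> A'\<close> the map
  \<open>(d, a)\<close> is an \<open>R\<close>-inflation, and splitting off \<open>A'\<close> and the other superfluous summands leaves \<open>k\<close>.\<close>

definition pre_infl where
  "pre_infl A B k \<longleftrightarrow> k \<in> Mor C A B \<and> (\<exists>A' T i j p q V \<sigma> U \<psi>. compl C S A A' T i j p q \<and> R V T \<sigma> U \<and>
     \<psi> \<in> Mor C B (cob U (Suc 0)) \<and> cdf U 0 \<cdot> i = \<psi> \<cdot> k)"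

lemma rd_pre_infl:
  assumes X: "rd Z A \<delta> X"
  shows "pre_infl A (cob X (Suc 0)) (cdf X 0)"
proof -
  note x = rd_D[OF X]
  obtain A' TA i j p q Z' TZ i' j' p' q' X0 \<iota> \<pi> where 1: "compl C S A A' TA i j p q" "compl C S Z Z' TZ i' j' p' q'"
        "R TZ TA (Act E p' i \<delta>) X0" "chain_map C n X X0 \<iota>" "\<iota> 0 = i" "\<iota> (Suc n) = i'"
        "chain_map C n X0 X \<pi>" "\<pi> 0 = p" "\<pi> (Suc n) = p'" using rd_obtain[OF X] by metis
  note c = chain_map_simps[OF x(1) R_D(4)[OF 1(3)] 1(4)]
  have "\<iota> (Suc 0) \<in> Mor C (cob X (Suc 0)) (cob X0 (Suc 0))" "cdf X0 0 \<cdot> i = \<iota> (Suc 0) \<cdot> cdf X 0"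
    using c(1-4)[of 0] c(1-3)[of "Suc 0"] 1(5) n_pos by (auto simp: in_Mor_iff)
  moreover have "cdf X 0 \<in> Mor C A (cob X (Suc 0))" using Ch_simps[OF x(1)] x(2) by (simp add: in_Mor_iff)
  ultimately show ?thesis unfolding pre_infl_def using 1 by blast
qed

text \<open>The extension of the second complex is pushed along \<open>\<psi> \<cdot> p2\<close> to
  a complex W starting in the degree 1 object of the first. Now the two first differentials compose
  within S, by \<open>R_comp\<close>, and the lift h from U2 to W carries the factorisation of g
  over to W.\<close>

lemma pre_infl_comp:
  assumes "pre_infl A B f" "pre_infl B D g"
  shows "pre_infl A D (g \<cdot> f)"
proof -
  have f: "f \<in> Mor C A B" and g: "g \<in> Mor C B D" using assms unfolding pre_infl_def by auto
  obtain A' T i j p q V \<sigma> U \<psi> where 1: "compl C S A A' T i j p q" "R V T \<sigma> U" "\<psi> \<in> Mor C B (cob U (Suc 0))" "cdf U 0 \<cdot> i = \<psi> \<cdot> f"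
    using assms(1) unfolding pre_infl_def by metis
  obtain B' T2 i2 j2 p2 q2 V2 \<sigma>2 U2 \<psi>2 where 2: "compl C S B B' T2 i2 j2 p2 q2" "R V2 T2 \<sigma>2 U2" "\<psi>2 \<in> Mor C D (cob U2 (Suc 0))" "cdf U2 0 \<cdot> i2 = \<psi>2 \<cdot> g"
    using assms(2) unfolding pre_infl_def by metis
  note b1 = biproductD[OF complD(1)[OF 1(1)]] and b2 = biproductD[OF complD(1)[OF 2(1)]]
  note r1 = R_D[OF 1(2)] and r2 = R_D[OF 2(2)]
  note t = b1(1-4,10-12)[unfolded in_Mor_iff] b2(1-4,10-12)[unfolded in_Mor_iff] f[unfolded in_Mor_iff] g[unfolded in_Mor_iff] 1(3)[unfolded in_Mor_iff] 2(3)[unfolded in_Mor_iff]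
    Ch_simps(1-4)[OF r1(4)] Ch_simps(1-4)[OF r2(4)]
  let ?a = "\<psi> \<cdot> p2" let ?X = "cob U (Suc 0)" let ?s = "Act E (Idt C V2) (\<psi> \<cdot> p2) \<sigma>2"
  have a: "?a \<in> Mor C T2 ?X" using t by (simp add: cat_simps)
  have X: "?X \<in> S" using r1(8) n_pos by simp
  have V: "Idt C V2 \<in> Mor C V2 V2" using r2(1) S_ob idt_mor by blast
  have s: "?s \<in> carrier (Ext E V2 ?X)" by (rule act_closed[OF V a r2(3)])
  obtain W where W: "R V2 ?X ?s W" using R_ex[OF r2(1) X s] by blast
  note w = R_D[OF W]
  obtain h where h: "chain_map C n U2 W h" "h 0 = ?a" "h (Suc n) = Idt C V2"
    using R_lift[OF 2(2) W a V] act_idt[OF _ _ s] r2(1) X S_ob by auto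
  obtain V' \<sigma>' U' where U: "R V' T \<sigma>' U'" "cob U' 1 = cob W 1" "cdf U' 0 = cdf W 0 \<cdot> cdf U 0"
    using R_comp[OF 1(2), of V2 ?s W] W by auto
  note hc = chain_map_simps[OF r2(4) w(4) h(1)] note tw = Ch_simps(1-4)[OF w(4)]
  have "cdf U' 0 \<cdot> i = cdf W 0 \<cdot> (\<psi> \<cdot> f)" unfolding U(3) 1(4)[symmetric] using t tw r1 w by (simp add: cat_simps)
  also have "\<dots> = (cdf W 0 \<cdot> ?a) \<cdot> (i2 \<cdot> f)" using t tw w b2(5) eqR[OF b2(5), of f] by (simp add: cat_simps)
  also have "\<dots> = h (Suc 0) \<cdot> ((cdf U2 0 \<cdot> i2) \<cdot> f)" unfolding h(2)[symmetric] using hc[of 0] hc(1-3)[of "Suc 0"] t r2 n_pos tw w(5) by (simp add: cat_simps)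
  also have "\<dots> = (h (Suc 0) \<cdot> \<psi>2) \<cdot> (g \<cdot> f)" unfolding 2(4) using hc(1-3)[of "Suc 0"] t n_pos by (simp add: cat_simps)
  finally have "cdf U' 0 \<cdot> i = (h (Suc 0) \<cdot> \<psi>2) \<cdot> (g \<cdot> f)" .
  moreover have "h (Suc 0) \<cdot> \<psi>2 \<in> Mor C D (cob U' (Suc 0))" using hc(1-3)[of "Suc 0"] t n_pos U(2) by (simp add: cat_simps)
  ultimately show ?thesis unfolding pre_infl_def using cmp_mor[OF f g] 1(1) U(1) by blast
qed

text \<open>By additivity \<delta> is the sum of its parts along i p and j q, and the second part is
  trivial.\<close>

lemma act_split:
  assumes "\<delta> \<in> carrier (Ext E Z A)" "biproduct C A1 A2 A i j p q" "Act E (Idt C Z) q \<delta> = \<one>\<^bsub>Ext E Z A2\<^esub>" "Z \<in> Ob C"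
  shows "Act E (Idt C Z) (i \<cdot> p) \<delta> = \<delta>"
proof -
  note b = biproductD[OF assms(2)]
  have Z: "Idt C Z \<in> Mor C Z Z" using assms(4) idt_mor by blast
  interpret G: group "Ext E Z A" using ext_group' assms(4) b by blast
  have c: "Act E (Idt C Z) (i \<cdot> p) \<delta> \<in> carrier (Ext E Z A)" by (rule act_closed[OF Z cmp_mor[OF b(3,1)] assms(1)])
  have "Act E (Idt C Z) (j \<cdot> q) \<delta> = Act E (Idt C Z \<cdot> Idt C Z) (j \<cdot> q) \<delta>" using Z by (simp add: cmp_idt)
  also have "\<dots> = Act E (Idt C Z) j (Act E (Idt C Z) q \<delta>)" by (rule act_cmp[OF Z Z b(4,2) assms(1)])
  also have "\<dots> = \<one>\<^bsub>Ext E Z A\<^esub>" unfolding assms(3) by (rule act_one[OF Z b(2)])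
  finally have "Act E (Idt C Z) ((i \<cdot> p) \<boxplus> (j \<cdot> q)) \<delta> = Act E (Idt C Z) (i \<cdot> p) \<delta> \<otimes>\<^bsub>Ext E Z A\<^esub> \<one>\<^bsub>Ext E Z A\<^esub>"
    using act_add_right[OF Z cmp_mor[OF b(3,1)] cmp_mor[OF b(4,2)] assms(1)] by simp
  then show ?thesis unfolding b(9) using act_idt[OF assms(4) b(12) assms(1)] c by simp
qed

lemma act_split_left:
  assumes "\<delta> \<in> carrier (Ext E Z A)" "biproduct C Z1 Z2 Z i j p q" "Act E j (Idt C A) \<delta> = \<one>\<^bsub>Ext E Z2 A\<^esub>" "A \<in> Ob C"
  shows "Act E (i \<cdot> p) (Idt C A) \<delta> = \<delta>"
proof -
  note b = biproductD[OF assms(2)]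
  have A: "Idt C A \<in> Mor C A A" using assms(4) idt_mor by blast
  interpret G: group "Ext E Z A" using ext_group' assms(4) b by blast
  have c: "Act E (i \<cdot> p) (Idt C A) \<delta> \<in> carrier (Ext E Z A)" by (rule act_closed[OF cmp_mor[OF b(3,1)] A assms(1)])
  have "Act E (j \<cdot> q) (Idt C A) \<delta> = Act E (j \<cdot> q) (Idt C A \<cdot> Idt C A) \<delta>" using A by (simp add: cmp_idt)
  also have "\<dots> = Act E q (Idt C A) (Act E j (Idt C A) \<delta>)" by (rule act_cmp[OF b(2,4) A A assms(1)])
  also have "\<dots> = \<one>\<^bsub>Ext E Z A\<^esub>" unfolding assms(3) by (rule act_one[OF b(4) A])
  finally have "Act E ((i \<cdot> p) \<boxplus> (j \<cdot> q)) (Idt C A) \<delta> = Act E (i \<cdot> p) (Idt C A) \<delta> \<otimes>\<^bsub>Ext E Z A\<^esub> \<one>\<^bsub>Ext E Z A\<^esub>"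
    using act_add_left[OF cmp_mor[OF b(3,1)] cmp_mor[OF b(4,2)] A assms(1)] by simp
  then show ?thesis unfolding b(9) using act_idt[OF b(12) assms(4) assms(1)] c by simp
qed

text \<open>D need not lie in S, so it is enlarged to TD, and k becomes a map a from T to a sum L of
  TD and A'. \<open>R_push\<close> makes the pair of d and a an inflation into the sum of the object
  X = \<open>?X\<close> and L. Stripping A' in the degrees 0 and 1 and the sum of X and D' in the
  degrees 1 and 2 leaves k.\<close>

lemma pre_infl_rd:
  assumes "pre_infl A D k"
  obtains Z \<delta> X where "rd Z A \<delta> X" "cob X (Suc 0) = D" "cdf X 0 = k"
proof -
  have k: "k \<in> Mor C A D" using assms unfolding pre_infl_def by auto
  obtain A' T i j p q V \<sigma> U \<psi> where 1: "compl C S A A' T i j p q" "R V T \<sigma> U" "\<psi> \<in> Mor C D (cob U (Suc 0))" "cdf U 0 \<cdot> i = \<psi> \<cdot> k"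
    using assms(1) unfolding pre_infl_def by metis
  let ?X = "cob U (Suc 0)" and ?d = "cdf U 0"
  note r1 = R_D[OF 1(2)]
  have XS: "?X \<in> S" using r1(8) n_pos by simp
  obtain D' TD i' j' p' q' where cD: "compl C S D D' TD i' j' p' q'" using S_compl mor_ob[OF k] by metis
  obtain L l1 l2 t1 t2 where L: "L \<in> S" "biproduct C TD A' L l1 l2 t1 t2" using S_biproduct[of TD A'] complD[OF cD] complD[OF 1(1)] by blast
  note bA = biproductD[OF complD(1)[OF 1(1)]] and bD = biproductD[OF complD(1)[OF cD]] and bL = biproductD[OF L(2)]
  note ty = bA(1-4,10-12)[unfolded in_Mor_iff] bD(1-4,10-12)[unfolded in_Mor_iff] bL(1-4,10-12)[unfolded in_Mor_iff] k[unfolded in_Mor_iff] 1(3)[unfolded in_Mor_iff]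
    Ch_simps(1-4)[OF r1(4)] r1(5,6)
  note e0 = bA(5-8) bD(5-8) bL(5-8)
  note e = e0 e0[THEN eqR]
  \<comment> \<open>a is k together with the identity of A', followed by the inclusion of D into TD.
    \<open>\<chi>\<close> is built so that \<open>\<chi> \<cdot> a\<close> is the first differential
    d of U; then d is redundant in the pair and can be removed by a shear.\<close>
  define a where "a = l1 \<cdot> (i' \<cdot> (k \<cdot> p)) \<boxplus> l2 \<cdot> q"
  define \<chi> where "\<chi> = \<psi> \<cdot> (p' \<cdot> t1) \<boxplus> ?d \<cdot> (j \<cdot> t2)"
  have a: "a \<in> Mor C T L" unfolding a_def using ty by (simp add: add_simps)
  have \<chi>: "\<chi> \<in> Mor C L ?X" unfolding \<chi>_def using ty n_pos by (simp add: add_simps)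
  have "\<chi> \<cdot> a = (\<psi> \<cdot> k) \<cdot> p \<boxplus> ?d \<cdot> (j \<cdot> q)" unfolding a_def \<chi>_def using ty n_pos by (simp add: add_simps e)
  also have "\<dots> = ?d \<cdot> ((i \<cdot> p) \<boxplus> (j \<cdot> q))" unfolding 1(4)[symmetric] using ty by (simp add: add_simps)
  finally have \<chi>a: "\<chi> \<cdot> a = ?d" unfolding bA(9) using ty by (simp add: cat_simps)
  have ai: "a \<cdot> i = l1 \<cdot> (i' \<cdot> k)" "a \<cdot> j = l2" "t2 \<cdot> a = q" unfolding a_def using ty by (simp_all add: add_simps e)
  obtain Q m1 m2 n1 n2 Z \<sigma>2 W where W: "Q \<in> S" "biproduct C ?X L Q m1 m2 n1 n2" "R Z T \<sigma>2 W" "cob W 1 = Q" "cdf W 0 = (m1 \<cdot> ?d) \<boxplus> (m2 \<cdot> a)"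
    using R_push[OF 1(2) a L(1)] by auto
  \<comment> \<open>The sheared inclusion of L. As \<open>\<chi> \<cdot> a\<close> is d, the pair of
    d and a equals \<open>\<iota> \<cdot> a\<close>, so in the sheared coordinates the first
    differential of W has no component in X.\<close>
  define \<iota> where "\<iota> = m1 \<cdot> \<chi> \<boxplus> m2"
  obtain n1' where bQ: "biproduct C ?X L Q m1 \<iota> n1' n2" using biproduct_shear[OF W(2) \<chi>] unfolding \<iota>_def by blast
  note ta = a[unfolded in_Mor_iff] \<chi>[unfolded in_Mor_iff]
  note tQ = biproductD(1-4,10-12)[OF bQ, unfolded in_Mor_iff] biproductD(2)[OF W(2), unfolded in_Mor_iff]
  note eQ = biproductD(5-8)[OF bQ] biproductD(5-8)[OF bQ, THEN eqR]
  have h: "cdf W 0 = \<iota> \<cdot> a" unfolding W(5) \<iota>_def \<chi>a[symmetric] using ta tQ by (simp add: add_simps)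
  note w = R_D[OF W(3)] note exW = exangleD[OF w(7)]
  have ZO: "Z \<in> Ob C" and TO: "T \<in> Ob C" using w(1,2) S_ob by auto
  obtain P u1 u2 v1 v2 where P: "P \<in> S" "biproduct C ?X TD P u1 u2 v1 v2" using S_biproduct[OF XS complD(3)[OF cD]] by blast
  note bQ' = biproduct_assoc[OF bQ L(2) P(2)]
  define I1 where "I1 = m1 \<cdot> v1 \<boxplus> \<iota> \<cdot> (l1 \<cdot> v2)"
  define P1 where "P1 = u1 \<cdot> n1' \<boxplus> u2 \<cdot> (t1 \<cdot> n2)"
  have b1: "biproduct C P A' (cob W (Suc 0)) I1 (\<iota> \<cdot> l2) P1 (t2 \<cdot> n2)" using bQ' W(4) unfolding I1_def P1_def by simp
  have b0: "biproduct C A A' (cob W 0) i j p q" using complD(1)[OF 1(1)] w(5) by simp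
  have hd: "cdf W 0 \<cdot> j = \<iota> \<cdot> l2" unfolding h ai(2)[symmetric] using ta tQ ty by (simp add: cat_simps)
  have wh: "(t2 \<cdot> n2) \<cdot> cdf W 0 = q" unfolding h ai(3)[symmetric] using ta tQ ty eQ by (simp add: cat_simps)
  obtain Y0 \<iota>0 \<pi>0 h0 where s0: "sdr C n W Y0 \<iota>0 \<pi>0 h0" "cob Y0 0 = A" "cob Y0 (Suc 0) = P" "\<iota>0 0 = i" "\<pi>0 0 = p" "\<iota>0 (Suc 0) = I1" "\<pi>0 (Suc 0) = P1"
    "\<forall>k. k \<noteq> 0 \<longrightarrow> k \<noteq> Suc 0 \<longrightarrow> cob Y0 k = cob W k \<and> \<iota>0 k = Idt C (cob W k) \<and> \<pi>0 k = Idt C (cob W k)"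
    using strip[OF w(4) n_pos le0 b0 b1 hd wh] by blast
  note d0 = sdrD[OF s0(1)]
  have n1: "Suc n \<noteq> 0" "Suc n \<noteq> Suc 0" using n_pos by auto
  have last: "cob Y0 (Suc n) = Z" "\<iota>0 (Suc n) = Idt C Z" "\<pi>0 (Suc n) = Idt C Z" using s0(8)[rule_format, OF n1] w(6) by auto
  note ty0 = Ch_simps(1-4)[OF d0(2)]
  \<comment> \<open>\<open>\<sigma>2\<close> pushed along q is zero, because q factors through the
    first differential of W. Hence pushing \<open>\<delta>\<close> forward along i recovers
    \<open>\<sigma>2\<close>.\<close>
  define \<delta> where "\<delta> = Act E (Idt C Z) p \<sigma>2"
  have Zid: "Idt C Z \<in> Mor C Z Z" using ZO idt_mor by blast
  have \<delta>: "\<delta> \<in> carrier (Ext E Z A)" unfolding \<delta>_def by (rule act_closed[OF Zid bA(3) w(3)])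
  have "Act E (Idt C Z) q \<sigma>2 = Act E (Idt C Z \<cdot> Idt C Z) ((t2 \<cdot> n2) \<cdot> cdf W 0) \<sigma>2" unfolding wh using Zid by (simp add: cmp_idt)
  also have "\<dots> = Act E (Idt C Z) (t2 \<cdot> n2) (Act E (Idt C Z) (cdf W 0) \<sigma>2)"
    by (rule act_cmp[OF Zid Zid _ _ w(3)]) (use Ch_simps[OF w(4)] w ty tQ W(4) in \<open>auto simp: cat_simps\<close>)
  also have "Act E (Idt C Z) (cdf W 0) \<sigma>2 = \<one>\<^bsub>Ext E Z Q\<^esub>" using exW(3) w W(4) by simp
  also have "Act E (Idt C Z) (t2 \<cdot> n2) \<one>\<^bsub>Ext E Z Q\<^esub> = \<one>\<^bsub>Ext E Z A'\<^esub>" by (rule act_one[OF Zid]) (use ty tQ in \<open>auto simp: cat_simps\<close>)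
  finally have q\<sigma>: "Act E (Idt C Z) q \<sigma>2 = \<one>\<^bsub>Ext E Z A'\<^esub>" .
  have i\<delta>: "Act E (Idt C Z) i \<delta> = \<sigma>2"
    using act_act[OF Zid Zid bA(3,1) w(3)] act_split[OF w(3) complD(1)[OF 1(1)] q\<sigma> ZO] Zid unfolding \<delta>_def by (simp add: cmp_idt)
  have ex0: "exangle C E n Y0 \<delta>"
    by (rule exangle_retract[OF w(7) d0(2) _ d0(3,4)])
      (use d0 \<delta> s0(2,4,5) last bA i\<delta> ZO homotopic_eq[OF d0(2,2) chain_map_id[OF d0(2)]] in \<open>auto simp: cat_simps\<close>)
  have tP: "mor C I1" "mor C P1" "dm C P1 = Q" "cd C P1 = P" using biproductD(1,3)[OF b1] W(4) by (auto simp: in_Mor_iff)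
  have d0Y: "cdf Y0 0 = (u2 \<cdot> i') \<cdot> k"
  proof -
    have "cdf Y0 0 = (cdf Y0 0 \<cdot> p) \<cdot> i" using ty0 s0(2) ty bA(5) by (simp add: cat_simps)
    also have "\<dots> = (P1 \<cdot> cdf W 0) \<cdot> i" using chain_map_simps(4)[OF d0(1,2,4), of 0] s0(5,7) by simp
    also have "\<dots> = P1 \<cdot> (\<iota> \<cdot> (l1 \<cdot> (i' \<cdot> k)))" unfolding h ai(1)[symmetric] using ta tQ ty tP by (simp add: cat_simps)
    also have "\<dots> = (u2 \<cdot> i') \<cdot> k" unfolding P1_def using ta tQ ty biproductD(1-4,10-12)[OF P(2)] by (simp add: add_simps eQ e)
    finally show ?thesis .
  qed
  \<comment> \<open>A complement of D in degree 1 of Y0 is the sum of X and D'. The first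
    differential has no component in it, so by exactness its projection factors through the next
    differential, which embeds it as a summand of degree 2.\<close>
  obtain Rr x1 x2 y1 y2 where Rr: "Rr \<in> S" "biproduct C ?X D' Rr x1 x2 y1 y2" using S_biproduct[OF XS complD(2)[OF cD]] by blast
  obtain \<gamma>' \<rho> \<rho>' where bP: "biproduct C D Rr P (u2 \<cdot> i') \<gamma>' \<rho> \<rho>'"
    using biproduct_swap[OF biproduct_assoc[OF P(2) biproduct_swap[OF complD(1)[OF cD]] Rr(2)]] by blast
  note bP' = biproductD[OF bP] note tyP = bP'(1-4,10-12)[unfolded in_Mor_iff]
  have "\<rho>' \<cdot> cdf Y0 0 = Zer C (cob Y0 0) Rr"
    unfolding d0Y using tyP ty bP'(8) eqR[OF bP'(8), of k] s0(2) by (simp add: add_simps)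
  then obtain v where v: "v \<in> Mor C (cob Y0 (Suc (Suc 0))) Rr" "\<rho>' = v \<cdot> cdf Y0 (Suc 0)"
    using exangleD(5)[OF ex0, unfolded cexact_def, rule_format, of 0 \<rho>' Rr] n_pos bP'(4) s0(3) by auto
  have vs: "v \<cdot> (cdf Y0 (Suc 0) \<cdot> \<gamma>') = Idt C Rr" using bP'(6) unfolding v(2) using v(1) ty0 n_pos tyP s0(3) by (simp add: cat_simps)
  obtain A2 i2 p2 where b2: "biproduct C A2 Rr (cob Y0 (Suc (Suc 0))) i2 (cdf Y0 (Suc 0) \<cdot> \<gamma>') p2 v"
    using ex_complement[OF v(1) _ vs] ty0 n_pos tyP s0(3) by (auto simp: cat_simps)
  have bP2: "biproduct C D Rr (cob Y0 (Suc 0)) (u2 \<cdot> i') \<gamma>' \<rho> \<rho>'" using bP s0(3) by simp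
  obtain Y \<iota>2 \<pi>2 h2 where s2: "sdr C n Y0 Y \<iota>2 \<pi>2 h2" "cob Y (Suc 0) = D" "cob Y (Suc (Suc 0)) = A2" "\<pi>2 (Suc 0) = \<rho>"
    "\<iota>2 (Suc (Suc 0)) = i2" "\<pi>2 (Suc (Suc 0)) = p2"
    "\<forall>k. k \<noteq> Suc 0 \<longrightarrow> k \<noteq> Suc (Suc 0) \<longrightarrow> cob Y k = cob Y0 k \<and> \<iota>2 k = Idt C (cob Y0 k) \<and> \<pi>2 k = Idt C (cob Y0 k)"
    using strip[OF d0(2) n_pos _ bP2 b2 refl v(2)[symmetric]] n_pos by auto
  note d2 = sdrD[OF s2(1)]
  have beg: "cob Y 0 = A" "\<iota>2 0 = Idt C A" "\<pi>2 0 = Idt C A" using s2(7)[rule_format, of 0] s0(2) by auto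
  have AO: "A \<in> Ob C" using bA by blast
  have dY: "cdf Y 0 = k"
  proof -
    have "cdf Y 0 = \<rho> \<cdot> cdf Y0 0" using chain_map_simps(4)[OF d2(1,2,4), of 0] beg s2(4) Ch_simps[OF d2(2)] by (simp add: cat_simps)
    also have "\<dots> = k" unfolding d0Y using tyP ty bP'(5) eqR[OF bP'(5), of k] by (simp add: cat_simps)
    finally show ?thesis .
  qed
  have Aid: "Idt C A \<in> Mor C A A" using AO idt_mor by blast
  \<comment> \<open>If n = 1, degree 2 is the end of the complex, and the stripping has cut Z down;
    the extension vanishes on the removed part because that part is included through the last
    differential. If n > 1, the end is untouched and its complement is zero.\<close>
  obtain Z2 i3 j3 p3 q3 where c3: "compl C S (cob Y (Suc n)) Z2 Z i3 j3 p3 q3" "\<iota>2 (Suc n) = i3" "\<pi>2 (Suc n) = p3" "Act E j3 (Idt C A) \<delta> = \<one>\<^bsub>Ext E Z2 A\<^esub>"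
  proof (cases "n = 1")
    case True
    have "Act E (cdf Y0 (Suc 0) \<cdot> \<gamma>') (Idt C A \<cdot> Idt C A) \<delta> = Act E \<gamma>' (Idt C A) (Act E (cdf Y0 (Suc 0)) (Idt C A) \<delta>)"
      by (rule act_cmp[OF _ _ Aid Aid \<delta>]) (use ty0 s0(3) tyP n_pos last True in \<open>auto simp: cat_simps\<close>)
    also have "\<dots> = Act E \<gamma>' (Idt C A) \<one>\<^bsub>Ext E P A\<^esub>" using exangleD(4)[OF ex0] True s0(2,3) by simp
    also have "\<dots> = \<one>\<^bsub>Ext E Rr A\<^esub>" by (rule act_one[OF bP'(2) Aid])
    finally have "Act E (cdf Y0 (Suc 0) \<cdot> \<gamma>') (Idt C A) \<delta> = \<one>\<^bsub>Ext E Rr A\<^esub>" using AO by (simp add: cat_simps)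
    moreover have "compl C S (cob Y (Suc n)) Rr Z i2 (cdf Y0 (Suc 0) \<cdot> \<gamma>') p2 v" unfolding compl_def using b2 True last(1) s2(3) Rr(1) w(1) by simp
    ultimately show thesis using that s2(5,6) True by simp
  next
    case False
    then have "Suc n \<noteq> Suc 0" "Suc n \<noteq> Suc (Suc 0)" using n_pos by auto
    then have l: "cob Y (Suc n) = Z" "\<iota>2 (Suc n) = Idt C Z" "\<pi>2 (Suc n) = Idt C Z" using s2(7) last(1) by auto
    obtain Z2 j3 q3 where c: "compl C S Z Z2 Z (Idt C Z) j3 (Idt C Z) q3" using compl_self[OF w(1)] by metis
    note bc = biproductD[OF complD(1)[OF c]]
    have "j3 = Zer C Z2 Z" using bc(7) idt_cmp[OF bc(2)] by simp
    then have "Act E j3 (Idt C A) \<delta> = \<one>\<^bsub>Ext E Z2 A\<^esub>" using act_zero_left[OF bc(11) ZO Aid \<delta>] by simp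
    then show thesis using that c l by simp
  qed
  note bc = biproductD[OF complD(1)[OF c3(1)]]
  define \<epsilon> where "\<epsilon> = Act E i3 (Idt C A) \<delta>"
  have \<epsilon>: "\<epsilon> \<in> carrier (Ext E (cob Y (Suc n)) A)" unfolding \<epsilon>_def by (rule act_closed[OF bc(1) Aid \<delta>])
  have p3: "Act E p3 (Idt C A) \<epsilon> = \<delta>"
    using act_act[OF bc(3,1) Aid Aid \<delta>] act_split_left[OF \<delta> complD(1)[OF c3(1)] c3(4) AO] AO unfolding \<epsilon>_def by (simp add: cat_simps)
  have ex: "exangle C E n Y \<epsilon>"
    by (rule exangle_retract[OF ex0 d2(2) _ d2(3,4)])
      (use d2 \<epsilon> beg c3(2,3) p3 bc AO homotopic_eq[OF d2(2,2) chain_map_id[OF d2(2)]] in \<open>auto simp: cat_simps\<close>)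
  have "Act E p3 i \<epsilon> = Act E (Idt C Z) i (Act E p3 (Idt C A) \<epsilon>)"
    using act_act[OF Zid bc(3) Aid bA(1) \<epsilon>] bc(3) bA(1) by (simp add: cmp_idt)
  then have R: "R Z T (Act E p3 i \<epsilon>) W" unfolding p3 i\<delta> using W(3) by simp
  have "rd (cob Y (Suc n)) A \<epsilon> Y"
    by (rule rd_I[OF ex beg(1) refl 1(1) c3(1) R chain_map_comp[OF d2(2,1) d0(1) d2(3) d0(3)] _ _ chain_map_comp[OF d0(1) d2(1,2) d0(4) d2(4)]])
     (use beg s0(4,5) last c3(2,3) bA bc in \<open>auto simp: cmp_idt idt_cmp\<close>)
  then show thesis using that s2(2) dY by blast
qed

lemma rd_comp:
  assumes "rd Z A \<delta> X" "rd W (cob X (Suc 0)) \<rho> Y"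
  obtains V \<epsilon> U where "rd V A \<epsilon> U" "cob U (Suc 0) = cob Y (Suc 0)" "cdf U 0 = cdf Y 0 \<cdot> cdf X 0"
  using pre_infl_rd[OF pre_infl_comp[OF rd_pre_infl[OF assms(1)] rd_pre_infl[OF assms(2)]]] by metis

end

section \<open>Mapping cones\<close>

context dense_realisation begin

text \<open>\<open>ex_standard_summand\<close> produces a complex of its own choice, whereas here X
  is given. The two are strongly equivalent, and composing with the equivalence preserves the outer
  components: k vanishes at both ends, and h keeps those coming from the complements.\<close>

lemma rd_strong_retract:
  assumes X: "rd Z A \<delta> X" and cA: "compl C S A A' TA i j p q" and cZ: "compl C S Z Z' TZ i' j' p' q'"
    and R: "R TZ TA (Act E p' i \<delta>) U" and w: "w \<in> Mor C (cob U (Suc 0)) A'" "w \<cdot> cdf U 0 = q"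
  obtains \<iota> \<pi> k h v where "chain_map C n X U \<iota>" "chain_map C n U X \<pi>" "\<iota> 0 = i" "\<pi> 0 = p" "\<iota> (Suc n) = i'" "\<pi> (Suc n) = p'"
    "hty C n X X k" "k (Suc 0) = Zer C (cob X (Suc 0)) (cob X 0)" "k (Suc n) = Zer C (cob X (Suc n)) (cob X n)"
    "\<And>l. l \<le> Suc n \<Longrightarrow> \<pi> l \<cdot> \<iota> l = Idt C (cob X l) \<boxplus> hb C n X X k l"
    "hty C n U U h" "\<And>l. l \<le> Suc n \<Longrightarrow> Idt C (cob U l) = \<iota> l \<cdot> \<pi> l \<boxplus> hb C n U U h l"
    "h (Suc 0) = j \<cdot> w" "v \<in> Mor C Z' (cob U n)" "h (Suc n) = v \<cdot> q'" "w \<cdot> \<iota> (Suc 0) = Zer C (cob X (Suc 0)) A'"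
proof -
  note x = rd_D[OF X] note u = R_D[OF R]
  note bA = biproductD[OF complD(1)[OF cA]] and bZ = biproductD[OF complD(1)[OF cZ]]
  obtain Y \<iota>0 \<pi>0 h0 v where s: "sdr C n U Y \<iota>0 \<pi>0 h0" "rd Z A \<delta> Y" "\<iota>0 0 = i" "\<pi>0 0 = p" "\<iota>0 (Suc n) = i'" "\<pi>0 (Suc n) = p'"
    "w \<cdot> \<iota>0 (Suc 0) = Zer C (cob Y (Suc 0)) A'" "h0 (Suc 0) = j \<cdot> w" "v \<in> Mor C Z' (cob U n)" "h0 (Suc n) = v \<cdot> q'"
    using ex_standard_summand[OF x(5) cA cZ R w] by metis
  note y = rd_D[OF s(2)] note d = sdrD[OF s(1)]
  obtain f where f: "chain_map_ends C n X Y f" using rd_lift_id[OF X s(2)] by blast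
  obtain g where g: "chain_map_ends C n Y X g" using rd_lift_id[OF s(2) X] by blast
  obtain r where r: "chain_map_ends C n Y X r" "strong_homotopic C n X X (\<lambda>i. r i \<cdot> f i) (\<lambda>i. Idt C (cob X i))"
    "strong_homotopic C n Y Y (\<lambda>i. f i \<cdot> r i) (\<lambda>i. Idt C (cob Y i))" using strong_equivalence[OF x(1,8) y(1,8) f g n_pos] by blast
  note fc = chain_map_endsD(1)[OF f] and rc = chain_map_endsD(1)[OF r(1)]
  have ends: "f 0 = Idt C A" "f (Suc n) = Idt C Z" "r 0 = Idt C A" "r (Suc n) = Idt C Z"
    using chain_map_endsD(2,3)[OF f] chain_map_endsD(2,3)[OF r(1)] x y by auto
  note t = chain_map_simps(1-3)[OF x(1) y(1) fc] chain_map_simps(1-3)[OF y(1) x(1) rc]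
    chain_map_simps(1-3)[OF d(2,1,3)] chain_map_simps(1-3)[OF d(1,2,4)] Ch_simps(1-4)[OF x(1)] Ch_simps(1-4)[OF y(1)] Ch_simps(1-4)[OF d(1)]
  define \<iota> where "\<iota> = (\<lambda>i. \<iota>0 i \<cdot> f i)"
  define \<pi> where "\<pi> = (\<lambda>i. r i \<cdot> \<pi>0 i)"
  have \<iota>: "chain_map C n X U \<iota>" unfolding \<iota>_def by (rule chain_map_comp[OF x(1) y(1) d(1) fc d(3)])
  have \<pi>: "chain_map C n U X \<pi>" unfolding \<pi>_def by (rule chain_map_comp[OF d(1) y(1) x(1) d(4) rc])
  have e: "\<iota> 0 = i" "\<pi> 0 = p" "\<iota> (Suc n) = i'" "\<pi> (Suc n) = p'"
    unfolding \<iota>_def \<pi>_def using s(3-6) ends bA bZ by (simp_all add: cmp_idt idt_cmp)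
  obtain k where k: "hty C n X X k" "k (Suc 0) = Zer C (cob X (Suc 0)) (cob X 0)" "k (Suc n) = Zer C (cob X (Suc n)) (cob X n)"
    "\<And>i. i \<le> Suc n \<Longrightarrow> r i \<cdot> f i = Idt C (cob X i) \<boxplus> hb C n X X k i" using strong_homotopic_hb[OF r(2)] by blast
  have "strong_homotopic C n Y Y (\<lambda>i. Idt C (cob Y i)) (\<lambda>i. f i \<cdot> r i)" by (rule strong_homotopic_sym[OF y(1) y(1) chain_map_id[OF y(1)] r(3)])
  then obtain k' where k': "hty C n Y Y k'" "k' (Suc 0) = Zer C (cob Y (Suc 0)) (cob Y 0)" "k' (Suc n) = Zer C (cob Y (Suc n)) (cob Y n)"
    "\<And>i. i \<le> Suc n \<Longrightarrow> Idt C (cob Y i) = f i \<cdot> r i \<boxplus> hb C n Y Y k' i" using strong_homotopic_hb by blast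
  have \<pi>\<iota>: "\<pi> l \<cdot> \<iota> l = Idt C (cob X l) \<boxplus> hb C n X X k l" if l: "l \<le> Suc n" for l
  proof -
    have "\<pi> l \<cdot> \<iota> l = r l \<cdot> ((\<pi>0 l \<cdot> \<iota>0 l) \<cdot> f l)" unfolding \<iota>_def \<pi>_def using t l by (simp add: cat_simps)
    then show ?thesis using d(6)[OF l] k(4)[OF l] t l by (simp add: cat_simps)
  qed
  note h1 = hty_pre[OF y(1) y(1) d(1) k'(1) d(4)]
  note h2 = hty_post[OF d(1) y(1) d(1) h1 d(3)]
  define h where "h = (\<lambda>i. (\<iota>0 (i - 1) \<cdot> (k' i \<cdot> \<pi>0 i)) \<boxplus> h0 i)"
  have h: "hty C n U U h" unfolding h_def by (rule hty_add[OF h2 d(5)])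
  have Id: "Idt C (cob U l) = \<iota> l \<cdot> \<pi> l \<boxplus> hb C n U U h l" if l: "l \<le> Suc n" for l
  proof -
    note tl = t l hb_typ[OF y(1) y(1) k'(1)] hb_typ[OF d(1,1,5)]
    have "hb C n U U h l = \<iota>0 l \<cdot> (hb C n Y Y k' l \<cdot> \<pi>0 l) \<boxplus> hb C n U U h0 l"
      unfolding h_def using hb_add[OF d(1,1) h2 d(5) l] hb_post[OF d(1) y(1) d(1) h1 d(3) l] hb_pre[OF y(1) y(1) d(1) k'(1) d(4) l] by simp
    then have "\<iota> l \<cdot> \<pi> l \<boxplus> hb C n U U h l = \<iota>0 l \<cdot> ((f l \<cdot> r l \<boxplus> hb C n Y Y k' l) \<cdot> \<pi>0 l) \<boxplus> hb C n U U h0 l"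
      unfolding \<iota>_def \<pi>_def using tl by (simp add: add_simps add_assoc)
    then show ?thesis using k'(4)[OF l, symmetric] d(7)[OF l] tl by (simp add: cat_simps)
  qed
  have n1: "Suc n \<noteq> 0" using n_pos by simp
  have h0: "h (Suc 0) = j \<cdot> w" "h (Suc n) = v \<cdot> q'"
    unfolding h_def using k'(2,3) s(8,9,10) t n_pos bA bZ w(1) u(5,6) by (simp_all add: add_simps)
  have "w \<cdot> \<iota> (Suc 0) = (w \<cdot> \<iota>0 (Suc 0)) \<cdot> f (Suc 0)" unfolding \<iota>_def using t w(1) n_pos by (simp add: cat_simps)
  also have "\<dots> = Zer C (cob X (Suc 0)) A'" unfolding s(7) using t n_pos bA(11) by (simp add: zero_cmp)
  finally show thesis using that[OF \<iota> \<pi> e k(1-3) \<pi>\<iota> h Id h0(1) s(9) h0(2)] by blast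
qed

text \<open>The good lift \<open>f\<close> between the \<open>R\<close>-realised complexes is restricted to the summands. Its cone and the
  cone of the restriction are linked by chain maps, through which the cone of the restriction is compared
  with a realisation of the pushed out extension.\<close>

lemma rd_EA2:
  assumes c: "c \<in> Mor C B D" and Y: "rd B A (Act E c (Idt C A) \<delta>) Y" and X: "rd D A \<delta> X"
  shows "\<exists>f M. chain_map C n Y X f \<and> f 0 = Idt C A \<and> f (Suc n) = c \<and> mapping_cone C n Y X f M \<and>
        rd D (cob Y 1) (Act E (Idt C D) (cdf Y 0) \<delta>) M"
proof -
  note x = rd_D[OF X] and y = rd_D[OF Y]
  obtain A' TA i j p q where cA: "compl C S A A' TA i j p q" using S_compl x(7) by metis
  obtain B' TB ib jb pb qb where cB: "compl C S B B' TB ib jb pb qb" using S_compl y(6) by metis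
  obtain D' TD id jd pd qd where cD: "compl C S D D' TD id jd pd qd" using S_compl x(6) by metis
  note bA = biproductD[OF complD(1)[OF cA]] and bB = biproductD[OF complD(1)[OF cB]] and bD = biproductD[OF complD(1)[OF cD]]
  note tb = bA(1-4,10-12)[unfolded in_Mor_iff] bB(1-4,10-12)[unfolded in_Mor_iff] bD(1-4,10-12)[unfolded in_Mor_iff] c[unfolded in_Mor_iff]
  note eb0 = bA(5-8) bB(5-8) bD(5-8)
  note eb = eb0 eb0[THEN eqR]
  have AA: "Act E c' a' (Act E c a \<delta>) = Act E (c \<cdot> c') (a' \<cdot> a) \<delta>" if "mor C c" "cd C c = D" "mor C a" "dm C a = A" "mor C c'" "cd C c' = dm C c" "mor C a'" "dm C a' = cd C a" for c a c' a'
    by (rule act_act[of _ "dm C c'" "dm C c" _ D _ A "cd C a" _ "cd C a'"]) (use x that in \<open>simp_all add: cat_simps\<close>)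
  obtain U where U: "R TD TA (Act E pd i \<delta>) U" using R_ex[OF complD(3)[OF cD] complD(3)[OF cA]] act_closed[OF bD(3) bA(1) x(5)] by blast
  \<comment> \<open>c transported to the enlarged ends. Pulling the enlarged \<delta> back along c'
    gives the enlargement of the pullback of \<delta> along c, so \<open>R_EA2\<close> applies to U
    and V.\<close>
  define c' where "c' = id \<cdot> (c \<cdot> pb)"
  have c': "c' \<in> Mor C TB TD" unfolding c'_def using tb by (simp add: cat_simps)
  have e1: "Act E pb i (Act E c (Idt C A) \<delta>) = Act E c' (Idt C TA) (Act E pd i \<delta>)"
    unfolding c'_def using tb by (simp add: AA cat_simps eb)
  obtain V where V: "R TB TA (Act E pb i (Act E c (Idt C A) \<delta>)) V"
    using R_ex[OF complD(3)[OF cB] complD(3)[OF cA]] act_closed[OF bB(3) bA(1) y(5)] by blast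
  note u = R_D[OF U] and v = R_D[OF V]
  obtain f M where f: "chain_map C n V U f" "f 0 = Idt C TA" "f (Suc n) = c'" "mapping_cone C n V U f M"
     "R TD (cob V 1) (Act E (Idt C TD) (cdf V 0) (Act E pd i \<delta>)) M"
    using R_EA2[OF complD(3)[OF cA] c' V[unfolded e1] U] by blast
  note m = R_D[OF f(5)]
  note tf = chain_map_simps(1-3)[OF v(4) u(4) f(1)]
  note tc = Ch_simps(1-4)[OF x(1)] Ch_simps(1-4)[OF y(1)] Ch_simps(1-4)[OF u(4)] Ch_simps(1-4)[OF v(4)]
  obtain w where w: "w \<in> Mor C (cob U (Suc 0)) A'" "w \<cdot> cdf U 0 = q" using ex_factor_inflation[OF x(5) complD(1)[OF cA] bD(3) U] by blast
  \<comment> \<open>The retraction for V is deliberately chosen as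
    \<open>w \<cdot> f (Suc 0)\<close>, possible because f 0 is the identity. This matches the first
    homotopy components of U and V and makes \<open>z0\<close> hold.\<close>
  have wY: "w \<cdot> f (Suc 0) \<in> Mor C (cob V (Suc 0)) A'" using w(1) tf n_pos by (simp add: cat_simps)
  have "(w \<cdot> f (Suc 0)) \<cdot> cdf V 0 = (w \<cdot> cdf U 0) \<cdot> f 0" using chain_map_simps(4)[OF v(4) u(4) f(1), of 0] w(1) tf[of 0] tf[of "Suc 0"] tc n_pos by (simp add: cat_simps)
  then have wY2: "(w \<cdot> f (Suc 0)) \<cdot> cdf V 0 = q" unfolding w(2) f(2) using bA(4) by (simp add: cmp_idt)
  obtain \<iota>X \<pi>X kX hX vX where PX: "chain_map C n X U \<iota>X" "chain_map C n U X \<pi>X" "\<iota>X 0 = i" "\<pi>X 0 = p" "\<iota>X (Suc n) = id" "\<pi>X (Suc n) = pd"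
    "hty C n X X kX" "kX (Suc 0) = Zer C (cob X (Suc 0)) (cob X 0)" "kX (Suc n) = Zer C (cob X (Suc n)) (cob X n)"
    "\<And>l. l \<le> Suc n \<Longrightarrow> \<pi>X l \<cdot> \<iota>X l = Idt C (cob X l) \<boxplus> hb C n X X kX l"
    "hty C n U U hX" "\<And>l. l \<le> Suc n \<Longrightarrow> Idt C (cob U l) = \<iota>X l \<cdot> \<pi>X l \<boxplus> hb C n U U hX l"
    "hX (Suc 0) = j \<cdot> w" "vX \<in> Mor C D' (cob U n)" "hX (Suc n) = vX \<cdot> qd" "w \<cdot> \<iota>X (Suc 0) = Zer C (cob X (Suc 0)) A'"
    using rd_strong_retract[OF X cA cD U w] by blast
  obtain \<iota>Y \<pi>Y kY hY vY where PY: "chain_map C n Y V \<iota>Y" "chain_map C n V Y \<pi>Y" "\<iota>Y 0 = i" "\<pi>Y 0 = p" "\<iota>Y (Suc n) = ib" "\<pi>Y (Suc n) = pb"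
    "hty C n Y Y kY" "kY (Suc 0) = Zer C (cob Y (Suc 0)) (cob Y 0)" "kY (Suc n) = Zer C (cob Y (Suc n)) (cob Y n)"
    "\<And>l. l \<le> Suc n \<Longrightarrow> \<pi>Y l \<cdot> \<iota>Y l = Idt C (cob Y l) \<boxplus> hb C n Y Y kY l"
    "hty C n V V hY" "\<And>l. l \<le> Suc n \<Longrightarrow> Idt C (cob V l) = \<iota>Y l \<cdot> \<pi>Y l \<boxplus> hb C n V V hY l"
    "hY (Suc 0) = j \<cdot> (w \<cdot> f (Suc 0))" "vY \<in> Mor C B' (cob V n)" "hY (Suc n) = vY \<cdot> qb" "(w \<cdot> f (Suc 0)) \<cdot> \<iota>Y (Suc 0) = Zer C (cob Y (Suc 0)) A'"
    using rd_strong_retract[OF Y cA cB V wY wY2] by blast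
  note tX = chain_map_simps(1-3)[OF x(1) u(4) PX(1)] chain_map_simps(1-3)[OF u(4) x(1) PX(2)] hty_simps[OF PX(7)] hty_simps[OF PX(11)] hb_typ[OF u(4) u(4) PX(11)] hb_typ[OF x(1) x(1) PX(7)]
  note tY = chain_map_simps(1-3)[OF y(1) v(4) PY(1)] chain_map_simps(1-3)[OF v(4) y(1) PY(2)] hty_simps[OF PY(7)] hty_simps[OF PY(11)] hb_typ[OF v(4) v(4) PY(11)] hb_typ[OF y(1) y(1) PY(7)]
  define f' where "f' = (\<lambda>l. \<pi>X l \<cdot> (f l \<cdot> \<iota>Y l))"
  note f\<iota> = chain_map_comp[OF y(1) v(4) u(4) PY(1) f(1)] and \<pi>f = chain_map_comp[OF v(4) u(4) x(1) f(1) PX(2)]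
  have f': "chain_map C n Y X f'" unfolding f'_def by (rule chain_map_comp[OF y(1) u(4) x(1) f\<iota> PX(2)])
  note tf' = chain_map_simps(1-3)[OF y(1) x(1) f']
  have f'0: "f' 0 = Idt C A" unfolding f'_def f(2) PX(4) PY(3) using tb by (simp add: cat_simps eb)
  have f'n: "f' (Suc n) = c" unfolding f'_def f(3) PX(6) PY(5) c'_def using tb by (simp add: cat_simps eb)
  obtain M' where M': "mapping_cone C n Y X f' M'" using ex_mapping_cone[OF y(1) x(1) n_pos] by blast
  obtain j1 j2 p1 p2 where cn: "cone C n V U f M j1 j2 p1 p2" using mapping_cone_imp_cone[OF v(4) u(4) f(1) n_pos f(4)] by blast
  obtain j1' j2' p1' p2' where cn': "cone C n Y X f' M' j1' j2' p1' p2'" using mapping_cone_imp_cone[OF y(1) x(1) f' n_pos M'] by blast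
  interpret A: mcone C n V U f M j1 j2 p1 p2 by unfold_locales (use v(4) u(4) f(1) n_pos cn in auto)
  interpret B: mcone C n Y X f' M' j1' j2' p1' p2' by unfold_locales (use x(1) y(1) f' n_pos cn' in auto)
  have mA: "mcone C n V U f M j1 j2 p1 p2" and mB: "mcone C n Y X f' M' j1' j2' p1' p2'" by unfold_locales
  note h1 = hty_pre[OF u(4) u(4) y(1) PX(11) f\<iota>]
  \<comment> \<open>The square from f' to f commutes up to the homotopy with components
    \<open>hX l \<cdot> (f l \<cdot> \<iota>Y l)\<close>, which measures the failure of
    \<open>\<iota>X\<close> followed by \<open>\<pi>X\<close> in the other order to be the identity
    of U. L is its negative, and it vanishes at both ends.\<close>
  obtain L where L: "hty C n Y U L" "\<And>l. l \<le> n \<Longrightarrow> hX (Suc l) \<cdot> (f (Suc l) \<cdot> \<iota>Y (Suc l)) \<boxplus> L (Suc l) = Zer C (cob Y (Suc l)) (cob U l)"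
    "\<And>l. l \<le> Suc n \<Longrightarrow> hb C n Y U (\<lambda>l. hX l \<cdot> (f l \<cdot> \<iota>Y l)) l \<boxplus> hb C n Y U L l = Zer C (cob Y l) (cob U l)"
    using ex_hty_neg[OF y(1) u(4) h1] by blast
  have z0: "hX (Suc 0) \<cdot> (f (Suc 0) \<cdot> \<iota>Y (Suc 0)) = Zer C (cob Y (Suc 0)) (cob U 0)"
    unfolding PX(13) using PY(16) eqR[of w "f (Suc 0)" _ "\<iota>Y (Suc 0)", OF refl] w(1) tf[of "Suc 0"] tY(1-3)[of "Suc 0"] n_pos tb u(5) Ch_simps(1)[OF y(1), of "Suc 0"] by (simp add: add_simps)
  have zn: "hX (Suc n) \<cdot> (f (Suc n) \<cdot> \<iota>Y (Suc n)) = Zer C (cob Y (Suc n)) (cob U n)"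
    unfolding PX(15) f(3) PY(5) c'_def using PX(14) tb y by (simp add: add_simps eb)
  have L0: "L (Suc 0) = Zer C (cob Y (Suc 0)) (cob U 0)" and Ln: "L (Suc n) = Zer C (cob Y (Suc n)) (cob U n)"
    using L(2)[of 0] L(2)[of n] z0 zn hty_simps[OF L(1)] by (simp_all add: add_zero)
  have e\<psi>: "f (Suc l) \<cdot> \<iota>Y (Suc l) \<boxplus> hb C n Y U L (Suc l) = \<iota>X (Suc l) \<cdot> f' (Suc l)" if l: "l \<le> n" for l
  proof -
    have l': "Suc l \<le> Suc n" using l by simp
    note tl = tX tY tf l' hb_typ[OF y(1) u(4) L(1)] hb_typ[OF y(1) u(4) h1]
    have "f (Suc l) \<cdot> \<iota>Y (Suc l) = (\<iota>X (Suc l) \<cdot> \<pi>X (Suc l) \<boxplus> hb C n U U hX (Suc l)) \<cdot> (f (Suc l) \<cdot> \<iota>Y (Suc l))"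
      unfolding PX(12)[OF l', symmetric] using tl by (simp add: cat_simps)
    also have "\<dots> = \<iota>X (Suc l) \<cdot> f' (Suc l) \<boxplus> hb C n Y U (\<lambda>l. hX l \<cdot> (f l \<cdot> \<iota>Y l)) (Suc l)"
      unfolding f'_def hb_pre[OF u(4) u(4) y(1) PX(11) f\<iota> l', symmetric] using tl by (simp add: add_simps)
    finally show ?thesis using L(3)[OF l'] tl tf' by (simp add: add_simps add_assoc)
  qed
  obtain \<psi> where \<psi>: "chain_map C n M' M \<psi>" "\<psi> 0 = \<iota>Y (Suc 0)" "\<psi> (Suc n) = \<iota>X (Suc n)"
    "\<And>l. l < n \<Longrightarrow> \<psi> (Suc l) \<cdot> j1' (Suc l) = j1 (Suc l) \<cdot> \<iota>Y (Suc (Suc l)) \<boxplus> j2 (Suc l) \<cdot> L (Suc (Suc l))"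
    "\<And>l. l < n \<Longrightarrow> \<psi> (Suc l) \<cdot> j2' (Suc l) = j2 (Suc l) \<cdot> \<iota>X (Suc l)"
    using cone_map[OF mB mA PY(1) PX(1) L(1) L0 e\<psi>] by blast
  note h2 = hty_post[OF v(4) v(4) x(1) PY(11) \<pi>f]
  \<comment> \<open>The analogous correction for the projections, coming from the homotopy on V. Its
    first component vanishes since p kills the image of j.\<close>
  define N where "N = (\<lambda>l. (\<pi>X (l - 1) \<cdot> f (l - 1)) \<cdot> hY l)"
  have N: "hty C n V X N" unfolding N_def by (rule h2)
  have N0: "N (Suc 0) = Zer C (cob V (Suc 0)) (cob X 0)"
    unfolding N_def PY(13) using PX(4) f(2) tb wY x by (simp add: add_simps eb)
  have e\<phi>: "f' (Suc l) \<cdot> \<pi>Y (Suc l) \<boxplus> hb C n V X N (Suc l) = \<pi>X (Suc l) \<cdot> f (Suc l)" if l: "l \<le> n" for l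
  proof -
    have l': "Suc l \<le> Suc n" using l by simp
    note tl = tX tY tf l'
    have "\<pi>X (Suc l) \<cdot> f (Suc l) = (\<pi>X (Suc l) \<cdot> f (Suc l)) \<cdot> (\<iota>Y (Suc l) \<cdot> \<pi>Y (Suc l) \<boxplus> hb C n V V hY (Suc l))"
      unfolding PY(12)[OF l', symmetric] using tl by (simp add: cat_simps)
    also have "\<dots> = f' (Suc l) \<cdot> \<pi>Y (Suc l) \<boxplus> (\<pi>X (Suc l) \<cdot> f (Suc l)) \<cdot> hb C n V V hY (Suc l)"
      unfolding f'_def using tl by (simp add: add_simps)
    also have "(\<pi>X (Suc l) \<cdot> f (Suc l)) \<cdot> hb C n V V hY (Suc l) = hb C n V X N (Suc l)"
      unfolding N_def using hb_post[OF v(4) v(4) x(1) PY(11) \<pi>f l'] by simp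
    finally show ?thesis by simp
  qed
  obtain \<phi> where \<phi>: "chain_map C n M M' \<phi>" "\<phi> 0 = \<pi>Y (Suc 0)" "\<phi> (Suc n) = \<pi>X (Suc n)"
    "\<And>l. l < n \<Longrightarrow> \<phi> (Suc l) \<cdot> j1 (Suc l) = j1' (Suc l) \<cdot> \<pi>Y (Suc (Suc l)) \<boxplus> j2' (Suc l) \<cdot> N (Suc (Suc l))"
    "\<And>l. l < n \<Longrightarrow> \<phi> (Suc l) \<cdot> j2 (Suc l) = j2' (Suc l) \<cdot> \<pi>X (Suc l)"
    using cone_map[OF mA mB PY(2) PX(2) N N0 e\<phi>] by blast
  note t\<psi> = chain_map_simps[OF B.M_Ch A.M_Ch \<psi>(1)] and t\<phi> = chain_map_simps[OF A.M_Ch B.M_Ch \<phi>(1)]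
  have cM: "cexact C n M" using exangleD(5)[OF m(7)] .
  \<comment> \<open>In the top degree exactness is imported from M: a map s on M' is carried to M by
    \<phi>, factored there and brought back by \<psi>. It then remains to see that s \<phi> \<psi>
    equals s, which is checked on the two inclusions j1' and j2'.\<close>
  have cM': "cexact C n M'" unfolding cexact_def
  proof (intro allI ballI impI)
    fix l K s assume l: "l < n" and s: "s \<in> Mor C (cob M' (Suc l)) K" "s \<cdot> cdf M' l = Zer C (cob M' l) K"
    show "\<exists>z \<in> Mor C (cob M' (Suc (Suc l))) K. s = z \<cdot> cdf M' (Suc l)"
    proof (cases "Suc l < n")
      case True
      then show ?thesis using B.cexact_low[OF y(8) x(8) _ True s] f'0 y(2) by simp
    next
      case False
      then have n': "n = Suc l" using l by simp
      have K: "K \<in> Ob C" using mor_ob s by blast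
      note ts = s(1)[unfolded in_Mor_iff] note sR = eqR[OF s(2)]
      have "(s \<cdot> \<phi> (Suc l)) \<cdot> cdf M l = Zer C (cob M l) K"
        using t\<phi>(1-3)[of l] t\<phi>(1-3)[of "Suc l"] t\<phi>(4)[of l] ts sR[of "\<phi> l"] l K A.tys B.tys by (simp add: add_simps)
      then obtain z where z: "z \<in> Mor C (cob M (Suc (Suc l))) K" "s \<cdot> \<phi> (Suc l) = z \<cdot> cdf M (Suc l)"
        using cM[unfolded cexact_def, rule_format, OF l, of "s \<cdot> \<phi> (Suc l)" K] ts t\<phi>(1-3)[of "Suc l"] l by (auto simp: cat_simps)
      have s2: "s \<cdot> (j2' (Suc l) \<cdot> (cdf X l \<cdot> y)) = Zer C (dm C y) K" if y: "l \<noteq> 0" "mor C y" "cd C y = cob X l" for y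
      proof -
        obtain l0 where l0: "l = Suc l0" using y(1) by (cases l) auto
        have "s \<cdot> (j2' (Suc l) \<cdot> (cdf X l \<cdot> y)) = s \<cdot> (cdf M' l \<cdot> (j2' l \<cdot> y))"
          using B.dj2[of l0 y] l l0 y by simp
        also have "\<dots> = Zer C (dm C y) K" using sR[of "j2' l \<cdot> y"] B.tys B.j2_typ[of l0] l l0 y ts K by (simp add: add_simps)
        finally show ?thesis .
      qed
      \<comment> \<open>As k vanishes at the end n + 1, in degree n the composite \<pi> \<iota>
        differs from the identity only by a map that passes through the differential of X into
        degree n. Behind j2' this is a cone differential, which s kills; for n = 1 the corresponding
        k vanishes already.\<close>
      have \<pi>\<iota>: "s \<cdot> (j2' n \<cdot> (\<pi>X n \<cdot> \<iota>X n)) = s \<cdot> j2' n"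
      proof -
        have hbn: "hb C n X X kX n = cdf X l \<cdot> kX n"
          using hb_simps(3)[of l n C X X kX] PX(9) tX tc l unfolding n' by (simp add: add_simps)
        have "s \<cdot> (j2' n \<cdot> (cdf X l \<cdot> kX n)) = Zer C (cob X n) K"
        proof (cases "l = 0")
          case True
          then show ?thesis using PX(8) ts B.tys tc l K n' by (simp add: add_simps)
        next
          case False
          then show ?thesis using s2[of "kX n"] tX(7-9)[of l] n' by simp
        qed
        then show ?thesis using PX(10)[of n] hbn tX(7-9)[of l] n' tc B.tys ts by (simp add: add_simps)
      qed
      have "s = (z \<cdot> \<psi> (Suc n)) \<cdot> cdf M' n"
      proof (rule B.epi[of n _ K])
        have e: "(z \<cdot> \<psi> (Suc n)) \<cdot> cdf M' n = (s \<cdot> \<phi> n) \<cdot> \<psi> n"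
          using z t\<psi>(1-4)[of n] t\<psi>(1-3)[of "Suc n"] n' A.tys B.tys by (simp add: cat_simps)
        have tn: "mor C (\<phi> n)" "dm C (\<phi> n) = cob M n" "cd C (\<phi> n) = cob M' n"
          "mor C (\<psi> n)" "dm C (\<psi> n) = cob M' n" "cd C (\<psi> n) = cob M n"
          "mor C (j1 n)" "dm C (j1 n) = TB" "cd C (j1 n) = cob M n" "mor C (j1' n)" "dm C (j1' n) = B" "cd C (j1' n) = cob M' n"
          "mor C (j2 n)" "dm C (j2 n) = cob U n" "cd C (j2 n) = cob M n" "mor C (j2' n)" "dm C (j2' n) = cob X n" "cd C (j2' n) = cob M' n"
          "mor C (\<pi>X n)" "dm C (\<pi>X n) = cob U n" "cd C (\<pi>X n) = cob X n" "mor C (\<iota>X n)" "dm C (\<iota>X n) = cob X n" "cd C (\<iota>X n) = cob U n"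
          "mor C (f n)" "dm C (f n) = cob V n" "cd C (f n) = cob U n" "mor C s" "dm C s = cob M' n" "cd C s = K"
          "mor C vY" "dm C vY = B'" "cd C vY = cob V n" "cob M n \<in> Ob C" "cob M' n \<in> Ob C" "cob X n \<in> Ob C" "cob U n \<in> Ob C"
          using t\<psi>(1-3)[of n] t\<phi>(1-3)[of n] ts A.j1_typ[of n] B.j1_typ[of n] A.j2_typ[of l] B.j2_typ[of l] tX(1-6)[of n] tf[of n] PY(14) n' v(6) y(3)
            A.M_typ(1)[of n] B.M_typ(1)[of n] tc(1)[of n] tc(9)[of n] by (simp_all add: in_Mor_iff)
        have \<psi>1: "\<psi> n \<cdot> j1' n = j1 n \<cdot> ib" using \<psi>(4)[OF l] Ln PY(5) n' tn tb y(3,6) by (simp add: add_simps)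
        have \<phi>1: "\<phi> n \<cdot> j1 n = j1' n \<cdot> pb \<boxplus> j2' n \<cdot> (((\<pi>X n \<cdot> f n) \<cdot> vY) \<cdot> qb)"
          using \<phi>(4)[OF l] PY(6,15) n' tn tb unfolding N_def by (simp add: cat_simps)
        have "(s \<cdot> \<phi> n) \<cdot> (\<psi> n \<cdot> j1' n) = s \<cdot> ((\<phi> n \<cdot> j1 n) \<cdot> ib)" unfolding \<psi>1 using tn tb by (simp add: cat_simps)
        also have "\<dots> = s \<cdot> j1' n" unfolding \<phi>1 using tn tb K by (simp add: add_simps eb)
        finally show "s \<cdot> j1' n = ((z \<cdot> \<psi> (Suc n)) \<cdot> cdf M' n) \<cdot> j1' n" unfolding e using tn by (simp add: cat_simps)
        fix k assume "n = Suc k"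
        have "(s \<cdot> \<phi> n) \<cdot> (\<psi> n \<cdot> j2' n) = s \<cdot> ((\<phi> n \<cdot> j2 n) \<cdot> \<iota>X n)"
          using tn \<psi>(5)[OF l] n' by (simp add: cat_simps)
        also have "\<dots> = s \<cdot> j2' n" using \<phi>(5)[OF l] tn \<pi>\<iota> n' by (simp add: cat_simps)
        finally show "s \<cdot> j2' n = ((z \<cdot> \<psi> (Suc n)) \<cdot> cdf M' n) \<cdot> j2' n" unfolding e using tn by (simp add: cat_simps)
      qed (use n' ts z(1) t\<psi>(1-3)[of "Suc n"] B.tys in \<open>auto simp: cat_simps\<close>)
      then show ?thesis using z(1) t\<psi>(1-3)[of "Suc n"] n' by (intro bexI[of _ "z \<cdot> \<psi> (Suc n)"]) (auto simp: cat_simps)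
    qed
  qed
  let ?Y1 = "cob Y (Suc 0)" let ?e = "Act E (Idt C D) (cdf Y 0) \<delta>"
  have Did: "Idt C D \<in> Mor C D D" using x idt_mor by blast
  have dY: "cdf Y 0 \<in> Mor C A ?Y1" using tc y by (simp add: in_Mor_iff)
  have e: "?e \<in> carrier (Ext E D ?Y1)" by (rule act_closed[OF Did dY x(5)])
  obtain W where W: "rd D ?Y1 ?e W" using rd_ex[OF e] x tc n_pos by auto
  note w' = rd_D[OF W]
  note Mrd = R_rd[OF f(5)]
  have V1: "cdf V 0 \<cdot> i = \<iota>Y (Suc 0) \<cdot> cdf Y 0" "\<pi>Y (Suc 0) \<cdot> cdf V 0 = cdf Y 0 \<cdot> p"
    using chain_map_simps(4)[OF y(1) v(4) PY(1), of 0] chain_map_simps(4)[OF v(4) y(1) PY(2), of 0] PY(3,4) by auto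
  have dV: "mor C (cdf V 0)" "dm C (cdf V 0) = TA" "cd C (cdf V 0) = cob V (Suc 0)" using tc(14-16)[of 0] v(5) by auto
  \<comment> \<open>\<open>A1\<close> and \<open>A2\<close> state that the projections and
    inclusions are morphisms between the extension realised by M and the pushed out extension
    realised by W. The lifts of these, composed with \<psi> and \<phi>, link M' to W.\<close>
  have A1: "Act E (Idt C TD) (\<pi>Y (Suc 0)) (Act E (Idt C TD) (cdf V 0) (Act E pd i \<delta>)) = Act E pd (Idt C ?Y1) ?e"
  proof -
    have "\<pi>Y (Suc 0) \<cdot> (cdf V 0 \<cdot> i) = cdf Y 0" using eqR[OF V1(2), of i] tb dV tY(4-6)[of "Suc 0"] dY n_pos by (simp add: cat_simps eb)
    then show ?thesis using tb dV tY(4-6)[of "Suc 0"] dY n_pos x Ch_simps(1)[OF y(1), of "Suc 0"] by (simp add: AA cat_simps)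
  qed
  have A2: "Act E (Idt C D) (\<iota>Y (Suc 0)) ?e = Act E id (Idt C (cob V (Suc 0))) (Act E (Idt C TD) (cdf V 0) (Act E pd i \<delta>))"
    using tb dV tY(1-3)[of "Suc 0"] dY n_pos x V1(1) Ch_simps(1)[OF v(4), of "Suc 0"] by (simp add: AA cat_simps eb)
  obtain \<omega> where \<omega>: "chain_map C n M W \<omega>" "\<omega> 0 = \<pi>Y (Suc 0)" "\<omega> (Suc n) = pd"
    using rd_lift[OF Mrd W, of "\<pi>Y (Suc 0)" pd] A1 tb tY(4-6)[of "Suc 0"] n_pos by (auto simp: in_Mor_iff)
  obtain \<omega>' where \<omega>': "chain_map C n W M \<omega>'" "\<omega>' 0 = \<iota>Y (Suc 0)" "\<omega>' (Suc n) = id"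
    using rd_lift[OF W Mrd, of "\<iota>Y (Suc 0)" id] A2 tb tY(1-3)[of "Suc 0"] n_pos by (auto simp: in_Mor_iff)
  note a = chain_map_comp[OF B.M_Ch A.M_Ch w'(1) \<psi>(1) \<omega>(1)] and b = chain_map_comp[OF w'(1) A.M_Ch B.M_Ch \<omega>'(1) \<phi>(1)]
  have \<pi>\<iota>1: "\<pi>Y (Suc 0) \<cdot> \<iota>Y (Suc 0) = Idt C ?Y1 \<boxplus> kY (Suc (Suc 0)) \<cdot> cdf Y (Suc 0)"
    using PY(10)[of "Suc 0"] hb_simps(3)[of 0 n C Y Y kY] PY(8) tY tc n_pos by (simp add: add_simps)
  have tk: "mor C (kY (Suc (Suc 0)))" "dm C (kY (Suc (Suc 0))) = cob Y (Suc (Suc 0))" "cd C (kY (Suc (Suc 0))) = ?Y1" using tY(7-9)[of "Suc 0"] n_pos by auto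
  have dY1: "mor C (cdf Y (Suc 0))" "dm C (cdf Y (Suc 0)) = ?Y1" "cd C (cdf Y (Suc 0)) = cob Y (Suc (Suc 0))" using tc n_pos by auto
  \<comment> \<open>The composite from M' to W starts with \<open>\<pi>Y\<close> after
    \<open>\<iota>Y\<close>, the identity plus \<open>kY\<close> times \<open>cdf Y (Suc 0)\<close>.
    The first component of the first cone differential is the negative of this differential of Y;
    hence \<open>nk\<close>, the negative of \<open>kY\<close>, composed with \<open>p1'\<close>
    exhibits the error as a multiple of the cone differential.\<close>
  obtain nk where nk: "nk \<in> Mor C (cob Y (Suc (Suc 0))) ?Y1" "kY (Suc (Suc 0)) \<boxplus> nk = Zer C (cob Y (Suc (Suc 0))) ?Y1"
    using ex_neg[of "kY (Suc (Suc 0))" "cob Y (Suc (Suc 0))" ?Y1] tk by (auto simp: in_Mor_iff)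
  have ends: "cob M' 0 = ?Y1" "cob M' (Suc n) = D" using B.c(1,2) x by auto
  obtain a' where a': "chain_map C n M' W a'" "a' 0 = Idt C ?Y1" "a' (Suc n) = Idt C D"
  proof (rule chain_map_fix_start[OF B.M_Ch w'(1) a n_pos, of "nk \<cdot> p1' (Suc 0)"])
    have tp: "mor C (p1' (Suc 0))" "dm C (p1' (Suc 0)) = cob M' (Suc 0)" "cd C (p1' (Suc 0)) = cob Y (Suc (Suc 0))" using B.p_typ[of 0] n_pos by auto
    note tM0 = B.M_typ(1-4)[of 0]
    show "nk \<cdot> p1' (Suc 0) \<in> Mor C (cob M' (Suc 0)) (cob M' 0)" using tp nk(1) ends by (simp add: cat_simps)
    have "(nk \<cdot> p1' (Suc 0)) \<cdot> cdf M' 0 \<boxplus> nk \<cdot> cdf Y (Suc 0) = nk \<cdot> (p1' (Suc 0) \<cdot> cdf M' 0 \<boxplus> cdf Y (Suc 0))"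
      using tp nk(1) tM0 dY1 ends by (simp add: add_simps)
    also have "\<dots> = Zer C ?Y1 ?Y1" unfolding B.c(10) using nk(1) tc n_pos by (simp add: add_simps)
    also have "\<dots> = (kY (Suc (Suc 0)) \<boxplus> nk) \<cdot> cdf Y (Suc 0)" unfolding nk(2) using dY1 tc n_pos by (simp add: add_simps)
    also have "\<dots> = kY (Suc (Suc 0)) \<cdot> cdf Y (Suc 0) \<boxplus> nk \<cdot> cdf Y (Suc 0)" using tk nk(1) dY1 by (simp add: add_simps)
    finally have "(nk \<cdot> p1' (Suc 0)) \<cdot> cdf M' 0 = kY (Suc (Suc 0)) \<cdot> cdf Y (Suc 0)"
      using tp nk(1) tM0 dY1 tk ends by (rule_tac add_cancel[of _ _ "nk \<cdot> cdf Y (Suc 0)"]) (simp_all add: add_simps)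
    then show "\<omega> 0 \<cdot> \<psi> 0 = Idt C (cob M' 0) \<boxplus> (nk \<cdot> p1' (Suc 0)) \<cdot> cdf M' 0" unfolding \<omega>(2) \<psi>(2) using \<pi>\<iota>1 ends by simp
    show "cob W 0 = cob M' 0" using ends w'(2) by simp
    fix b assume "chain_map C n M' W b" "b 0 = Idt C (cob M' 0)" "b (Suc n) = \<omega> (Suc n) \<cdot> \<psi> (Suc n)"
    then show thesis using that ends \<omega>(3) \<psi>(3) PX(5) bD(5) by simp
  qed
  \<comment> \<open>The same error at the start of the composite from W to M'. It kills the pushed
    out extension because two consecutive differentials of Y compose to zero, so it factors through
    the first differential of W.\<close>
  have "Act E (Idt C D) (kY (Suc (Suc 0)) \<cdot> cdf Y (Suc 0)) ?e = \<one>\<^bsub>Ext E D ?Y1\<^esub>"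
  proof -
    have "(kY (Suc (Suc 0)) \<cdot> cdf Y (Suc 0)) \<cdot> cdf Y 0 = Zer C A ?Y1" using tk dY1 dY Ch_simps(5)[OF y(1), of 0] n_pos tc y by (simp add: add_simps)
    then show ?thesis using act_zero_right[OF x(7) _ Did x(5), of ?Y1] tk dY1 dY x tc n_pos by (simp add: AA cat_simps)
  qed
  then obtain \<kappa> where \<kappa>: "\<kappa> \<in> Mor C (cob W (Suc 0)) ?Y1" "kY (Suc (Suc 0)) \<cdot> cdf Y (Suc 0) = \<kappa> \<cdot> cdf W 0"
    using exangleD(8)[OF w'(4), of "kY (Suc (Suc 0)) \<cdot> cdf Y (Suc 0)" ?Y1] w'(2,3) tk dY1 by (auto simp: cat_simps)
  obtain b' where b': "chain_map C n W M' b'" "b' 0 = Idt C ?Y1" "b' (Suc n) = Idt C D"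
  proof (rule chain_map_fix_start[OF w'(1) B.M_Ch b n_pos, of \<kappa>])
    show "\<kappa> \<in> Mor C (cob W (Suc 0)) (cob W 0)" using \<kappa>(1) w'(2) by simp
    show "\<phi> 0 \<cdot> \<omega>' 0 = Idt C (cob W 0) \<boxplus> \<kappa> \<cdot> cdf W 0" unfolding \<phi>(2) \<omega>'(2) \<kappa>(2)[symmetric] using \<pi>\<iota>1 w'(2) by simp
    show "cob M' 0 = cob W 0" using ends w'(2) by simp
    fix b assume "chain_map C n W M' b" "b 0 = Idt C (cob W 0)" "b (Suc n) = \<phi> (Suc n) \<cdot> \<omega>' (Suc n)"
    then show thesis using that w'(2) \<omega>'(3) \<phi>(3) PX(6) bD(5) by simp
  qed
  have "chain_map_ends C n W M' b'" "chain_map_ends C n M' W a'" unfolding chain_map_ends_def using a' b' w'(2,3) ends by auto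
  then have "M' \<in> kclass C n W" unfolding kclass_iff[OF w'(1,8) n_pos] using B.M_Ch cM' by blast
  then have "rd D ?Y1 ?e M'" using rd_kclass[OF W] by simp
  then show ?thesis using f' f'0 f'n M' by auto
qed

end

section \<open>Extending a realisation to direct summands\<close>

context additive_category begin

lemma zero_object_unique:
  assumes "zero_object C Z"
  shows "Z \<in> Ob C" "f \<in> Mor C A Z \<Longrightarrow> g \<in> Mor C A Z \<Longrightarrow> f = g" "f \<in> Mor C Z A \<Longrightarrow> g \<in> Mor C Z A \<Longrightarrow> f = g"
  using assms mor_ob unfolding zero_object_def by blast+

lemma triv_left_Ch: "Z \<in> Ob C \<Longrightarrow> A \<in> Ob C \<Longrightarrow> 1 \<le> n \<Longrightarrow> triv_left C Z A \<in> Ch C n"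
  by (rule ChI) (auto simp: triv_left_def Let_def add_simps)

lemma triv_left_cexact:
  assumes Z: "zero_object C Z" and A: "A \<in> Ob C"
  shows "cexact C n (triv_left C Z A)"
  unfolding cexact_def
proof (intro allI ballI impI)
  note zu = zero_object_unique[OF Z]
  fix i Y u assume i: "i < n" and u: "u \<in> Mor C (cob (triv_left C Z A) (Suc i)) Y" "u \<cdot> cdf (triv_left C Z A) i = Zer C (cob (triv_left C Z A) i) Y"
  have Y: "Y \<in> Ob C" using u mor_ob by blast
  have "u = Zer C Z Y \<cdot> cdf (triv_left C Z A) (Suc i)"
  proof (cases "i = 0")
    case True
    then show ?thesis using u A Y zu(1) by (simp add: triv_left_def Let_def add_simps)
  next
    case False
    then show ?thesis using u(1) A Y zu(1) by (intro zu(3)[of _ Y]) (auto simp: triv_left_def Let_def add_simps)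
  qed
  moreover have "Zer C Z Y \<in> Mor C (cob (triv_left C Z A) (Suc (Suc i))) Y" using Y zu(1) Zer_mor by (simp add: triv_left_def Let_def)
  ultimately show "\<exists>w\<in>Mor C (cob (triv_left C Z A) (Suc (Suc i))) Y. u = w \<cdot> cdf (triv_left C Z A) (Suc i)" by blast
qed

end

context biadditive_functor begin

text \<open>Pushing the zero extension along the identity of A gives zero, so the identity factors
  through the first differential by some w. The comparison maps are w and that differential in
  degree 1 and zero further up, where equations hold because maps into or out of a zero object are
  unique.\<close>

lemma triv_left_kclass:
  assumes Z: "zero_object C Z" and A: "A \<in> Ob C" and n: "1 \<le> n" and X: "exangle C E n X \<one>\<^bsub>Ext E Z A\<^esub>" "cob X 0 = A" "cob X (Suc n) = Z"
  shows "triv_left C Z A \<in> kclass C n X"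
proof -
  note zu = zero_object_unique[OF Z] note x = exangleD[OF X(1)] note t = Ch_simps[OF x(1)]
  let ?T = "triv_left C Z A"
  have T: "cob ?T i = (if i \<le> 1 then A else Z)" "cdf ?T i = (if i = 0 then Idt C A else Zer C (if i \<le> 1 then A else Z) Z)" for i
    by (simp_all add: triv_left_def Let_def)
  have "Act E (Idt C Z) (Idt C A) \<one>\<^bsub>Ext E Z A\<^esub> = \<one>\<^bsub>Ext E Z A\<^esub>" using act_one idt_mor zu(1) A by blast
  then obtain w where w: "w \<in> Mor C (cob X (Suc 0)) A" "Idt C A = w \<cdot> cdf X 0"
    using x(8)[of "Idt C A" A] X(2,3) idt_mor[OF A] by auto
  define f where "f i = (if i = 0 then Idt C A else if i = Suc 0 then w else Zer C (cob X i) Z)" for i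
  define g where "g i = (if i = 0 then Idt C A else if i = Suc 0 then cdf X 0 else Zer C Z (cob X i))" for i
  have ft: "f i \<in> Mor C (cob X i) (cob ?T i)" if "i \<le> Suc n" for i
    using that w(1) X(2) A zu(1) t(1)[of i] idt_mor Zer_mor unfolding f_def T by auto
  have gt: "g i \<in> Mor C (cob ?T i) (cob X i)" if "i \<le> Suc n" for i
    using that X(2) A zu(1) t(1)[of i] t(1-4)[of 0] idt_mor Zer_mor unfolding g_def T by (auto simp: in_Mor_iff)
  have zz: "Zer C Z Z = Idt C Z" using zu(1) Zer_mor idt_mor by (intro zu(2)[of _ Z]) auto
  have f: "chain_map_ends C n X ?T f" unfolding chain_map_ends_def
  proof (intro conjI chain_mapI)
    fix i assume i: "i \<le> n"
    show "f (Suc i) \<cdot> cdf X i = cdf ?T i \<cdot> f i"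
    proof (cases "i = 0")
      case True
      then show ?thesis using w(1) w(2)[symmetric] A X(2) by (simp add: f_def T cat_simps)
    next
      case False
      have Ti: "cob ?T (Suc i) = Z" using False by (simp add: T)
      have cT: "cdf ?T i \<in> Mor C (cob ?T i) Z" using False zu(1) A Zer_mor by (auto simp: T)
      show ?thesis using cmp_mor[of "cdf X i" "cob X i" "cob X (Suc i)" "f (Suc i)" Z] ft[of "Suc i"] ft[of i] i t(2-4)[of i] Ti cmp_mor[OF ft[of i] cT]
        by (intro zu(2)[of _ "cob X i"]) (auto simp: in_Mor_iff)
    qed
  qed (use ft n X(2,3) zz in \<open>auto simp: f_def\<close>)
  have g: "chain_map_ends C n ?T X g" unfolding chain_map_ends_def
  proof (intro conjI chain_mapI)
    fix i assume i: "i \<le> n"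
    consider "i = 0" | "i = Suc 0" | "Suc 0 < i" by linarith
    then show "g (Suc i) \<cdot> cdf ?T i = cdf X i \<cdot> g i"
    proof cases
      case 1
      then show ?thesis using t(2-4)[of 0] A X(2) by (simp add: g_def T cat_simps)
    next
      case 2
      then show ?thesis using t(1)[of "Suc (Suc 0)"] t(5)[of 0] A X(2) i zu(1) by (simp add: g_def T add_simps)
    next
      case 3
      then have Ti: "cob ?T i = Z" "cob ?T (Suc i) = Z" and cT: "cdf ?T i \<in> Mor C Z Z" using zu(1) Zer_mor by (auto simp: T)
      show ?thesis using cmp_mor[OF cT, of "g (Suc i)" "cob X (Suc i)"] gt[of "Suc i"] gt[of i] i t(2-4)[of i] Ti
        by (intro zu(3)[of _ "cob X (Suc i)"]) (auto simp: cat_simps)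
    qed
  qed (use gt n X(2,3) zz in \<open>auto simp: g_def T\<close>)
  show ?thesis unfolding kclass_iff[OF x(1,5) n] using f g triv_left_Ch[OF zu(1) A n] triv_left_cexact[OF Z A] by blast
qed

text \<open>Dual of \<open>triv_left_kclass\<close>. X first has to be replaced by its double
  reversal, with which it agrees, so that it is the reversal of a complex in the opposite
  category.\<close>

lemma triv_right_kclass:
  assumes Z: "zero_object C Z" and A: "A \<in> Ob C" and n: "1 \<le> n" and X: "exangle C E n X \<one>\<^bsub>Ext E A Z\<^esub>" "cob X 0 = Z" "cob X (Suc n) = A"
  shows "triv_right C n Z A \<in> kclass C n X"
proof -
  interpret O: biadditive_functor "op_cat C" "op_bifunctor E" by (rule biadditive_functor_op[OF biadditive_functor_axioms])
  note x = exangleD[OF X(1)]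
  let ?X = "op_cpx n (op_cpx n X)"
  have ag: "agree n X ?X" by (rule agree_sym[OF agree_op_op])
  have X': "exangle C E n ?X \<one>\<^bsub>Ext E A Z\<^esub>" by (rule agree_exangle[OF ag n X(1)])
  note x' = exangleD[OF X']
  have "triv_left (op_cat C) Z A \<in> kclass (op_cat C) n (op_cpx n X)"
    using O.triv_left_kclass[of Z A n "op_cpx n X"] Z A n X' X(2,3) by (simp add: exangle_op[OF biadditive_functor_axioms])
  then have "op_cpx n (triv_left (op_cat C) Z A) \<in> kclass C n ?X"
    using kclass_op[OF additive_category_axioms x'(1,5,6) n] by blast
  then have "triv_right C n Z A \<in> kclass C n ?X" using kclass_agree[OF x'(1,5) n _ triv_agree(1)[OF n]] by blast
  then show ?thesis using kclass_eq[OF x(1,5) n kclass_agree[OF x(1,5) n kclass_self[OF x(1,5) n] ag]] by simp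
qed

end

context dense_realisation begin

context
  fixes r assumes r: "\<And>Z A \<delta>. Z \<in> Ob C \<Longrightarrow> A \<in> Ob C \<Longrightarrow> \<delta> \<in> carrier (Ext E Z A) \<Longrightarrow> r Z A \<delta> = Collect (rd Z A \<delta>)"
begin

text \<open>By \<open>rd_kclass\<close> the summand realisations of an extension form one
  isomorphism class, so taking this set as the value of r defines a realisation.\<close>

lemma realises_rd:
  assumes "Z \<in> Ob C" "A \<in> Ob C" "\<delta> \<in> carrier (Ext E Z A)"
  shows "realises C n r Z A \<delta> X \<longleftrightarrow> rd Z A \<delta> X"
proof
  assume "realises C n r Z A \<delta> X"
  then have "r Z A \<delta> = kclass C n X" "X \<in> Ch_ends C n A Z" unfolding realises_def by auto
  moreover have "X \<in> kclass C n X" using calculation(2) K_iso_refl unfolding kclass_def Ch_ends_def by auto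
  ultimately show "rd Z A \<delta> X" using r[OF assms] by auto
next
  assume X: "rd Z A \<delta> X"
  show "realises C n r Z A \<delta> X"
    unfolding realises_def r[OF assms] Ch_ends_def using rd_kclass[OF X] rd_D[OF X] by auto
qed

lemma exact_realisation_rd: "exact_realisation C E n r"
proof (intro exact_realisation.intro exact_realisation_axioms.intro biadditive_functor_axioms)
  fix Z A \<delta> assume a: "Z \<in> Ob C" "A \<in> Ob C" "\<delta> \<in> carrier (Ext E Z A)"
  show "\<exists>X. realises C n r Z A \<delta> X" using rd_ex[OF a(3,1,2)] realises_rd[OF a] by blast
  fix X assume "realises C n r Z A \<delta> X"
  then show "exangle C E n X \<delta>" using realises_rd[OF a] rd_D by blast
next
  fix \<delta> Z A \<rho> W B a c X Y
  assume a: "\<delta> \<in> carrier (Ext E Z A)" "\<rho> \<in> carrier (Ext E W B)" "a \<in> Mor C A B" "c \<in> Mor C Z W" "push C E Z a \<delta> = pull C E B c \<rho>"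
    "realises C n r Z A \<delta> X" "realises C n r W B \<rho> Y"
  have "rd Z A \<delta> X" "rd W B \<rho> Y" using a realises_rd mor_ob by blast+
  then show "\<exists>f. chain_map C n X Y f \<and> f 0 = a \<and> f (n + 1) = c" using rd_lift a(3-5) unfolding push_def pull_def by simp
next
  fix Z A assume a: "zero_object C Z" "A \<in> Ob C"
  then have Z: "Z \<in> Ob C" using zero_object_unique by blast
  have 1: "\<one>\<^bsub>Ext E A Z\<^esub> \<in> carrier (Ext E A Z)" "\<one>\<^bsub>Ext E Z A\<^esub> \<in> carrier (Ext E Z A)"
    using ext_group' a(2) Z monoid.one_closed group.is_monoid by auto
  obtain X where X: "rd Z A \<one>\<^bsub>Ext E Z A\<^esub> X" using rd_ex[OF 1(2) Z a(2)] by blast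
  show "realises C n r Z A \<one>\<^bsub>Ext E Z A\<^esub> (triv_left C Z A)"
    using triv_left_kclass[OF a n_pos rd_D(4,2,3)[OF X]] rd_kclass[OF X] realises_rd[OF Z a(2) 1(2)] by blast
  obtain Y where Y: "rd A Z \<one>\<^bsub>Ext E A Z\<^esub> Y" using rd_ex[OF 1(1) a(2) Z] by blast
  show "realises C n r A Z \<one>\<^bsub>Ext E A Z\<^esub> (triv_right C n Z A)"
    using triv_right_kclass[OF a n_pos rd_D(4,2,3)[OF Y]] rd_kclass[OF Y] realises_rd[OF a(2) Z 1(1)] by blast
qed

lemma inflation_comp_rd:
  assumes f: "f \<in> Mor C A B" and g: "g \<in> Mor C B D" and "inflation C E n r f" "inflation C E n r g"
  shows "inflation C E n r (g \<cdot> f)"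
proof -
  obtain Z A' \<delta> X where X: "rd Z A' \<delta> X" "f = cdf X 0" using assms(3) realises_rd unfolding inflation_def by blast
  obtain W B' \<rho> Y where Y: "rd W B' \<rho> Y" "g = cdf Y 0" using assms(4) realises_rd unfolding inflation_def by blast
  have "cob X (Suc 0) = B" using f Ch_simps(4)[OF rd_D(1)[OF X(1)], of 0] X(2) by (simp add: in_Mor_iff)
  moreover have "B' = B" using g Ch_simps(3)[OF rd_D(1)[OF Y(1)], of 0] Y(2) rd_D(2)[OF Y(1)] by (simp add: in_Mor_iff)
  ultimately obtain V \<epsilon> U where U: "rd V A' \<epsilon> U" "cdf U 0 = g \<cdot> f" using rd_comp[OF X(1)] X Y by metis
  then show ?thesis unfolding inflation_def using realises_rd rd_D(5-7)[OF U(1)] by metis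
qed

lemma EA2_rd: "EA2 C E n r"
  unfolding EA2_def
proof (intro allI impI, elim conjE)
  fix A B D c \<delta> X Y
  assume a: "A \<in> Ob C" "c \<in> Mor C B D" "\<delta> \<in> carrier (Ext E D A)" "realises C n r B A (pull C E A c \<delta>) Y" "realises C n r D A \<delta> X"
  have ob: "B \<in> Ob C" "D \<in> Ob C" using mor_ob[OF a(2)] by auto
  have p: "pull C E A c \<delta> \<in> carrier (Ext E B A)" using act_closed[OF a(2) idt_mor[OF a(1)] a(3)] by (simp add: pull_def)
  have Y: "rd B A (Act E c (Idt C A) \<delta>) Y" using a(4) realises_rd[OF ob(1) a(1) p] by (simp add: pull_def)
  have X: "rd D A \<delta> X" using a(5) realises_rd[OF ob(2) a(1,3)] by simp
  obtain f M where M: "chain_map C n Y X f \<and> f 0 = Idt C A \<and> f (Suc n) = c \<and> mapping_cone C n Y X f M"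
        "rd D (cob Y 1) (Act E (Idt C D) (cdf Y 0) \<delta>) M" using rd_EA2[OF a(2) Y X] by blast
  show "\<exists>f M. chain_map C n Y X f \<and> f 0 = Idt C A \<and> f (n + 1) = c \<and> mapping_cone C n Y X f M \<and>
      realises C n r D (cob Y 1) (push C E D (cdf Y 0) \<delta>) M"
    using M realises_rd rd_D(5-7)[OF M(2)] unfolding push_def by (intro exI[of _ f] exI[of _ M]) auto
qed

end

text \<open>The complement of a section, provided by \<open>ex_complement\<close>, is a kernel of
  the retraction.\<close>

lemma weakly_idempotent_complete: "weakly_idempotent_complete C"
  unfolding weakly_idempotent_complete_def
proof (intro allI impI, elim conjE bexE)
  fix A B r s assume r: "r \<in> Mor C A B" and s: "s \<in> Mor C B A" and rs: "r \<cdot> s = Idt C B"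
  obtain Y i p where b: "biproduct C Y B A i s p r" using ex_complement[OF r s rs] by blast
  note bb = biproductD[OF b]
  have "is_kernel C A B r Y i" unfolding is_kernel_def
  proof (intro conjI allI impI)
    show "i \<in> Mor C Y A" "r \<cdot> i = Zer C Y B" using bb by auto
    fix W g assume "g \<in> Mor C W A \<and> r \<cdot> g = Zer C W B"
    then have g: "g \<in> Mor C W A" "r \<cdot> g = Zer C W B" by auto
    show "\<exists>!h. h \<in> Mor C W Y \<and> i \<cdot> h = g"
    proof
      have "g = i \<cdot> (p \<cdot> g) \<boxplus> s \<cdot> (r \<cdot> g)" by (rule biproduct_split(2)[OF b g(1)])
      then have "g = i \<cdot> (p \<cdot> g)" unfolding g(2) using g(1) bb(1-4,10-12) mor_ob[OF g(1)] by (simp add: add_simps)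
      then show "p \<cdot> g \<in> Mor C W Y \<and> i \<cdot> (p \<cdot> g) = g" using g bb(3) cmp_mor by auto
      fix h assume h: "h \<in> Mor C W Y \<and> i \<cdot> h = g"
      then show "h = p \<cdot> g" using bb(1,3,5) eqR[OF bb(5), of h] by (auto simp: cat_simps)
    qed
  qed
  then show "\<exists>K k. is_kernel C A B r K k" by blast
qed

end

lemma compl_op: "compl (op_cat C) S A A' T i j p q \<longleftrightarrow> compl C S A A' T p q i j"
  by (simp add: compl_def biproduct_op)

text \<open>The condition is self-dual: reversal exchanges the two ends, inclusions with
  projections, and \<iota> with \<pi>. The witnesses are therefore the old ones in a different
  order.\<close>

lemma summand_realises_op:
  assumes bi: "biadditive_functor C E"
    and 1: "\<And>Z A \<delta> Y. R' Z A \<delta> Y \<Longrightarrow> R A Z \<delta> (op_cpx n Y)" and 2: "\<And>Z A \<delta> Y. R A Z \<delta> Y \<Longrightarrow> R' Z A \<delta> (op_cpx n Y)"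
  shows "summand_realises (op_cat C) (op_bifunctor E) n S R' Z A \<delta> X \<longleftrightarrow> summand_realises C E n S R A Z \<delta> (op_cpx n X)"
proof
  assume "summand_realises (op_cat C) (op_bifunctor E) n S R' Z A \<delta> X"
  then obtain A' TA i j p q Z' TZ i' j' p' q' Y \<iota> \<pi> where *: "exangle C E n (op_cpx n X) \<delta>" "cob X 0 = A" "cob X (Suc n) = Z"
    "compl C S A A' TA p q i j" "compl C S Z Z' TZ p' q' i' j'"
        "R' TZ TA (Act E i p' \<delta>) Y" "chain_map C n (op_cpx n Y) (op_cpx n X) (\<lambda>i. \<iota> (Suc n - i))" "\<iota> 0 = i" "\<iota> (Suc n) = i'"
        "chain_map C n (op_cpx n X) (op_cpx n Y) (\<lambda>i. \<pi> (Suc n - i))" "\<pi> 0 = p" "\<pi> (Suc n) = p'"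
    unfolding summand_realises_def exangle_op[OF bi] compl_op chain_map_op op_bifunctor_simps by metis
  show "summand_realises C E n S R A Z \<delta> (op_cpx n X)"
    unfolding summand_realises_def
    by (intro conjI *(1), simp add: *(3), simp add: *(2))
     (rule exI[of _ Z'], rule exI[of _ TZ], rule exI[of _ p'], rule exI[of _ q'], rule exI[of _ i'], rule exI[of _ j'], rule exI[of _ A'], rule exI[of _ TA], rule exI[of _ p], rule exI[of _ q], rule exI[of _ i], rule exI[of _ j],
       rule exI[of _ "op_cpx n Y"], rule exI[of _ "\<lambda>i. \<pi> (Suc n - i)"], rule exI[of _ "\<lambda>i. \<iota> (Suc n - i)"],
       use * 1[OF *(6)] in simp)
next
  assume "summand_realises C E n S R A Z \<delta> (op_cpx n X)"
  then obtain A' TA i j p q Z' TZ i' j' p' q' Y \<iota> \<pi> where *: "exangle C E n (op_cpx n X) \<delta>" "cob X 0 = A" "cob X (Suc n) = Z"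
    "compl C S Z Z' TZ i' j' p' q'" "compl C S A A' TA i j p q"
        "R TA TZ (Act E p i' \<delta>) Y" "chain_map C n (op_cpx n X) Y \<iota>" "\<iota> 0 = i'" "\<iota> (Suc n) = i"
        "chain_map C n Y (op_cpx n X) \<pi>" "\<pi> 0 = p'" "\<pi> (Suc n) = p"
    unfolding summand_realises_def by auto
  have c: "chain_map (op_cat C) n X (op_cpx n Y) (\<lambda>i. \<pi> (Suc n - i))" "chain_map (op_cat C) n (op_cpx n Y) X (\<lambda>i. \<iota> (Suc n - i))"
    unfolding chain_map_op using agree_chain_map(1)[OF agree_sym[OF agree_op_op] *(10)] agree_chain_map(2)[OF agree_sym[OF agree_op_op] *(7)]
    unfolding chain_map_def by (auto simp: Suc_diff_le)
  have "R' TZ TA (Act (op_bifunctor E) i' p \<delta>) (op_cpx n Y)" using 2[OF *(6)] by simp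
  then show "summand_realises (op_cat C) (op_bifunctor E) n S R' Z A \<delta> X"
    unfolding summand_realises_def exangle_op[OF bi] compl_op using * c
    by (intro conjI *(1-3)) (rule exI[of _ A'], rule exI[of _ TA], rule exI[of _ p], rule exI[of _ q], rule exI[of _ i], rule exI[of _ j],
       rule exI[of _ Z'], rule exI[of _ TZ], rule exI[of _ p'], rule exI[of _ q'], rule exI[of _ i'], rule exI[of _ j'],
       rule exI[of _ "op_cpx n Y"], rule exI[of _ "\<lambda>i. \<pi> (Suc n - i)"], rule exI[of _ "\<lambda>i. \<iota> (Suc n - i)"], simp)
qed

text \<open>\<open>R\<close> and \<open>R'\<close> have to correspond under reversal in both
  directions, so that the dual of r consists of the summand realisations of the opposite category;
  each half of the axioms then comes from one of the two instances.\<close>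

lemma dense_realisation_n_exangulated:
  assumes 1: "dense_realisation C E n S R" and 2: "dense_realisation (op_cat C) (op_bifunctor E) n S R'"
    and a: "\<And>Z A \<delta> Y. R' Z A \<delta> Y \<Longrightarrow> R A Z \<delta> (op_cpx n Y)" and b: "\<And>Z A \<delta> Y. R A Z \<delta> Y \<Longrightarrow> R' Z A \<delta> (op_cpx n Y)"
    and r: "\<And>Z A \<delta>. Z \<in> Ob C \<Longrightarrow> A \<in> Ob C \<Longrightarrow> \<delta> \<in> carrier (Ext E Z A) \<Longrightarrow> r Z A \<delta> = Collect (summand_realises C E n S R Z A \<delta>)"
  shows "n_exangulated_category C E n r"
proof -
  interpret W: dense_realisation C E n S R by fact
  interpret O: dense_realisation "op_cat C" "op_bifunctor E" n S R' by fact
  have bi: "biadditive_functor C E" by unfold_locales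
  have ex: "exact_realisation C E n r" by (rule W.exact_realisation_rd[OF r])
  have r': "op_realisation n r Z A \<delta> = Collect (O.rd Z A \<delta>)" if "Z \<in> Ob (op_cat C)" "A \<in> Ob (op_cat C)" "\<delta> \<in> carrier (Ext (op_bifunctor E) Z A)" for Z A \<delta>
    using r[of A Z \<delta>] that summand_realises_op[OF bi, of R' R n S Z A \<delta>] a b unfolding op_realisation_def by auto
  show ?thesis
  proof (intro n_exangulated_category.intro n_exangulated_category_axioms.intro ex)
    show "EA2 C E n r" by (rule W.EA2_rd[OF r])
    show "EA2 (op_cat C) (op_bifunctor E) n (op_realisation n r)" by (rule O.EA2_rd[OF r'])
    fix f A B g D assume fg: "f \<in> Mor C A B" "g \<in> Mor C B D"
    show "inflation C E n r f \<Longrightarrow> inflation C E n r g \<Longrightarrow> inflation C E n r (g \<cdot>\<^bsub>C\<^esub> f)"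
      by (rule W.inflation_comp_rd[OF r fg])
    show "deflation C E n r f \<Longrightarrow> deflation C E n r g \<Longrightarrow> deflation C E n r (g \<cdot>\<^bsub>C\<^esub> f)"
      using O.inflation_comp_rd[OF r', of g D B f A] fg by (simp add: inflation_op[OF ex W.n_pos])
  qed
qed

section \<open>Additive functors\<close>

lemma map_cpx_simps [simp]: "cob (map_cpx F X) i = Fob F (cob X i)" "cdf (map_cpx F X) i = Fmor F (cdf X i)"
  by (simp_all add: map_cpx_def)

lemma map_cpx_op: "map_cpx F (op_cpx n X) = op_cpx n (map_cpx F X)"
  by (simp add: map_cpx_def op_cpx_def fun_eq_iff)

locale add_functor = C: additive_category C + D: additive_category D
    for C :: "('o, 'm) cat" and D :: "('p, 'q) cat" +
  fixes F :: "('o, 'm, 'p, 'q) cfunctor"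
  assumes additive: "additive_functor C D F"
begin

lemma F_ob: "A \<in> Ob C \<Longrightarrow> Fob F A \<in> Ob D"
  and F_mor: "f \<in> Mor C A B \<Longrightarrow> Fmor F f \<in> Mor D (Fob F A) (Fob F B)"
  and F_idt: "A \<in> Ob C \<Longrightarrow> Fmor F (Idt C A) = Idt D (Fob F A)"
  and F_cmp: "f \<in> Mor C A B \<Longrightarrow> g \<in> Mor C B B' \<Longrightarrow> Fmor F (g \<cdot>\<^bsub>C\<^esub> f) = Fmor F g \<cdot>\<^bsub>D\<^esub> Fmor F f"
  and F_add: "f \<in> Mor C A B \<Longrightarrow> g \<in> Mor C A B \<Longrightarrow> Fmor F (f \<boxplus>\<^bsub>C\<^esub> g) = Fmor F f \<boxplus>\<^bsub>D\<^esub> Fmor F g"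
  using additive unfolding additive_functor_def by blast+

lemma F_zer: assumes "A \<in> Ob C" "B \<in> Ob C" shows "Fmor F (Zer C A B) = Zer D (Fob F A) (Fob F B)"
proof -
  note z = C.Zer_mor[OF assms]
  have "Fmor F (Zer C A B) \<boxplus>\<^bsub>D\<^esub> Fmor F (Zer C A B) = Fmor F (Zer C A B)"
    using F_add[OF z z] z by (simp add: C.add_zero C.in_Mor_iff)
  then show ?thesis using D.self_add_zero[of "Fmor F (Zer C A B)"] F_mor[OF z] by (simp add: D.in_Mor_iff)
qed

lemma F_neg: assumes "f \<in> Mor C A B" shows "Fmor F (Neg C A B f) = Neg D (Fob F A) (Fob F B) (Fmor F f)"
proof -
  note t = assms C.Neg_mor[OF assms] F_mor[OF assms] D.Neg_mor[OF F_mor[OF assms]] F_mor[OF C.Neg_mor[OF assms]]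
  have "Fmor F (Neg C A B f) \<boxplus>\<^bsub>D\<^esub> Fmor F f = Zer D (Fob F A) (Fob F B)"
    using F_add[OF t(2,1)] C.add_Neg(2)[OF assms] F_zer C.mor_ob[OF assms] by simp
  also have "\<dots> = Neg D (Fob F A) (Fob F B) (Fmor F f) \<boxplus>\<^bsub>D\<^esub> Fmor F f" using D.add_Neg(2)[OF t(3)] by simp
  finally show ?thesis using t by (rule_tac D.add_cancel[of _ _ "Fmor F f"]) (auto simp: D.in_Mor_iff)
qed

lemma F_biproduct:
  assumes "biproduct C A B P i j p q" shows "biproduct D (Fob F A) (Fob F B) (Fob F P) (Fmor F i) (Fmor F j) (Fmor F p) (Fmor F q)"
proof -
  note b = C.biproductD[OF assms]
  show ?thesis unfolding biproduct_def
    using F_mor[OF b(1)] F_mor[OF b(2)] F_mor[OF b(3)] F_mor[OF b(4)] F_cmp[OF b(1,3)] F_cmp[OF b(2,3)] F_cmp[OF b(1,4)] F_cmp[OF b(2,4)]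
      F_idt[OF b(10)] F_idt[OF b(11)] F_idt[OF b(12)] F_zer[OF b(10,11)] F_zer[OF b(11,10)]
      F_add[OF C.cmp_mor[OF b(3,1)] C.cmp_mor[OF b(4,2)]] F_cmp[OF b(3,1)] F_cmp[OF b(4,2)] b(5-9) by simp
qed

lemma F_zero: assumes "zero_object C Z" shows "zero_object D (Fob F Z)"
proof -
  have Z: "Z \<in> Ob C" using assms unfolding zero_object_def by blast
  have "Idt C Z = Zer C Z Z" using C.zero_object_unique(2)[OF assms, of "Idt C Z" Z "Zer C Z Z"] C.idt_mor C.Zer_mor Z by blast
  then have i: "Idt D (Fob F Z) = Zer D (Fob F Z) (Fob F Z)" using F_idt[OF Z] F_zer[OF Z Z] by simp
  note FZ = F_ob[OF Z]
  show ?thesis unfolding zero_object_def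
  proof (intro conjI ballI FZ)
    fix A assume A: "A \<in> Ob D"
    have "f = Zer D A (Fob F Z)" if "f \<in> Mor D A (Fob F Z)" for f
      using D.idt_cmp[OF that] that A FZ unfolding i by (simp add: D.add_simps)
    then show "\<exists>!f. f \<in> Mor D A (Fob F Z)" using D.Zer_mor[OF A FZ] by blast
    have "f = Zer D (Fob F Z) A" if "f \<in> Mor D (Fob F Z) A" for f
      using D.cmp_idt[OF that] that A FZ unfolding i by (simp add: D.add_simps)
    then show "\<exists>!f. f \<in> Mor D (Fob F Z) A" using D.Zer_mor[OF FZ A] by blast
  qed
qed

lemma F_Ch: assumes "X \<in> Ch C n" shows "map_cpx F X \<in> Ch D n"
proof -
  have t: "i \<le> Suc n \<Longrightarrow> cob X i \<in> Ob C" "i \<le> n \<Longrightarrow> cdf X i \<in> Mor C (cob X i) (cob X (Suc i))" for i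
    using C.Ch_simps(1-4)[OF assms] by (auto simp: C.in_Mor_iff)
  show ?thesis
    by (rule D.ChI) (use t F_ob F_mor F_cmp[OF t(2) t(2), symmetric] C.Ch_simps(5)[OF assms] F_zer in auto)
qed

lemma F_chain_map:
  assumes "X \<in> Ch C n" "Y \<in> Ch C n" "chain_map C n X Y f"
  shows "chain_map D n (map_cpx F X) (map_cpx F Y) (\<lambda>i. Fmor F (f i))"
proof -
  have t: "i \<le> Suc n \<Longrightarrow> f i \<in> Mor C (cob X i) (cob Y i)" "i \<le> n \<Longrightarrow> cdf X i \<in> Mor C (cob X i) (cob X (Suc i))"
    "i \<le> n \<Longrightarrow> cdf Y i \<in> Mor C (cob Y i) (cob Y (Suc i))" "i \<le> n \<Longrightarrow> f (Suc i) \<cdot>\<^bsub>C\<^esub> cdf X i = cdf Y i \<cdot>\<^bsub>C\<^esub> f i" for i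
    using C.Ch_simps(1-4)[OF assms(1)] C.Ch_simps(1-4)[OF assms(2)] C.chain_map_simps(1-4)[OF assms] by (auto simp: C.in_Mor_iff)
  have "Fmor F (f (Suc i)) \<cdot>\<^bsub>D\<^esub> Fmor F (cdf X i) = Fmor F (cdf Y i) \<cdot>\<^bsub>D\<^esub> Fmor F (f i)" if "i \<le> n" for i
    using F_cmp[OF t(2)[OF that] t(1)[of "Suc i"]] F_cmp[OF t(1)[of i] t(3)[OF that]] t(4)[OF that] that by simp
  then show ?thesis by (intro D.chain_mapI) (use t(1) F_mor in auto)
qed

lemma F_homotopic:
  assumes "X \<in> Ch C n" "Y \<in> Ch C n" "chain_map C n X Y g" "homotopic C n X Y f g"
  shows "homotopic D n (map_cpx F X) (map_cpx F Y) (\<lambda>i. Fmor F (f i)) (\<lambda>i. Fmor F (g i))"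
proof -
  obtain h where h: "hty C n X Y h" "\<And>i. i \<le> Suc n \<Longrightarrow> f i = g i \<boxplus>\<^bsub>C\<^esub> hb C n X Y h i" using assms(4) unfolding homotopic_iff by auto
  have t: "i \<le> Suc n \<Longrightarrow> g i \<in> Mor C (cob X i) (cob Y i)" "i \<le> n \<Longrightarrow> cdf X i \<in> Mor C (cob X i) (cob X (Suc i))"
    "i \<le> n \<Longrightarrow> cdf Y i \<in> Mor C (cob Y i) (cob Y (Suc i))" "i \<le> n \<Longrightarrow> h (Suc i) \<in> Mor C (cob X (Suc i)) (cob Y i)"
    "i \<le> Suc n \<Longrightarrow> hb C n X Y h i \<in> Mor C (cob X i) (cob Y i)" for i
    using C.Ch_simps(1-4)[OF assms(1)] C.Ch_simps(1-4)[OF assms(2)] C.chain_map_simps(1-4)[OF assms(1-3)] C.hty_simps[OF h(1)] C.hb_typ[OF assms(1,2) h(1)] by (auto simp: C.in_Mor_iff)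
  have Fh: "hty D n (map_cpx F X) (map_cpx F Y) (\<lambda>i. Fmor F (h i))" by (rule D.htyI) (use t F_mor in auto)
  have "Fmor F (hb C n X Y h i) = hb D n (map_cpx F X) (map_cpx F Y) (\<lambda>i. Fmor F (h i)) i" if i: "i \<le> Suc n" for i
  proof (rule C.degree_cases[OF i])
    assume "i = 0" then show ?thesis using F_cmp[OF t(2)[of 0] t(4)[of 0]] by (simp add: hb_simps)
  next
    assume "i = Suc n" then show ?thesis using F_cmp[OF t(4)[of n] t(3)[of n]] by (simp add: hb_simps)
  next
    fix j assume "i = Suc j" "j < n"
    then show ?thesis using F_cmp[OF t(4)[of j] t(3)[of j]] F_cmp[OF t(2)[of "Suc j"] t(4)[of "Suc j"]]
        F_add[OF C.cmp_mor[OF t(4)[of j] t(3)[of j]] C.cmp_mor[OF t(2)[of "Suc j"] t(4)[of "Suc j"]]] by (simp add: hb_simps)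
  qed
  then have "Fmor F (f i) = Fmor F (g i) \<boxplus>\<^bsub>D\<^esub> hb D n (map_cpx F X) (map_cpx F Y) (\<lambda>i. Fmor F (h i)) i" if "i \<le> Suc n" for i
    using h(2)[OF that] F_add[OF t(1,5)[OF that]] that by simp
  with Fh show ?thesis unfolding homotopic_iff by auto
qed

lemma F_mapping_cone:
  assumes X: "X \<in> Ch C n" and Y: "Y \<in> Ch C n" and f: "chain_map C n X Y f" and n: "1 \<le> n" and M: "mapping_cone C n X Y f M"
  shows "mapping_cone D n (map_cpx F X) (map_cpx F Y) (\<lambda>i. Fmor F (f i)) (map_cpx F M)"
proof -
  obtain i1 i2 p1 p2 where m: "cob M 0 = cob X 1 \<and> cob M (n + 1) = cob Y (n + 1) \<and>
     (\<forall>i \<in> {1..n}. biproduct C (cob X (i + 1)) (cob Y i) (cob M i) (i1 i) (i2 i) (p1 i) (p2 i)) \<and>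
     cdf M 0 = (i1 1 \<cdot>\<^bsub>C\<^esub> Neg C (cob X 1) (cob X 2) (cdf X 1)) \<boxplus>\<^bsub>C\<^esub> (i2 1 \<cdot>\<^bsub>C\<^esub> f 1) \<and>
     (\<forall>i \<in> {1..<n}. cdf M i =
        (i1 (i + 1) \<cdot>\<^bsub>C\<^esub> Neg C (cob X (i + 1)) (cob X (i + 2)) (cdf X (i + 1)) \<cdot>\<^bsub>C\<^esub> p1 i) \<boxplus>\<^bsub>C\<^esub>
        (i2 (i + 1) \<cdot>\<^bsub>C\<^esub> f (i + 1) \<cdot>\<^bsub>C\<^esub> p1 i) \<boxplus>\<^bsub>C\<^esub>
        (i2 (i + 1) \<cdot>\<^bsub>C\<^esub> cdf Y i \<cdot>\<^bsub>C\<^esub> p2 i)) \<and>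
     cdf M n = (f (n + 1) \<cdot>\<^bsub>C\<^esub> p1 n) \<boxplus>\<^bsub>C\<^esub> (cdf Y n \<cdot>\<^bsub>C\<^esub> p2 n)"
    using M unfolding mapping_cone_def by blast
  have b: "biproduct C (cob X (i + 1)) (cob Y i) (cob M i) (i1 i) (i2 i) (p1 i) (p2 i)" if "i \<in> {1..n}" for i using m that by blast
  note bD = C.biproductD(1-4)[OF b]
  have t: "i \<le> n + 1 \<Longrightarrow> f i \<in> Mor C (cob X i) (cob Y i)" "i \<le> n \<Longrightarrow> cdf X i \<in> Mor C (cob X i) (cob X (i + 1))"
    "i \<le> n \<Longrightarrow> cdf Y i \<in> Mor C (cob Y i) (cob Y (i + 1))" for i
    using X Y f unfolding Ch_def chain_map_def by auto
  have Fm: "mor C f \<Longrightarrow> mor C g \<Longrightarrow> dm C g = cd C f \<Longrightarrow> Fmor F (g \<cdot>\<^bsub>C\<^esub> f) = Fmor F g \<cdot>\<^bsub>D\<^esub> Fmor F f" for f g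
    by (rule F_cmp) (auto simp: C.in_Mor_iff)
  have Fa: "mor C f \<Longrightarrow> mor C g \<Longrightarrow> dm C f = dm C g \<Longrightarrow> cd C f = cd C g \<Longrightarrow> Fmor F (f \<boxplus>\<^bsub>C\<^esub> g) = Fmor F f \<boxplus>\<^bsub>D\<^esub> Fmor F g" for f g
    by (rule F_add[of _ "dm C g" "cd C g"]) (auto simp: C.in_Mor_iff)
  have Fn: "mor C f \<Longrightarrow> dm C f = A \<Longrightarrow> cd C f = B \<Longrightarrow> Fmor F (Neg C A B f) = Neg D (Fob F A) (Fob F B) (Fmor F f)" for f A B
    by (rule F_neg) (auto simp: C.in_Mor_iff)
  note T = t[unfolded C.in_Mor_iff] bD[unfolded C.in_Mor_iff]
  have d0: "Fmor F (cdf M 0) = (Fmor F (i1 1) \<cdot>\<^bsub>D\<^esub> Neg D (Fob F (cob X 1)) (Fob F (cob X 2)) (Fmor F (cdf X 1))) \<boxplus>\<^bsub>D\<^esub> (Fmor F (i2 1) \<cdot>\<^bsub>D\<^esub> Fmor F (f 1))"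
    using m T(1-3)[of 1] T(4-7)[of 1] n by (simp add: Fm Fa Fn C.cmp_typ C.Neg_typ numeral_2_eq_2)
  have dn: "Fmor F (cdf M n) = (Fmor F (f (n + 1)) \<cdot>\<^bsub>D\<^esub> Fmor F (p1 n)) \<boxplus>\<^bsub>D\<^esub> (Fmor F (cdf Y n) \<cdot>\<^bsub>D\<^esub> Fmor F (p2 n))"
    using m T(1-3)[of n] T(1)[of "n+1"] T(4-7)[of n] n by (simp add: Fm Fa C.cmp_typ)
  have di: "Fmor F (cdf M i) =
        (Fmor F (i1 (i + 1)) \<cdot>\<^bsub>D\<^esub> Neg D (Fob F (cob X (i + 1))) (Fob F (cob X (i + 2))) (Fmor F (cdf X (i + 1))) \<cdot>\<^bsub>D\<^esub> Fmor F (p1 i)) \<boxplus>\<^bsub>D\<^esub>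
        (Fmor F (i2 (i + 1)) \<cdot>\<^bsub>D\<^esub> Fmor F (f (i + 1)) \<cdot>\<^bsub>D\<^esub> Fmor F (p1 i)) \<boxplus>\<^bsub>D\<^esub>
        (Fmor F (i2 (i + 1)) \<cdot>\<^bsub>D\<^esub> Fmor F (cdf Y i) \<cdot>\<^bsub>D\<^esub> Fmor F (p2 i))" if i: "i \<in> {1..<n}" for i
  proof -
    have "cdf M i =
        (i1 (i + 1) \<cdot>\<^bsub>C\<^esub> Neg C (cob X (i + 1)) (cob X (i + 2)) (cdf X (i + 1)) \<cdot>\<^bsub>C\<^esub> p1 i) \<boxplus>\<^bsub>C\<^esub>
        (i2 (i + 1) \<cdot>\<^bsub>C\<^esub> f (i + 1) \<cdot>\<^bsub>C\<^esub> p1 i) \<boxplus>\<^bsub>C\<^esub>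
        (i2 (i + 1) \<cdot>\<^bsub>C\<^esub> cdf Y i \<cdot>\<^bsub>C\<^esub> p2 i)" using m i by blast
    then show ?thesis using T(1-3)[of i] T(1-3)[of "i+1"] T(4-7)[of i] T(4-7)[of "i+1"] i by (simp add: Fm Fa Fn C.cmp_typ C.Neg_typ C.add_typ)
  qed
  have Fb: "\<forall>i \<in> {1..n}. biproduct D (Fob F (cob X (i + 1))) (Fob F (cob Y i)) (Fob F (cob M i)) (Fmor F (i1 i)) (Fmor F (i2 i)) (Fmor F (p1 i)) (Fmor F (p2 i))"
    using b F_biproduct by blast
  have c0: "Fob F (cob M 0) = Fob F (cob X 1)" "Fob F (cob M (n + 1)) = Fob F (cob Y (n + 1))" using m by auto
  show ?thesis unfolding mapping_cone_def map_cpx_simps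
    using c0 Fb d0 di dn
    by (intro exI[of _ "\<lambda>i. Fmor F (i1 i)"] exI[of _ "\<lambda>i. Fmor F (i2 i)"] exI[of _ "\<lambda>i. Fmor F (p1 i)"] exI[of _ "\<lambda>i. Fmor F (p2 i)"]) blast
qed

end

text \<open>The dual of (EA2), applied to \<delta> and its pushout along a, yields a cone whose
  first differential has the components \<open>cdf X 0\<close> and a. It is the last differential of
  the cone formed in the opposite category, and it realises \<delta> pulled back along the last
  differential of Y.\<close>

lemma (in n_exangulated_category) push_inflation:
  assumes n: "1 \<le> n" and X: "realises C n s Z A \<delta> X" and ob: "Z \<in> Ob C" and \<delta>: "\<delta> \<in> carrier (Ext E Z A)" and a: "a \<in> Mor C A B"
  obtains Q i j p q V \<sigma> U where "biproduct C (cob X 1) B Q i j p q" "V \<in> Ob C" "\<sigma> \<in> carrier (Ext E V A)"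
    "realises C n s V A \<sigma> U" "cob U 1 = Q" "cdf U 0 = (i \<cdot> cdf X 0) \<boxplus> (j \<cdot> a)"
proof -
  have AB: "A \<in> Ob C" "B \<in> Ob C" using mor_ob[OF a] by auto
  have pd: "push C E Z a \<delta> \<in> carrier (Ext E Z B)" using act_closed[OF idt_mor[OF ob] a \<delta>] by (simp add: push_def)
  obtain Y where Y: "realises C n s Z B (push C E Z a \<delta>) Y" using realised[OF ob AB(2) pd] by blast
  have oX: "realises (op_cat C) n (op_realisation n s) A Z \<delta> (op_cpx n X)"
    using realises_op[OF n ob AB(1) \<delta>] realises_agree[OF n ob AB(1) \<delta> X] agree_sym[OF agree_op_op] by blast
  have oY: "realises (op_cat C) n (op_realisation n s) B Z (push C E Z a \<delta>) (op_cpx n Y)"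
    using realises_op[OF n ob AB(2) pd] realises_agree[OF n ob AB(2) pd Y] agree_sym[OF agree_op_op] by blast
  let ?\<sigma> = "pull C E A (cdf Y n) \<delta>"
  note y = realises_Ch[OF Y] note x = realises_Ch[OF X]
  obtain f M where M: "chain_map (op_cat C) n (op_cpx n Y) (op_cpx n X) f" "f (n + 1) = a"
      "mapping_cone (op_cat C) n (op_cpx n Y) (op_cpx n X) f M"
      "realises (op_cat C) n (op_realisation n s) A (cob Y n) ?\<sigma> M"
    using EA2_op[unfolded EA2_def, rule_format, of Z a B A \<delta> "op_cpx n Y" "op_cpx n X"] ob a \<delta> oX oY by auto
  have yn: "cob Y n \<in> Ob C" "cdf Y n \<in> Mor C (cob Y n) Z" using Ch_simps(1-4)[of Y n n] y by (auto simp: in_Mor_iff)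
  have \<sigma>: "?\<sigma> \<in> carrier (Ext E (cob Y n) A)" using act_closed[OF yn(2) idt_mor[OF AB(1)] \<delta>] by (simp add: pull_def)
  have U: "realises C n s (cob Y n) A ?\<sigma> (op_cpx n M)" using realises_op[OF n yn(1) AB(1) \<sigma>] M(4) by simp
  obtain i1 i2 p1 p2 where c: "\<forall>i \<in> {1..n}. biproduct (op_cat C) (cob (op_cpx n Y) (i + 1)) (cob (op_cpx n X) i) (cob M i) (i1 i) (i2 i) (p1 i) (p2 i)"
     "cdf M n = (f (n + 1) \<cdot>\<^bsub>op_cat C\<^esub> p1 n) \<boxplus>\<^bsub>op_cat C\<^esub> (cdf (op_cpx n X) n \<cdot>\<^bsub>op_cat C\<^esub> p2 n)"
    using M(3) unfolding mapping_cone_def by blast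
  have "biproduct (op_cat C) (cob (op_cpx n Y) (n + 1)) (cob (op_cpx n X) n) (cob M n) (i1 n) (i2 n) (p1 n) (p2 n)" using c(1)[rule_format, of n] n by simp
  then have b: "biproduct C B (cob X 1) (cob M n) (p1 n) (p2 n) (i1 n) (i2 n)" using y by (simp add: biproduct_op)
  note bb = biproductD[OF b]
  have "cdf (op_cpx n M) 0 = (p2 n \<cdot> cdf X 0) \<boxplus> (p1 n \<cdot> a)"
    using c(2) M(2) bb(1,2) a x Ch_simps(2-4)[of X n 0] add_comm[of "p1 n \<cdot> a" "p2 n \<cdot> cdf X 0"] by (simp add: cat_simps)
  then show thesis using that[OF biproduct_swap[OF b] yn(1) \<sigma> U] by simp
qed

section \<open>Realisations along a full embedding\<close>

definition image_realises where
  "image_realises C E n s F \<Phi> Z A \<delta> X \<longleftrightarrow> (\<exists>Z0 A0 \<delta>0 X0. Z0 \<in> Ob C \<and> A0 \<in> Ob C \<and> \<delta>0 \<in> carrier (Ext E Z0 A0) \<and> realises C n s Z0 A0 \<delta>0 X0 \<and>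
     Z = Fob F Z0 \<and> A = Fob F A0 \<and> \<delta> = \<Phi> Z0 A0 \<delta>0 \<and> X = map_cpx F X0)"

text \<open>The embedding satisfies conditions that are symmetric under reversal, so that the locale
  can be instantiated again in the opposite categories. \<open>compl_ex\<close> makes the image
  dense, and \<open>split_ex\<close> asks for complements of retractions only between objects of the
  image.\<close>

locale full_embedding = C: n_exangulated_category C E n s + D: biadditive_functor D G + add_functor C D F
    for C :: "('o, 'm) cat" and E :: "('o, 'm, 'x) bifunctor" and n s and D :: "('p, 'q) cat" and G :: "('p, 'q, 'y) bifunctor"
      and F :: "('o, 'm, 'p, 'q) cfunctor" +
  fixes \<Phi> :: "'o \<Rightarrow> 'o \<Rightarrow> 'x \<Rightarrow> 'y"
  assumes n_pos: "1 \<le> n"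
    and inj: "inj_on (Fob F) (Ob C)"
    and full: "A \<in> Ob C \<Longrightarrow> B \<in> Ob C \<Longrightarrow> g \<in> Mor D (Fob F A) (Fob F B) \<Longrightarrow> \<exists>f \<in> Mor C A B. g = Fmor F f"
    and faithful: "f \<in> Mor C A B \<Longrightarrow> f' \<in> Mor C A B \<Longrightarrow> Fmor F f = Fmor F f' \<Longrightarrow> f = f'"
    and \<Phi>_bij: "Z \<in> Ob C \<Longrightarrow> A \<in> Ob C \<Longrightarrow> bij_betw (\<Phi> Z A) (carrier (Ext E Z A)) (carrier (Ext G (Fob F Z) (Fob F A)))"
    and \<Phi>_hom: "Z \<in> Ob C \<Longrightarrow> A \<in> Ob C \<Longrightarrow> \<Phi> Z A \<in> hom (Ext E Z A) (Ext G (Fob F Z) (Fob F A))"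
    and \<Phi>_nat: "c \<in> Mor C W Z \<Longrightarrow> a \<in> Mor C A B \<Longrightarrow> \<delta> \<in> carrier (Ext E Z A) \<Longrightarrow>
      \<Phi> W B (Act E c a \<delta>) = Act G (Fmor F c) (Fmor F a) (\<Phi> Z A \<delta>)"
    and compl_ex: "P \<in> Ob D \<Longrightarrow> \<exists>A' T i j p q. compl D (Fob F ` Ob C) P A' T i j p q"
    and split_ex: "P \<in> Fob F ` Ob C \<Longrightarrow> Q \<in> Fob F ` Ob C \<Longrightarrow> u \<in> Mor D Q P \<Longrightarrow> v \<in> Mor D P Q \<Longrightarrow> v \<cdot>\<^bsub>D\<^esub> u = Idt D Q \<Longrightarrow>
      \<exists>K i p. biproduct D K Q P i u p v"
begin

lemma \<Phi>_closed: "Z \<in> Ob C \<Longrightarrow> A \<in> Ob C \<Longrightarrow> \<delta> \<in> carrier (Ext E Z A) \<Longrightarrow> \<Phi> Z A \<delta> \<in> carrier (Ext G (Fob F Z) (Fob F A))"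
  using \<Phi>_bij bij_betwE by blast

lemma \<Phi>_one: "Z \<in> Ob C \<Longrightarrow> A \<in> Ob C \<Longrightarrow> \<Phi> Z A \<one>\<^bsub>Ext E Z A\<^esub> = \<one>\<^bsub>Ext G (Fob F Z) (Fob F A)\<^esub>"
  using group_hom.hom_one[OF group_hom.intro[OF C.ext_group' D.ext_group' group_hom_axioms.intro]] \<Phi>_hom F_ob by metis

lemma \<Phi>_inj: "Z \<in> Ob C \<Longrightarrow> A \<in> Ob C \<Longrightarrow> \<delta> \<in> carrier (Ext E Z A) \<Longrightarrow> \<delta>' \<in> carrier (Ext E Z A) \<Longrightarrow> \<Phi> Z A \<delta> = \<Phi> Z A \<delta>' \<Longrightarrow> \<delta> = \<delta>'"
  using \<Phi>_bij bij_betw_imp_inj_on inj_onD by metis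

lemma \<Phi>_one_iff: "Z \<in> Ob C \<Longrightarrow> A \<in> Ob C \<Longrightarrow> \<delta> \<in> carrier (Ext E Z A) \<Longrightarrow> \<Phi> Z A \<delta> = \<one>\<^bsub>Ext G (Fob F Z) (Fob F A)\<^esub> \<Longrightarrow> \<delta> = \<one>\<^bsub>Ext E Z A\<^esub>"
  using \<Phi>_inj[of Z A \<delta> "\<one>\<^bsub>Ext E Z A\<^esub>"] \<Phi>_one monoid.one_closed[OF group.is_monoid[OF C.ext_group']] by metis

lemma F_zero_imp: "f \<in> Mor C A B \<Longrightarrow> Fmor F f = Zer D (Fob F A) (Fob F B) \<Longrightarrow> f = Zer C A B"
  using faithful[of f A B "Zer C A B"] F_zer C.Zer_mor C.mor_ob by metis

lemma ex_summand: "P \<in> Ob D \<Longrightarrow> \<exists>T T' i j p q. T \<in> Ob C \<and> biproduct D P T' (Fob F T) i j p q"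
  using compl_ex[of P] unfolding compl_def by blast

text \<open>The test object P may lie outside the image, but it is a summand of some
  \<open>Fob F T\<close>. Composing with the inclusion moves the problem into C by fullness; the
  factor found there is sent back and composed with the projection.\<close>

lemma F_cexact:
  assumes X: "X \<in> Ch C n" and ce: "cexact C n X"
  shows "cexact D n (map_cpx F X)"
proof -
  have tX: "i \<le> Suc n \<Longrightarrow> cob X i \<in> Ob C" "i \<le> n \<Longrightarrow> cdf X i \<in> Mor C (cob X i) (cob X (Suc i))" for i
    using C.Ch_simps(1-4)[OF X] by (auto simp: C.in_Mor_iff)
  show "cexact D n (map_cpx F X)" unfolding cexact_def
  proof (intro allI ballI impI)
    fix k P u assume k: "k < n" and u: "u \<in> Mor D (cob (map_cpx F X) (Suc k)) P" "u \<cdot>\<^bsub>D\<^esub> cdf (map_cpx F X) k = Zer D (cob (map_cpx F X) k) P"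
    have P: "P \<in> Ob D" using u D.mor_ob by blast
    obtain T T' i j p q where b: "T \<in> Ob C" "biproduct D P T' (Fob F T) i j p q" using ex_summand[OF P] by blast
    note bb = D.biproductD[OF b(2)]
    note tm = F_mor[OF tX(2)[of k], unfolded D.in_Mor_iff] F_mor[OF tX(2)[of "Suc k"], unfolded D.in_Mor_iff] u(1)[unfolded D.in_Mor_iff] bb(1-4)[unfolded D.in_Mor_iff]
    obtain u0 where u0: "u0 \<in> Mor C (cob X (Suc k)) T" "i \<cdot>\<^bsub>D\<^esub> u = Fmor F u0"
      using full[OF tX(1)[of "Suc k"] b(1), of "i \<cdot>\<^bsub>D\<^esub> u"] tm k by (auto simp: D.cat_simps)
    have "Fmor F (u0 \<cdot>\<^bsub>C\<^esub> cdf X k) = i \<cdot>\<^bsub>D\<^esub> (u \<cdot>\<^bsub>D\<^esub> cdf (map_cpx F X) k)"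
      using F_cmp[OF tX(2)[of k] u0(1)] u0(2)[symmetric] k tm by (simp add: D.cat_simps)
    also have "\<dots> = Zer D (Fob F (cob X k)) (Fob F T)" unfolding u(2) using tm F_ob[OF tX(1)[of k]] k by (simp add: D.add_simps)
    finally have "u0 \<cdot>\<^bsub>C\<^esub> cdf X k = Zer C (cob X k) T" using F_zero_imp C.cmp_mor[OF tX(2)[of k] u0(1)] k by simp
    then obtain w0 where w0: "w0 \<in> Mor C (cob X (Suc (Suc k))) T" "u0 = w0 \<cdot>\<^bsub>C\<^esub> cdf X (Suc k)"
      using ce k u0(1) unfolding cexact_def by blast
    have Fw: "mor D (Fmor F w0)" "dm D (Fmor F w0) = Fob F (cob X (Suc (Suc k)))" "cd D (Fmor F w0) = Fob F T" using F_mor[OF w0(1)] by (auto simp: D.in_Mor_iff)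
    have "u = p \<cdot>\<^bsub>D\<^esub> (i \<cdot>\<^bsub>D\<^esub> u)" using D.eqR[OF bb(5), of u] tm by (simp add: D.cat_simps)
    also have "\<dots> = (p \<cdot>\<^bsub>D\<^esub> Fmor F w0) \<cdot>\<^bsub>D\<^esub> cdf (map_cpx F X) (Suc k)"
      unfolding u0(2) unfolding w0(2) using F_cmp[OF tX(2)[of "Suc k"] w0(1)] k tm Fw by (simp add: D.cat_simps)
    finally show "\<exists>w \<in> Mor D (cob (map_cpx F X) (Suc (Suc k))) P. u = w \<cdot>\<^bsub>D\<^esub> cdf (map_cpx F X) (Suc k)"
      using tm Fw by (intro bexI[of _ "p \<cdot>\<^bsub>D\<^esub> Fmor F w0"]) (auto simp: D.cat_simps)
  qed
qed

text \<open>The device of \<open>F_cexact\<close> at the extension group, with injectivity of \<Phi>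
  detecting that the extension vanishes. It is stated for a single morphism f, so that the opposite
  instance yields the condition at the other end.\<close>

lemma F_factor:
  assumes Z: "Z \<in> Ob C" and A: "A \<in> Ob C" and \<delta>: "\<delta> \<in> carrier (Ext E Z A)" and f: "f \<in> Mor C A B"
    and x: "\<And>u Y. u \<in> Mor C A Y \<Longrightarrow> Act E (Idt C Z) u \<delta> = \<one>\<^bsub>Ext E Z Y\<^esub> \<Longrightarrow> \<exists>w \<in> Mor C B Y. u = w \<cdot>\<^bsub>C\<^esub> f"
    and u: "u \<in> Mor D (Fob F A) P" "Act G (Idt D (Fob F Z)) u (\<Phi> Z A \<delta>) = \<one>\<^bsub>Ext G (Fob F Z) P\<^esub>"
  shows "\<exists>w \<in> Mor D (Fob F B) P. u = w \<cdot>\<^bsub>D\<^esub> Fmor F f"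
proof -
  have P: "P \<in> Ob D" using u D.mor_ob by blast
  obtain T T' i j p q where b: "T \<in> Ob C" "biproduct D P T' (Fob F T) i j p q" using ex_summand[OF P] by blast
  note bb = D.biproductD[OF b(2)]
  note tm = F_mor[OF f, unfolded D.in_Mor_iff] u(1)[unfolded D.in_Mor_iff] bb(1-4)[unfolded D.in_Mor_iff]
  obtain u0 where u0: "u0 \<in> Mor C A T" "i \<cdot>\<^bsub>D\<^esub> u = Fmor F u0"
    using full[OF A b(1), of "i \<cdot>\<^bsub>D\<^esub> u"] tm by (auto simp: D.cat_simps)
  have idZ: "Idt D (Fob F Z) \<in> Mor D (Fob F Z) (Fob F Z)" using D.idt_mor F_ob[OF Z] by blast
  have "\<Phi> Z T (Act E (Idt C Z) u0 \<delta>) = Act G (Idt D (Fob F Z)) (i \<cdot>\<^bsub>D\<^esub> u) (\<Phi> Z A \<delta>)"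
    using \<Phi>_nat[OF C.idt_mor[OF Z] u0(1) \<delta>] F_idt[OF Z] u0(2) by simp
  also have "\<dots> = Act G (Idt D (Fob F Z)) i (Act G (Idt D (Fob F Z)) u (\<Phi> Z A \<delta>))"
    using D.act_act[OF idZ idZ u(1) bb(1) \<Phi>_closed[OF Z A \<delta>]] idZ by (simp add: D.cmp_idt)
  also have "\<dots> = \<one>\<^bsub>Ext G (Fob F Z) (Fob F T)\<^esub>" unfolding u(2) by (rule D.act_one[OF idZ bb(1)])
  finally have "Act E (Idt C Z) u0 \<delta> = \<one>\<^bsub>Ext E Z T\<^esub>" using \<Phi>_one_iff[OF Z b(1) C.act_closed[OF C.idt_mor[OF Z] u0(1) \<delta>]] by simp
  then obtain w0 where w0: "w0 \<in> Mor C B T" "u0 = w0 \<cdot>\<^bsub>C\<^esub> f" using x[OF u0(1)] by blast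
  have Fw: "mor D (Fmor F w0)" "dm D (Fmor F w0) = Fob F B" "cd D (Fmor F w0) = Fob F T" using F_mor[OF w0(1)] by (auto simp: D.in_Mor_iff)
  have "u = p \<cdot>\<^bsub>D\<^esub> (i \<cdot>\<^bsub>D\<^esub> u)" using D.eqR[OF bb(5), of u] tm by (simp add: D.cat_simps)
  also have "\<dots> = (p \<cdot>\<^bsub>D\<^esub> Fmor F w0) \<cdot>\<^bsub>D\<^esub> Fmor F (f)"
    unfolding u0(2) unfolding w0(2) using F_cmp[OF f w0(1)] tm Fw by (simp add: D.cat_simps)
  finally show ?thesis using tm Fw by (intro bexI[of _ "p \<cdot>\<^bsub>D\<^esub> Fmor F w0"]) (auto simp: D.cat_simps)
qed

end

lemma full_embedding_op:
  assumes "full_embedding C E n s D G F \<Phi>"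
  shows "full_embedding (op_cat C) (op_bifunctor E) n (op_realisation n s) (op_cat D) (op_bifunctor G) F (\<lambda>Z A. \<Phi> A Z)"
proof -
  interpret full_embedding C E n s D G F \<Phi> by fact
  have o: "n_exangulated_category (op_cat C) (op_bifunctor E) n (op_realisation n s)" by (rule n_exangulated_category_op[OF C.n_exangulated_category_axioms n_pos])
  have d: "biadditive_functor (op_cat D) (op_bifunctor G)" by (rule biadditive_functor_op[OF D.biadditive_functor_axioms])
  have a: "additive_functor (op_cat C) (op_cat D) F" using additive unfolding additive_functor_def by simp
  show ?thesis
  proof (intro full_embedding.intro full_embedding_axioms.intro add_functor.intro add_functor_axioms.intro o d a n_pos
      additive_category_op C.additive_category_axioms D.additive_category_axioms)
    show "inj_on (Fob F) (Ob (op_cat C))" using inj by simp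
  next
    fix A B g assume "A \<in> Ob (op_cat C)" "B \<in> Ob (op_cat C)" "g \<in> Mor (op_cat D) (Fob F A) (Fob F B)"
    then show "\<exists>f\<in>Mor (op_cat C) A B. g = Fmor F f" using full[of B A g] by simp
  next
    fix f A B f' assume "f \<in> Mor (op_cat C) A B" "f' \<in> Mor (op_cat C) A B" "Fmor F f = Fmor F f'"
    then show "f = f'" using faithful[of f B A f'] by simp
  next
    fix Z A assume "Z \<in> Ob (op_cat C)" "A \<in> Ob (op_cat C)"
    then show "bij_betw (\<Phi> A Z) (carrier (Ext (op_bifunctor E) Z A)) (carrier (Ext (op_bifunctor G) (Fob F Z) (Fob F A)))"
      "\<Phi> A Z \<in> hom (Ext (op_bifunctor E) Z A) (Ext (op_bifunctor G) (Fob F Z) (Fob F A))"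
      using \<Phi>_bij[of A Z] \<Phi>_hom[of A Z] by simp_all
  next
    fix c W Z a A B \<delta> assume "c \<in> Mor (op_cat C) W Z" "a \<in> Mor (op_cat C) A B" "\<delta> \<in> carrier (Ext (op_bifunctor E) Z A)"
    then show "\<Phi> B W (Act (op_bifunctor E) c a \<delta>) = Act (op_bifunctor G) (Fmor F c) (Fmor F a) (\<Phi> A Z \<delta>)"
      using \<Phi>_nat[of a B A c Z W \<delta>] by simp
  next
    fix P assume "P \<in> Ob (op_cat D)"
    then obtain A' T i j p q where "compl D (Fob F ` Ob C) P A' T i j p q" using compl_ex[of P] by auto
    then show "\<exists>A' T i j p q. compl (op_cat D) (Fob F ` Ob (op_cat C)) P A' T i j p q" unfolding compl_op op_cat_simps by blast
  next
    fix P Q u v assume "P \<in> Fob F ` Ob (op_cat C)" "Q \<in> Fob F ` Ob (op_cat C)" "u \<in> Mor (op_cat D) Q P" "v \<in> Mor (op_cat D) P Q"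
      "v \<cdot>\<^bsub>op_cat D\<^esub> u = Idt (op_cat D) Q"
    then obtain K i p where "biproduct D K Q P i v p u" using split_ex[of P Q v u] by auto
    then show "\<exists>K i p. biproduct (op_cat D) K Q P i u p v" unfolding biproduct_op by blast
  qed
qed

context full_embedding begin

lemma F_exangle:
  assumes Z: "Z \<in> Ob C" and A: "A \<in> Ob C" and \<delta>: "\<delta> \<in> carrier (Ext E Z A)" and X: "exangle C E n X \<delta>" and ends: "cob X 0 = A" "cob X (Suc n) = Z"
  shows "exangle D G n (map_cpx F X) (\<Phi> Z A \<delta>)"
proof -
  interpret O: full_embedding "op_cat C" "op_bifunctor E" n "op_realisation n s" "op_cat D" "op_bifunctor G" F "\<lambda>Z A. \<Phi> A Z"
    by (rule full_embedding_op[OF full_embedding_axioms])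
  note x = C.exangleD[OF X]
  have tX: "i \<le> Suc n \<Longrightarrow> cob X i \<in> Ob C" "i \<le> n \<Longrightarrow> cdf X i \<in> Mor C (cob X i) (cob X (Suc i))" for i
    using C.Ch_simps(1-4)[OF x(1)] by (auto simp: C.in_Mor_iff)
  have "dexact C n (op_cpx n (op_cpx n X))" "op_cpx n (op_cpx n X) \<in> Ch C n"
    using agree_dexact[OF agree_sym[OF agree_op_op] x(6)] agree_Ch[OF agree_sym[OF agree_op_op] x(1)] .
  then have de: "dexact D n (map_cpx F X)"
    using O.F_cexact[of "op_cpx n X"] agree_dexact[OF agree_op_op, of D n "map_cpx F X"] by (simp add: Ch_op cexact_op map_cpx_op)
  have d: "\<Phi> Z A \<delta> \<in> carrier (Ext G (Fob F Z) (Fob F A))" by (rule \<Phi>_closed[OF Z A \<delta>])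
  have d0: "cdf X 0 \<in> Mor C A (cob X (Suc 0))" and dn: "cdf X n \<in> Mor C (cob X n) Z" using tX(2)[of 0] tX(2)[of n] ends by auto
  have 1: "Act G (Idt D (Fob F Z)) (Fmor F (cdf X 0)) (\<Phi> Z A \<delta>) = \<one>\<^bsub>Ext G (Fob F Z) (Fob F (cob X (Suc 0)))\<^esub>"
    using \<Phi>_nat[OF C.idt_mor[OF Z] d0 \<delta>] x(3) F_idt[OF Z] \<Phi>_one[OF Z tX(1)[of "Suc 0"]] ends n_pos by simp
  have 2: "Act G (Fmor F (cdf X n)) (Idt D (Fob F A)) (\<Phi> Z A \<delta>) = \<one>\<^bsub>Ext G (Fob F (cob X n)) (Fob F A)\<^esub>"
    using \<Phi>_nat[OF dn C.idt_mor[OF A] \<delta>] x(4) F_idt[OF A] \<Phi>_one[OF tX(1)[of n] A] ends n_pos by simp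
  have 3: "\<exists>w \<in> Mor D P (Fob F (cob X n)). u = Fmor F (cdf X n) \<cdot>\<^bsub>D\<^esub> w" if "u \<in> Mor D P (Fob F Z)" "Act G u (Idt D (Fob F A)) (\<Phi> Z A \<delta>) = \<one>\<^bsub>Ext G P (Fob F A)\<^esub>" for P u
    using O.F_factor[of A Z \<delta> "cdf X n" "cob X n" u P] x(7) that A Z \<delta> dn ends by simp
  have 4: "\<exists>w \<in> Mor D (Fob F (cob X (Suc 0))) P. u = w \<cdot>\<^bsub>D\<^esub> Fmor F (cdf X 0)" if "u \<in> Mor D (Fob F A) P" "Act G (Idt D (Fob F Z)) u (\<Phi> Z A \<delta>) = \<one>\<^bsub>Ext G (Fob F Z) P\<^esub>" for P u
    using F_factor[OF Z A \<delta> d0 _ that] x(8) ends by simp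
  show ?thesis unfolding D.exangle_iff' push_def pull_def map_cpx_simps ends
    using F_Ch[OF x(1)] d 1 2 3 4 F_cexact[OF x(1,5)] de by blast
qed

text \<open>Each condition is an axiom of C. Fullness and surjectivity of \<Phi> pull the data back
  to C, faithfulness and injectivity pull equations back, and F carries the resulting complexes and
  cones forward.\<close>

lemma dense_realisation_image: "dense_realisation D G n (Fob F ` Ob C) (image_realises C E n s F \<Phi>)"
proof (intro dense_realisation.intro dense_realisation_axioms.intro D.biadditive_functor_axioms n_pos)
  show "Fob F ` Ob C \<subseteq> Ob D" using F_ob by blast
  show "\<exists>Z\<in>Fob F ` Ob C. zero_object D Z"
  proof -
    obtain Z where Z: "zero_object C Z" using C.ex_zero by (elim exE)
    then have "Z \<in> Ob C" unfolding zero_object_def by (elim conjunct1)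
    then show ?thesis using F_zero[OF Z] by (intro bexI[of _ "Fob F Z"]) auto
  qed
  fix A B assume "A \<in> Fob F ` Ob C" "B \<in> Fob F ` Ob C"
  then obtain A0 B0 where a: "A0 \<in> Ob C" "B0 \<in> Ob C" "A = Fob F A0" "B = Fob F B0" by blast
  obtain P i j p q where b: "biproduct C A0 B0 P i j p q" using C.ex_biproduct[OF a(1,2)] by (elim exE)
  show "\<exists>P\<in>Fob F ` Ob C. \<exists>i j p q. biproduct D A B P i j p q" using F_biproduct[OF b] C.biproductD(12)[OF b] a(3,4) by (metis imageI)
next
  show "\<And>A. A \<in> Ob D \<Longrightarrow> \<exists>A' T i j p q. compl D (Fob F ` Ob C) A A' T i j p q" by (rule compl_ex)
  show "\<And>P B u v. P \<in> Fob F ` Ob C \<Longrightarrow> B \<in> Fob F ` Ob C \<Longrightarrow> u \<in> Mor D B P \<Longrightarrow> v \<in> Mor D P B \<Longrightarrow> v \<cdot>\<^bsub>D\<^esub> u = Idt D B \<Longrightarrow> \<exists>K i p. biproduct D K B P i u p v"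
    by (rule split_ex)
next
  fix Z A \<delta> X assume r: "image_realises C E n s F \<Phi> Z A \<delta> X"
  then obtain Z0 A0 \<delta>0 X0 where x: "Z0 \<in> Ob C" "A0 \<in> Ob C" "\<delta>0 \<in> carrier (Ext E Z0 A0)" "realises C n s Z0 A0 \<delta>0 X0"
     "Z = Fob F Z0" "A = Fob F A0" "\<delta> = \<Phi> Z0 A0 \<delta>0" "X = map_cpx F X0" unfolding image_realises_def by blast
  note xc = realises_Ch[OF x(4)]
  show "Z \<in> Fob F ` Ob C \<and> A \<in> Fob F ` Ob C \<and> \<delta> \<in> carrier (Ext G Z A)" using x \<Phi>_closed by auto
  show "X \<in> Ch D n \<and> cob X 0 = A \<and> cob X (Suc n) = Z \<and> (\<forall>i\<le>Suc n. cob X i \<in> Fob F ` Ob C)"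
    using x xc F_Ch C.Ch_simps(1)[of X0 n] by auto
  show "exangle D G n X \<delta>" unfolding x using F_exangle[OF x(1-3) C.R1[OF x(1-4)]] xc by simp
  fix W B \<rho> Y a c assume r': "image_realises C E n s F \<Phi> W B \<rho> Y" and a: "a \<in> Mor D A B" and c: "c \<in> Mor D Z W" and e: "Act G (Idt D Z) a \<delta> = Act G c (Idt D B) \<rho>"
  obtain W1 B0 \<rho>0 Y0 where y: "W1 \<in> Ob C" "B0 \<in> Ob C" "\<rho>0 \<in> carrier (Ext E W1 B0)" "realises C n s W1 B0 \<rho>0 Y0"
     "W = Fob F W1" "B = Fob F B0" "\<rho> = \<Phi> W1 B0 \<rho>0" "Y = map_cpx F Y0" using r' unfolding image_realises_def by blast
  obtain a0 where a0: "a0 \<in> Mor C A0 B0" "a = Fmor F a0" using full[OF x(2) y(2)] a x y by blast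
  obtain c0 where c0: "c0 \<in> Mor C Z0 W1" "c = Fmor F c0" using full[OF x(1) y(1)] c x y by blast
  note iZ = C.idt_mor[OF x(1)] and iB = C.idt_mor[OF y(2)]
  have "\<Phi> Z0 B0 (Act E (Idt C Z0) a0 \<delta>0) = \<Phi> Z0 B0 (Act E c0 (Idt C B0) \<rho>0)"
    using e unfolding \<Phi>_nat[OF iZ a0(1) x(3)] \<Phi>_nat[OF c0(1) iB y(3)] x y a0(2) c0(2) F_idt[OF x(1)] F_idt[OF y(2)] by simp
  then have "push C E Z0 a0 \<delta>0 = pull C E B0 c0 \<rho>0" unfolding push_def pull_def
    using \<Phi>_inj[OF x(1) y(2) C.act_closed[OF iZ a0(1) x(3)] C.act_closed[OF c0(1) iB y(3)]] by blast
  then obtain f where f: "chain_map C n X0 Y0 f" "f 0 = a0" "f (n + 1) = c0" using C.R0[OF x(3) y(3) a0(1) c0(1) _ x(4) y(4)] by blast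
  show "\<exists>f. chain_map D n X Y f \<and> f 0 = a \<and> f (Suc n) = c"
    unfolding x y using F_chain_map[OF _ _ f(1)] xc realises_Ch[OF y(4)] f a0 c0 by (intro exI[of _ "\<lambda>i. Fmor F (f i)"]) auto
next
  fix Z A \<delta> assume "Z \<in> Fob F ` Ob C" "A \<in> Fob F ` Ob C" "\<delta> \<in> carrier (Ext G Z A)"
  then obtain Z0 A0 where x: "Z0 \<in> Ob C" "A0 \<in> Ob C" "Z = Fob F Z0" "A = Fob F A0" "\<delta> \<in> carrier (Ext G (Fob F Z0) (Fob F A0))" by blast
  then obtain \<delta>0 where "\<delta>0 \<in> carrier (Ext E Z0 A0)" "\<delta> = \<Phi> Z0 A0 \<delta>0" using \<Phi>_bij[OF x(1,2)] unfolding bij_betw_def by blast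
  then show "\<exists>X. image_realises C E n s F \<Phi> Z A \<delta> X" using C.realised[OF x(1,2)] x unfolding image_realises_def by blast
next
  fix Z A \<delta> X W \<rho> Y assume r: "image_realises C E n s F \<Phi> Z A \<delta> X" and r': "image_realises C E n s F \<Phi> W (cob X 1) \<rho> Y"
  obtain Z0 A0 \<delta>0 X0 where x: "Z0 \<in> Ob C" "A0 \<in> Ob C" "\<delta>0 \<in> carrier (Ext E Z0 A0)" "realises C n s Z0 A0 \<delta>0 X0"
     "Z = Fob F Z0" "A = Fob F A0" "\<delta> = \<Phi> Z0 A0 \<delta>0" "X = map_cpx F X0" using r unfolding image_realises_def by blast
  obtain W1 B0 \<rho>0 Y0 where y: "W1 \<in> Ob C" "B0 \<in> Ob C" "\<rho>0 \<in> carrier (Ext E W1 B0)" "realises C n s W1 B0 \<rho>0 Y0"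
     "W = Fob F W1" "cob X 1 = Fob F B0" "\<rho> = \<Phi> W1 B0 \<rho>0" "Y = map_cpx F Y0" using r' unfolding image_realises_def by blast
  note xc = realises_Ch[OF x(4)] and yc = realises_Ch[OF y(4)]
  \<comment> \<open>Injectivity on objects identifies the start of the second preimage with the
    degree 1 object of the first, so the two inflations are composable in C already.\<close>
  have B: "cob X0 (Suc 0) = B0" using y(6) x(8) inj y(2) C.Ch_simps(1)[of X0 n "Suc 0"] xc n_pos by (auto dest: inj_onD)
  have dX: "cdf X0 0 \<in> Mor C A0 B0" using C.Ch_simps(2-4)[of X0 n 0] xc B by (auto simp: C.in_Mor_iff)
  have dY: "cdf Y0 0 \<in> Mor C B0 (cob Y0 (Suc 0))" using C.Ch_simps(2-4)[of Y0 n 0] yc by (auto simp: C.in_Mor_iff)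
  have "inflation C E n s (cdf X0 0)" "inflation C E n s (cdf Y0 0)" unfolding inflation_def using x y by blast+
  then have "inflation C E n s (cdf Y0 0 \<cdot>\<^bsub>C\<^esub> cdf X0 0)" using C.EA1_inflation[OF dX dY] by blast
  then obtain V A1 \<sigma> U where u: "V \<in> Ob C" "A1 \<in> Ob C" "\<sigma> \<in> carrier (Ext E V A1)" "realises C n s V A1 \<sigma> U" "cdf Y0 0 \<cdot>\<^bsub>C\<^esub> cdf X0 0 = cdf U 0"
    unfolding inflation_def by blast
  note uc = realises_Ch[OF u(4)]
  have "cdf U 0 \<in> Mor C A1 (cob U (Suc 0))" using C.Ch_simps(2-4)[of U n 0] uc by (auto simp: C.in_Mor_iff)
  then have A1: "A1 = A0" "cob U (Suc 0) = cob Y0 (Suc 0)" using C.cmp_mor[OF dX dY] C.mor_disjoint u(5) by metis+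
  have "image_realises C E n s F \<Phi> (Fob F V) A (\<Phi> V A0 \<sigma>) (map_cpx F U)" unfolding image_realises_def using u x(6) A1 by blast
  moreover have "cdf (map_cpx F U) 0 = cdf Y 0 \<cdot>\<^bsub>D\<^esub> cdf X 0" using F_cmp[OF dX dY] u(5) x y by simp
  ultimately show "\<exists>V \<sigma> U. image_realises C E n s F \<Phi> V A \<sigma> U \<and> cob U 1 = cob Y 1 \<and> cdf U 0 = cdf Y 0 \<cdot>\<^bsub>D\<^esub> cdf X 0"
    using A1 y(8) by (intro exI[of _ "Fob F V"] exI[of _ "\<Phi> V A0 \<sigma>"] exI[of _ "map_cpx F U"]) simp
next
  fix Z A \<delta> X a B assume r: "image_realises C E n s F \<Phi> Z A \<delta> X" and a: "a \<in> Mor D A B" "B \<in> Fob F ` Ob C"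
  obtain Z0 A0 \<delta>0 X0 where x: "Z0 \<in> Ob C" "A0 \<in> Ob C" "\<delta>0 \<in> carrier (Ext E Z0 A0)" "realises C n s Z0 A0 \<delta>0 X0"
     "Z = Fob F Z0" "A = Fob F A0" "\<delta> = \<Phi> Z0 A0 \<delta>0" "X = map_cpx F X0" using r unfolding image_realises_def by blast
  obtain B0 where B0: "B0 \<in> Ob C" "B = Fob F B0" using a by blast
  obtain a0 where a0: "a0 \<in> Mor C A0 B0" "a = Fmor F a0" using full[OF x(2) B0(1), of a] a(1) unfolding x(6) B0(2) by blast
  obtain Q i j p q V \<sigma> U where u: "biproduct C (cob X0 1) B0 Q i j p q" "V \<in> Ob C" "\<sigma> \<in> carrier (Ext E V A0)"
    "realises C n s V A0 \<sigma> U" "cob U 1 = Q" "cdf U 0 = (i \<cdot>\<^bsub>C\<^esub> cdf X0 0) \<boxplus>\<^bsub>C\<^esub> (j \<cdot>\<^bsub>C\<^esub> a0)"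
    using C.push_inflation[OF n_pos x(4,1,3) a0(1)] by blast
  note b = C.biproductD[OF u(1)]
  have dX: "cdf X0 0 \<in> Mor C A0 (cob X0 1)" using C.Ch_simps(2-4)[of X0 n 0] realises_Ch[OF x(4)] by (auto simp: C.in_Mor_iff)
  have "Fmor F (cdf U 0) = (Fmor F i \<cdot>\<^bsub>D\<^esub> cdf X 0) \<boxplus>\<^bsub>D\<^esub> (Fmor F j \<cdot>\<^bsub>D\<^esub> a)"
    unfolding u(6) using F_add[OF C.cmp_mor[OF dX b(1)] C.cmp_mor[OF a0(1) b(2)]] F_cmp[OF dX b(1)] F_cmp[OF a0(1) b(2)] x(8) a0(2) by simp
  moreover have "image_realises C E n s F \<Phi> (Fob F V) A (\<Phi> V A0 \<sigma>) (map_cpx F U)" unfolding image_realises_def using u x(2,6) by blast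
  ultimately show "\<exists>Q i j p q V \<sigma> U. Q \<in> Fob F ` Ob C \<and> biproduct D (cob X 1) B Q i j p q \<and> image_realises C E n s F \<Phi> V A \<sigma> U \<and> cob U 1 = Q \<and>
           cdf U 0 = (i \<cdot>\<^bsub>D\<^esub> cdf X 0) \<boxplus>\<^bsub>D\<^esub> (j \<cdot>\<^bsub>D\<^esub> a)"
    using F_biproduct[OF u(1)] b(12) u(5) x(8) B0(2)
    by (intro exI[of _ "Fob F Q"] exI[of _ "Fmor F i"] exI[of _ "Fmor F j"] exI[of _ "Fmor F p"] exI[of _ "Fmor F q"] exI[of _ "Fob F V"] exI[of _ "\<Phi> V A0 \<sigma>"] exI[of _ "map_cpx F U"]) simp
next
  fix A c B D' \<delta> Y X assume A: "A \<in> Fob F ` Ob C" and c: "c \<in> Mor D B D'" and r: "image_realises C E n s F \<Phi> B A (Act G c (Idt D A) \<delta>) Y" and r': "image_realises C E n s F \<Phi> D' A \<delta> X"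
  obtain Z0 A0 \<delta>0 X0 where x: "Z0 \<in> Ob C" "A0 \<in> Ob C" "\<delta>0 \<in> carrier (Ext E Z0 A0)" "realises C n s Z0 A0 \<delta>0 X0"
     "D' = Fob F Z0" "A = Fob F A0" "\<delta> = \<Phi> Z0 A0 \<delta>0" "X = map_cpx F X0" using r' unfolding image_realises_def by blast
  obtain B0 A1 \<rho>0 Y0 where y: "B0 \<in> Ob C" "A1 \<in> Ob C" "\<rho>0 \<in> carrier (Ext E B0 A1)" "realises C n s B0 A1 \<rho>0 Y0"
     "B = Fob F B0" "A = Fob F A1" "Act G c (Idt D A) \<delta> = \<Phi> B0 A1 \<rho>0" "Y = map_cpx F Y0" using r unfolding image_realises_def by blast
  have A1: "A1 = A0" using x(2,6) y(2,6) inj by (auto dest: inj_onD)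
  obtain c0 where c0: "c0 \<in> Mor C B0 Z0" "c = Fmor F c0" using full[OF y(1) x(1)] c x y by blast
  note iA = C.idt_mor[OF x(2)]
  have "\<Phi> B0 A0 (Act E c0 (Idt C A0) \<delta>0) = \<Phi> B0 A0 \<rho>0"
    using y(7) unfolding \<Phi>_nat[OF c0(1) iA x(3)] x(6,7) A1 c0(2) F_idt[OF x(2)] by simp
  then have \<rho>: "\<rho>0 = pull C E A0 c0 \<delta>0" unfolding pull_def
    using \<Phi>_inj[OF y(1) x(2) C.act_closed[OF c0(1) iA x(3)]] y(3) A1 by blast
  obtain f M where M: "chain_map C n Y0 X0 f" "f 0 = Idt C A0" "f (n + 1) = c0" "mapping_cone C n Y0 X0 f M"
        "realises C n s Z0 (cob Y0 1) (push C E Z0 (cdf Y0 0) \<delta>0) M"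
    using C.EA2[unfolded EA2_def, rule_format, of A0 c0 B0 Z0 \<delta>0 Y0 X0] x y(4) c0(1) A1 \<rho> by blast
  note xc = realises_Ch[OF x(4)] and yc = realises_Ch[OF y(4)]
  have dY: "cdf Y0 0 \<in> Mor C A0 (cob Y0 1)" "cob Y0 1 \<in> Ob C" using C.Ch_simps(1-4)[of Y0 n 0] C.Ch_simps(1)[of Y0 n "Suc 0"] yc A1 n_pos by (auto simp: C.in_Mor_iff)
  note iZ = C.idt_mor[OF x(1)]
  have "image_realises C E n s F \<Phi> D' (cob Y 1) (Act G (Idt D D') (cdf Y 0) \<delta>) (map_cpx F M)" unfolding image_realises_def
    by (intro exI[of _ Z0] exI[of _ "cob Y0 1"] exI[of _ "push C E Z0 (cdf Y0 0) \<delta>0"] exI[of _ M])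
      (use x y(8) M(5) dY \<Phi>_nat[OF iZ dY(1) x(3)] F_idt[OF x(1)] C.act_closed[OF iZ dY(1) x(3)] in \<open>auto simp: push_def\<close>)
  then show "\<exists>f M. chain_map D n Y X f \<and> f 0 = Idt D A \<and> f (Suc n) = c \<and> mapping_cone D n Y X f M \<and>
           image_realises C E n s F \<Phi> D' (cob Y 1) (Act G (Idt D D') (cdf Y 0) \<delta>) M"
    using F_chain_map[OF _ _ M(1)] F_mapping_cone[OF _ _ M(1) n_pos M(4)] xc yc M(2,3) F_idt[OF x(2)] x(6,8) y(8) c0(2)
    by (intro exI[of _ "\<lambda>i. Fmor F (f i)"] exI[of _ "map_cpx F M"]) simp
qed

abbreviation "imr \<equiv> image_realises C E n s F \<Phi>"
abbreviation "imr_op \<equiv> image_realises (op_cat C) (op_bifunctor E) n (op_realisation n s) F (\<lambda>Z A. \<Phi> A Z)"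

lemma imr_op_imp: assumes "imr_op Z A \<delta> Y" shows "imr A Z \<delta> (op_cpx n Y)"
proof -
  obtain Z0 A0 \<delta>0 X0 where x: "Z0 \<in> Ob C" "A0 \<in> Ob C" "\<delta>0 \<in> carrier (Ext E A0 Z0)" "realises (op_cat C) n (op_realisation n s) Z0 A0 \<delta>0 X0"
     "Z = Fob F Z0" "A = Fob F A0" "\<delta> = \<Phi> A0 Z0 \<delta>0" "Y = map_cpx F X0" using assms unfolding image_realises_def by auto
  then have "realises C n s A0 Z0 \<delta>0 (op_cpx n X0)" using C.realises_op[OF n_pos x(2,1,3)] by blast
  then show ?thesis unfolding image_realises_def using x map_cpx_op[of F n X0] by metis
qed

lemma imr_imp_op: assumes "imr A Z \<delta> Y" shows "imr_op Z A \<delta> (op_cpx n Y)"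
proof -
  obtain Z0 A0 \<delta>0 X0 where x: "Z0 \<in> Ob C" "A0 \<in> Ob C" "\<delta>0 \<in> carrier (Ext E A0 Z0)" "realises C n s A0 Z0 \<delta>0 X0"
     "Z = Fob F Z0" "A = Fob F A0" "\<delta> = \<Phi> A0 Z0 \<delta>0" "Y = map_cpx F X0" using assms unfolding image_realises_def by auto
  then have "realises (op_cat C) n (op_realisation n s) Z0 A0 \<delta>0 (op_cpx n X0)"
    using C.realises_op[OF n_pos x(2,1,3)] C.realises_agree[OF n_pos x(2,1,3,4) agree_sym[OF agree_op_op]] by blast
  then show ?thesis unfolding image_realises_def using x map_cpx_op[of F n X0] by (metis op_bifunctor_simps(1) op_cat_simps(1))
qed

lemma n_exangulated_embedding:
  assumes r: "\<And>Z A \<delta>. Z \<in> Ob D \<Longrightarrow> A \<in> Ob D \<Longrightarrow> \<delta> \<in> carrier (Ext G Z A) \<Longrightarrow> r Z A \<delta> = Collect (summand_realises D G n (Fob F ` Ob C) imr Z A \<delta>)"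
  shows "n_exangulated_category D G n r" "weakly_idempotent_complete D" "n_exangulated_functor C E s D G r n F \<Phi>"
proof -
  interpret W: dense_realisation D G n "Fob F ` Ob C" imr by (rule dense_realisation_image)
  interpret O: full_embedding "op_cat C" "op_bifunctor E" n "op_realisation n s" "op_cat D" "op_bifunctor G" F "\<lambda>Z A. \<Phi> A Z"
    by (rule full_embedding_op[OF full_embedding_axioms])
  have o: "dense_realisation (op_cat D) (op_bifunctor G) n (Fob F ` Ob C) imr_op" using O.dense_realisation_image by simp
  show "n_exangulated_category D G n r" by (rule dense_realisation_n_exangulated[OF dense_realisation_image o imr_op_imp imr_imp_op r])
  show "weakly_idempotent_complete D" by (rule W.weakly_idempotent_complete)
  show "n_exangulated_functor C E s D G r n F \<Phi>" unfolding n_exangulated_functor_def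
  proof (intro conjI ballI allI impI additive \<Phi>_hom \<Phi>_nat)
    fix Z A \<delta> X assume x: "Z \<in> Ob C" "A \<in> Ob C" "\<delta> \<in> carrier (Ext E Z A)" "realises C n s Z A \<delta> X"
    then have "imr (Fob F Z) (Fob F A) (\<Phi> Z A \<delta>) (map_cpx F X)" unfolding image_realises_def by blast
    then show "realises D n r (Fob F Z) (Fob F A) (\<Phi> Z A \<delta>) (map_cpx F X)"
      using W.realises_rd[OF r F_ob[OF x(1)] F_ob[OF x(2)] \<Phi>_closed[OF x(1-3)]] W.R_rd by blast
  qed assumption+
qed

end

section \<open>The weak idempotent completion\<close>

lemma full_subcat_simps [simp]: "Ob (full_subcat C S) = Ob C \<inter> S"
    "f \<in> Mor (full_subcat C S) A B \<longleftrightarrow> A \<in> S \<and> B \<in> S \<and> f \<in> Mor C A B"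
    "Cmp (full_subcat C S) = Cmp C" "Idt (full_subcat C S) = Idt C" "Add (full_subcat C S) = Add C" "Zer (full_subcat C S) = Zer C"
  by (auto simp: full_subcat_def)

lemma HomG_full_subcat: "A \<in> S \<Longrightarrow> B \<in> S \<Longrightarrow> HomG (full_subcat C S) A B = HomG C A B"
  by (simp add: HomG_def full_subcat_def)

lemma biproduct_full_subcat: "biproduct (full_subcat C S) A B P i j p q \<longleftrightarrow> A \<in> S \<and> B \<in> S \<and> P \<in> S \<and> biproduct C A B P i j p q"
  by (auto simp: biproduct_def)

lemma category_full_subcat: assumes "category C" shows "category (full_subcat C S)"
proof -
  interpret category C by fact
  show ?thesis
    by (intro category.intro) (auto dest: mor_ob mor_disjoint intro: idt_mor cmp_mor cmp_assoc cmp_idt idt_cmp)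
qed

lemma additive_category_full_subcat:
  assumes "additive_category C" and Z: "zero_object C Z" "Z \<in> S"
    and b: "\<And>A B. A \<in> Ob C \<Longrightarrow> B \<in> Ob C \<Longrightarrow> A \<in> S \<Longrightarrow> B \<in> S \<Longrightarrow> \<exists>P i j p q. P \<in> S \<and> biproduct C A B P i j p q"
  shows "additive_category (full_subcat C S)"
proof -
  interpret additive_category C by fact
  show ?thesis
  proof (intro additive_category.intro additive_category_axioms.intro category_full_subcat category_axioms)
    show "\<And>A B. A \<in> Ob (full_subcat C S) \<Longrightarrow> B \<in> Ob (full_subcat C S) \<Longrightarrow> comm_group (HomG (full_subcat C S) A B)"
      using hom_group by (simp add: HomG_full_subcat)
    show "\<exists>Z. zero_object (full_subcat C S) Z" using Z unfolding zero_object_def by (intro exI[of _ Z]) simp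
    show "\<And>A B. A \<in> Ob (full_subcat C S) \<Longrightarrow> B \<in> Ob (full_subcat C S) \<Longrightarrow> \<exists>P i1 i2 p1 p2. biproduct (full_subcat C S) A B P i1 i2 p1 p2"
      using b unfolding biproduct_full_subcat by simp
  qed (simp_all, (use cmp_add add_cmp in blast)+)
qed

lemma biadditive_functor_full_subcat:
  assumes "biadditive_functor C E" "additive_category (full_subcat C S)" shows "biadditive_functor (full_subcat C S) E"
proof -
  interpret biadditive_functor C E by fact
  show ?thesis
  proof (intro biadditive_functor.intro biadditive_functor_axioms.intro assms(2))
    fix Z A \<delta> assume "Z \<in> Ob (full_subcat C S)" "A \<in> Ob (full_subcat C S)"
    then show "comm_group (Ext E Z A)" "\<delta> \<in> carrier (Ext E Z A) \<Longrightarrow> Act E (Idt (full_subcat C S) Z) (Idt (full_subcat C S) A) \<delta> = \<delta>"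
      by (simp_all add: ext_group act_idt)
  next
    fix c W Z a A B assume "c \<in> Mor (full_subcat C S) W Z" "a \<in> Mor (full_subcat C S) A B"
    then show "Act E c a \<in> hom (Ext E Z A) (Ext E W B)" by (simp add: act_hom)
  next
    fix c W Z c' V a A B a' D \<delta>
    assume "c \<in> Mor (full_subcat C S) W Z" "c' \<in> Mor (full_subcat C S) V W" "a \<in> Mor (full_subcat C S) A B" "a' \<in> Mor (full_subcat C S) B D"
      "\<delta> \<in> carrier (Ext E Z A)"
    then show "Act E (c \<cdot>\<^bsub>full_subcat C S\<^esub> c') (a' \<cdot>\<^bsub>full_subcat C S\<^esub> a) \<delta> = Act E c' a' (Act E c a \<delta>)"
      using act_cmp[of c W Z c' V a A B a' D \<delta>] by simp
  next
    fix c W Z c' a A B \<delta>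
    assume "c \<in> Mor (full_subcat C S) W Z" "c' \<in> Mor (full_subcat C S) W Z" "a \<in> Mor (full_subcat C S) A B" "\<delta> \<in> carrier (Ext E Z A)"
    then show "Act E (c \<boxplus>\<^bsub>full_subcat C S\<^esub> c') a \<delta> = Act E c a \<delta> \<otimes>\<^bsub>Ext E W B\<^esub> Act E c' a \<delta>"
      using act_add_left[of c W Z c' a A B \<delta>] by simp
  next
    fix c W Z a A B a' \<delta>
    assume "c \<in> Mor (full_subcat C S) W Z" "a \<in> Mor (full_subcat C S) A B" "a' \<in> Mor (full_subcat C S) A B" "\<delta> \<in> carrier (Ext E Z A)"
    then show "Act E c (a \<boxplus>\<^bsub>full_subcat C S\<^esub> a') \<delta> = Act E c a \<delta> \<otimes>\<^bsub>Ext E W B\<^esub> Act E c a' \<delta>"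
      using act_add_right[of c W Z a A B a' \<delta>] by simp
  qed
qed

lemma Ch_full_subcat: "X \<in> Ch (full_subcat C S) n \<longleftrightarrow> X \<in> Ch C n \<and> (\<forall>i \<le> Suc n. cob X i \<in> S)"
proof -
  have "\<And>i. i \<le> n \<Longrightarrow> cob X i \<in> S \<and> cob X (i + 1) \<in> S" if "\<forall>i \<le> Suc n. cob X i \<in> S" using that by simp
  then show ?thesis unfolding Ch_def mem_Collect_eq full_subcat_simps Suc_eq_plus1 by blast
qed

lemma chain_map_full_subcat:
  assumes "\<And>i. i \<le> Suc n \<Longrightarrow> cob X i \<in> S" "\<And>i. i \<le> Suc n \<Longrightarrow> cob Y i \<in> S"
  shows "chain_map (full_subcat C S) n X Y f \<longleftrightarrow> chain_map C n X Y f"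
  using assms by (simp add: chain_map_def)

lemma homotopic_full_subcat:
  assumes "\<And>i. i \<le> Suc n \<Longrightarrow> cob X i \<in> S" "\<And>i. i \<le> Suc n \<Longrightarrow> cob Y i \<in> S"
  shows "homotopic (full_subcat C S) n X Y f g \<longleftrightarrow> homotopic C n X Y f g"
proof -
  have "\<And>i. i \<in> {1..n+1} \<Longrightarrow> cob X i \<in> S \<and> cob Y (i - 1) \<in> S" using assms by auto
  then have "\<And>h. (\<forall>i\<in>{1..n + 1}. cob X i \<in> S \<and> cob Y (i - 1) \<in> S \<and> h i \<in> Mor C (cob X i) (cob Y (i - 1))) \<longleftrightarrow>
     (\<forall>i\<in>{1..n + 1}. h i \<in> Mor C (cob X i) (cob Y (i - 1)))" by blast
  then show ?thesis unfolding homotopic_def full_subcat_simps by simp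
qed

section \<open>The idempotent completion as an additive category with a biadditive functor\<close>

lemma idem_Ob [simp]: "(X, e) \<in> Ob (idem_cat C) \<longleftrightarrow> X \<in> Ob C \<and> e \<in> Mor C X X \<and> e \<cdot>\<^bsub>C\<^esub> e = e"
  by (simp add: idem_cat_def Let_def)

lemma idem_Mor: "f \<in> Mor (idem_cat C) (X, e) (Y, e') \<longleftrightarrow>
    (\<exists>r. f = (e', r, e) \<and> (X, e) \<in> Ob (idem_cat C) \<and> (Y, e') \<in> Ob (idem_cat C) \<and> r \<in> Mor C X Y \<and> r \<cdot>\<^bsub>C\<^esub> e = r \<and> e' \<cdot>\<^bsub>C\<^esub> r = r)"
  by (auto simp: idem_cat_def Let_def)

lemma idem_Mor3: "(b, r, a) \<in> Mor (idem_cat C) (X, e) (Y, e') \<longleftrightarrow> a = e \<and> b = e' \<and>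
   (X, e) \<in> Ob (idem_cat C) \<and> (Y, e') \<in> Ob (idem_cat C) \<and> r \<in> Mor C X Y \<and> r \<cdot>\<^bsub>C\<^esub> e = r \<and> e' \<cdot>\<^bsub>C\<^esub> r = r"
  by (auto simp: idem_Mor)

lemma idem_simps [simp]: "(e2, s, e1') \<cdot>\<^bsub>idem_cat C\<^esub> (e1, r, e) = (e2, s \<cdot>\<^bsub>C\<^esub> r, e)"
    "Idt (idem_cat C) (X, e) = (e, e, e)" "(e1, r, e) \<boxplus>\<^bsub>idem_cat C\<^esub> (e1', r', e') = (e1, r \<boxplus>\<^bsub>C\<^esub> r', e)"
    "Zer (idem_cat C) (X, e) (Y, e1) = (e1, Zer C X Y, e)"
  by (simp_all add: idem_cat_def Let_def)

lemma idem_MorE: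
  assumes "f \<in> Mor (idem_cat C) A B"
  obtains X e Y e' r where "A = (X, e)" "B = (Y, e')" "f = (e', r, e)" "X \<in> Ob C" "e \<in> Mor C X X" "e \<cdot>\<^bsub>C\<^esub> e = e"
    "Y \<in> Ob C" "e' \<in> Mor C Y Y" "e' \<cdot>\<^bsub>C\<^esub> e' = e'" "r \<in> Mor C X Y" "r \<cdot>\<^bsub>C\<^esub> e = r" "e' \<cdot>\<^bsub>C\<^esub> r = r"
  using assms by (cases A; cases B) (auto simp: idem_Mor)

context additive_category begin

lemma idem_biproduct:
  assumes b: "biproduct C A B P i j p q" and e: "e \<in> Mor C A A" "e \<cdot> e = e" and f: "f \<in> Mor C B B" "f \<cdot> f = f"
  shows "biproduct (idem_cat C) (A, e) (B, f) (P, i \<cdot> (e \<cdot> p) \<boxplus> j \<cdot> (f \<cdot> q))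
    (i \<cdot> (e \<cdot> p) \<boxplus> j \<cdot> (f \<cdot> q), i \<cdot> e, e) (i \<cdot> (e \<cdot> p) \<boxplus> j \<cdot> (f \<cdot> q), j \<cdot> f, f)
    (e, e \<cdot> p, i \<cdot> (e \<cdot> p) \<boxplus> j \<cdot> (f \<cdot> q)) (f, f \<cdot> q, i \<cdot> (e \<cdot> p) \<boxplus> j \<cdot> (f \<cdot> q))"
proof -
  note bb = biproductD[OF b]
  note t = bb(1-4)[unfolded in_Mor_iff] e(1)[unfolded in_Mor_iff] f(1)[unfolded in_Mor_iff]
  note q = e(2) f(2) bb(5-8) eqR[OF e(2)] eqR[OF f(2)] eqR[OF bb(5)] eqR[OF bb(6)] eqR[OF bb(7)] eqR[OF bb(8)]
  show ?thesis unfolding biproduct_def idem_Mor3 idem_Ob idem_simps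
    using bb(10-12) by (simp add: add_simps t q)
qed

lemma idem_zero: assumes "zero_object C Z" shows "zero_object (idem_cat C) (Z, Idt C Z)"
proof -
  have Z: "Z \<in> Ob C" using assms unfolding zero_object_def by (elim conjunct1)
  have 1: "f = Zer C A Z" if "f \<in> Mor C A Z" for f A using zero_object_unique(2)[OF assms that, of "Zer C A Z"] Zer_mor mor_ob[OF that] by blast
  have 2: "f = Zer C Z A" if "f \<in> Mor C Z A" for f A using zero_object_unique(3)[OF assms that, of "Zer C Z A"] Zer_mor mor_ob[OF that] by blast
  show ?thesis unfolding zero_object_def
  proof (intro conjI ballI)
    show "(Z, Idt C Z) \<in> Ob (idem_cat C)" using Z by (simp add: cat_simps)
    fix B assume B: "B \<in> Ob (idem_cat C)"
    obtain A e where A: "B = (A, e)" by (cases B)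
    have a: "A \<in> Ob C" "e \<in> Mor C A A" "e \<cdot> e = e" using B A by simp_all
    show "\<exists>!f. f \<in> Mor (idem_cat C) B (Z, Idt C Z)" unfolding A
    proof (rule ex1I[of _ "(Idt C Z, Zer C A Z, e)"])
      show "(Idt C Z, Zer C A Z, e) \<in> Mor (idem_cat C) (A, e) (Z, Idt C Z)" using a Z by (simp add: idem_Mor3 add_simps)
      fix f assume "f \<in> Mor (idem_cat C) (A, e) (Z, Idt C Z)"
      then show "f = (Idt C Z, Zer C A Z, e)" unfolding idem_Mor using 1 by blast
    qed
    show "\<exists>!f. f \<in> Mor (idem_cat C) (Z, Idt C Z) B" unfolding A
    proof (rule ex1I[of _ "(e, Zer C Z A, Idt C Z)"])
      show "(e, Zer C Z A, Idt C Z) \<in> Mor (idem_cat C) (Z, Idt C Z) (A, e)" using a Z by (simp add: idem_Mor3 add_simps)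
      fix f assume "f \<in> Mor (idem_cat C) (Z, Idt C Z) (A, e)"
      then show "f = (e, Zer C Z A, Idt C Z)" unfolding idem_Mor using 2 by blast
    qed
  qed
qed

lemma additive_category_idem: "additive_category (idem_cat C)"
proof (intro additive_category.intro additive_category_axioms.intro category.intro)
  fix A B f assume "f \<in> Mor (idem_cat C) A B"
  then show "A \<in> Ob (idem_cat C) \<and> B \<in> Ob (idem_cat C)" by (elim idem_MorE) simp
next
  fix A B f A' B' assume "f \<in> Mor (idem_cat C) A B" "f \<in> Mor (idem_cat C) A' B'"
  then show "A = A' \<and> B = B'" by (elim idem_MorE) (auto simp: in_Mor_iff)
next
  fix A assume "A \<in> Ob (idem_cat C)"
  then show "Idt (idem_cat C) A \<in> Mor (idem_cat C) A A" by (cases A) (simp add: idem_Mor3)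
next
  fix f A B g D assume "f \<in> Mor (idem_cat C) A B" "g \<in> Mor (idem_cat C) B D"
  then show "g \<cdot>\<^bsub>idem_cat C\<^esub> f \<in> Mor (idem_cat C) A D"
  proof (elim idem_MorE)
    fix X e Y e1 r Y' e1' Z e2 s assume *: "A = (X, e)" "B = (Y, e1)" "f = (e1, r, e)" "X \<in> Ob C" "e \<in> Mor C X X" "e \<cdot> e = e"
       "r \<in> Mor C X Y" "r \<cdot> e = r" "e1 \<cdot> r = r" "B = (Y', e1')" "D = (Z, e2)" "g = (e2, s, e1')" "Z \<in> Ob C"
       "e2 \<in> Mor C Z Z" "e2 \<cdot> e2 = e2" "s \<in> Mor C Y' Z" "s \<cdot> e1' = s" "e2 \<cdot> s = s"
    then show ?thesis using eqR[of e2 s s r] by (simp add: idem_Mor3 cat_simps)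
  qed
next
  fix f A B g D h F assume "f \<in> Mor (idem_cat C) A B" "g \<in> Mor (idem_cat C) B D" "h \<in> Mor (idem_cat C) D F"
  then show "(h \<cdot>\<^bsub>idem_cat C\<^esub> g) \<cdot>\<^bsub>idem_cat C\<^esub> f = h \<cdot>\<^bsub>idem_cat C\<^esub> (g \<cdot>\<^bsub>idem_cat C\<^esub> f)"
    by (elim idem_MorE) (auto simp: cat_simps)
next
  fix f A B assume "f \<in> Mor (idem_cat C) A B"
  then show "f \<cdot>\<^bsub>idem_cat C\<^esub> Idt (idem_cat C) A = f" "Idt (idem_cat C) B \<cdot>\<^bsub>idem_cat C\<^esub> f = f"
    by (elim idem_MorE; simp)+
next
  fix A B assume AB: "A \<in> Ob (idem_cat C)" "B \<in> Ob (idem_cat C)"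
  obtain X e Y e' where x: "A = (X, e)" "B = (Y, e')" by (cases A; cases B)
  have o: "X \<in> Ob C" "e \<in> Mor C X X" "e \<cdot> e = e" "Y \<in> Ob C" "e' \<in> Mor C Y Y" "e' \<cdot> e' = e'" using AB x by simp_all
  show "comm_group (HomG (idem_cat C) A B)" unfolding x
  proof (intro comm_groupI)
    fix f assume "f \<in> carrier (HomG (idem_cat C) (X, e) (Y, e'))"
    then obtain r where r: "f = (e', r, e)" "r \<in> Mor C X Y" "r \<cdot> e = r" "e' \<cdot> r = r" by (auto simp: HomG_def idem_Mor)
    obtain h where h: "h \<in> Mor C X Y" "r \<boxplus> h = Zer C X Y" using ex_neg[OF r(2)] by blast
    note t = h(1)[unfolded in_Mor_iff] r(2)[unfolded in_Mor_iff] o(2,5)[unfolded in_Mor_iff]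
    \<comment> \<open>The negative h of r, cut down by the idempotents on both sides so that it
      becomes a morphism of the completion. Since r is fixed by both idempotents, it is still a
      negative of r.\<close>
    have "e' \<cdot> ((r \<boxplus> h) \<cdot> e) = Zer C X Y" unfolding h(2) using t o by (simp add: add_simps)
    then have z: "(e' \<cdot> (h \<cdot> e)) \<boxplus> r = Zer C X Y" using t r(3,4) add_comm[of r "e' \<cdot> (h \<cdot> e)"] by (simp add: add_simps)
    show "\<exists>y\<in>carrier (HomG (idem_cat C) (X, e) (Y, e')). y \<otimes>\<^bsub>HomG (idem_cat C) (X, e) (Y, e')\<^esub> f = \<one>\<^bsub>HomG (idem_cat C) (X, e) (Y, e')\<^esub>"
      using o t z eqR[OF o(6)] by (intro bexI[of _ "(e', e' \<cdot> (h \<cdot> e), e)"]) (simp_all add: HomG_def r(1) idem_Mor3 add_simps)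
  next
    fix x y z assume "x \<in> carrier (HomG (idem_cat C) (X, e) (Y, e'))" "y \<in> carrier (HomG (idem_cat C) (X, e) (Y, e'))"
    then obtain r r1 where r: "x = (e', r, e)" "r \<in> Mor C X Y" "r \<cdot> e = r" "e' \<cdot> r = r"
      "y = (e', r1, e)" "r1 \<in> Mor C X Y" "r1 \<cdot> e = r1" "e' \<cdot> r1 = r1" by (auto simp: HomG_def idem_Mor)
    note t = r(2,6)[unfolded in_Mor_iff] o(2,5)[unfolded in_Mor_iff]
    show "x \<otimes>\<^bsub>HomG (idem_cat C) (X, e) (Y, e')\<^esub> y \<in> carrier (HomG (idem_cat C) (X, e) (Y, e'))"
      using o r t by (simp add: HomG_def idem_Mor3 add_simps)
    show "x \<otimes>\<^bsub>HomG (idem_cat C) (X, e) (Y, e')\<^esub> y = y \<otimes>\<^bsub>HomG (idem_cat C) (X, e) (Y, e')\<^esub> x"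
      using add_comm[of r r1] r(1,5) t by (simp add: HomG_def)
    assume "z \<in> carrier (HomG (idem_cat C) (X, e) (Y, e'))"
    then obtain r2 where r2: "z = (e', r2, e)" "r2 \<in> Mor C X Y" by (auto simp: HomG_def idem_Mor)
    show "x \<otimes>\<^bsub>HomG (idem_cat C) (X, e) (Y, e')\<^esub> y \<otimes>\<^bsub>HomG (idem_cat C) (X, e) (Y, e')\<^esub> z =
        x \<otimes>\<^bsub>HomG (idem_cat C) (X, e) (Y, e')\<^esub> (y \<otimes>\<^bsub>HomG (idem_cat C) (X, e) (Y, e')\<^esub> z)"
      using add_assoc[of r r1 r2] r(1,5) r2(1) t r2(2)[unfolded in_Mor_iff] by (simp add: HomG_def)
  next
    show "\<one>\<^bsub>HomG (idem_cat C) (X, e) (Y, e')\<^esub> \<in> carrier (HomG (idem_cat C) (X, e) (Y, e'))"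
      using o by (simp add: HomG_def idem_Mor3 add_simps)
    fix x assume "x \<in> carrier (HomG (idem_cat C) (X, e) (Y, e'))"
    then show "\<one>\<^bsub>HomG (idem_cat C) (X, e) (Y, e')\<^esub> \<otimes>\<^bsub>HomG (idem_cat C) (X, e) (Y, e')\<^esub> x = x"
      by (auto simp: HomG_def idem_Mor add_zero in_Mor_iff)
  qed
next
  fix f A B f' g D assume "f \<in> Mor (idem_cat C) A B" "f' \<in> Mor (idem_cat C) A B" "g \<in> Mor (idem_cat C) B D"
  then show "g \<cdot>\<^bsub>idem_cat C\<^esub> (f \<boxplus>\<^bsub>idem_cat C\<^esub> f') = (g \<cdot>\<^bsub>idem_cat C\<^esub> f) \<boxplus>\<^bsub>idem_cat C\<^esub> (g \<cdot>\<^bsub>idem_cat C\<^esub> f')"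
    by (elim idem_MorE) (auto simp: cmp_add)
next
  fix f A B g D g' assume "f \<in> Mor (idem_cat C) A B" "g \<in> Mor (idem_cat C) B D" "g' \<in> Mor (idem_cat C) B D"
  then show "(g \<boxplus>\<^bsub>idem_cat C\<^esub> g') \<cdot>\<^bsub>idem_cat C\<^esub> f = (g \<cdot>\<^bsub>idem_cat C\<^esub> f) \<boxplus>\<^bsub>idem_cat C\<^esub> (g' \<cdot>\<^bsub>idem_cat C\<^esub> f)"
    by (elim idem_MorE) (auto simp: add_cmp)
next
  show "\<exists>Z. zero_object (idem_cat C) Z" using idem_zero ex_zero by blast
next
  fix A B assume AB: "A \<in> Ob (idem_cat C)" "B \<in> Ob (idem_cat C)"
  obtain X e Y e' where x: "A = (X, e)" "B = (Y, e')" by (cases A; cases B)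
  have o: "X \<in> Ob C" "e \<in> Mor C X X" "e \<cdot> e = e" "Y \<in> Ob C" "e' \<in> Mor C Y Y" "e' \<cdot> e' = e'" using AB x by simp_all
  show "\<exists>P i1 i2 p1 p2. biproduct (idem_cat C) A B P i1 i2 p1 p2" unfolding x
    using idem_biproduct[OF _ o(2,3,5,6)] ex_biproduct[OF o(1,4)] by blast
qed

end

lemma idem_ext: "\<delta> \<in> carrier (Ext (idem_bifunctor C E) (Z, e') (A, e)) \<longleftrightarrow>
    (\<exists>\<epsilon>. \<delta> = (e, \<epsilon>, e') \<and> \<epsilon> \<in> carrier (Ext E Z A) \<and> push C E Z e \<epsilon> = \<epsilon> \<and> pull C E A e' \<epsilon> = \<epsilon>)"
  by (auto simp: idem_bifunctor_def)

lemma idem_ext3: "(a, \<epsilon>, b) \<in> carrier (Ext (idem_bifunctor C E) (Z, e') (A, e)) \<longleftrightarrow> a = e \<and> b = e' \<and>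
    \<epsilon> \<in> carrier (Ext E Z A) \<and> push C E Z e \<epsilon> = \<epsilon> \<and> pull C E A e' \<epsilon> = \<epsilon>"
  by (auto simp: idem_ext)

lemma idem_bifunctor_simps [simp]: "Act (idem_bifunctor C E) (e2', c, e2) (e1, a, e1') (e, \<delta>, e') = (e1, Act E c a \<delta>, e2)"
  "(a, \<delta>, b) \<otimes>\<^bsub>Ext (idem_bifunctor C E) (Z, e') (A, e)\<^esub> (a', \<rho>, b') = (e, \<delta> \<otimes>\<^bsub>Ext E Z A\<^esub> \<rho>, e')"
  "\<one>\<^bsub>Ext (idem_bifunctor C E) (Z, e') (A, e)\<^esub> = (e, \<one>\<^bsub>Ext E Z A\<^esub>, e')"
  by (simp_all add: idem_bifunctor_def)

context biadditive_functor begin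

lemma act_hom_mult: "c \<in> Mor C W Z \<Longrightarrow> a \<in> Mor C A B \<Longrightarrow> \<delta> \<in> carrier (Ext E Z A) \<Longrightarrow> \<rho> \<in> carrier (Ext E Z A) \<Longrightarrow>
    Act E c a (\<delta> \<otimes>\<^bsub>Ext E Z A\<^esub> \<rho>) = Act E c a \<delta> \<otimes>\<^bsub>Ext E W B\<^esub> Act E c a \<rho>"
  using act_hom by (rule hom_mult)

lemma act_inv:
  assumes "c \<in> Mor C W Z" "a \<in> Mor C A B" "\<delta> \<in> carrier (Ext E Z A)"
  shows "Act E c a (inv\<^bsub>Ext E Z A\<^esub> \<delta>) = inv\<^bsub>Ext E W B\<^esub> (Act E c a \<delta>)"
  using group_hom.hom_inv[OF group_hom.intro[OF ext_group' ext_group' group_hom_axioms.intro[OF act_hom[OF assms(1,2)]]] assms(3)]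
    mor_ob[OF assms(1)] mor_ob[OF assms(2)] by blast

lemma act_fixed:
  assumes c: "c \<in> Mor C W Z" "c \<cdot> e' = c" and a: "a \<in> Mor C A B" "f \<cdot> a = a" and e: "e' \<in> Mor C W W" and f: "f \<in> Mor C B B" and d: "\<delta> \<in> carrier (Ext E Z A)"
  shows "push C E W f (Act E c a \<delta>) = Act E c a \<delta>" "pull C E B e' (Act E c a \<delta>) = Act E c a \<delta>"
proof -
  have o: "W \<in> Ob C" "B \<in> Ob C" using mor_ob e f by blast+
  show "push C E W f (Act E c a \<delta>) = Act E c a \<delta>" unfolding push_def act_act[OF idt_mor[OF o(1)] c(1) a(1) f d] cmp_idt[OF c(1)] a(2) by (rule refl)
  show "pull C E B e' (Act E c a \<delta>) = Act E c a \<delta>" unfolding pull_def act_act[OF e c(1) a(1) idt_mor[OF o(2)] d] idt_cmp[OF a(1)] c(2) by (rule refl)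
qed

lemma act_push_pull:
  assumes "e' \<in> Mor C Z Z" "e \<in> Mor C A A" "\<delta> \<in> carrier (Ext E Z A)" "push C E Z e \<delta> = \<delta>" "pull C E A e' \<delta> = \<delta>"
  shows "Act E e' e \<delta> = \<delta>"
proof -
  have o: "Z \<in> Ob C" "A \<in> Ob C" using mor_ob assms by blast+
  have "Act E e' e \<delta> = pull C E A e' (push C E Z e \<delta>)"
    unfolding push_def pull_def act_act[OF assms(1) idt_mor[OF o(1)] assms(2) idt_mor[OF o(2)] assms(3)] idt_cmp[OF assms(1)] idt_cmp[OF assms(2)] by (rule refl)
  then show ?thesis using assms by simp
qed

lemma biadditive_functor_idem: "biadditive_functor (idem_cat C) (idem_bifunctor C E)"
proof (intro biadditive_functor.intro biadditive_functor_axioms.intro additive_category_idem)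
  let ?G = "idem_bifunctor C E"
  fix Z' A' assume ZA: "Z' \<in> Ob (idem_cat C)" "A' \<in> Ob (idem_cat C)"
  obtain Z e' A e where x: "Z' = (Z, e')" "A' = (A, e)" by (cases Z'; cases A')
  have o: "A \<in> Ob C" "e \<in> Mor C A A" "e \<cdot> e = e" "Z \<in> Ob C" "e' \<in> Mor C Z Z" "e' \<cdot> e' = e'" using ZA x by simp_all
  interpret X: comm_group "Ext E Z A" by (rule ext_group[OF o(4,1)])
  note i = idt_mor[OF o(1)] idt_mor[OF o(4)]
  show "comm_group (Ext ?G Z' A')" unfolding x
  proof (intro comm_groupI)
    fix \<delta> assume "\<delta> \<in> carrier (Ext ?G (Z, e') (A, e))"
    then obtain d where d: "\<delta> = (e, d, e')" "d \<in> carrier (Ext E Z A)" "push C E Z e d = d" "pull C E A e' d = d" unfolding idem_ext by blast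
    show "\<one>\<^bsub>Ext ?G (Z, e') (A, e)\<^esub> \<otimes>\<^bsub>Ext ?G (Z, e') (A, e)\<^esub> \<delta> = \<delta>" using d by simp
    have "(e, inv\<^bsub>Ext E Z A\<^esub> d, e') \<in> carrier (Ext ?G (Z, e') (A, e))"
      using d act_inv[OF i(2) o(2) d(2)] act_inv[OF o(5) i(1) d(2)] by (simp add: idem_ext3 push_def pull_def)
    then show "\<exists>y \<in> carrier (Ext ?G (Z, e') (A, e)). y \<otimes>\<^bsub>Ext ?G (Z, e') (A, e)\<^esub> \<delta> = \<one>\<^bsub>Ext ?G (Z, e') (A, e)\<^esub>"
      using d by (intro bexI[of _ "(e, inv\<^bsub>Ext E Z A\<^esub> d, e')"]) simp_all
    fix \<delta>1 assume "\<delta>1 \<in> carrier (Ext ?G (Z, e') (A, e))"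
    then obtain d1 where d1: "\<delta>1 = (e, d1, e')" "d1 \<in> carrier (Ext E Z A)" "push C E Z e d1 = d1" "pull C E A e' d1 = d1" unfolding idem_ext by blast
    show "\<delta> \<otimes>\<^bsub>Ext ?G (Z, e') (A, e)\<^esub> \<delta>1 \<in> carrier (Ext ?G (Z, e') (A, e))"
      using d d1 act_hom_mult[OF i(2) o(2) d(2) d1(2)] act_hom_mult[OF o(5) i(1) d(2) d1(2)] by (simp add: idem_ext3 push_def pull_def)
    show "\<delta> \<otimes>\<^bsub>Ext ?G (Z, e') (A, e)\<^esub> \<delta>1 = \<delta>1 \<otimes>\<^bsub>Ext ?G (Z, e') (A, e)\<^esub> \<delta>"
      using d d1 X.m_comm by simp
    fix \<delta>2 assume "\<delta>2 \<in> carrier (Ext ?G (Z, e') (A, e))"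
    then obtain d2 where d2: "\<delta>2 = (e, d2, e')" "d2 \<in> carrier (Ext E Z A)" unfolding idem_ext by blast
    show "\<delta> \<otimes>\<^bsub>Ext ?G (Z, e') (A, e)\<^esub> \<delta>1 \<otimes>\<^bsub>Ext ?G (Z, e') (A, e)\<^esub> \<delta>2 = \<delta> \<otimes>\<^bsub>Ext ?G (Z, e') (A, e)\<^esub> (\<delta>1 \<otimes>\<^bsub>Ext ?G (Z, e') (A, e)\<^esub> \<delta>2)"
      using d d1 d2 X.m_assoc by simp
  next
    show "\<one>\<^bsub>Ext ?G (Z, e') (A, e)\<^esub> \<in> carrier (Ext ?G (Z, e') (A, e))"
      using act_one[OF i(2) o(2)] act_one[OF o(5) i(1)] by (simp add: idem_ext3 push_def pull_def)
  qed
  fix \<delta> assume "\<delta> \<in> carrier (Ext ?G Z' A')"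
  then show "Act ?G (Idt (idem_cat C) Z') (Idt (idem_cat C) A') \<delta> = \<delta>" unfolding x using act_push_pull[OF o(5,2)] by (auto simp: idem_ext)
next
  let ?G = "idem_bifunctor C E"
  fix c W Z a A B assume ca: "c \<in> Mor (idem_cat C) W Z" "a \<in> Mor (idem_cat C) A B"
  obtain W0 w Z0 z c0 where c: "W = (W0, w)" "Z = (Z0, z)" "c = (z, c0, w)" "W0 \<in> Ob C" "w \<in> Mor C W0 W0" "w \<cdot> w = w"
    "Z0 \<in> Ob C" "z \<in> Mor C Z0 Z0" "z \<cdot> z = z" "c0 \<in> Mor C W0 Z0" "c0 \<cdot> w = c0" "z \<cdot> c0 = c0" using ca(1) by (elim idem_MorE)
  obtain A0 e B0 f a0 where a: "A = (A0, e)" "B = (B0, f)" "a = (f, a0, e)" "A0 \<in> Ob C" "e \<in> Mor C A0 A0" "e \<cdot> e = e"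
    "B0 \<in> Ob C" "f \<in> Mor C B0 B0" "f \<cdot> f = f" "a0 \<in> Mor C A0 B0" "a0 \<cdot> e = a0" "f \<cdot> a0 = a0" using ca(2) by (elim idem_MorE)
  show "Act ?G c a \<in> hom (Ext ?G Z A) (Ext ?G W B)"
  proof (rule homI)
    fix \<delta> assume "\<delta> \<in> carrier (Ext ?G Z A)"
    then obtain d where d: "\<delta> = (e, d, z)" "d \<in> carrier (Ext E Z0 A0)" unfolding idem_ext c a by blast
    show "Act ?G c a \<delta> \<in> carrier (Ext ?G W B)"
      unfolding c(1,2,3) a(1,2,3) d(1) using act_fixed[OF c(10,11) a(10,12) c(5) a(8) d(2)] act_closed[OF c(10) a(10) d(2)] by (simp add: idem_ext3)
    fix \<rho> assume "\<rho> \<in> carrier (Ext ?G Z A)"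
    then obtain r where r: "\<rho> = (e, r, z)" "r \<in> carrier (Ext E Z0 A0)" unfolding idem_ext c a by blast
    show "Act ?G c a (\<delta> \<otimes>\<^bsub>Ext ?G Z A\<^esub> \<rho>) = Act ?G c a \<delta> \<otimes>\<^bsub>Ext ?G W B\<^esub> Act ?G c a \<rho>"
      unfolding c(1,2,3) a(1,2,3) d(1) r(1) using act_hom_mult[OF c(10) a(10) d(2) r(2)] by simp
  qed
next
  let ?G = "idem_bifunctor C E"
  fix c W Z c' V a A B a' D \<delta>
  assume "c \<in> Mor (idem_cat C) W Z" "c' \<in> Mor (idem_cat C) V W" "a \<in> Mor (idem_cat C) A B" "a' \<in> Mor (idem_cat C) B D" "\<delta> \<in> carrier (Ext ?G Z A)"
  then show "Act ?G (c \<cdot>\<^bsub>idem_cat C\<^esub> c') (a' \<cdot>\<^bsub>idem_cat C\<^esub> a) \<delta> = Act ?G c' a' (Act ?G c a \<delta>)"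
    by (elim idem_MorE) (clarsimp simp: idem_ext act_cmp)
next
  let ?G = "idem_bifunctor C E"
  fix c W Z c' a A B \<delta>
  assume "c \<in> Mor (idem_cat C) W Z" "c' \<in> Mor (idem_cat C) W Z" "a \<in> Mor (idem_cat C) A B" "\<delta> \<in> carrier (Ext ?G Z A)"
  then show "Act ?G (c \<boxplus>\<^bsub>idem_cat C\<^esub> c') a \<delta> = Act ?G c a \<delta> \<otimes>\<^bsub>Ext ?G W B\<^esub> Act ?G c' a \<delta>"
    by (elim idem_MorE) (clarsimp simp: idem_ext act_add_left)
next
  let ?G = "idem_bifunctor C E"
  fix c W Z a A B a' \<delta>
  assume "c \<in> Mor (idem_cat C) W Z" "a \<in> Mor (idem_cat C) A B" "a' \<in> Mor (idem_cat C) A B" "\<delta> \<in> carrier (Ext ?G Z A)"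
  then show "Act ?G c (a \<boxplus>\<^bsub>idem_cat C\<^esub> a') \<delta> = Act ?G c a \<delta> \<otimes>\<^bsub>Ext ?G W B\<^esub> Act ?G c a' \<delta>"
    by (elim idem_MorE) (clarsimp simp: idem_ext act_add_right)
qed

end

section \<open>Objects with split complementary idempotent\<close>

definition wic_ob :: "('o, 'm) cat \<Rightarrow> ('o \<times> 'm) set" where
  "wic_ob C = {(X, e). split_idempotent C X (Idt C X \<boxplus>\<^bsub>C\<^esub> Neg C X X e)}"

lemma wic_cat_eq: "wic_cat C = full_subcat (idem_cat C) (wic_ob C)"
  by (simp add: wic_cat_def wic_ob_def)

context additive_category begin

text \<open>Brings the splitting of 1 - e into a form without negatives, in which e and s r are
  complementary.\<close>

lemma wic_ob_iff: assumes "e \<in> Mor C X X"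
  shows "(X, e) \<in> wic_ob C \<longleftrightarrow> (\<exists>Y. \<exists>r \<in> Mor C X Y. \<exists>s \<in> Mor C Y X. r \<cdot> s = Idt C Y \<and> e \<boxplus> s \<cdot> r = Idt C X)"
proof -
  have X: "X \<in> Ob C" using mor_ob assms by blast
  have "Idt C X \<boxplus> Neg C X X e = s \<cdot> r \<longleftrightarrow> e \<boxplus> s \<cdot> r = Idt C X" if "r \<in> Mor C X Y" "s \<in> Mor C Y X" for r s Y
  proof -
    have N: "mor C (Neg C X X e)" "dm C (Neg C X X e) = X" "cd C (Neg C X X e) = X" using Neg_mor[OF assms] by (auto simp: in_Mor_iff)
    note t = N that[unfolded in_Mor_iff] assms[unfolded in_Mor_iff]
    show ?thesis
    proof
      assume "Idt C X \<boxplus> Neg C X X e = s \<cdot> r"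
      then have "e \<boxplus> s \<cdot> r = e \<boxplus> (Neg C X X e \<boxplus> Idt C X)" using t X add_comm[of "Idt C X" "Neg C X X e"] by (simp add: cat_simps)
      also have "\<dots> = Idt C X" using t X add_Neg(1)[OF assms] add_assoc[of e "Neg C X X e" "Idt C X"] by (simp add: add_simps)
      finally show "e \<boxplus> s \<cdot> r = Idt C X" .
    next
      assume "e \<boxplus> s \<cdot> r = Idt C X"
      then have "Idt C X \<boxplus> Neg C X X e = (s \<cdot> r \<boxplus> e) \<boxplus> Neg C X X e" using t X add_comm[of e "s \<cdot> r"] by (simp add: cat_simps)
      also have "\<dots> = s \<cdot> r" using t X add_Neg(1)[OF assms] add_assoc[of "s \<cdot> r" e "Neg C X X e"] by (simp add: add_simps)
      finally show "Idt C X \<boxplus> Neg C X X e = s \<cdot> r" .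
    qed
  qed
  then show ?thesis unfolding wic_ob_def split_idempotent_def mem_Collect_eq prod.case by blast
qed

lemma split_complement:
  assumes e: "e \<in> Mor C X X" and r: "r \<in> Mor C X Y" and s: "s \<in> Mor C Y X" and rs: "r \<cdot> s = Idt C Y" and c: "e \<boxplus> s \<cdot> r = Idt C X"
  shows "e \<cdot> e = e" "r \<cdot> e = Zer C X Y" "e \<cdot> s = Zer C Y X"
proof -
  note t = e[unfolded in_Mor_iff] r[unfolded in_Mor_iff] s[unfolded in_Mor_iff]
  have o: "X \<in> Ob C" "Y \<in> Ob C" using mor_ob r by blast+
  have "r \<cdot> e \<boxplus> r = Zer C X Y \<boxplus> r" using arg_cong[OF c, of "\<lambda>x. r \<cdot> x"] t o eqR[OF rs] by (simp add: add_simps)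
  then show re: "r \<cdot> e = Zer C X Y" using t o by (rule_tac add_cancel[of _ _ r]) (simp_all add: add_simps)
  have "e \<cdot> s \<boxplus> s = Zer C Y X \<boxplus> s" using arg_cong[OF c, of "\<lambda>x. x \<cdot> s"] t o rs by (simp add: add_simps)
  then show "e \<cdot> s = Zer C Y X" using t o by (rule_tac add_cancel[of _ _ s]) (simp_all add: add_simps)
  show "e \<cdot> e = e" using arg_cong[OF c, of "\<lambda>x. x \<cdot> e"] t o re by (simp add: add_simps)
qed

text \<open>The idempotent complementary to the identity is zero, and it splits through a zero
  object.\<close>

lemma wic_ob_self: assumes X: "X \<in> Ob C" shows "(X, Idt C X) \<in> wic_ob C"
proof -
  obtain Z where Z: "zero_object C Z" using ex_zero by blast
  note zu = zero_object_unique[OF Z]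
  have "Zer C X Z \<cdot> Zer C Z X = Idt C Z" using zu(2)[of "Zer C X Z \<cdot> Zer C Z X" Z "Idt C Z"] X zu(1) by (simp add: add_simps)
  moreover have "Idt C X \<boxplus> Zer C Z X \<cdot> Zer C X Z = Idt C X" using X zu(1) by (simp add: add_simps)
  ultimately show ?thesis unfolding wic_ob_iff[OF idt_mor[OF X]] using X zu(1) Zer_mor by blast
qed

lemma wic_Ob: "(X, e) \<in> Ob (wic_cat C) \<longleftrightarrow> (X, e) \<in> Ob (idem_cat C) \<and> (X, e) \<in> wic_ob C"
  by (simp add: wic_cat_eq)

lemma additive_category_wic: "additive_category (wic_cat C)"
proof -
  obtain Z where Z: "zero_object C Z" using ex_zero by blast
  have Zo: "Z \<in> Ob C" by (rule zero_object_unique(1)[OF Z])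
  show ?thesis unfolding wic_cat_eq
  proof (rule additive_category_full_subcat[OF additive_category_idem idem_zero[OF Z] wic_ob_self[OF Zo]])
    fix A' B' assume "A' \<in> Ob (idem_cat C)" "B' \<in> Ob (idem_cat C)" "A' \<in> wic_ob C" "B' \<in> wic_ob C"
    moreover obtain A e B f where x: "A' = (A, e)" "B' = (B, f)" by (cases A'; cases B')
    ultimately have o: "A \<in> Ob C" "e \<in> Mor C A A" "e \<cdot> e = e" "B \<in> Ob C" "f \<in> Mor C B B" "f \<cdot> f = f"
      and w: "(A, e) \<in> wic_ob C" "(B, f) \<in> wic_ob C" by simp_all
    obtain Y r s where r: "r \<in> Mor C A Y" "s \<in> Mor C Y A" "r \<cdot> s = Idt C Y" "e \<boxplus> s \<cdot> r = Idt C A" using w(1) wic_ob_iff[OF o(2)] by blast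
    obtain Y' r' s' where r': "r' \<in> Mor C B Y'" "s' \<in> Mor C Y' B" "r' \<cdot> s' = Idt C Y'" "f \<boxplus> s' \<cdot> r' = Idt C B" using w(2) wic_ob_iff[OF o(5)] by blast
    obtain P i j p q where b: "biproduct C A B P i j p q" using ex_biproduct[OF o(1,4)] by (elim exE)
    have yo: "Y \<in> Ob C" "Y' \<in> Ob C" using r r' mor_ob by blast+
    obtain Q k l m n where b': "biproduct C Y Y' Q k l m n" using ex_biproduct[OF yo] by (elim exE)
    let ?g = "i \<cdot> (e \<cdot> p) \<boxplus> j \<cdot> (f \<cdot> q)"
    note c = biproductD[OF b] and c' = biproductD[OF b']
    note t = c(1-4)[unfolded in_Mor_iff] c'(1-4)[unfolded in_Mor_iff] o(2,5)[unfolded in_Mor_iff] r(1,2)[unfolded in_Mor_iff] r'(1,2)[unfolded in_Mor_iff]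
    have g: "?g \<in> Mor C P P" using t by (simp add: add_simps)
    \<comment> \<open>The complement of the sum of e and f splits through the sum of the objects Y
      and Y' through which the complements of e and f split.\<close>
    let ?r = "k \<cdot> (r \<cdot> p) \<boxplus> l \<cdot> (r' \<cdot> q)" and ?s = "i \<cdot> (s \<cdot> m) \<boxplus> j \<cdot> (s' \<cdot> n)"
    have rs: "?r \<in> Mor C P Q" "?s \<in> Mor C Q P" using t by (simp_all add: add_simps)
    have 1: "?r \<cdot> ?s = Idt C Q"
      using t yo o c'(9,12) c(12) eqR[OF c(5)] eqR[OF c(6)] eqR[OF c(7)] eqR[OF c(8)] eqR[OF r(3)] eqR[OF r'(3)] by (simp add: add_simps)
    have sr: "?s \<cdot> ?r = i \<cdot> (s \<cdot> (r \<cdot> p)) \<boxplus> j \<cdot> (s' \<cdot> (r' \<cdot> q))"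
      using t yo o c'(12) c(12) eqR[OF c'(5)] eqR[OF c'(6)] eqR[OF c'(7)] eqR[OF c'(8)] by (simp add: add_simps)
    have "?g \<boxplus> ?s \<cdot> ?r = i \<cdot> ((e \<boxplus> s \<cdot> r) \<cdot> p) \<boxplus> j \<cdot> ((f \<boxplus> s' \<cdot> r') \<cdot> q)" unfolding sr
      using t by (simp add: add_simps add_ac)
    also have "\<dots> = Idt C P" unfolding r(4) r'(4) using t c(9) by (simp add: cat_simps)
    finally have "(P, ?g) \<in> wic_ob C" unfolding wic_ob_iff[OF g] using rs 1 by blast
    then show "\<exists>P i j p q. P \<in> wic_ob C \<and> biproduct (idem_cat C) A' B' P i j p q" unfolding x
      using idem_biproduct[OF b o(2,3,5,6)] by blast
  qed
qed

lemma wic_simps [simp]: "Cmp (wic_cat C) = Cmp (idem_cat C)" "Idt (wic_cat C) = Idt (idem_cat C)" "Add (wic_cat C) = Add (idem_cat C)" "Zer (wic_cat C) = Zer (idem_cat C)"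
  by (simp_all add: wic_cat_eq)

lemma wic_Mor: "f \<in> Mor (wic_cat C) A B \<longleftrightarrow> f \<in> Mor (idem_cat C) A B \<and> A \<in> wic_ob C \<and> B \<in> wic_ob C"
  by (auto simp: wic_cat_eq)

end

lemma homotopic_cong:
  assumes "homotopic C n X Y f g" "\<And>i. i \<le> Suc n \<Longrightarrow> f' i = f i" shows "homotopic C n X Y f' g"
  using assms unfolding homotopic_iff by simp

lemma idem_cpx_simps [simp]: "cob (idem_cpx C X e) i = (cob X i, e i)"
    "cdf (idem_cpx C X e) i = (e (Suc i), e (Suc i) \<cdot>\<^bsub>C\<^esub> (cdf X i \<cdot>\<^bsub>C\<^esub> e i), e i)"
  by (simp_all add: idem_cpx_def)

lemma (in category) wic_functor_simps:
  "Fob (wic_functor C) X = (X, Idt C X)" "f \<in> Mor C A B \<Longrightarrow> Fmor (wic_functor C) f = (Idt C B, f, Idt C A)"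
proof -
  show "Fob (wic_functor C) X = (X, Idt C X)" by (simp add: wic_functor_def)
  assume f: "f \<in> Mor C A B"
  have "(THE t. \<exists>X Y. f \<in> Mor C X Y \<and> t = (Idt C Y, f, Idt C X)) = (Idt C B, f, Idt C A)"
    by (rule the_equality) (use f mor_disjoint[OF f] in blast)+
  then show "Fmor (wic_functor C) f = (Idt C B, f, Idt C A)" by (simp add: wic_functor_def)
qed

context additive_category begin

lemma wic_biproduct:
  assumes e: "e \<in> Mor C X X" and r: "r \<in> Mor C X Y" and s: "s \<in> Mor C Y X" and rs: "r \<cdot> s = Idt C Y" and c: "e \<boxplus> s \<cdot> r = Idt C X"
  shows "biproduct (wic_cat C) (X, e) (Y, Idt C Y) (X, Idt C X) (Idt C X, e, e) (Idt C X, s, Idt C Y) (e, e, Idt C X) (Idt C Y, r, Idt C X)"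
proof -
  note z = split_complement[OF assms]
  note t = e[unfolded in_Mor_iff] r[unfolded in_Mor_iff] s[unfolded in_Mor_iff]
  have o: "X \<in> Ob C" "Y \<in> Ob C" using mor_ob r by blast+
  have w: "(X, e) \<in> wic_ob C" "(X, Idt C X) \<in> wic_ob C" "(Y, Idt C Y) \<in> wic_ob C"
    using wic_ob_self o wic_ob_iff[OF e] r s rs c by blast+
  have "biproduct (idem_cat C) (X, e) (Y, Idt C Y) (X, Idt C X) (Idt C X, e, e) (Idt C X, s, Idt C Y) (e, e, Idt C X) (Idt C Y, r, Idt C X)"
    unfolding biproduct_def idem_Mor3 idem_Ob idem_simps using t o z rs c by (simp add: cat_simps)
  then show ?thesis unfolding wic_cat_eq biproduct_full_subcat using w by blast
qed

lemma additive_wic_functor: "additive_functor C (wic_cat C) (wic_functor C)"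
proof -
  have 1: "Fob (wic_functor C) A \<in> Ob (wic_cat C)" if "A \<in> Ob C" for A using that wic_ob_self by (simp add: wic_functor_simps wic_Ob cat_simps)
  have 2: "Fmor (wic_functor C) f \<in> Mor (wic_cat C) (Fob (wic_functor C) A) (Fob (wic_functor C) B)" if f: "f \<in> Mor C A B" for A B f
    using f mor_ob[OF f] wic_ob_self by (simp add: wic_functor_simps wic_Mor idem_Mor3 cat_simps)
  show ?thesis unfolding additive_functor_def
  proof (intro conjI ballI allI)
    fix A assume "A \<in> Ob C" then show "Fmor (wic_functor C) (Idt C A) = Idt (wic_cat C) (Fob (wic_functor C) A)"
      using wic_functor_simps(2)[OF idt_mor] by (simp add: wic_functor_simps)
  next
    fix A B B' f g assume "f \<in> Mor C A B" "g \<in> Mor C B B'"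
    then show "Fmor (wic_functor C) (g \<cdot> f) = Fmor (wic_functor C) g \<cdot>\<^bsub>wic_cat C\<^esub> Fmor (wic_functor C) f"
      using cmp_mor by (simp add: wic_functor_simps)
  next
    fix A B f g assume "f \<in> Mor C A B" "g \<in> Mor C A B"
    then show "Fmor (wic_functor C) (f \<boxplus> g) = Fmor (wic_functor C) f \<boxplus>\<^bsub>wic_cat C\<^esub> Fmor (wic_functor C) g"
      using add_mor by (simp add: wic_functor_simps)
  qed (rule 1 2; assumption)+
qed

end

lemma (in n_exangulated_category) full_embedding_wic:
  assumes n: "1 \<le> n"
  shows "full_embedding C E n s (wic_cat C) (wic_bifunctor C E) (wic_functor C) (wic_trans C)"
proof -
  have wa: "additive_category (wic_cat C)" by (rule additive_category_wic)
  have wb: "biadditive_functor (wic_cat C) (wic_bifunctor C E)" unfolding wic_cat_eq wic_bifunctor_def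
    by (rule biadditive_functor_full_subcat[OF biadditive_functor_idem wa[unfolded wic_cat_eq]])
  have id: "push C E Z (Idt C A) \<delta> = \<delta>" "pull C E A (Idt C Z) \<delta> = \<delta>" if "Z \<in> Ob C" "A \<in> Ob C" "\<delta> \<in> carrier (Ext E Z A)" for Z A \<delta>
    using act_idt that by (simp_all add: push_def pull_def)
  note K = wic_functor_simps(1)
  show ?thesis
  proof (intro full_embedding.intro full_embedding_axioms.intro add_functor.intro add_functor_axioms.intro n wa wb
      n_exangulated_category_axioms additive_category_axioms additive_wic_functor)
    show "inj_on (Fob (wic_functor C)) (Ob C)" by (simp add: K inj_on_def)
  next
    fix A B g assume "A \<in> Ob C" "B \<in> Ob C" "g \<in> Mor (wic_cat C) (Fob (wic_functor C) A) (Fob (wic_functor C) B)"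
    then obtain r where "g = (Idt C B, r, Idt C A)" "r \<in> Mor C A B" unfolding K wic_Mor idem_Mor by blast
    then show "\<exists>f\<in>Mor C A B. g = Fmor (wic_functor C) f" by (intro bexI[of _ r]) (simp_all add: wic_functor_simps)
  next
    fix f A B f' assume "f \<in> Mor C A B" "f' \<in> Mor C A B" "Fmor (wic_functor C) f = Fmor (wic_functor C) f'"
    then show "f = f'" by (simp add: wic_functor_simps)
  next
    fix Z A assume o: "Z \<in> Ob C" "A \<in> Ob C"
    have c: "carrier (Ext (wic_bifunctor C E) (Fob (wic_functor C) Z) (Fob (wic_functor C) A)) = wic_trans C Z A ` carrier (Ext E Z A)"
      unfolding wic_bifunctor_def K using id[OF o] by (auto simp: idem_ext wic_trans_def)
    show "bij_betw (wic_trans C Z A) (carrier (Ext E Z A)) (carrier (Ext (wic_bifunctor C E) (Fob (wic_functor C) Z) (Fob (wic_functor C) A)))"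
      unfolding c by (simp add: bij_betw_def inj_on_def wic_trans_def)
    show "wic_trans C Z A \<in> hom (Ext E Z A) (Ext (wic_bifunctor C E) (Fob (wic_functor C) Z) (Fob (wic_functor C) A))"
      by (rule homI; (unfold c)?) (simp_all add: wic_trans_def wic_bifunctor_def K)
  next
    fix c W Z a A B \<delta> assume ca: "c \<in> Mor C W Z" "a \<in> Mor C A B" "\<delta> \<in> carrier (Ext E Z A)"
    then show "wic_trans C W B (Act E c a \<delta>) = Act (wic_bifunctor C E) (Fmor (wic_functor C) c) (Fmor (wic_functor C) a) (wic_trans C Z A \<delta>)"
      by (simp add: wic_functor_simps wic_trans_def wic_bifunctor_def)
  next
    fix P assume P: "P \<in> Ob (wic_cat C)"
    obtain X e where x: "P = (X, e)" by (cases P)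
    have e: "e \<in> Mor C X X" "(X, e) \<in> wic_ob C" using P by (simp_all add: x wic_Ob)
    obtain Y r s where r: "r \<in> Mor C X Y" "s \<in> Mor C Y X" "r \<cdot> s = Idt C Y" "e \<boxplus> s \<cdot> r = Idt C X" using e(2) wic_ob_iff[OF e(1)] by blast
    have "compl (wic_cat C) (Fob (wic_functor C) ` Ob C) (X, e) (Y, Idt C Y) (X, Idt C X) (Idt C X, e, e) (Idt C X, s, Idt C Y) (e, e, Idt C X) (Idt C Y, r, Idt C X)"
      unfolding compl_def K using wic_biproduct[OF e(1) r] mor_ob[OF r(1)] by blast
    then show "\<exists>A' T i j p q. compl (wic_cat C) (Fob (wic_functor C) ` Ob C) P A' T i j p q" unfolding x by blast
  next
    fix P Q u v assume PQ: "P \<in> Fob (wic_functor C) ` Ob C" "Q \<in> Fob (wic_functor C) ` Ob C" "u \<in> Mor (wic_cat C) Q P" "v \<in> Mor (wic_cat C) P Q"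
      "v \<cdot>\<^bsub>wic_cat C\<^esub> u = Idt (wic_cat C) Q"
    then obtain X Y where x: "X \<in> Ob C" "P = (X, Idt C X)" "Y \<in> Ob C" "Q = (Y, Idt C Y)" unfolding K by blast
    obtain r s where r: "v = (Idt C Y, r, Idt C X)" "r \<in> Mor C X Y" "u = (Idt C X, s, Idt C Y)" "s \<in> Mor C Y X"
      using PQ(3,4) unfolding x wic_Mor idem_Mor by blast
    have rs: "r \<cdot> s = Idt C Y" using PQ(5) unfolding r x by simp
    \<comment> \<open>e is 1 - s r. By construction its complement splits through Y, so
      \<open>(X, e)\<close> belongs to the weak idempotent completion and complements Q.\<close>
    obtain e where e: "e \<in> Mor C X X" "Idt C X = s \<cdot> r \<boxplus> e" using ex_diff[OF idt_mor[OF x(1)] cmp_mor[OF r(2,4)]] by blast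
    have "e \<boxplus> s \<cdot> r = Idt C X" using e r(2,4) add_comm[of e "s \<cdot> r"] by (simp add: cat_simps)
    then show "\<exists>K i p. biproduct (wic_cat C) K Q P i u p v" unfolding r x using wic_biproduct[OF e(1) r(2,4) rs] by blast
  qed
qed

text \<open>The data among which \<open>idem_realisation\<close> chooses, named so that independence
  of the choice can be stated.\<close>

definition idem_lift where
  "idem_lift C n s Z A \<delta> e0 e' X e \<longleftrightarrow> realises C n s Z A \<delta> X \<and> chain_map C n X X e \<and>
     (\<forall>i \<le> n + 1. e i \<cdot>\<^bsub>C\<^esub> e i = e i) \<and> e 0 = e0 \<and> e (n + 1) = e'"

context additive_category begin

text \<open>The complex on the objects \<open>(X, e)\<close> is a retract of that on the objects
  \<open>(X, id)\<close>; both connecting chain maps have e as underlying map. For exactness a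
  factorisation is found in C and then cut down by the idempotents.\<close>

lemma idem_cpx:
  assumes X: "X \<in> Ch C n" and e: "chain_map C n X X e" "\<forall>i \<le> Suc n. e i \<cdot> e i = e i"
  shows "idem_cpx C X e \<in> Ch (idem_cat C) n"
    "cexact C n X \<Longrightarrow> cexact (idem_cat C) n (idem_cpx C X e)"
    "chain_map (idem_cat C) n (idem_cpx C X e) (map_cpx (wic_functor C) X) (\<lambda>i. (Idt C (cob X i), e i, e i))"
    "chain_map (idem_cat C) n (map_cpx (wic_functor C) X) (idem_cpx C X e) (\<lambda>i. (e i, e i, Idt C (cob X i)))"
proof -
  interpret D: additive_category "idem_cat C" by (rule additive_category_idem)
  note t = Ch_simps[OF X] chain_map_simps[OF X X e(1)] e(2)[rule_format]
  have o: "i \<le> Suc n \<Longrightarrow> (cob X i, e i) \<in> Ob (idem_cat C)" for i using t by (simp add: in_Mor_iff)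
  have K: "i \<le> n \<Longrightarrow> Fmor (wic_functor C) (cdf X i) = (Idt C (cob X (Suc i)), cdf X i, Idt C (cob X i))" for i
    using t by (intro wic_functor_simps(2)) (simp add: in_Mor_iff)
  have ee: "i \<le> Suc n \<Longrightarrow> mor C x \<Longrightarrow> cd C x = cob X i \<Longrightarrow> e i \<cdot> (e i \<cdot> x) = e i \<cdot> x" for i x using eqR[OF e(2)[rule_format], of i x] t by simp
  have d: "i \<le> n \<Longrightarrow> cdf (idem_cpx C X e) i = (e (Suc i), cdf X i \<cdot> e i, e i)" for i
    using t ee by (simp add: cat_simps)
  have d': "i \<le> n \<Longrightarrow> cdf (idem_cpx C X e) i = (e (Suc i), e (Suc i) \<cdot> cdf X i, e i)" for i
    using t ee by (simp add: cat_simps)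
  show Ch: "idem_cpx C X e \<in> Ch (idem_cat C) n"
  proof (rule D.ChI)
    show "cob (idem_cpx C X e) i \<in> Ob (idem_cat C)" if "i \<le> Suc n" for i using o that by simp
    show "cdf (idem_cpx C X e) i \<in> Mor (idem_cat C) (cob (idem_cpx C X e) i) (cob (idem_cpx C X e) (Suc i))" if "i \<le> n" for i
      unfolding d[OF that] using that o t ee by (simp add: idem_Mor3 cat_simps)
    show "cdf (idem_cpx C X e) (Suc i) \<cdot>\<^bsub>idem_cat C\<^esub> cdf (idem_cpx C X e) i = Zer (idem_cat C) (cob (idem_cpx C X e) i) (cob (idem_cpx C X e) (Suc (Suc i)))" if "i < n" for i
      using d[of "Suc i"] d[of i] that t ee by (simp add: add_simps del: idem_cpx_simps(2))
  qed
  show "chain_map (idem_cat C) n (idem_cpx C X e) (map_cpx (wic_functor C) X) (\<lambda>i. (Idt C (cob X i), e i, e i))"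
    by (rule D.chain_mapI) (use o t ee in \<open>auto simp: wic_functor_simps(1) idem_Mor3 cat_simps K\<close>)
  show "chain_map (idem_cat C) n (map_cpx (wic_functor C) X) (idem_cpx C X e) (\<lambda>i. (e i, e i, Idt C (cob X i)))"
    by (rule D.chain_mapI) (use o t ee in \<open>auto simp: wic_functor_simps(1) idem_Mor3 cat_simps K\<close>)
  assume ce: "cexact C n X"
  show "cexact (idem_cat C) n (idem_cpx C X e)" unfolding cexact_def
  proof (intro allI ballI impI)
    fix i Y u assume i: "i < n" and u: "u \<in> Mor (idem_cat C) (cob (idem_cpx C X e) (Suc i)) Y"
      "u \<cdot>\<^bsub>idem_cat C\<^esub> cdf (idem_cpx C X e) i = Zer (idem_cat C) (cob (idem_cpx C X e) i) Y"
    obtain B f r where r: "Y = (B, f)" "u = (f, r, e (Suc i))" "r \<in> Mor C (cob X (Suc i)) B" "r \<cdot> e (Suc i) = r" "f \<cdot> r = r"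
        "B \<in> Ob C" "f \<in> Mor C B B" "f \<cdot> f = f"
      using u(1) by (elim idem_MorE) simp
    have "r \<cdot> cdf X i = r \<cdot> (e (Suc i) \<cdot> cdf X i)" using eqR[OF r(4), of "cdf X i"] r(3) t i by (simp add: in_Mor_iff)
    also have "\<dots> = Zer C (cob X i) B" using u(2) d'[of i] i unfolding r by simp
    finally obtain w where w: "w \<in> Mor C (cob X (Suc (Suc i))) B" "r = w \<cdot> cdf X (Suc i)" using ce i r(3) unfolding cexact_def by blast
    note wt = w(1)[unfolded in_Mor_iff] r(7)[unfolded in_Mor_iff]
    have "r = f \<cdot> (w \<cdot> (cdf X (Suc i) \<cdot> e (Suc i)))" using r(4,5) unfolding w(2) using wt t i by (simp add: cat_simps)
    then have "u = (f, f \<cdot> (w \<cdot> e (Suc (Suc i))), e (Suc (Suc i))) \<cdot>\<^bsub>idem_cat C\<^esub> cdf (idem_cpx C X e) (Suc i)"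
      unfolding r(2) using d'[of "Suc i"] wt t i ee by (simp add: cat_simps del: idem_cpx_simps(2))
    moreover have "(f, f \<cdot> (w \<cdot> e (Suc (Suc i))), e (Suc (Suc i))) \<in> Mor (idem_cat C) (cob (idem_cpx C X e) (Suc (Suc i))) Y"
      using o[of "Suc (Suc i)"] i r(6-8) wt t ee eqR[OF r(8)] by (simp add: r(1) idem_Mor3 cat_simps)
    ultimately show "\<exists>w\<in>Mor (idem_cat C) (cob (idem_cpx C X e) (Suc (Suc i))) Y. u = w \<cdot>\<^bsub>idem_cat C\<^esub> cdf (idem_cpx C X e) (Suc i)" by blast
  qed
qed

lemma idem_cpx_map:
  assumes X: "X \<in> Ch C n" and e: "chain_map C n X X e" "\<forall>i \<le> Suc n. e i \<cdot> e i = e i"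
    and Y: "Y \<in> Ch C n" and f: "chain_map C n Y Y f" "\<forall>i \<le> Suc n. f i \<cdot> f i = f i" and g: "chain_map C n X Y g"
  shows "chain_map (idem_cat C) n (idem_cpx C X e) (idem_cpx C Y f) (\<lambda>i. (f i, f i \<cdot> (g i \<cdot> e i), e i))"
proof -
  interpret D: additive_category "idem_cat C" by (rule additive_category_idem)
  note t = Ch_simps[OF X] chain_map_simps[OF X X e(1)] e(2)[rule_format] Ch_simps[OF Y] chain_map_simps[OF Y Y f(1)] f(2)[rule_format] chain_map_simps[OF X Y g]
  have ee: "i \<le> Suc n \<Longrightarrow> mor C x \<Longrightarrow> cd C x = cob X i \<Longrightarrow> e i \<cdot> (e i \<cdot> x) = e i \<cdot> x" for i x using eqR[OF e(2)[rule_format], of i x] t by simp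
  have ff: "i \<le> Suc n \<Longrightarrow> mor C x \<Longrightarrow> cd C x = cob Y i \<Longrightarrow> f i \<cdot> (f i \<cdot> x) = f i \<cdot> x" for i x using eqR[OF f(2)[rule_format], of i x] t by simp
  show ?thesis
    by (rule D.chain_mapI) (use t ee ff in \<open>auto simp: idem_Mor3 cat_simps\<close>)
qed

end

section \<open>The realisation of the weak idempotent completion\<close>

context n_exangulated_category begin

text \<open>A lift of the identities between X and Y, conjugated by the idempotent chain maps, has
  ends e0 and e', which are the identities of the end objects in the completion. So both complexes
  have comparison maps.\<close>

lemma idem_kclass_eq:
  assumes n: "1 \<le> n" and ob: "Z \<in> Ob C" "A \<in> Ob C" and d: "\<delta> \<in> carrier (Ext E Z A)"
    and 1: "idem_lift C n s Z A \<delta> e0 e' X e" and 2: "idem_lift C n s Z A \<delta> e0 e' Y f"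
  shows "kclass (idem_cat C) n (idem_cpx C X e) = kclass (idem_cat C) n (idem_cpx C Y f)"
proof -
  interpret D: additive_category "idem_cat C" by (rule additive_category_idem)
  have 1: "realises C n s Z A \<delta> X" "chain_map C n X X e" "\<forall>i \<le> Suc n. e i \<cdot> e i = e i" "e 0 = e0" "e (Suc n) = e'"
    using 1 unfolding idem_lift_def by auto
  have 2: "realises C n s Z A \<delta> Y" "chain_map C n Y Y f" "\<forall>i \<le> Suc n. f i \<cdot> f i = f i" "f 0 = e0" "f (Suc n) = e'"
    using 2 unfolding idem_lift_def by auto
  note x = realises_exact[OF ob d 1(1)] realises_Ch[OF 1(1)] and y = realises_exact[OF ob d 2(1)] realises_Ch[OF 2(1)]
  have pp: "push C E Z (Idt C A) \<delta> = pull C E A (Idt C Z) \<delta>" by (simp add: push_def pull_def)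
  obtain g where g: "chain_map C n X Y g" "g 0 = Idt C A" "g (Suc n) = Idt C Z"
    using R0[OF d d idt_mor[OF ob(2)] idt_mor[OF ob(1)] pp 1(1) 2(1)] by auto
  obtain h where h: "chain_map C n Y X h" "h 0 = Idt C A" "h (Suc n) = Idt C Z"
    using R0[OF d d idt_mor[OF ob(2)] idt_mor[OF ob(1)] pp 2(1) 1(1)] by auto
  have X: "X \<in> Ch C n" and Y: "Y \<in> Ch C n" using x y by auto
  note t = chain_map_simps[OF X X 1(2)]
  have e0: "e0 \<in> Mor C A A" "e' \<in> Mor C Z Z" using t(1-3)[of 0] t(1-3)[of "Suc n"] x(2) 1(4,5) by (auto simp: in_Mor_iff)
  have ee: "e0 \<cdot> e0 = e0" "e' \<cdot> e' = e'" using 1(3)[rule_format, of 0] 1(3)[rule_format, of "Suc n"] 1(4,5) by auto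
  note IX = idem_cpx[OF X 1(2,3)] and IY = idem_cpx[OF Y 2(2,3)]
  have "chain_map_ends (idem_cat C) n (idem_cpx C X e) (idem_cpx C Y f) (\<lambda>i. (f i, f i \<cdot> (g i \<cdot> e i), e i))"
    unfolding chain_map_ends_def using idem_cpx_map[OF X 1(2,3) Y 2(2,3) g(1)] g(2,3) 1(4,5) 2(4,5) e0 ee x(2) by (simp add: idt_cmp)
  moreover have "chain_map_ends (idem_cat C) n (idem_cpx C Y f) (idem_cpx C X e) (\<lambda>i. (e i, e i \<cdot> (h i \<cdot> f i), f i))"
    unfolding chain_map_ends_def using idem_cpx_map[OF Y 2(2,3) X 1(2,3) h(1)] h(2,3) 1(4,5) 2(4,5) e0 ee y(2) by (simp add: idt_cmp)
  ultimately have "idem_cpx C Y f \<in> kclass (idem_cat C) n (idem_cpx C X e)"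
    unfolding D.kclass_iff[OF IX(1) IX(2)[OF x(1)[THEN conjunct2, THEN conjunct1]] n] using IY(1,2) y by blast
  then show ?thesis using D.kclass_eq[OF IX(1) IX(2)[OF x(1)[THEN conjunct2, THEN conjunct1]] n] by simp
qed

lemma idem_realisation_eq:
  assumes "1 \<le> n" "Z \<in> Ob C" "A \<in> Ob C" "\<delta> \<in> carrier (Ext E Z A)" "idem_lift C n s Z A \<delta> e0 e' X e"
  shows "idem_realisation C n s (Z, e') (A, e0) (a, \<delta>, b) = kclass (idem_cat C) n (idem_cpx C X e)"
  unfolding idem_realisation_def prod.case
proof (rule some_equality)
  show "\<exists>X' e''. realises C n s Z A \<delta> X' \<and> chain_map C n X' X' e'' \<and> (\<forall>i\<le>n + 1. e'' i \<cdot> e'' i = e'' i) \<and> e'' 0 = e0 \<and> e'' (n + 1) = e' \<and>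
      kclass (idem_cat C) n (idem_cpx C X e) = kclass (idem_cat C) n (idem_cpx C X' e'')"
    using assms(5) unfolding idem_lift_def by blast
  fix K assume "\<exists>X' e''. realises C n s Z A \<delta> X' \<and> chain_map C n X' X' e'' \<and> (\<forall>i\<le>n + 1. e'' i \<cdot> e'' i = e'' i) \<and> e'' 0 = e0 \<and> e'' (n + 1) = e' \<and>
      K = kclass (idem_cat C) n (idem_cpx C X' e'')"
  then obtain X' e'' where "idem_lift C n s Z A \<delta> e0 e' X' e''" "K = kclass (idem_cat C) n (idem_cpx C X' e'')" unfolding idem_lift_def by blast
  then show "K = kclass (idem_cat C) n (idem_cpx C X e)" using idem_kclass_eq[OF assms(1-4) _ assms(5)] by simp
qed

abbreviation "wicR \<equiv> image_realises C E n s (wic_functor C) (wic_trans C)"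
abbreviation "wicRD \<equiv> summand_realises (wic_cat C) (wic_bifunctor C E) n (Fob (wic_functor C) ` Ob C) wicR"

lemma wic_obD:
  assumes "(X, e) \<in> Ob (wic_cat C)"
  obtains Y j q where "compl (wic_cat C) (Fob (wic_functor C) ` Ob C) (X, e) (Y, Idt C Y) (X, Idt C X) (Idt C X, e, e) j (e, e, Idt C X) q"
proof -
  have e: "e \<in> Mor C X X" "(X, e) \<in> wic_ob C" using assms by (simp_all add: wic_Ob)
  obtain Y r s where r: "r \<in> Mor C X Y" "s \<in> Mor C Y X" "r \<cdot> s = Idt C Y" "e \<boxplus> s \<cdot> r = Idt C X" using e(2) wic_ob_iff[OF e(1)] by blast
  have "compl (wic_cat C) (Fob (wic_functor C) ` Ob C) (X, e) (Y, Idt C Y) (X, Idt C X) (Idt C X, e, e) (Idt C X, s, Idt C Y) (e, e, Idt C X) (Idt C Y, r, Idt C X)"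
    unfolding compl_def wic_functor_simps(1) using wic_biproduct[OF e(1) r] mor_ob[OF r(1)] by blast
  then show thesis by (rule that)
qed

text \<open>An isomorphism in the homotopy category composed with the retraction of
  \<open>(X, id)\<close> onto \<open>(X, e)\<close> exhibits Y as a retract up to homotopy of the
  image of X. Since the weak idempotent completion is a full subcategory, chain maps and homotopies
  between its complexes may be taken in the idempotent completion.\<close>

lemma idem_lift_rd:
  assumes n: "1 \<le> n" and Z: "(Z, e') \<in> Ob (wic_cat C)" and A: "(A, e0) \<in> Ob (wic_cat C)"
    and d: "(e0, \<delta>, e') \<in> carrier (Ext (wic_bifunctor C E) (Z, e') (A, e0))"
    and L: "idem_lift C n s Z A \<delta> e0 e' X e" and Y: "Y \<in> Ch (wic_cat C) n" and K: "Y \<in> kclass (idem_cat C) n (idem_cpx C X e)"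
  shows "wicRD (Z, e') (A, e0) (e0, \<delta>, e') Y"
proof -
  interpret F: full_embedding C E n s "wic_cat C" "wic_bifunctor C E" "wic_functor C" "wic_trans C" by (rule full_embedding_wic[OF n])
  interpret W: dense_realisation "wic_cat C" "wic_bifunctor C E" n "Fob (wic_functor C) ` Ob C" wicR by (rule F.dense_realisation_image)
  interpret D: additive_category "idem_cat C" by (rule additive_category_idem)
  let ?D = "idem_cat C" and ?H = "wic_cat C" and ?KX = "map_cpx (wic_functor C) X" and ?I = "idem_cpx C X e"
  have ob: "Z \<in> Ob C" "A \<in> Ob C" "e' \<in> Mor C Z Z" "e0 \<in> Mor C A A" "e0 \<cdot> e0 = e0" "e' \<cdot> e' = e'" using Z A by (simp_all add: wic_Ob)
  have d': "\<delta> \<in> carrier (Ext E Z A)" "Act E e' e0 \<delta> = \<delta>" using d act_push_pull[OF ob(3,4)] by (auto simp: wic_bifunctor_def idem_ext3)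
  have L: "realises C n s Z A \<delta> X" "chain_map C n X X e" "\<forall>i \<le> Suc n. e i \<cdot> e i = e i" "e 0 = e0" "e (Suc n) = e'"
    using L unfolding idem_lift_def by auto
  note x = realises_exact[OF ob(1,2) d'(1) L(1)] realises_Ch[OF L(1)]
  have X: "X \<in> Ch C n" using x by blast
  note IX = idem_cpx[OF X L(2,3)]
  have KH: "?KX \<in> Ch ?H n" by (rule F.F_Ch[OF X])
  have KD: "?KX \<in> Ch ?D n" and kw: "\<And>i. i \<le> Suc n \<Longrightarrow> cob ?KX i \<in> wic_ob C" using KH unfolding wic_cat_eq Ch_full_subcat by auto
  have YD: "Y \<in> Ch ?D n" and yw: "\<And>i. i \<le> Suc n \<Longrightarrow> cob Y i \<in> wic_ob C" using Y unfolding wic_cat_eq Ch_full_subcat by auto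
  obtain f g where f: "chain_map_ends ?D n ?I Y f" and g: "chain_map_ends ?D n Y ?I g"
    and fg: "homotopic ?D n Y Y (\<lambda>i. f i \<cdot>\<^bsub>?D\<^esub> g i) (\<lambda>i. Idt ?D (cob Y i))" using K unfolding kclass_def K_iso_def by blast
  have yc: "cob Y 0 = (A, e0)" "cob Y (Suc n) = (Z, e')" using K x(2) L(4,5) unfolding kclass_def Ch_ends_def by auto
  note f' = D.chain_map_endsD[OF f] and g' = D.chain_map_endsD[OF g]
  let ?i = "\<lambda>i. (Idt C (cob X i), e i, e i) \<cdot>\<^bsub>?D\<^esub> g i" and ?p = "\<lambda>i. f i \<cdot>\<^bsub>?D\<^esub> (e i, e i, Idt C (cob X i))"
  have iD: "chain_map ?D n Y ?KX ?i" by (rule D.chain_map_comp[OF YD IX(1) KD g'(1) IX(3)])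
  have pD: "chain_map ?D n ?KX Y ?p" by (rule D.chain_map_comp[OF KD IX(1) YD IX(4) f'(1)])
  have i: "chain_map ?H n Y ?KX ?i" using iD unfolding wic_cat_eq by (simp only: chain_map_full_subcat[OF yw kw])
  have p: "chain_map ?H n ?KX Y ?p" using pD unfolding wic_cat_eq by (simp only: chain_map_full_subcat[OF kw yw])
  note tf = D.chain_map_simps[OF IX(1) YD f'(1)] and tg = D.chain_map_simps[OF YD IX(1) g'(1)]
    and ti = D.chain_map_simps[OF IX(1) KD IX(3)] and tp = D.chain_map_simps[OF KD IX(1) IX(4)]
  have pi: "?p l \<cdot>\<^bsub>?D\<^esub> ?i l = f l \<cdot>\<^bsub>?D\<^esub> g l" if l: "l \<le> Suc n" for l
  proof -
    have "(e l, e l, Idt C (cob X l)) \<cdot>\<^bsub>?D\<^esub> (Idt C (cob X l), e l, e l) = Idt ?D (cob ?I l)" using L(3)[rule_format, OF l] by simp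
    note q = D.eqR[OF this, of "g l"]
    have "?p l \<cdot>\<^bsub>?D\<^esub> ?i l = f l \<cdot>\<^bsub>?D\<^esub> ((e l, e l, Idt C (cob X l)) \<cdot>\<^bsub>?D\<^esub> ((Idt C (cob X l), e l, e l) \<cdot>\<^bsub>?D\<^esub> g l))"
      using tf(1-3)[OF l] tg(1-3)[OF l] ti(1-3)[OF l] tp(1-3)[OF l] by (simp add: D.cat_simps del: idem_simps)
    also have "\<dots> = f l \<cdot>\<^bsub>?D\<^esub> g l" using q tf(1-3)[OF l] tg(1-3)[OF l] ti(1-3)[OF l] tp(1-3)[OF l] by (simp add: D.cat_simps del: idem_simps)
    finally show ?thesis .
  qed
  have h: "homotopic ?H n Y Y (\<lambda>i. ?p i \<cdot>\<^bsub>?H\<^esub> ?i i) (\<lambda>i. Idt ?H (cob Y i))"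
    using homotopic_cong[OF fg pi] unfolding wic_simps unfolding wic_cat_eq by (simp only: homotopic_full_subcat[OF yw yw])
  have i0: "?i 0 = (Idt C A, e0, e0)" "?p 0 = (e0, e0, Idt C A)" and i1: "?i (Suc n) = (Idt C Z, e', e')" "?p (Suc n) = (e', e', Idt C Z)"
    using f'(2,3) g'(2,3) yc x(2) L(4,5) ob(5,6) by simp_all
  have \<Phi>: "wic_trans C Z A \<delta> = Act (wic_bifunctor C E) (?p (Suc n)) (?i 0) (e0, \<delta>, e')" unfolding i0 i1 wic_bifunctor_def wic_trans_def by (simp add: d'(2))
  have ex: "exangle ?H (wic_bifunctor C E) n Y (e0, \<delta>, e')"
  proof (rule F.D.exangle_retract[OF F.F_exangle[OF ob(1,2) d'(1) R1[OF ob(1,2) d'(1) L(1)]] Y _ i p h \<Phi>])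
    show "cob X 0 = A" "cob X (Suc n) = Z" using x(2) by auto
    show "(e0, \<delta>, e') \<in> carrier (Ext (wic_bifunctor C E) (cob Y (Suc n)) (cob Y 0))" using d yc by simp
    show "?p 0 \<cdot>\<^bsub>?H\<^esub> ?i 0 = Idt ?H (cob Y 0)" "?p (Suc n) \<cdot>\<^bsub>?H\<^esub> ?i (Suc n) = Idt ?H (cob Y (Suc n))"
      unfolding i0 i1 wic_simps yc using ob(5,6) by simp_all
  qed
  obtain A' j q where cA: "compl ?H (Fob (wic_functor C) ` Ob C) (A, e0) (A', Idt C A') (A, Idt C A) (Idt C A, e0, e0) j (e0, e0, Idt C A) q" by (rule wic_obD[OF A])
  obtain Z' j' q' where cZ: "compl ?H (Fob (wic_functor C) ` Ob C) (Z, e') (Z', Idt C Z') (Z, Idt C Z) (Idt C Z, e', e') j' (e', e', Idt C Z) q'" by (rule wic_obD[OF Z])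
  have R: "wicR (Z, Idt C Z) (A, Idt C A) (Act (wic_bifunctor C E) (e', e', Idt C Z) (Idt C A, e0, e0) (e0, \<delta>, e')) ?KX"
    unfolding image_realises_def wic_functor_simps(1) using ob(1,2) d' L(1) by (auto simp: wic_bifunctor_def wic_trans_def)
  show ?thesis by (rule W.rd_I[OF ex yc cA cZ R i i0(1) i1(1) p i0(2) i1(2)])
qed

text \<open>The idempotent chain map is read off instead of being made strict by corrections. The
  standard summand Y of the image of X satisfies \<pi> \<iota> = 1 strictly, so \<iota> \<pi> is an
  idempotent endomorphism of that image and comes from a chain map e on X. Then Y is strictly
  isomorphic to \<open>(X, e)\<close>, which also shows that the class has a member in the weak
  idempotent completion.\<close>

lemma ex_idem_lift:
  assumes n: "1 \<le> n" and Z: "(Z, e') \<in> Ob (wic_cat C)" and A: "(A, e0) \<in> Ob (wic_cat C)"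
    and d: "(e0, \<delta>, e') \<in> carrier (Ext (wic_bifunctor C E) (Z, e') (A, e0))"
  obtains X e Y where "idem_lift C n s Z A \<delta> e0 e' X e" "Y \<in> Ch (wic_cat C) n" "Y \<in> kclass (idem_cat C) n (idem_cpx C X e)"
proof -
  interpret F: full_embedding C E n s "wic_cat C" "wic_bifunctor C E" "wic_functor C" "wic_trans C" by (rule full_embedding_wic[OF n])
  interpret W: dense_realisation "wic_cat C" "wic_bifunctor C E" n "Fob (wic_functor C) ` Ob C" wicR by (rule F.dense_realisation_image)
  interpret D: additive_category "idem_cat C" by (rule additive_category_idem)
  let ?D = "idem_cat C" and ?H = "wic_cat C"
  have ob: "Z \<in> Ob C" "A \<in> Ob C" "e' \<in> Mor C Z Z" "e0 \<in> Mor C A A" "e0 \<cdot> e0 = e0" "e' \<cdot> e' = e'" using Z A by (simp_all add: wic_Ob)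
  have d': "\<delta> \<in> carrier (Ext E Z A)" "Act E e' e0 \<delta> = \<delta>" using d act_push_pull[OF ob(3,4)] by (auto simp: wic_bifunctor_def idem_ext3)
  obtain X where X0: "realises C n s Z A \<delta> X" using realised[OF ob(1,2) d'(1)] by blast
  note x = realises_Ch[OF X0]
  have X: "X \<in> Ch C n" using x by blast
  let ?KX = "map_cpx (wic_functor C) X"
  obtain A' j q where cA: "compl ?H (Fob (wic_functor C) ` Ob C) (A, e0) (A', Idt C A') (A, Idt C A) (Idt C A, e0, e0) j (e0, e0, Idt C A) q" by (rule wic_obD[OF A])
  obtain Z' j' q' where cZ: "compl ?H (Fob (wic_functor C) ` Ob C) (Z, e') (Z', Idt C Z') (Z, Idt C Z) (Idt C Z, e', e') j' (e', e', Idt C Z) q'" by (rule wic_obD[OF Z])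
  have R: "wicR (Z, Idt C Z) (A, Idt C A) (Act (wic_bifunctor C E) (e', e', Idt C Z) (Idt C A, e0, e0) (e0, \<delta>, e')) ?KX"
    unfolding image_realises_def wic_functor_simps(1) using ob(1,2) d' X0 by (auto simp: wic_bifunctor_def wic_trans_def)
  obtain w where w: "w \<in> Mor ?H (cob ?KX (Suc 0)) (A', Idt C A')" "w \<cdot>\<^bsub>?H\<^esub> cdf ?KX 0 = q"
    using W.ex_factor_inflation[OF d complD(1)[OF cA] F.D.biproductD(3)[OF complD(1)[OF cZ]] R] by blast
  obtain Y \<iota> \<pi> h v where s: "sdr ?H n ?KX Y \<iota> \<pi> h" "wicRD (Z, e') (A, e0) (e0, \<delta>, e') Y" "\<iota> 0 = (Idt C A, e0, e0)" "\<pi> 0 = (e0, e0, Idt C A)"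
     "\<iota> (Suc n) = (Idt C Z, e', e')" "\<pi> (Suc n) = (e', e', Idt C Z)" by (rule W.ex_standard_summand[OF d cA cZ R w])
  note sd = sdrD[OF s(1)]
  have kw: "\<And>i. i \<le> Suc n \<Longrightarrow> cob ?KX i \<in> wic_ob C" and KD: "?KX \<in> Ch ?D n" using sd(1) unfolding wic_cat_eq Ch_full_subcat by auto
  have yw: "\<And>i. i \<le> Suc n \<Longrightarrow> cob Y i \<in> wic_ob C" and YD: "Y \<in> Ch ?D n" using sd(2) unfolding wic_cat_eq Ch_full_subcat by auto
  have \<iota>: "chain_map ?D n Y ?KX \<iota>" and \<pi>: "chain_map ?D n ?KX Y \<pi>"
    using sd(3,4) unfolding wic_cat_eq by (simp_all only: chain_map_full_subcat[OF yw kw] chain_map_full_subcat[OF kw yw])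
  have \<pi>\<iota>: "\<pi> i \<cdot>\<^bsub>?D\<^esub> \<iota> i = Idt ?D (cob Y i)" if "i \<le> Suc n" for i using sd(6)[OF that] by simp
  note t\<iota> = D.chain_map_simps[OF YD KD \<iota>] and t\<pi> = D.chain_map_simps[OF KD YD \<pi>]
  \<comment> \<open>The middle entry of the triple; the outer entries are identities because the
    objects are of the form \<open>(X, id)\<close>.\<close>
  define e where "e i = fst (snd (\<iota> i \<cdot>\<^bsub>?D\<^esub> \<pi> i))" for i
  have ip: "chain_map ?D n ?KX ?KX (\<lambda>i. \<iota> i \<cdot>\<^bsub>?D\<^esub> \<pi> i)" by (rule D.chain_map_comp[OF KD YD KD \<pi> \<iota>])
  have em: "\<iota> i \<cdot>\<^bsub>?D\<^esub> \<pi> i = (Idt C (cob X i), e i, Idt C (cob X i))" "e i \<in> Mor C (cob X i) (cob X i)" if i: "i \<le> Suc n" for i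
  proof -
    have "\<iota> i \<cdot>\<^bsub>?D\<^esub> \<pi> i \<in> Mor ?D (cob X i, Idt C (cob X i)) (cob X i, Idt C (cob X i))"
      using D.chain_map_simps(1-3)[OF KD KD ip i] by (simp add: D.in_Mor_iff wic_functor_simps)
    then show "\<iota> i \<cdot>\<^bsub>?D\<^esub> \<pi> i = (Idt C (cob X i), e i, Idt C (cob X i))" "e i \<in> Mor C (cob X i) (cob X i)" unfolding idem_Mor e_def by auto
  qed
  have K: "i \<le> n \<Longrightarrow> Fmor (wic_functor C) (cdf X i) = (Idt C (cob X (Suc i)), cdf X i, Idt C (cob X i))" for i
    using Ch_simps[OF X] by (intro wic_functor_simps(2)) (simp add: in_Mor_iff)
  have ec: "chain_map C n X X e"
  proof (rule chain_mapI[OF em(2)])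
    fix i assume i: "i \<le> n"
    show "e (Suc i) \<cdot> cdf X i = cdf X i \<cdot> e i" using D.chain_map_simps(4)[OF KD KD ip i] em(1)[of i] em(1)[of "Suc i"] i by (simp add: K)
  qed
  have ee': "e i \<cdot> e i = e i" if i: "i \<le> Suc n" for i
  proof -
    have "(\<iota> i \<cdot>\<^bsub>?D\<^esub> \<pi> i) \<cdot>\<^bsub>?D\<^esub> (\<iota> i \<cdot>\<^bsub>?D\<^esub> \<pi> i) = \<iota> i \<cdot>\<^bsub>?D\<^esub> \<pi> i"
      using D.eqR[OF \<pi>\<iota>[OF i], of "\<pi> i"] t\<iota>(1-3)[OF i] t\<pi>(1-3)[OF i] by (simp add: D.cat_simps)
    then show ?thesis unfolding em(1)[OF i] by simp
  qed
  then have ee: "\<forall>i \<le> Suc n. e i \<cdot> e i = e i" by blast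
  have e0: "e 0 = e0" "e (Suc n) = e'" unfolding e_def s(3-6) using ob by simp_all
  have L: "idem_lift C n s Z A \<delta> e0 e' X e" unfolding idem_lift_def using X0 ec ee e0 by simp
  note IX = idem_cpx[OF X ec ee]
  note ti = D.chain_map_simps[OF IX(1) KD IX(3)] and tp = D.chain_map_simps[OF KD IX(1) IX(4)]
  let ?I = "idem_cpx C X e"
  let ?f = "\<lambda>i. \<pi> i \<cdot>\<^bsub>?D\<^esub> (Idt C (cob X i), e i, e i)" and ?g = "\<lambda>i. (e i, e i, Idt C (cob X i)) \<cdot>\<^bsub>?D\<^esub> \<iota> i"
  have f: "chain_map ?D n ?I Y ?f" by (rule D.chain_map_comp[OF IX(1) KD YD IX(3) \<pi>])
  have g: "chain_map ?D n Y ?I ?g" by (rule D.chain_map_comp[OF YD KD IX(1) \<iota> IX(4)])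
  have yc: "cob Y 0 = (A, e0)" "cob Y (Suc n) = (Z, e')" using W.rd_D(2,3)[OF s(2)] by auto
  have fg: "?f i \<cdot>\<^bsub>?D\<^esub> ?g i = Idt ?D (cob Y i)" if i: "i \<le> Suc n" for i
  proof -
    have 1: "(Idt C (cob X i), e i, e i) \<cdot>\<^bsub>?D\<^esub> (e i, e i, Idt C (cob X i)) = \<iota> i \<cdot>\<^bsub>?D\<^esub> \<pi> i" using em(1)[OF i] ee'[OF i] by simp
    show ?thesis using D.eqR[OF 1, of "\<iota> i"] D.eqR[OF \<pi>\<iota>[OF i], of "\<pi> i \<cdot>\<^bsub>?D\<^esub> \<iota> i"] \<pi>\<iota>[OF i] t\<iota>(1-3)[OF i] t\<pi>(1-3)[OF i] ti(1-3)[OF i] tp(1-3)[OF i]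
      by (simp add: D.cat_simps del: idem_simps)
  qed
  have gf: "?g i \<cdot>\<^bsub>?D\<^esub> ?f i = Idt ?D (cob ?I i)" if i: "i \<le> Suc n" for i
  proof -
    have "?g i \<cdot>\<^bsub>?D\<^esub> ?f i = (e i, e i, Idt C (cob X i)) \<cdot>\<^bsub>?D\<^esub> ((\<iota> i \<cdot>\<^bsub>?D\<^esub> \<pi> i) \<cdot>\<^bsub>?D\<^esub> (Idt C (cob X i), e i, e i))"
      using t\<iota>(1-3)[OF i] t\<pi>(1-3)[OF i] ti(1-3)[OF i] tp(1-3)[OF i] by (simp add: D.cat_simps del: idem_simps)
    also have "\<dots> = Idt ?D (cob ?I i)" unfolding em(1)[OF i] using ee'[OF i] by simp
    finally show ?thesis .
  qed
  have "chain_map_ends ?D n ?I Y ?f" unfolding chain_map_ends_def using f s(4,6) e0 ob x by simp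
  moreover have "chain_map_ends ?D n Y ?I ?g" unfolding chain_map_ends_def using g s(3,5) e0 ob x yc by simp
  ultimately have "K_iso ?D n ?I Y" unfolding K_iso_def
    using D.homotopic_eq[OF IX(1) IX(1) D.chain_map_id[OF IX(1)], of "\<lambda>i. ?g i \<cdot>\<^bsub>?D\<^esub> ?f i"] gf D.homotopic_eq[OF YD YD D.chain_map_id[OF YD], of "\<lambda>i. ?f i \<cdot>\<^bsub>?D\<^esub> ?g i"] fg by blast
  then have "Y \<in> kclass ?D n ?I" unfolding kclass_def Ch_ends_def using YD yc x e0 by simp
  then show thesis by (rule that[OF L sd(2)])
qed

text \<open>Evaluates the two choices in the definition: \<open>ex_idem_lift\<close> shows that
  there is something to choose, and \<open>idem_lift_rd\<close> that every admissible complex is a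
  summand realisation, whose class is the set of all of them.\<close>

lemma wic_realisation_eq:
  assumes n: "1 \<le> n" and Z: "Z \<in> Ob (wic_cat C)" and A: "A \<in> Ob (wic_cat C)" and d: "\<delta> \<in> carrier (Ext (wic_bifunctor C E) Z A)"
  shows "wic_realisation C n s Z A \<delta> = Collect (wicRD Z A \<delta>)"
proof -
  interpret F: full_embedding C E n s "wic_cat C" "wic_bifunctor C E" "wic_functor C" "wic_trans C" by (rule full_embedding_wic[OF n])
  interpret W: dense_realisation "wic_cat C" "wic_bifunctor C E" n "Fob (wic_functor C) ` Ob C" wicR by (rule F.dense_realisation_image)
  interpret D: additive_category "idem_cat C" by (rule additive_category_idem)
  obtain Z0 z A0 a where x: "Z = (Z0, z)" "A = (A0, a)" by (cases Z; cases A)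
  obtain \<epsilon> where \<epsilon>: "\<delta> = (a, \<epsilon>, z)" "\<epsilon> \<in> carrier (Ext E Z0 A0)" using d unfolding x wic_bifunctor_def idem_ext by blast
  note Z' = Z[unfolded x] and A' = A[unfolded x] and d' = d[unfolded x \<epsilon>]
  have ob: "Z0 \<in> Ob C" "A0 \<in> Ob C" using Z' A' by (simp_all add: wic_Ob)
  obtain X e Y where y: "idem_lift C n s Z0 A0 \<epsilon> a z X e" "Y \<in> Ch (wic_cat C) n" "Y \<in> kclass (idem_cat C) n (idem_cpx C X e)"
    by (rule ex_idem_lift[OF n Z' A' d'])
  have t: "idem_realisation C n s Z A \<delta> = kclass (idem_cat C) n (idem_cpx C X e)" unfolding x \<epsilon> by (rule idem_realisation_eq[OF n ob \<epsilon>(2) y(1)])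
  have L: "realises C n s Z0 A0 \<epsilon> X" "chain_map C n X X e" "\<forall>i \<le> Suc n. e i \<cdot> e i = e i" "e 0 = a" "e (Suc n) = z"
    using y(1) unfolding idem_lift_def by auto
  note xx = realises_exact[OF ob \<epsilon>(2) L(1)] realises_Ch[OF L(1)]
  have X: "X \<in> Ch C n" using xx by blast
  note IX = idem_cpx[OF X L(2,3)]
  have ce: "cexact (idem_cat C) n (idem_cpx C X e)" using IX(2) xx by blast
  have rd: "wicRD Z A \<delta> V" if "V \<in> Ch (wic_cat C) n" "realises (idem_cat C) n (idem_realisation C n s) Z A \<delta> V" for V
  proof -
    have V: "V \<in> Ch_ends (idem_cat C) n A Z" "kclass (idem_cat C) n (idem_cpx C X e) = kclass (idem_cat C) n V" using that(2) unfolding realises_def t by auto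
    then have "V \<in> kclass (idem_cat C) n V" unfolding kclass_def Ch_ends_def using D.K_iso_refl by simp
    then show ?thesis using idem_lift_rd[OF n Z' A' d' y(1) that(1)] V(2) unfolding x \<epsilon> by simp
  qed
  have "realises (idem_cat C) n (idem_realisation C n s) Z A \<delta> Y"
    unfolding realises_def t using D.kclass_eq[OF IX(1) ce n y(3)] y(3) xx(2) L(4,5) by (simp add: kclass_def x)
  then have "\<exists>K. \<exists>V \<in> Ch (wic_cat C) n. realises (idem_cat C) n (idem_realisation C n s) Z A \<delta> V \<and> K = kclass (wic_cat C) n V" using y(2) by blast
  from someI_ex[OF this] obtain V where V: "V \<in> Ch (wic_cat C) n" "realises (idem_cat C) n (idem_realisation C n s) Z A \<delta> V"
     "wic_realisation C n s Z A \<delta> = kclass (wic_cat C) n V" unfolding wic_realisation_def by blast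
  show ?thesis unfolding V(3) using W.rd_kclass[OF rd[OF V(1,2)]] by blast
qed

theorem wic_n_exangulated:
  assumes n: "1 \<le> n"
  shows "n_exangulated_category (wic_cat C) (wic_bifunctor C E) n (wic_realisation C n s)" "weakly_idempotent_complete (wic_cat C)"
    "n_exangulated_functor C E s (wic_cat C) (wic_bifunctor C E) (wic_realisation C n s) n (wic_functor C) (wic_trans C)"
  using full_embedding.n_exangulated_embedding[OF full_embedding_wic[OF n] wic_realisation_eq[OF n]] by blast+

end

section \<open>The universal property\<close>

text \<open>Y is an n-exangle by \<open>exangle_retract\<close>, and it is compared with some
  realisation U of \<delta> through X: the lifts between X and U over the ends of f and g compose
  with f and g to maps between Y and U that are identities at the ends.\<close>

lemma (in exact_realisation) realises_retract:
  assumes n: "1 \<le> n" and ob: "Z \<in> Ob C" "A \<in> Ob C" and d': "\<delta>' \<in> carrier (Ext E Z A)" and X: "realises C n s Z A \<delta>' X"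
    and Y: "Y \<in> Ch C n" and d: "\<delta> \<in> carrier (Ext E (cob Y (Suc n)) (cob Y 0))"
    and f: "chain_map C n Y X f" and g: "chain_map C n X Y g"
    and h: "homotopic C n Y Y (\<lambda>i. g i \<cdot> f i) (\<lambda>i. Idt C (cob Y i))"
    and e: "\<delta>' = Act E (g (Suc n)) (f 0) \<delta>" "g 0 \<cdot> f 0 = Idt C (cob Y 0)" "g (Suc n) \<cdot> f (Suc n) = Idt C (cob Y (Suc n))"
  shows "realises C n s (cob Y (Suc n)) (cob Y 0) \<delta> Y"
proof -
  let ?W = "cob Y (Suc n)" and ?B = "cob Y 0"
  note xc = realises_Ch[OF X]
  have XC: "X \<in> Ch C n" and x0: "cob X 0 = A" and x1: "cob X (Suc n) = Z" using xc by auto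
  have exY: "exangle C E n Y \<delta>" by (rule exangle_retract[OF R1[OF ob d' X] Y d f g h e])
  have ob': "?W \<in> Ob C" "?B \<in> Ob C" using Ch_simps(1)[OF Y] by auto
  have m: "f 0 \<in> Mor C ?B A" "f (Suc n) \<in> Mor C ?W Z" "g 0 \<in> Mor C A ?B" "g (Suc n) \<in> Mor C Z ?W"
    using chain_map_simps(1-3)[OF Y XC f, of 0] chain_map_simps(1-3)[OF Y XC f, of "Suc n"]
      chain_map_simps(1-3)[OF XC Y g, of 0] chain_map_simps(1-3)[OF XC Y g, of "Suc n"] x0 x1 by (auto simp: in_Mor_iff)
  obtain U where U: "realises C n s ?W ?B \<delta> U" using realised[OF ob' d] by blast
  note uc = realises_Ch[OF U] and ue = realises_exact[OF ob' d U]
  have UC: "U \<in> Ch C n" using uc by blast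
  have p1: "push C E Z (g 0) \<delta>' = pull C E ?B (g (Suc n)) \<delta>"
    unfolding push_def pull_def e(1) act_act[OF idt_mor[OF ob(1)] m(4) m(1) m(3) d] using e(2) m(4) by (simp add: cmp_idt)
  obtain k where k: "chain_map C n X U k" "k 0 = g 0" "k (Suc n) = g (Suc n)" using R0[OF d' d m(3,4) p1 X U] by auto
  have p2: "push C E ?W (f 0) \<delta> = pull C E A (f (Suc n)) \<delta>'"
    unfolding push_def pull_def e(1) act_act[OF m(2) m(4) m(1) idt_mor[OF ob(2)] d] using e(3) m(1) by (simp add: idt_cmp)
  obtain l where l: "chain_map C n U X l" "l 0 = f 0" "l (Suc n) = f (Suc n)" using R0[OF d d' m(1,2) p2 U X] by auto
  have "chain_map_ends C n Y U (\<lambda>i. k i \<cdot> f i)" unfolding chain_map_ends_def using chain_map_comp[OF Y XC UC f k(1)] k e(2,3) by simp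
  moreover have "chain_map_ends C n U Y (\<lambda>i. g i \<cdot> l i)" unfolding chain_map_ends_def using chain_map_comp[OF UC XC Y l(1) g] l e(2,3) uc by simp
  ultimately have "Y \<in> kclass C n U" unfolding kclass_iff[OF UC ue[THEN conjunct2, THEN conjunct1] n] using Y exangleD(5)[OF exY] by blast
  then have "Y \<in> s ?W ?B \<delta>" using U unfolding realises_def by simp
  then show ?thesis using realises_iff[OF n ob' d] by blast
qed

text \<open>The idempotent e is killed by r, hence factors through the kernel as k h; that h k is
  the identity follows from uniqueness in the universal property.\<close>

lemma (in additive_category) weakly_idempotent_complete_split:
  assumes w: "weakly_idempotent_complete C" and e: "e \<in> Mor C X X" and r: "r \<in> Mor C X Y" and s: "s \<in> Mor C Y X"
    and rs: "r \<cdot> s = Idt C Y" and c: "e \<boxplus> s \<cdot> r = Idt C X"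
  shows "\<exists>L. \<exists>i \<in> Mor C L X. \<exists>p \<in> Mor C X L. p \<cdot> i = Idt C L \<and> i \<cdot> p = e"
proof -
  obtain K k where "is_kernel C X Y r K k" using w r s rs unfolding weakly_idempotent_complete_def by blast
  then have k: "k \<in> Mor C K X" "r \<cdot> k = Zer C K Y" and u: "\<And>W g. g \<in> Mor C W X \<Longrightarrow> r \<cdot> g = Zer C W Y \<Longrightarrow> \<exists>!h. h \<in> Mor C W K \<and> k \<cdot> h = g"
    unfolding is_kernel_def by blast+
  note z = split_complement[OF e r s rs c]
  obtain h where h: "h \<in> Mor C X K" "k \<cdot> h = e" using u[OF e z(2)] by blast
  note t = k(1)[unfolded in_Mor_iff] h(1)[unfolded in_Mor_iff] e[unfolded in_Mor_iff] r[unfolded in_Mor_iff] s[unfolded in_Mor_iff]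
  have o: "K \<in> Ob C" "X \<in> Ob C" "Y \<in> Ob C" using mor_ob k r by blast+
  have "e \<cdot> k = (e \<boxplus> s \<cdot> r) \<cdot> k" using t o k(2) by (simp add: add_simps)
  also have "\<dots> = k" unfolding c using k(1) by (rule idt_cmp)
  finally have "k \<cdot> (h \<cdot> k) = k" using eqR[OF h(2), of k] t by simp
  then have "h \<cdot> k = Idt C K" using u[OF k] cmp_mor[OF k(1) h(1)] idt_mor[OF o(1)] cmp_idt[OF k(1)] by blast
  then show ?thesis using k(1) h by blast
qed

lemma n_exangulated_functorD:
  assumes "n_exangulated_functor C E s D G t n F \<Gamma>"
  shows "additive_functor C D F"
    "Z \<in> Ob C \<Longrightarrow> A \<in> Ob C \<Longrightarrow> \<Gamma> Z A \<in> hom (Ext E Z A) (Ext G (Fob F Z) (Fob F A))"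
    "c \<in> Mor C W Z \<Longrightarrow> a \<in> Mor C A B \<Longrightarrow> \<delta> \<in> carrier (Ext E Z A) \<Longrightarrow> \<Gamma> W B (Act E c a \<delta>) = Act G (Fmor F c) (Fmor F a) (\<Gamma> Z A \<delta>)"
    "Z \<in> Ob C \<Longrightarrow> A \<in> Ob C \<Longrightarrow> \<delta> \<in> carrier (Ext E Z A) \<Longrightarrow> realises C n s Z A \<delta> X \<Longrightarrow>
      realises D n t (Fob F Z) (Fob F A) (\<Gamma> Z A \<delta>) (map_cpx F X)"
  using assms unfolding n_exangulated_functor_def by blast+

text \<open>\<open>li\<close> and \<open>lp\<close> split the image of the idempotent through the
  object \<open>LO\<close>. The splitting is arbitrary on all objects, those of the form
  \<open>(X, id)\<close> included, so the extension restricts to F only up to the isomorphism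
  \<open>lp\<close>.\<close>

locale wic_extension = C: n_exangulated_category C E n s + D: n_exangulated_category D G n t + add_functor C D F
    for C :: "('o, 'm) cat" and E :: "('o, 'm, 'x) bifunctor" and n s and D :: "('p, 'q) cat" and G :: "('p, 'q, 'y) bifunctor" and t
      and F :: "('o, 'm, 'p, 'q) cfunctor" +
  fixes \<Lambda> :: "'o \<Rightarrow> 'o \<Rightarrow> 'x \<Rightarrow> 'y" and LO :: "'o \<times> 'm \<Rightarrow> 'p" and li lp :: "'o \<times> 'm \<Rightarrow> 'q"
  assumes n_pos: "1 \<le> n"
    and ex_functor: "n_exangulated_functor C E s D G t n F \<Lambda>"
    and li_mor: "P \<in> Ob (wic_cat C) \<Longrightarrow> li P \<in> Mor D (LO P) (Fob F (fst P))"
    and lp_mor: "P \<in> Ob (wic_cat C) \<Longrightarrow> lp P \<in> Mor D (Fob F (fst P)) (LO P)"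
    and lp_li: "P \<in> Ob (wic_cat C) \<Longrightarrow> lp P \<cdot>\<^bsub>D\<^esub> li P = Idt D (LO P)"
    and li_lp: "P \<in> Ob (wic_cat C) \<Longrightarrow> li P \<cdot>\<^bsub>D\<^esub> lp P = Fmor F (snd P)"
begin

abbreviation "H \<equiv> wic_cat C"
abbreviation "K \<equiv> wic_functor C"
abbreviation cmpD (infixr "\<bullet>" 70) where "g \<bullet> f \<equiv> g \<cdot>\<^bsub>D\<^esub> f"

text \<open>A triple records the two idempotents but not the objects, which are recovered from the
  middle entry by \<open>dm\<close> and \<open>cd\<close>.\<close>

definition L :: "('o \<times> 'm, 'm \<times> 'm \<times> 'm, 'p, 'q) cfunctor" where
  "L = \<lparr>Fob = LO, Fmor = (\<lambda>(e', f, e). lp (cd C f, e') \<bullet> (Fmor F f \<bullet> li (dm C f, e)))\<rparr>"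

definition \<Psi> :: "'o \<times> 'm \<Rightarrow> 'o \<times> 'm \<Rightarrow> 'm \<times> 'x \<times> 'm \<Rightarrow> 'y" where
  "\<Psi> Z A = (\<lambda>(_, \<delta>, _). Act G (li Z) (lp A) (\<Lambda> (fst Z) (fst A) \<delta>))"

lemma H_Ob: "(X, e) \<in> Ob H \<Longrightarrow> X \<in> Ob C \<and> e \<in> Mor C X X \<and> e \<cdot>\<^bsub>C\<^esub> e = e"
  by (simp add: C.wic_Ob)

lemma K_Ob: "X \<in> Ob C \<Longrightarrow> (X, Idt C X) \<in> Ob H"
  using C.wic_ob_self by (simp add: C.wic_Ob C.cat_simps)

lemma H_MorE:
  assumes "f \<in> Mor H P Q"
  obtains X e Y e' r where "P = (X, e)" "Q = (Y, e')" "f = (e', r, e)" "(X, e) \<in> Ob H" "(Y, e') \<in> Ob H" "r \<in> Mor C X Y" "r \<cdot>\<^bsub>C\<^esub> e = r" "e' \<cdot>\<^bsub>C\<^esub> r = r"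
proof -
  have w: "f \<in> Mor (idem_cat C) P Q" "P \<in> wic_ob C" "Q \<in> wic_ob C" using assms C.wic_Mor by blast+
  from w(1) show thesis
  proof (rule idem_MorE)
    fix X e Y e' r assume "P = (X, e)" "Q = (Y, e')" "f = (e', r, e)" "X \<in> Ob C" "e \<in> Mor C X X" "e \<cdot>\<^bsub>C\<^esub> e = e"
      "Y \<in> Ob C" "e' \<in> Mor C Y Y" "e' \<cdot>\<^bsub>C\<^esub> e' = e'" "r \<in> Mor C X Y" "r \<cdot>\<^bsub>C\<^esub> e = r" "e' \<cdot>\<^bsub>C\<^esub> r = r"
    then show thesis using w(2,3) by (intro that[of X e Y e' r]) (simp_all add: C.wic_Ob)
  qed
qed

lemma l_typ:
  assumes "(X, e) \<in> Ob H"
  shows "mor D (li (X, e))" "dm D (li (X, e)) = LO (X, e)" "cd D (li (X, e)) = Fob F X"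
    "mor D (lp (X, e))" "dm D (lp (X, e)) = Fob F X" "cd D (lp (X, e)) = LO (X, e)"
    "lp (X, e) \<bullet> li (X, e) = Idt D (LO (X, e))" "li (X, e) \<bullet> lp (X, e) = Fmor F e" "LO (X, e) \<in> Ob D"
  using li_mor[OF assms] lp_mor[OF assms] lp_li[OF assms] li_lp[OF assms] D.mor_ob[OF li_mor[OF assms]] by (simp_all add: D.in_Mor_iff)

lemma lk: assumes "X \<in> Ob C"
  shows "li (X, Idt C X) \<bullet> lp (X, Idt C X) = Idt D (Fob F X)"
  using l_typ(8)[OF K_Ob[OF assms]] F_idt[OF assms] by simp

lemma L_simps: "Fob L P = LO P"
    "r \<in> Mor C X Y \<Longrightarrow> Fmor L (e', r, e) = lp (Y, e') \<bullet> (Fmor F r \<bullet> li (X, e))"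
  by (simp_all add: L_def C.in_Mor_iff)

lemma L_mor: assumes "(X, e) \<in> Ob H" "(Y, e') \<in> Ob H" "r \<in> Mor C X Y"
  shows "Fmor L (e', r, e) \<in> Mor D (LO (X, e)) (LO (Y, e'))"
  using l_typ[OF assms(1)] l_typ[OF assms(2)] F_mor[OF assms(3)] unfolding L_simps(2)[OF assms(3)] by (simp add: D.cat_simps)

text \<open>Together with \<open>L_lp\<close> this expresses naturality of the splitting maps:
  \<open>li\<close> absorbs the idempotent of the target, \<open>lp\<close> that of the source.
  Functoriality of L and naturality of \<Psi> rest on these squares.\<close>

lemma L_li: assumes "(X, e) \<in> Ob H" "(Y, e') \<in> Ob H" "r \<in> Mor C X Y" "e' \<cdot>\<^bsub>C\<^esub> r = r"
  shows "li (Y, e') \<bullet> Fmor L (e', r, e) = Fmor F r \<bullet> li (X, e)"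
proof -
  note x = l_typ[OF assms(1)] and y = l_typ[OF assms(2)] and Fr = F_mor[OF assms(3)]
  have e': "e' \<in> Mor C Y Y" using H_Ob assms(2) by blast
  have "Fmor F e' \<bullet> Fmor F r = Fmor F r" using F_cmp[OF assms(3) e'] assms(4) by simp
  then show ?thesis unfolding L_simps(2)[OF assms(3)]
    using x y Fr D.eqR[OF y(8), of "Fmor F r \<bullet> li (X, e)"] D.eqR[of "Fmor F e'" "Fmor F r" "Fmor F r" "li (X, e)"] F_mor[OF e'] by (simp add: D.cat_simps)
qed

lemma L_lp: assumes "(X, e) \<in> Ob H" "(Y, e') \<in> Ob H" "r \<in> Mor C X Y" "r \<cdot>\<^bsub>C\<^esub> e = r"
  shows "Fmor L (e', r, e) \<bullet> lp (X, e) = lp (Y, e') \<bullet> Fmor F r"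
proof -
  note x = l_typ[OF assms(1)] and y = l_typ[OF assms(2)] and Fr = F_mor[OF assms(3)]
  have e: "e \<in> Mor C X X" using H_Ob assms(1) by blast
  have "Fmor F r \<bullet> Fmor F e = Fmor F r" using F_cmp[OF e assms(3)] assms(4) by simp
  then show ?thesis unfolding L_simps(2)[OF assms(3)] using x y Fr F_mor[OF e] by (simp add: D.cat_simps)
qed

lemma L_additive: "additive_functor H D L"
  unfolding additive_functor_def C.wic_simps
proof (intro conjI ballI allI)
  fix A assume A: "A \<in> Ob H"
  obtain X e where x: "A = (X, e)" by (cases A)
  note l = l_typ[OF A[unfolded x]] and h = H_Ob[OF A[unfolded x]]
  show "Fob L A \<in> Ob D" unfolding x L_simps using l by simp
  have "lp (X, e) \<bullet> ((li (X, e) \<bullet> lp (X, e)) \<bullet> li (X, e)) = Idt D (LO (X, e))"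
    using l(1-7,9) D.eqR[OF l(7), of "lp (X, e) \<bullet> li (X, e)"] by (simp add: D.cat_simps)
  then show "Fmor L (Idt (idem_cat C) A) = Idt D (Fob L A)" unfolding x using l(8) h by (simp add: L_simps(1) L_simps(2)[of e X X])
next
  fix A B f assume "f \<in> Mor H A B"
  then show "Fmor L f \<in> Mor D (Fob L A) (Fob L B)" by (elim H_MorE) (simp add: L_mor L_simps(1))
next
  fix A B B' f g assume "f \<in> Mor H A B" "g \<in> Mor H B B'"
  then show "Fmor L (g \<cdot>\<^bsub>idem_cat C\<^esub> f) = Fmor L g \<bullet> Fmor L f"
  proof (elim H_MorE)
    fix X e Y e' r Y' e'' Z d q assume *: "A = (X, e)" "B = (Y, e')" "f = (e', r, e)" "(X, e) \<in> Ob H" "(Y, e') \<in> Ob H" "r \<in> Mor C X Y"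
        "r \<cdot>\<^bsub>C\<^esub> e = r" "e' \<cdot>\<^bsub>C\<^esub> r = r"
        "B = (Y', e'')" "B' = (Z, d)" "g = (d, q, e'')" "(Y', e'') \<in> Ob H" "(Z, d) \<in> Ob H" "q \<in> Mor C Y' Z" "q \<cdot>\<^bsub>C\<^esub> e'' = q" "d \<cdot>\<^bsub>C\<^esub> q = q"
    then have Y: "Y' = Y" "e'' = e'" by auto
    note q = *(14)[unfolded Y]
    note l = l_typ[OF *(4)] l_typ[OF *(5)] l_typ[OF *(13)] F_mor[OF *(6)] F_mor[OF q]
    have "Fmor L (d, q, e') \<bullet> Fmor L (e', r, e) = lp (Z, d) \<bullet> (Fmor F q \<bullet> (li (Y, e') \<bullet> Fmor L (e', r, e)))"
      unfolding L_simps(2)[OF q] using l L_mor[OF *(4-6)] by (simp add: D.cat_simps)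
    also have "\<dots> = Fmor L (d, q \<cdot>\<^bsub>C\<^esub> r, e)"
      unfolding L_li[OF *(4,5,6,8)] L_simps(2)[OF C.cmp_mor[OF *(6) q]] F_cmp[OF *(6) q] using l by (simp add: D.cat_simps)
    finally show ?thesis using * Y by simp
  qed
next
  fix A B f g assume "f \<in> Mor H A B" "g \<in> Mor H A B"
  then show "Fmor L (f \<boxplus>\<^bsub>idem_cat C\<^esub> g) = Fmor L f \<boxplus>\<^bsub>D\<^esub> Fmor L g"
  proof (elim H_MorE)
    fix X e Y e' r X' e2 Y' e3 q assume *: "A = (X, e)" "B = (Y, e')" "f = (e', r, e)" "(X, e) \<in> Ob H" "(Y, e') \<in> Ob H" "r \<in> Mor C X Y"
      "A = (X', e2)" "B = (Y', e3)" "g = (e3, q, e2)" "q \<in> Mor C X' Y'"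
    have q: "q \<in> Mor C X Y" using * by simp
    note l = l_typ[OF *(4)] l_typ[OF *(5)] F_mor[OF *(6)] F_mor[OF q]
    show ?thesis using * l by (simp add: L_simps(2)[OF q] L_simps(2)[OF *(6)] L_simps(2)[OF C.add_mor[OF *(6) q]] F_add[OF *(6) q] D.add_simps)
  qed
qed

lemma \<Lambda>_closed: "Z \<in> Ob C \<Longrightarrow> A \<in> Ob C \<Longrightarrow> \<delta> \<in> carrier (Ext E Z A) \<Longrightarrow> \<Lambda> Z A \<delta> \<in> carrier (Ext G (Fob F Z) (Fob F A))"
  using n_exangulated_functorD(2)[OF ex_functor] hom_in_carrier by metis

lemma extE:
  assumes "\<delta> \<in> carrier (Ext (wic_bifunctor C E) (Z, z) (A, e))"
  obtains \<epsilon> where "\<delta> = (e, \<epsilon>, z)" "\<epsilon> \<in> carrier (Ext E Z A)" "Act E (Idt C Z) e \<epsilon> = \<epsilon>" "Act E z (Idt C A) \<epsilon> = \<epsilon>"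
  using assms unfolding wic_bifunctor_def idem_ext push_def pull_def by blast

lemma \<Psi>_simps: "\<Psi> (Z, z) (A, e) (a, \<delta>, b) = Act G (li (Z, z)) (lp (A, e)) (\<Lambda> Z A \<delta>)"
  by (simp add: \<Psi>_def)

lemma \<Psi>_closed:
  assumes Z: "(Z, z) \<in> Ob H" and A: "(A, e) \<in> Ob H" and d: "\<delta> \<in> carrier (Ext E Z A)"
  shows "\<Psi> (Z, z) (A, e) (a, \<delta>, b) \<in> carrier (Ext G (LO (Z, z)) (LO (A, e)))"
  unfolding \<Psi>_simps using D.act_closed[OF li_mor[OF Z] lp_mor[OF A], of "\<Lambda> Z A \<delta>"] \<Lambda>_closed d H_Ob[OF Z] H_Ob[OF A] by simp

lemma \<Psi>_nat:
  assumes c: "c \<in> Mor H W Z" and a: "a \<in> Mor H A B" and d: "\<delta> \<in> carrier (Ext (wic_bifunctor C E) Z A)"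
  shows "\<Psi> W B (Act (wic_bifunctor C E) c a \<delta>) = Act G (Fmor L c) (Fmor L a) (\<Psi> Z A \<delta>)"
proof -
  obtain W0 w Z0 z c0 where c: "W = (W0, w)" "Z = (Z0, z)" "c = (z, c0, w)" "(W0, w) \<in> Ob H" "(Z0, z) \<in> Ob H" "c0 \<in> Mor C W0 Z0" "c0 \<cdot>\<^bsub>C\<^esub> w = c0" "z \<cdot>\<^bsub>C\<^esub> c0 = c0"
    using c by (rule H_MorE)
  obtain A0 e B0 f a0 where a: "A = (A0, e)" "B = (B0, f)" "a = (f, a0, e)" "(A0, e) \<in> Ob H" "(B0, f) \<in> Ob H" "a0 \<in> Mor C A0 B0" "a0 \<cdot>\<^bsub>C\<^esub> e = a0" "f \<cdot>\<^bsub>C\<^esub> a0 = a0"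
    using a by (rule H_MorE)
  obtain \<epsilon> where \<epsilon>: "\<delta> = (e, \<epsilon>, z)" "\<epsilon> \<in> carrier (Ext E Z0 A0)" using d unfolding c(2) a(1) by (rule extE)
  have \<Lambda>\<epsilon>: "\<Lambda> Z0 A0 \<epsilon> \<in> carrier (Ext G (Fob F Z0) (Fob F A0))" using \<Lambda>_closed \<epsilon>(2) H_Ob[OF c(5)] H_Ob[OF a(4)] by blast
  note m = li_mor[OF c(4), unfolded fst_conv] lp_mor[OF a(5), unfolded fst_conv] li_mor[OF c(5), unfolded fst_conv] lp_mor[OF a(4), unfolded fst_conv]
  have "\<Psi> W B (Act (wic_bifunctor C E) c a \<delta>) = Act G (li (W0, w)) (lp (B0, f)) (Act G (Fmor F c0) (Fmor F a0) (\<Lambda> Z0 A0 \<epsilon>))"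
    unfolding c(1-3) a(1-3) \<epsilon>(1) wic_bifunctor_def idem_bifunctor_simps \<Psi>_simps n_exangulated_functorD(3)[OF ex_functor c(6) a(6) \<epsilon>(2)] by (rule refl)
  also have "\<dots> = Act G (Fmor L c) (Fmor L a) (Act G (li (Z0, z)) (lp (A0, e)) (\<Lambda> Z0 A0 \<epsilon>))"
    unfolding D.act_act[OF m(1) F_mor[OF c(6)] F_mor[OF a(6)] m(2) \<Lambda>\<epsilon>] c(3) a(3)
      D.act_act[OF L_mor[OF c(4-6)] m(3) m(4) L_mor[OF a(4-6)] \<Lambda>\<epsilon>] L_li[OF c(4,5,6,8)] L_lp[OF a(4,5,6,7)] by (rule refl)
  finally show ?thesis unfolding c(1,2) a(1,2) \<epsilon>(1) \<Psi>_simps .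
qed

lemma \<Psi>_hom:
  assumes Z: "Z \<in> Ob H" and A: "A \<in> Ob H"
  shows "\<Psi> Z A \<in> hom (Ext (wic_bifunctor C E) Z A) (Ext G (Fob L Z) (Fob L A))"
proof -
  obtain Z0 z A0 e where x: "Z = (Z0, z)" "A = (A0, e)" by (cases Z; cases A)
  note Z' = Z[unfolded x] and A' = A[unfolded x]
  have ob: "Z0 \<in> Ob C" "A0 \<in> Ob C" using H_Ob Z' A' by blast+
  show ?thesis unfolding x L_simps
  proof (rule homI)
    fix \<delta> assume "\<delta> \<in> carrier (Ext (wic_bifunctor C E) (Z0, z) (A0, e))"
    then obtain d where d: "\<delta> = (e, d, z)" "d \<in> carrier (Ext E Z0 A0)" by (rule extE)
    show "\<Psi> (Z0, z) (A0, e) \<delta> \<in> carrier (Ext G (LO (Z0, z)) (LO (A0, e)))" unfolding d(1) by (rule \<Psi>_closed[OF Z' A' d(2)])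
    fix \<rho> assume "\<rho> \<in> carrier (Ext (wic_bifunctor C E) (Z0, z) (A0, e))"
    then obtain r where r: "\<rho> = (e, r, z)" "r \<in> carrier (Ext E Z0 A0)" by (rule extE)
    show "\<Psi> (Z0, z) (A0, e) (\<delta> \<otimes>\<^bsub>Ext (wic_bifunctor C E) (Z0, z) (A0, e)\<^esub> \<rho>) = \<Psi> (Z0, z) (A0, e) \<delta> \<otimes>\<^bsub>Ext G (LO (Z0, z)) (LO (A0, e))\<^esub> \<Psi> (Z0, z) (A0, e) \<rho>"
      unfolding d(1) r(1) wic_bifunctor_def idem_bifunctor_simps \<Psi>_simps hom_mult[OF n_exangulated_functorD(2)[OF ex_functor ob] d(2) r(2)]
      using D.act_hom_mult[OF li_mor[OF Z', unfolded fst_conv] lp_mor[OF A', unfolded fst_conv] \<Lambda>_closed[OF ob d(2)] \<Lambda>_closed[OF ob r(2)]] .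
  qed
qed

lemma \<Psi>_K: "\<Psi> (Z, Idt C Z) (A, Idt C A) (wic_trans C Z A \<delta>) = Act G (li (Z, Idt C Z)) (lp (A, Idt C A)) (\<Lambda> Z A \<delta>)"
  by (simp add: wic_trans_def \<Psi>_simps)

end

context wic_extension begin

abbreviation "wr \<equiv> wic_realisation C n s"
abbreviation "wG \<equiv> wic_bifunctor C E"
abbreviation "wT \<equiv> wic_trans C"

text \<open>A realising complex X is a retract up to homotopy of the image of some X0 from C. L
  preserves this, and the splitting maps identify the image of X0 under L and K with its image under
  F, which realises \<Lambda> of the extension. So \<open>realises_retract\<close> applies.\<close>

lemma L_exangulated: "n_exangulated_functor H wG wr D G t n L \<Psi>"
proof -
  interpret e: full_embedding C E n s H wG K wT by (rule C.full_embedding_wic[OF n_pos])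
  interpret W: dense_realisation H wG n "Fob K ` Ob C" C.wicR by (rule e.dense_realisation_image)
  interpret L: add_functor H D L
    by (intro add_functor.intro add_functor_axioms.intro L_additive C.additive_category_wic D.additive_category_axioms)
  have "realises D n t (Fob L Z) (Fob L A) (\<Psi> Z A \<delta>) (map_cpx L X)"
    if ob: "Z \<in> Ob H" "A \<in> Ob H" and d: "\<delta> \<in> carrier (Ext wG Z A)" and X: "realises H n wr Z A \<delta> X" for Z A \<delta> X
  proof -
    have rd: "C.wicRD Z A \<delta> X" using X W.realises_rd[OF C.wic_realisation_eq[OF n_pos] ob d] by blast
    note rdD = W.rd_D[OF rd]
    obtain A' TA i j p q Z' TZ i' j' p' q' Y \<iota> \<pi> where r: "compl H (Fob K ` Ob C) A A' TA i j p q" "compl H (Fob K ` Ob C) Z Z' TZ i' j' p' q'"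
        "C.wicR TZ TA (Act wG p' i \<delta>) Y" "chain_map H n X Y \<iota>" "\<iota> 0 = i" "\<iota> (Suc n) = i'"
        "chain_map H n Y X \<pi>" "\<pi> 0 = p" "\<pi> (Suc n) = p'" by (rule W.rd_obtain[OF rd])
    note bA = e.D.biproductD[OF complD(1)[OF r(1)]] and bZ = e.D.biproductD[OF complD(1)[OF r(2)]]
    obtain Z0 A0 \<delta>0 X0 where x: "Z0 \<in> Ob C" "A0 \<in> Ob C" "\<delta>0 \<in> carrier (Ext E Z0 A0)" "realises C n s Z0 A0 \<delta>0 X0"
      "TZ = Fob K Z0" "TA = Fob K A0" "Act wG p' i \<delta> = wT Z0 A0 \<delta>0" "Y = map_cpx K X0" using r(3) unfolding image_realises_def by blast
    have Y: "Y \<in> Ch H n" using W.R_D(4)[OF r(3)] .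
    note XH = rdD(1)
    note xc = realises_Ch[OF x(4)]
    \<comment> \<open>The composite \<pi> \<iota> is only known to be the identity at the ends.
      Multiplying \<pi> by a strong inverse v of it makes the composite homotopic to the identity,
      and leaves the ends of \<pi> unchanged as v is the identity there.\<close>
    have "chain_map_ends H n X X (\<lambda>l. \<pi> l \<cdot>\<^bsub>H\<^esub> \<iota> l)" unfolding chain_map_ends_def
      using e.D.chain_map_comp[OF XH Y XH r(4,7)] r(5,6,8,9) bA(5) bZ(5) rdD(2,3) by simp
    from e.D.strong_inverse[OF XH rdD(8) this n_pos] obtain v where v: "chain_map_ends H n X X v"
        "strong_homotopic H n X X (\<lambda>l. v l \<cdot>\<^bsub>H\<^esub> (\<pi> l \<cdot>\<^bsub>H\<^esub> \<iota> l)) (\<lambda>l. Idt H (cob X l))" by blast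
    note v' = e.D.chain_map_endsD[OF v(1)]
    define \<pi>' where "\<pi>' l = v l \<cdot>\<^bsub>H\<^esub> \<pi> l" for l
    have \<pi>': "chain_map H n Y X \<pi>'" unfolding \<pi>'_def by (rule e.D.chain_map_comp[OF Y XH XH r(7) v'(1)])
    note tv = e.D.chain_map_simps[OF XH XH v'(1)] and t\<pi> = e.D.chain_map_simps[OF Y XH r(7)] and t\<iota> = e.D.chain_map_simps[OF XH Y r(4)]
      and t\<pi>' = e.D.chain_map_simps[OF Y XH \<pi>']
    have h: "homotopic H n X X (\<lambda>l. \<pi>' l \<cdot>\<^bsub>H\<^esub> \<iota> l) (\<lambda>l. Idt H (cob X l))"
      by (rule homotopic_cong[OF strong_homotopic_homotopic[OF v(2)]]) (use tv(1-3) t\<pi>(1-3) t\<iota>(1-3) in \<open>simp add: \<pi>'_def e.D.cat_simps del: C.wic_simps\<close>)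
    have \<pi>'0: "\<pi>' 0 = p" "\<pi>' (Suc n) = p'" unfolding \<pi>'_def using v'(2,3) rdD(2,3) r(8,9) e.D.idt_cmp[OF bA(3)] e.D.idt_cmp[OF bZ(3)] by simp_all
    have Ych: "\<And>l. l \<le> Suc n \<Longrightarrow> cob X0 l \<in> Ob C" using C.Ch_simps(1)[of X0 n] xc by blast
    let ?FX = "map_cpx F X0" and ?LX = "map_cpx L X" and ?LY = "map_cpx L Y"
    have FX: "?FX \<in> Ch D n" and LX: "?LX \<in> Ch D n" and LY: "?LY \<in> Ch D n" using F_Ch xc L.F_Ch XH Y by blast+
    have KF: "Fmor K (cdf X0 l) = (Idt C (cob X0 (Suc l)), cdf X0 l, Idt C (cob X0 l))" "cdf X0 l \<in> Mor C (cob X0 l) (cob X0 (Suc l))" if "l \<le> n" for l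
      using C.Ch_simps[of X0 n] xc that by (auto intro!: C.wic_functor_simps(2) simp: C.in_Mor_iff)
    have a: "chain_map D n ?LY ?FX (\<lambda>l. li (cob X0 l, Idt C (cob X0 l)))"
    proof (rule D.chain_mapI)
      fix l assume "l \<le> Suc n" then show "li (cob X0 l, Idt C (cob X0 l)) \<in> Mor D (cob ?LY l) (cob ?FX l)"
        using li_mor[OF K_Ob[OF Ych]] by (simp add: x(8) L_simps(1) C.wic_functor_simps(1))
    next
      fix l assume l: "l \<le> n" then show "li (cob X0 (Suc l), Idt C (cob X0 (Suc l))) \<bullet> cdf ?LY l = cdf ?FX l \<bullet> li (cob X0 l, Idt C (cob X0 l))"
        using L_li[OF K_Ob K_Ob KF(2)[OF l] C.idt_cmp[OF KF(2)[OF l]]] Ych by (simp add: x(8) KF(1))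
    qed
    have b: "chain_map D n ?FX ?LY (\<lambda>l. lp (cob X0 l, Idt C (cob X0 l)))"
    proof (rule D.chain_mapI)
      fix l assume "l \<le> Suc n" then show "lp (cob X0 l, Idt C (cob X0 l)) \<in> Mor D (cob ?FX l) (cob ?LY l)"
        using lp_mor[OF K_Ob[OF Ych]] by (simp add: x(8) L_simps(1) C.wic_functor_simps(1))
    next
      fix l assume l: "l \<le> n" then show "lp (cob X0 (Suc l), Idt C (cob X0 (Suc l))) \<bullet> cdf ?FX l = cdf ?LY l \<bullet> lp (cob X0 l, Idt C (cob X0 l))"
        using L_lp[OF K_Ob K_Ob KF(2)[OF l] C.cmp_idt[OF KF(2)[OF l]]] Ych by (simp add: x(8) KF(1))
    qed
    note L\<iota> = L.F_chain_map[OF XH Y r(4)] and L\<pi> = L.F_chain_map[OF Y XH \<pi>']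
    let ?f = "\<lambda>l. li (cob X0 l, Idt C (cob X0 l)) \<bullet> Fmor L (\<iota> l)" and ?g = "\<lambda>l. Fmor L (\<pi>' l) \<bullet> lp (cob X0 l, Idt C (cob X0 l))"
    have f: "chain_map D n ?LX ?FX ?f" by (rule D.chain_map_comp[OF LX LY FX L\<iota> a])
    have g: "chain_map D n ?FX ?LX ?g" by (rule D.chain_map_comp[OF FX LY LX b L\<pi>])
    have gf: "?g l \<bullet> ?f l = Fmor L (\<pi>' l \<cdot>\<^bsub>H\<^esub> \<iota> l)" if l: "l \<le> Suc n" for l
    proof -
      have m: "\<iota> l \<in> Mor H (cob X l) (cob Y l)" "\<pi>' l \<in> Mor H (cob Y l) (cob X l)" using t\<iota>(1-3)[OF l] t\<pi>'(1-3)[OF l] by (simp_all add: e.D.in_Mor_iff)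
      have Yl: "Fob L (cob Y l) = LO (cob X0 l, Idt C (cob X0 l))" by (simp add: x(8) C.wic_functor_simps(1) L_simps(1))
      note ll = l_typ[OF K_Ob[OF Ych[OF l]]]
      show ?thesis unfolding L.F_cmp[OF m] using L.F_mor[OF m(1)] L.F_mor[OF m(2)] ll Yl D.eqR[OF ll(7), of "Fmor L (\<iota> l)"] by (simp add: D.cat_simps)
    qed
    have lh: "homotopic D n ?LX ?LX (\<lambda>l. ?g l \<bullet> ?f l) (\<lambda>l. Idt D (cob ?LX l))"
    proof -
      have "homotopic D n ?LX ?LX (\<lambda>l. Fmor L (\<pi>' l \<cdot>\<^bsub>H\<^esub> \<iota> l)) (\<lambda>l. Fmor L (Idt H (cob X l)))"
        by (rule L.F_homotopic[OF XH XH e.D.chain_map_id[OF XH] h])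
      then have "homotopic D n ?LX ?LX (\<lambda>l. ?g l \<bullet> ?f l) (\<lambda>l. Fmor L (Idt H (cob X l)))" by (rule homotopic_cong) (rule gf)
      moreover have "Fmor L (Idt H (cob X l)) = Idt D (cob ?LX l)" if "l \<le> Suc n" for l using L.F_idt e.D.Ch_simps(1)[OF XH that] by simp
      ultimately show ?thesis unfolding homotopic_iff by simp
    qed
    have g0: "?g 0 \<bullet> ?f 0 = Idt D (cob ?LX 0)" "?g (Suc n) \<bullet> ?f (Suc n) = Idt D (cob ?LX (Suc n))"
      using gf[of 0] gf[of "Suc n"] \<pi>'0 r(5,6) bA(5) bZ(5) L.F_idt[OF bA(10)] L.F_idt[OF bZ(10)] rdD(2,3) by simp_all
    have oZA: "Fob F Z0 \<in> Ob D" "Fob F A0 \<in> Ob D" using F_ob x by blast+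
    have X00: "cob X0 0 = A0" "cob X0 (Suc n) = Z0" using xc by auto
    have \<Psi>d: "\<Psi> Z A \<delta> \<in> carrier (Ext G (Fob L Z) (Fob L A))" using \<Psi>_hom[OF ob] d by (rule hom_in_carrier)
    have \<Lambda>d: "\<Lambda> Z0 A0 \<delta>0 \<in> carrier (Ext G (Fob F Z0) (Fob F A0))" by (rule \<Lambda>_closed[OF x(1-3)])
    note kZ = K_Ob[OF x(1)] and kA = K_Ob[OF x(2)]
    note lZ = li_mor[OF kZ, unfolded fst_conv] lp_mor[OF kZ, unfolded fst_conv] and lA = li_mor[OF kA, unfolded fst_conv] lp_mor[OF kA, unfolded fst_conv]
    have Li: "Fmor L i \<in> Mor D (Fob L A) (LO (A0, Idt C A0))" and Lp: "Fmor L p' \<in> Mor D (LO (Z0, Idt C Z0)) (Fob L Z)"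
      using L.F_mor[OF bA(1)] L.F_mor[OF bZ(3)] by (simp_all add: x(5,6) C.wic_functor_simps(1) L_simps(1))
    \<comment> \<open>The extension upstairs must be the one obtained from \<Psi> of \<delta> by the
      ends of the chain maps: first the splitting maps over \<open>(Z0, id)\<close> and
      \<open>(A0, id)\<close> are inserted, then naturality of \<Psi> moves p' and i
      outside.\<close>
    have "\<Lambda> Z0 A0 \<delta>0 = Act G (Idt D (Fob F Z0)) (Idt D (Fob F A0)) (\<Lambda> Z0 A0 \<delta>0)" using D.act_idt[OF oZA \<Lambda>d] by simp
    also have "\<dots> = Act G (lp (Z0, Idt C Z0)) (li (A0, Idt C A0)) (Act G (li (Z0, Idt C Z0)) (lp (A0, Idt C A0)) (\<Lambda> Z0 A0 \<delta>0))"
      unfolding D.act_act[OF lZ(2,1) lA(2,1) \<Lambda>d] lk[OF x(1)] lk[OF x(2)] by (rule refl)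
    also have "\<dots> = Act G (lp (Z0, Idt C Z0)) (li (A0, Idt C A0)) (Act G (Fmor L p') (Fmor L i) (\<Psi> Z A \<delta>))"
      unfolding \<Psi>_nat[OF bZ(3) bA(1) d, symmetric] x(5-7) C.wic_functor_simps(1) \<Psi>_K by (rule refl)
    also have "\<dots> = Act G (?g (Suc n)) (?f 0) (\<Psi> Z A \<delta>)"
      unfolding D.act_act[OF lZ(2) Lp Li lA(1) \<Psi>d] X00 \<pi>'0 r(5) by (rule refl)
    finally have e: "\<Lambda> Z0 A0 \<delta>0 = Act G (?g (Suc n)) (?f 0) (\<Psi> Z A \<delta>)" .
    have "realises D n t (cob ?LX (Suc n)) (cob ?LX 0) (\<Psi> Z A \<delta>) ?LX"
      by (rule D.realises_retract[OF n_pos oZA \<Lambda>d n_exangulated_functorD(4)[OF ex_functor x(1-4)] LX _ f g lh e g0])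
        (use \<Psi>d rdD(2,3) in simp)
    then show ?thesis using rdD(2,3) by simp
  qed
  then show ?thesis unfolding n_exangulated_functor_def using L_additive \<Psi>_hom \<Psi>_nat by (simp add: L_simps(1))
qed

lemma alpha_iso:
  "n_exangulated_iso C E D G F \<Lambda> (comp_functor L K) (comp_trans \<Psi> K wT) (\<lambda>X. lp (X, Idt C X))"
proof -
  have cf: "Fob (comp_functor L K) X = LO (X, Idt C X)" for X by (simp add: comp_functor_def C.wic_functor_simps(1) L_simps(1))
  have cm: "Fmor (comp_functor L K) f = Fmor L (Idt C Y, f, Idt C X)" if "f \<in> Mor C X Y" for f X Y
    using C.wic_functor_simps(2)[OF that] by (simp add: comp_functor_def)
  have ct: "comp_trans \<Psi> K wT Z A \<delta> = Act G (li (Z, Idt C Z)) (lp (A, Idt C A)) (\<Lambda> Z A \<delta>)" for Z A \<delta>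
    by (simp add: comp_trans_def C.wic_functor_simps(1) \<Psi>_K)
  note lm = li_mor[OF K_Ob, unfolded fst_conv] and pm = lp_mor[OF K_Ob, unfolded fst_conv]
  have "n_exangulated_trans C E D G F \<Lambda> (comp_functor L K) (comp_trans \<Psi> K wT) (\<lambda>X. lp (X, Idt C X))"
    unfolding n_exangulated_trans_def natural_trans_def cf ct
  proof (intro conjI ballI allI)
    fix A B f assume f: "f \<in> Mor C A B"
    show "lp (B, Idt C B) \<bullet> Fmor F f = Fmor (comp_functor L K) f \<bullet> lp (A, Idt C A)"
      unfolding cm[OF f] using L_lp[OF K_Ob K_Ob f C.cmp_idt[OF f]] C.mor_ob[OF f] by simp
  next
    fix Z A \<delta> assume x: "Z \<in> Ob C" "A \<in> Ob C" "\<delta> \<in> carrier (Ext E Z A)"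
    have oL: "LO (Z, Idt C Z) \<in> Ob D" "LO (A, Idt C A) \<in> Ob D" using l_typ(9)[OF K_Ob] x by blast+
    have "pull D G (LO (A, Idt C A)) (lp (Z, Idt C Z)) (Act G (li (Z, Idt C Z)) (lp (A, Idt C A)) (\<Lambda> Z A \<delta>)) =
       Act G (Idt D (Fob F Z)) (Idt D (LO (A, Idt C A)) \<bullet> lp (A, Idt C A)) (\<Lambda> Z A \<delta>)"
      unfolding pull_def D.act_act[OF pm[OF x(1)] lm[OF x(1)] pm[OF x(2)] D.idt_mor[OF oL(2)] \<Lambda>_closed[OF x]] lk[OF x(1)] by (rule refl)
    then show "push D G (Fob F Z) (lp (A, Idt C A)) (\<Lambda> Z A \<delta>) = pull D G (LO (A, Idt C A)) (lp (Z, Idt C Z)) (Act G (li (Z, Idt C Z)) (lp (A, Idt C A)) (\<Lambda> Z A \<delta>))"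
      unfolding push_def using D.idt_cmp[OF pm[OF x(2)]] by simp
  qed (rule pm)
  moreover have "n_exangulated_trans C E D G (comp_functor L K) (comp_trans \<Psi> K wT) F \<Lambda> (\<lambda>X. li (X, Idt C X))"
    unfolding n_exangulated_trans_def natural_trans_def cf ct
  proof (intro conjI ballI allI)
    fix A B f assume f: "f \<in> Mor C A B"
    show "li (B, Idt C B) \<bullet> Fmor (comp_functor L K) f = Fmor F f \<bullet> li (A, Idt C A)"
      unfolding cm[OF f] using L_li[OF K_Ob K_Ob f C.idt_cmp[OF f]] C.mor_ob[OF f] by simp
  next
    fix Z A \<delta> assume x: "Z \<in> Ob C" "A \<in> Ob C" "\<delta> \<in> carrier (Ext E Z A)"
    have oL: "LO (Z, Idt C Z) \<in> Ob D" "LO (A, Idt C A) \<in> Ob D" using l_typ(9)[OF K_Ob] x by blast+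
    have "push D G (LO (Z, Idt C Z)) (li (A, Idt C A)) (Act G (li (Z, Idt C Z)) (lp (A, Idt C A)) (\<Lambda> Z A \<delta>)) =
       Act G (li (Z, Idt C Z) \<bullet> Idt D (LO (Z, Idt C Z))) (Idt D (Fob F A)) (\<Lambda> Z A \<delta>)"
      unfolding push_def D.act_act[OF D.idt_mor[OF oL(1)] lm[OF x(1)] pm[OF x(2)] lm[OF x(2)] \<Lambda>_closed[OF x]] lk[OF x(2)] by (rule refl)
    then show "push D G (LO (Z, Idt C Z)) (li (A, Idt C A)) (Act G (li (Z, Idt C Z)) (lp (A, Idt C A)) (\<Lambda> Z A \<delta>)) = pull D G (Fob F A) (li (Z, Idt C Z)) (\<Lambda> Z A \<delta>)"
      unfolding pull_def using D.cmp_idt[OF lm[OF x(1)]] by simp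
  qed (rule lm)
  ultimately show ?thesis unfolding n_exangulated_iso_def cf using lk l_typ(7)[OF K_Ob] by blast
qed

text \<open>\<open>(X, e)\<close> is a retract of \<open>(X, id)\<close>, where \<gamma> is forced
  by \<beta> because \<open>lp (X, id)\<close> is invertible. Naturality along the projection
  \<open>(e, e, id)\<close> then determines \<gamma> at \<open>(X, e)\<close>. Extensionality fixes
  the values of the function outside the objects, so that uniqueness can be literal.\<close>

lemma ex1_trans:
  assumes M: "n_exangulated_functor H wG wr D G t n M \<Theta>"
    and \<beta>: "n_exangulated_trans C E D G F \<Lambda> (comp_functor M K) (comp_trans \<Theta> K wT) \<beta>"
  shows "\<exists>!\<gamma>. \<gamma> \<in> extensional (Ob H) \<and> n_exangulated_trans H wG D G L \<Psi> M \<Theta> \<gamma> \<and> (\<forall>X \<in> Ob C. \<beta> X = \<gamma> (Fob K X) \<bullet> lp (X, Idt C X))"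
proof -
  interpret M: add_functor H D M
    by (intro add_functor.intro add_functor_axioms.intro n_exangulated_functorD(1)[OF M] C.additive_category_wic D.additive_category_axioms)
  have cf: "Fob (comp_functor M K) X = Fob M (X, Idt C X)" for X by (simp add: comp_functor_def C.wic_functor_simps(1))
  have cm: "Fmor (comp_functor M K) f = Fmor M (Idt C Y, f, Idt C X)" if "f \<in> Mor C X Y" for f X Y
    using C.wic_functor_simps(2)[OF that] by (simp add: comp_functor_def)
  have ct: "comp_trans \<Theta> K wT Z A \<delta> = \<Theta> (Z, Idt C Z) (A, Idt C A) (Idt C A, \<delta>, Idt C Z)" for Z A \<delta>
    by (simp add: comp_trans_def C.wic_functor_simps(1) wic_trans_def)
  have \<beta>m: "\<beta> X \<in> Mor D (Fob F X) (Fob M (X, Idt C X))" if "X \<in> Ob C" for X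
    using \<beta> that unfolding n_exangulated_trans_def natural_trans_def cf by blast
  have \<beta>n: "\<beta> Y \<bullet> Fmor F f = Fmor M (Idt C Y, f, Idt C X) \<bullet> \<beta> X" if "f \<in> Mor C X Y" for f X Y
    using \<beta> that cm[OF that] unfolding n_exangulated_trans_def natural_trans_def by metis
  have \<beta>e: "Act G (Idt D (Fob F Z)) (\<beta> A) (\<Lambda> Z A \<delta>) = Act G (\<beta> Z) (Idt D (Fob M (A, Idt C A))) (\<Theta> (Z, Idt C Z) (A, Idt C A) (Idt C A, \<delta>, Idt C Z))"
    if "Z \<in> Ob C" "A \<in> Ob C" "\<delta> \<in> carrier (Ext E Z A)" for Z A \<delta>
    using \<beta> that unfolding n_exangulated_trans_def cf ct push_def pull_def by blast
  have hm: "(e', r, e) \<in> Mor H (X, e) (Y, e')" if "(X, e) \<in> Ob H" "(Y, e') \<in> Ob H" "r \<in> Mor C X Y" "r \<cdot>\<^bsub>C\<^esub> e = r" "e' \<cdot>\<^bsub>C\<^esub> r = r" for X e Y e' r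
    using that by (simp add: C.wic_Mor C.wic_Ob idem_Mor3)
  define \<gamma> where "\<gamma> = restrict (\<lambda>(X, e). Fmor M (e, e, Idt C X) \<bullet> (\<beta> X \<bullet> li (X, e))) (Ob H)"
  have \<gamma>: "\<gamma> (X, e) = Fmor M (e, e, Idt C X) \<bullet> (\<beta> X \<bullet> li (X, e))" if "(X, e) \<in> Ob H" for X e using that by (simp add: \<gamma>_def)
  have pr: "(e, e, Idt C X) \<in> Mor H (X, Idt C X) (X, e)" "(Idt C X, e, e) \<in> Mor H (X, e) (X, Idt C X)" if x: "(X, e) \<in> Ob H" for X e
    using H_Ob[OF x] K_Ob x by (auto intro!: hm simp: C.cat_simps)
  have m: "Fmor M (e, e, Idt C X) \<in> Mor D (Fob M (X, Idt C X)) (Fob M (X, e))" "\<beta> X \<in> Mor D (Fob F X) (Fob M (X, Idt C X))"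
     "li (X, e) \<in> Mor D (LO (X, e)) (Fob F X)" if x: "(X, e) \<in> Ob H" for X e
    using M.F_mor[OF pr(1)[OF x]] \<beta>m H_Ob[OF x] li_mor[OF x] by auto
  have \<gamma>m: "\<gamma> (X, e) \<in> Mor D (LO (X, e)) (Fob M (X, e))" if x: "(X, e) \<in> Ob H" for X e
    unfolding \<gamma>[OF x] by (intro D.cmp_mor[OF D.cmp_mor[OF m(3,2)[OF x]] m(1)[OF x]])
  have \<gamma>n: "\<gamma> Q \<bullet> Fmor L f = Fmor M f \<bullet> \<gamma> P" if f: "f \<in> Mor H P Q" for P Q f
  proof -
    obtain X e Y e' r where x: "P = (X, e)" "Q = (Y, e')" "f = (e', r, e)" "(X, e) \<in> Ob H" "(Y, e') \<in> Ob H" "r \<in> Mor C X Y" "r \<cdot>\<^bsub>C\<^esub> e = r" "e' \<cdot>\<^bsub>C\<^esub> r = r"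
      using f by (rule H_MorE)
    have o: "X \<in> Ob C" "Y \<in> Ob C" using H_Ob x(4,5) by blast+
    note tm = m(1,2,3)[OF x(4), unfolded D.in_Mor_iff] m(1,2,3)[OF x(5), unfolded D.in_Mor_iff] L_mor[OF x(4-6), unfolded D.in_Mor_iff] F_mor[OF x(6), unfolded D.in_Mor_iff]
    have k: "(Idt C Y, r, Idt C X) \<in> Mor H (X, Idt C X) (Y, Idt C Y)" using o x(6) by (intro hm K_Ob) (simp_all add: C.cat_simps)
    note tk = M.F_mor[OF k, unfolded D.in_Mor_iff] M.F_mor[OF f, unfolded x D.in_Mor_iff]
    have "\<gamma> Q \<bullet> Fmor L f = Fmor M (e', e', Idt C Y) \<bullet> (\<beta> Y \<bullet> (li (Y, e') \<bullet> Fmor L (e', r, e)))"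
      unfolding x(2,3) \<gamma>[OF x(5)] using tm by (simp add: D.cat_simps)
    also have "\<dots> = Fmor M (e', e', Idt C Y) \<bullet> ((\<beta> Y \<bullet> Fmor F r) \<bullet> li (X, e))"
      unfolding L_li[OF x(4,5,6,8)] using tm by (simp add: D.cat_simps)
    also have "\<dots> = (Fmor M (e', e', Idt C Y) \<bullet> Fmor M (Idt C Y, r, Idt C X)) \<bullet> (\<beta> X \<bullet> li (X, e))"
      unfolding \<beta>n[OF x(6)] using tm tk by (simp add: D.cat_simps)
    also have "Fmor M (e', e', Idt C Y) \<bullet> Fmor M (Idt C Y, r, Idt C X) = Fmor M (e', r, Idt C X)"
      using M.F_cmp[OF k pr(1)[OF x(5)]] x(8) by simp
    also have "Fmor M (e', r, Idt C X) = Fmor M (e', r, e) \<bullet> Fmor M (e, e, Idt C X)"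
      using M.F_cmp[OF pr(1)[OF x(4)] f[unfolded x]] x(7) by simp
    also have "(Fmor M (e', r, e) \<bullet> Fmor M (e, e, Idt C X)) \<bullet> (\<beta> X \<bullet> li (X, e)) = Fmor M f \<bullet> \<gamma> P"
      unfolding x(1,3) \<gamma>[OF x(4)] using tm tk by (simp add: D.cat_simps)
    finally show ?thesis .
  qed
  have \<gamma>e: "push D G (Fob L Z) (\<gamma> A) (\<Psi> Z A \<delta>) = pull D G (Fob M A) (\<gamma> Z) (\<Theta> Z A \<delta>)"
    if ob: "Z \<in> Ob H" "A \<in> Ob H" and d: "\<delta> \<in> carrier (Ext wG Z A)" for Z A \<delta>
  proof -
    obtain Z0 z A0 e where x: "Z = (Z0, z)" "A = (A0, e)" by (cases Z; cases A)
    note Z' = ob(1)[unfolded x] and A' = ob(2)[unfolded x]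
    obtain \<epsilon> where \<epsilon>: "\<delta> = (e, \<epsilon>, z)" "\<epsilon> \<in> carrier (Ext E Z0 A0)" "Act E (Idt C Z0) e \<epsilon> = \<epsilon>" "Act E z (Idt C A0) \<epsilon> = \<epsilon>" using d unfolding x by (rule extE)
    have o: "Z0 \<in> Ob C" "A0 \<in> Ob C" "z \<in> Mor C Z0 Z0" "e \<in> Mor C A0 A0" using H_Ob Z' A' by blast+
    note kZ = K_Ob[OF o(1)] and kA = K_Ob[OF o(2)]
    have \<Lambda>d: "\<Lambda> Z0 A0 \<epsilon> \<in> carrier (Ext G (Fob F Z0) (Fob F A0))" by (rule \<Lambda>_closed[OF o(1,2) \<epsilon>(2)])
    have d1: "(Idt C A0, \<epsilon>, Idt C Z0) \<in> carrier (Ext wG (Z0, Idt C Z0) (A0, Idt C A0))"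
      using \<epsilon>(2) C.act_idt o by (simp add: wic_bifunctor_def idem_ext3 push_def pull_def)
    note mA = m[OF A'] and mZ = m[OF Z'] and pA = lp_mor[OF A', unfolded fst_conv]
    note M2 = n_exangulated_functorD(2)[OF M] and M3 = n_exangulated_functorD(3)[OF M]
    let ?T = "\<Theta> (Z0, Idt C Z0) (A0, Idt C A0) (Idt C A0, \<epsilon>, Idt C Z0)"
    have T: "?T \<in> carrier (Ext G (Fob M (Z0, Idt C Z0)) (Fob M (A0, Idt C A0)))" by (rule hom_in_carrier[OF M2[OF kZ kA] d1])
    have T': "\<Theta> Z A \<delta> \<in> carrier (Ext G (Fob M (Z0, z)) (Fob M (A0, e)))" using hom_in_carrier[OF M2[OF ob] d] unfolding x .
    have oD: "LO (Z0, z) \<in> Ob D" "Fob F Z0 \<in> Ob D" "Fob M (Z0, Idt C Z0) \<in> Ob D" "Fob M (A0, e) \<in> Ob D" "Fob M (A0, Idt C A0) \<in> Ob D"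
      using D.mor_ob mA mZ by blast+
    note i = D.idt_mor[OF oD(1)] D.idt_mor[OF oD(2)] D.idt_mor[OF oD(3)] D.idt_mor[OF oD(4)] D.idt_mor[OF oD(5)]
    have Fe: "Act G (Idt D (Fob F Z0)) (Fmor F e) (\<Lambda> Z0 A0 \<epsilon>) = \<Lambda> Z0 A0 \<epsilon>"
      using n_exangulated_functorD(3)[OF ex_functor C.idt_mor[OF o(1)] o(4) \<epsilon>(2)] \<epsilon>(3) F_idt[OF o(1)] by simp
    have MT1: "Act G (Idt D (Fob M (Z0, Idt C Z0))) (Fmor M (e, e, Idt C A0)) ?T = \<Theta> (Z0, Idt C Z0) (A0, e) (e, \<epsilon>, Idt C Z0)"
      using M3[OF M.C.idt_mor[OF kZ] pr(1)[OF A'] d1] \<epsilon>(3) M.F_idt[OF kZ] by (simp add: wic_bifunctor_def)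
    have MT2: "Act G (Fmor M (z, z, Idt C Z0)) (Idt D (Fob M (A0, e))) (\<Theta> Z A \<delta>) = \<Theta> (Z0, Idt C Z0) (A0, e) (e, \<epsilon>, Idt C Z0)"
      using M3[OF pr(1)[OF Z'] M.C.idt_mor[OF A'] d[unfolded x]] C.act_push_pull[OF o(3,4) \<epsilon>(2)] \<epsilon>(3,4) M.F_idt[OF A']
      by (simp add: wic_bifunctor_def x \<epsilon>(1) push_def pull_def)
    \<comment> \<open>The idempotent e is absorbed by \<Lambda> of the extension
      (\<open>Fe\<close>), then compatibility of \<beta> moves the extension from F to M over
      \<open>(Z0, id)\<close> and \<open>(A0, id)\<close>. \<open>MT1\<close> and \<open>MT2\<close>
      meet in the extension from \<open>(Z0, id)\<close> to \<open>(A0, e)\<close>, reached by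
      pushing forward from one side and by pulling back from the other.\<close>
    have "push D G (Fob L Z) (\<gamma> A) (\<Psi> Z A \<delta>) =
        Act G (Idt D (LO (Z0, z))) (Fmor M (e, e, Idt C A0) \<bullet> (\<beta> A0 \<bullet> li (A0, e))) (Act G (li (Z0, z)) (lp (A0, e)) (\<Lambda> Z0 A0 \<epsilon>))"
      unfolding push_def x \<epsilon>(1) \<gamma>[OF A'] \<Psi>_simps L_simps(1) by (rule refl)
    also have "\<dots> = Act G (li (Z0, z)) ((Fmor M (e, e, Idt C A0) \<bullet> \<beta> A0) \<bullet> Fmor F e) (\<Lambda> Z0 A0 \<epsilon>)"
      unfolding D.act_act[OF i(1) mZ(3) pA D.cmp_mor[OF D.cmp_mor[OF mA(3,2)] mA(1)] \<Lambda>d] l_typ(8)[OF A', symmetric]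
      using mZ(3) mA pA by (simp add: D.cat_simps)
    also have "\<dots> = Act G (li (Z0, z)) (Fmor M (e, e, Idt C A0) \<bullet> \<beta> A0) (Act G (Idt D (Fob F Z0)) (Fmor F e) (\<Lambda> Z0 A0 \<epsilon>))"
      unfolding D.act_act[OF mZ(3) i(2) F_mor[OF o(4)] D.cmp_mor[OF mA(2,1)] \<Lambda>d] D.idt_cmp[OF mZ(3)] by (rule refl)
    also have "\<dots> = Act G (li (Z0, z)) (Fmor M (e, e, Idt C A0)) (Act G (Idt D (Fob F Z0)) (\<beta> A0) (\<Lambda> Z0 A0 \<epsilon>))"
      unfolding Fe D.act_act[OF mZ(3) i(2) mA(2,1) \<Lambda>d] D.idt_cmp[OF mZ(3)] by (rule refl)
    also have "\<dots> = Act G (\<beta> Z0 \<bullet> li (Z0, z)) (Fmor M (e, e, Idt C A0)) ?T"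
      unfolding \<beta>e[OF o(1,2) \<epsilon>(2)] D.act_act[OF mZ(3) mZ(2) i(5) mA(1) T] D.cmp_idt[OF mA(1)] by (rule refl)
    also have "\<dots> = Act G (\<beta> Z0 \<bullet> li (Z0, z)) (Idt D (Fob M (A0, e))) (Act G (Idt D (Fob M (Z0, Idt C Z0))) (Fmor M (e, e, Idt C A0)) ?T)"
      unfolding D.act_act[OF D.cmp_mor[OF mZ(3,2)] i(3) mA(1) i(4) T] D.idt_cmp[OF mA(1)] D.idt_cmp[OF D.cmp_mor[OF mZ(3,2)]] by (rule refl)
    also have "\<dots> = Act G (Fmor M (z, z, Idt C Z0) \<bullet> (\<beta> Z0 \<bullet> li (Z0, z))) (Idt D (Fob M (A0, e))) (\<Theta> Z A \<delta>)"
      unfolding MT1 MT2[symmetric] D.act_act[OF D.cmp_mor[OF mZ(3,2)] mZ(1) i(4) i(4) T'] D.idt_cmp[OF i(4)] by (rule refl)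
    finally show ?thesis unfolding pull_def x \<gamma>[OF Z'] .
  qed
  have \<gamma>t: "n_exangulated_trans H wG D G L \<Psi> M \<Theta> \<gamma>" unfolding n_exangulated_trans_def natural_trans_def
  proof (intro conjI ballI allI)
    show "\<gamma> A \<in> Mor D (Fob L A) (Fob M A)" if "A \<in> Ob H" for A using \<gamma>m that by (cases A) (simp add: L_simps(1))
  qed (use \<gamma>n \<gamma>e in blast)+
  have \<gamma>\<alpha>: "\<beta> X = \<gamma> (Fob K X) \<bullet> lp (X, Idt C X)" if X: "X \<in> Ob C" for X
  proof -
    note k = K_Ob[OF X]
    have "Fmor M (Idt C X, Idt C X, Idt C X) = Idt D (Fob M (X, Idt C X))" using M.F_idt[OF k] by simp
    then show ?thesis unfolding C.wic_functor_simps(1) \<gamma>[OF k] using m(1,2,3)[OF k] lp_mor[OF k] lk[OF X] by (simp add: D.cat_simps)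
  qed
  show ?thesis
  proof (rule ex1I[of _ \<gamma>])
    show "\<gamma> \<in> extensional (Ob H) \<and> n_exangulated_trans H wG D G L \<Psi> M \<Theta> \<gamma> \<and> (\<forall>X\<in>Ob C. \<beta> X = \<gamma> (Fob K X) \<bullet> lp (X, Idt C X))"
      using \<gamma>t \<gamma>\<alpha> by (simp add: \<gamma>_def)
    fix \<gamma>' assume g: "\<gamma>' \<in> extensional (Ob H) \<and> n_exangulated_trans H wG D G L \<Psi> M \<Theta> \<gamma>' \<and> (\<forall>X\<in>Ob C. \<beta> X = \<gamma>' (Fob K X) \<bullet> lp (X, Idt C X))"
    have gm: "\<gamma>' P \<in> Mor D (LO P) (Fob M P)" if "P \<in> Ob H" for P using g that unfolding n_exangulated_trans_def natural_trans_def L_simps(1) by blast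
    have gn: "\<gamma>' Q \<bullet> Fmor L f = Fmor M f \<bullet> \<gamma>' P" if "f \<in> Mor H P Q" for P Q f using g that unfolding n_exangulated_trans_def natural_trans_def by blast
    have "\<gamma>' P = \<gamma> P" if P: "P \<in> Ob H" for P
    proof -
      obtain X e where x: "P = (X, e)" by (cases P)
      note x' = P[unfolded x]
      have o: "X \<in> Ob C" "e \<in> Mor C X X" "e \<cdot>\<^bsub>C\<^esub> e = e" using H_Ob[OF x'] by auto
      note k = K_Ob[OF o(1)]
      note t = m(1,2,3)[OF x', unfolded D.in_Mor_iff] lp_mor[OF k, unfolded D.in_Mor_iff] gm[OF k, unfolded D.in_Mor_iff] gm[OF x', unfolded D.in_Mor_iff]
        l_typ[OF x'] l_typ(1-6)[OF k] F_mor[OF o(2), unfolded D.in_Mor_iff]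
      \<comment> \<open>The inclusion of \<open>(X, e)\<close> into \<open>(X, id)\<close>,
        expressed by splitting maps, is a section of L applied to the projection; inserting it
        reduces the component at \<open>(X, e)\<close> to the one at \<open>(X, id)\<close>.\<close>
      have Le: "Fmor L (e, e, Idt C X) \<bullet> (lp (X, Idt C X) \<bullet> li (X, e)) = Idt D (LO (X, e))"
      proof -
        have 1: "Fmor L (e, e, Idt C X) \<bullet> lp (X, Idt C X) = lp (X, e) \<bullet> Fmor F e"
          by (rule L_lp[OF k x' o(2) C.cmp_idt[OF o(2)]])
        have "Fmor L (e, e, Idt C X) \<bullet> (lp (X, Idt C X) \<bullet> li (X, e)) = lp (X, e) \<bullet> ((li (X, e) \<bullet> lp (X, e)) \<bullet> li (X, e))"
          using D.eqR[OF 1, of "li (X, e)"] t L_mor[OF k x' o(2)] by (simp add: D.cat_simps)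
        also have "\<dots> = Idt D (LO (X, e))" using l_typ(1-7,9)[OF x'] D.eqR[OF l_typ(7)[OF x'], of "lp (X, e) \<bullet> li (X, e)"] by (simp add: D.cat_simps)
        finally show ?thesis .
      qed
      have "\<gamma>' (X, e) = (\<gamma>' (X, e) \<bullet> Fmor L (e, e, Idt C X)) \<bullet> (lp (X, Idt C X) \<bullet> li (X, e))"
        using Le t L_mor[OF k x' o(2)] by (simp add: D.cat_simps)
      also have "\<dots> = Fmor M (e, e, Idt C X) \<bullet> ((\<gamma>' (X, Idt C X) \<bullet> lp (X, Idt C X)) \<bullet> li (X, e))"
        unfolding gn[OF pr(1)[OF x']] using t by (simp add: D.cat_simps)
      also have "\<dots> = \<gamma> (X, e)" unfolding \<gamma>[OF x'] using g o(1) by (simp add: C.wic_functor_simps(1))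
      finally show ?thesis unfolding x .
    qed
    then show "\<gamma>' = \<gamma>" using g by (intro extensionalityI[of _ "Ob H"]) (auto simp: \<gamma>_def)
  qed
qed

end

lemma ex_wic_extension:
  assumes n: "1 \<le> n" and C: "n_exangulated_category C E n s" and D: "n_exangulated_category D G n t"
    and w: "weakly_idempotent_complete D" and F: "n_exangulated_functor C E s D G t n F \<Lambda>"
  obtains LO li lp where "wic_extension C E n s D G t F \<Lambda> LO li lp"
proof -
  interpret C: n_exangulated_category C E n s by fact
  interpret D: n_exangulated_category D G n t by fact
  interpret add_functor C D F
    by (intro add_functor.intro add_functor_axioms.intro n_exangulated_functorD(1)[OF F] C.additive_category_axioms D.additive_category_axioms)
  have "\<exists>L i p. i \<in> Mor D L (Fob F (fst P)) \<and> p \<in> Mor D (Fob F (fst P)) L \<and> p \<cdot>\<^bsub>D\<^esub> i = Idt D L \<and> i \<cdot>\<^bsub>D\<^esub> p = Fmor F (snd P)"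
    if P: "P \<in> Ob (wic_cat C)" for P
  proof -
    obtain X e where x: "P = (X, e)" by (cases P)
    have e: "e \<in> Mor C X X" "(X, e) \<in> wic_ob C" using P by (simp_all add: x C.wic_Ob)
    obtain Y r s where r: "r \<in> Mor C X Y" "s \<in> Mor C Y X" "r \<cdot>\<^bsub>C\<^esub> s = Idt C Y" "e \<boxplus>\<^bsub>C\<^esub> s \<cdot>\<^bsub>C\<^esub> r = Idt C X" using e(2) C.wic_ob_iff[OF e(1)] by blast
    have o: "X \<in> Ob C" "Y \<in> Ob C" using C.mor_ob r by blast+
    have "Fmor F e \<boxplus>\<^bsub>D\<^esub> Fmor F s \<cdot>\<^bsub>D\<^esub> Fmor F r = Idt D (Fob F X)"
      using F_add[OF e(1) C.cmp_mor[OF r(1,2)]] F_cmp[OF r(1,2)] F_idt[OF o(1)] r(4) by simp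
    moreover have "Fmor F r \<cdot>\<^bsub>D\<^esub> Fmor F s = Idt D (Fob F Y)" using F_cmp[OF r(2,1)] F_idt[OF o(2)] r(3) by simp
    ultimately show ?thesis
      using D.weakly_idempotent_complete_split[OF w F_mor[OF e(1)] F_mor[OF r(1)] F_mor[OF r(2)]] by (auto simp: x)
  qed
  then obtain LO li lp where "\<forall>P \<in> Ob (wic_cat C). li P \<in> Mor D (LO P) (Fob F (fst P)) \<and> lp P \<in> Mor D (Fob F (fst P)) (LO P) \<and>
      lp P \<cdot>\<^bsub>D\<^esub> li P = Idt D (LO P) \<and> li P \<cdot>\<^bsub>D\<^esub> lp P = Fmor F (snd P)" by metis
  then have "wic_extension C E n s D G t F \<Lambda> LO li lp"
    by (intro wic_extension.intro wic_extension_axioms.intro C D add_functor_axioms n F) blast+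
  then show thesis by (rule that)
qed

theorem theorem5p5:
  fixes n :: nat
    and C :: "('o, 'm) cat"
    and E :: "('o, 'm, 'x) bifunctor"
    and s :: "('o, 'm, 'x) realisation"
  assumes "n \<ge> 1"
    and "n_exangulated_category C E n s"
  defines "hC \<equiv> wic_cat C"
    and "G \<equiv> wic_bifunctor C E"
    and "r \<equiv> wic_realisation C n s"
    and "K \<equiv> wic_functor C"
    and "\<Delta> \<equiv> wic_trans C"
  shows "n_exangulated_category hC G n r \<and>
    weakly_idempotent_complete hC \<and>
    n_exangulated_functor C E s hC G r n K \<Delta> \<and>
    (\<forall>(C' :: ('p, 'q) cat) (E' :: ('p, 'q, 'y) bifunctor) s' F \<Lambda>.
       n_exangulated_category C' E' n s' \<and>
       weakly_idempotent_complete C' \<and>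
       n_exangulated_functor C E s C' E' s' n F \<Lambda> \<longrightarrow>
       (\<exists>L \<Psi> \<alpha>.
          n_exangulated_functor hC G r C' E' s' n L \<Psi> \<and>
          n_exangulated_iso C E C' E' F \<Lambda> (comp_functor L K) (comp_trans \<Psi> K \<Delta>) \<alpha> \<and>
          (\<forall>H \<Theta> \<beta>.
             n_exangulated_functor hC G r C' E' s' n H \<Theta> \<and>
             n_exangulated_trans C E C' E' F \<Lambda> (comp_functor H K) (comp_trans \<Theta> K \<Delta>) \<beta> \<longrightarrow>
             (\<exists>!\<gamma>. \<gamma> \<in> extensional (Ob hC) \<and>
                n_exangulated_trans hC G C' E' L \<Psi> H \<Theta> \<gamma> \<and>
                (\<forall>X \<in> Ob C. \<beta> X = \<gamma> (Fob K X) \<cdot>\<^bsub>C'\<^esub> \<alpha> X)))))"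
proof -
  interpret C: n_exangulated_category C E n s by fact
  show ?thesis unfolding hC_def G_def r_def K_def \<Delta>_def
  proof (intro conjI C.wic_n_exangulated assms(1) allI impI)
    fix C' :: "('p, 'q) cat" and E' :: "('p, 'q, 'y) bifunctor" and s' F \<Lambda>
    assume a: "n_exangulated_category C' E' n s' \<and> weakly_idempotent_complete C' \<and> n_exangulated_functor C E s C' E' s' n F \<Lambda>"
    obtain LO li lp where "wic_extension C E n s C' E' s' F \<Lambda> LO li lp"
      using ex_wic_extension[OF assms(1,2)] a by metis
    then interpret wic_extension C E n s C' E' s' F \<Lambda> LO li lp .
    show "\<exists>L \<Psi> \<alpha>. n_exangulated_functor (wic_cat C) (wic_bifunctor C E) (wic_realisation C n s) C' E' s' n L \<Psi> \<and>
       n_exangulated_iso C E C' E' F \<Lambda> (comp_functor L (wic_functor C)) (comp_trans \<Psi> (wic_functor C) (wic_trans C)) \<alpha> \<and>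
       (\<forall>H \<Theta> \<beta>. n_exangulated_functor (wic_cat C) (wic_bifunctor C E) (wic_realisation C n s) C' E' s' n H \<Theta> \<and>
          n_exangulated_trans C E C' E' F \<Lambda> (comp_functor H (wic_functor C)) (comp_trans \<Theta> (wic_functor C) (wic_trans C)) \<beta> \<longrightarrow>
          (\<exists>!\<gamma>. \<gamma> \<in> extensional (Ob (wic_cat C)) \<and> n_exangulated_trans (wic_cat C) (wic_bifunctor C E) C' E' L \<Psi> H \<Theta> \<gamma> \<and>
             (\<forall>X \<in> Ob C. \<beta> X = \<gamma> (Fob (wic_functor C) X) \<cdot>\<^bsub>C'\<^esub> \<alpha> X)))"
    proof (intro exI conjI allI impI; (elim conjE)?)
      show "n_exangulated_functor (wic_cat C) (wic_bifunctor C E) (wic_realisation C n s) C' E' s' n L \<Psi>" by (rule L_exangulated)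
      show "n_exangulated_iso C E C' E' F \<Lambda> (comp_functor L (wic_functor C)) (comp_trans \<Psi> (wic_functor C) (wic_trans C)) (\<lambda>X. lp (X, Idt C X))"
        by (rule alpha_iso)
    qed (rule ex1_trans)
  qed
qed

end
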